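(* Let $X$ be a reduced complex space, let $\mathbb{E}$ be a holomorphic family of rank $k$ $[\lambda]$-primitive frescos parametrized by $X$, and let $\theta\in\mathbb{C}[[a]]$ be a change of variable. Then the family $\theta_*(\mathbb{E}(x))$, $x\in X$, is holomorphic; that is, the sheaf $\theta_*(\mathbb{E})$, whose value at $x$ is $\theta_*(\mathbb{E}(x))$, is a holomorphic family of rank $k$ $[\lambda]$-primitive frescos parametrized by $X$.
   Context: **The algebra $\hat A$.** $\hat A$ is the $\mathbb{C}$-algebra of formal sums $\sum_{\nu\ge 0}P_\nu(a)b^\nu$ with $P_\nu\in\mathbb{C}[[a]]$, whose product is determined by $ab-ba=b^2$ and by requiring left and right multiplication by any $T\in\mathbb{C}[[a]]$ to be continuous for the $b$-adic filtration. It contains $\mathbb{C}[[a]]$ and $\mathbb{C}[[b]]$. Modules are left modules. **Change of variable.** A change of variable is $\theta\in\mathbb{C}[[a]]$ with $\theta(0)=0$, $\theta'(0)\ne 0$. There is a unique $b$-adically continuous $\mathbb{C}$-algebra automorphism $\Theta$ of $\hat A$ with $\Theta(T(a))=T(\theta(a))$ for $T\in\mathbb{C}[[a]]$ and $\Theta(b)=b\,\theta'(a)$. For an $\hat A$-module $E$, $\theta_*(E)$ is the vector space $E$ with the new action $x\cdot e:=\Theta(x)e$. For a sheaf $\mathbb{E}$ of $\hat A$-modules, $\theta_*(\mathbb{E})$ is the same sheaf with action of $\hat A$ twisted by $\Theta$ in the same way (so $b$ acts as $\Theta(b)$), and the same action of $\mathcal{O}_X$. **Frescos.** A simple pole (a,b)-module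 is an $\hat A$-module $E$ free of finite rank over $\mathbb{C}[[b]]$ with $aE\subset bE$. A regular (a,b)-module $E$ is an $\hat A$-submodule of a simple pole (a,b)-module; $E^\sharp$ denotes the smallest simple pole (a,b)-module containing $E$ (the saturation of $E$ by $b^{-1}a$ in $E\otimes_{\mathbb{C}[[b]]}\mathbb{C}[[b]][b^{-1}]$), and the Bernstein polynomial of $E$ is the minimal polynomial of $-b^{-1}a$ on $E^\sharp/bE^\sharp$. $E$ is geometric if the roots of its Bernstein polynomial are negative rational numbers. A fresco is a geometric (a,b)-module generated by one element over $\hat A$; its rank is its rank over $\mathbb{C}[[b]]$. For $\lambda\in\,]0,1]\cap\mathbb{Q}$ let $[\lambda]=\lambda+\mathbb{Z}$; a fresco is $[\lambda]$-primitive if all roots of its Bernstein polynomial lie in $-\lambda+\mathbb{Z}$. **Holomorphic families.** An $\hat A_X$-sheaf is a sheaf on $X$ with compatible structures of $\mathcal{O}_X[[b]]$-module and left $\hat A$-module. $\Xi^{(N)}_{\lambda,X}$ is the free $\mathcal{O}_X[[b]]$-module with basis $e_0,\dots,e_N$ and $\mathcal{O}_X$-linear, $b$-adically continuous action of $a$ with $ae_0=\lambda be_0$, $ae_j=\lambda be_j+be_{j-1}$ ($1\le j\le N$), $ab-ba=b^2$. For a finite dimensional complex vector space $V$, $a$ and $b$ act on $\Xi^{(N)}_{\lambda,X}\otimes V$ as $a\otimes\mathrm{id}$, $b\otimes\mathrm{id}$. For $x\in X$ evaluation of coefficients at $x$ gives $ev_x:\Xi^{(N)}_{\lambda,X}\otimes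 V\to\Xi^{(N)}_{\lambda}\otimes V$ (where $\Xi_\lambda^{(N)}$ is the case $X$ = point), and for a subsheaf $\mathbb{E}$, $\mathbb{E}(x):=ev_x(\mathbb{E})$. A section $\varphi$ of $\Xi^{(N)}_{\lambda,X}\otimes V$ is $k$-admissible if the sub-$\hat A_X$-sheaf $\mathbb{E}$ it generates is a free $\mathcal{O}_X[[b]]$-module with basis $\varphi,a\varphi,\dots,a^{k-1}\varphi$ and $\mathbb{E}(x)$ is a rank $k$ fresco for every $x\in X$ (in that case $\mathbb{E}(x)$ is also the fibre $\mathbb{E}/\mathfrak{M}_x\mathbb{E}$). An $\hat A_X$-sheaf $\mathbb{E}$ is a holomorphic family of rank $k$ $[\lambda]$-primitive frescos parametrized by $X$ if it is locally on $X$ isomorphic, as an $\hat A_X$-sheaf, to one generated by a $k$-admissible section of some $\Xi^{(N)}_{\lambda,X}\otimes V$. *)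

theory Defs
  imports
    "HOL-Analysis.Function_Topology"
    "HOL-Analysis.T1_Spaces"
    "HOL-Computational_Algebra.Polynomial"
    "HOL-Computational_Algebra.Formal_Power_Series"
    "HOL-Algebra.Module"
    "HOL-Library.Function_Algebras"
begin

text \<open>\<open>Ahat P\<close> is the formal sum $\sum_\nu P_\nu(a) b^\nu$.\<close>
datatype ahat = Ahat (acoeff: "nat \<Rightarrow> complex fps")

lemma ahat_eqI: "(\<And>n. acoeff x n = acoeff y n) \<Longrightarrow> x = y"
  by (rule ahat.expand) auto

abbreviation nbinom :: "nat \<Rightarrow> nat \<Rightarrow> complex"
  where "nbinom \<nu> j \<equiv> (- of_nat \<nu>) gchoose j"

definition triples :: "nat \<Rightarrow> (nat \<times> nat \<times> nat) set"
  where "triples n = {(\<nu>, j, \<mu>). \<nu> + j + \<mu> = n}"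

lemma finite_triples [simp]: "finite (triples n)"
  by (rule finite_subset[of _ "{..n} \<times> {..n} \<times> {..n}"]) (auto simp: triples_def)

lemma triples_mem: "(0, 0, n) \<in> triples n" "(n, 0, 0) \<in> triples n"
  by (auto simp: triples_def)

lemma sum_fps_const: "(\<Sum>x\<in>A. fps_const (f x)) = fps_const (\<Sum>x\<in>A. f x :: complex)"
  by (rule fps_ext) (simp add: fps_sum_nth)

lemma deriv_sum: "(fps_deriv ^^ j) (sum f A) = (\<Sum>x\<in>A. (fps_deriv ^^ j) (f x :: complex fps))"
  by (induction j) (auto simp: fps_deriv_sum)

lemma deriv_const_mult: "(fps_deriv ^^ j) (fps_const c * f) = fps_const c * (fps_deriv ^^ j) (f :: complex fps)"
  by (induction j) auto

lemma deriv_add: "(fps_deriv ^^ j) (f + g) = (fps_deriv ^^ j) f + (fps_deriv ^^ j) (g :: complex fps)"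
  by (induction j) auto

lemma deriv_0: "(fps_deriv ^^ j) (0 :: complex fps) = 0"
  by (induction j) auto

lemma deriv_1: "(fps_deriv ^^ j) (1 :: complex fps) = (if j = 0 then 1 else 0)"
proof (cases j)
  case (Suc i)
  have "(fps_deriv ^^ j) (1 :: complex fps) = (fps_deriv ^^ i) (fps_deriv 1)"
    unfolding Suc funpow_Suc_right by simp
  then show ?thesis using Suc by (simp add: deriv_0)
qed simp

lemma deriv_mult: "(fps_deriv ^^ l) (f * g :: complex fps) =
   (\<Sum>p\<le>l. fps_const (of_nat (l choose p)) * (fps_deriv ^^ p) f * (fps_deriv ^^ (l - p)) g)"
proof (induction l)
  case (Suc l)
  let ?T = "\<lambda>c p q. fps_const (of_nat c) * (fps_deriv ^^ p) f * (fps_deriv ^^ q) g :: complex fps"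
  have "(fps_deriv ^^ Suc l) (f * g) =
     (\<Sum>p\<le>l. ?T (l choose p) p (Suc (l - p)) + ?T (l choose p) (Suc p) (l - p))"
    by (simp add: Suc fps_deriv_sum algebra_simps)
  also have "\<dots> = (\<Sum>p\<le>l. ?T (l choose p) p (Suc l - p)) + (\<Sum>p\<le>l. ?T (l choose p) (Suc p) (l - p))"
    by (subst sum.distrib) (intro arg_cong2[of _ _ _ _ "(+)"] sum.cong refl, auto simp: Suc_diff_le)
  also have "(\<Sum>p\<le>l. ?T (l choose p) p (Suc l - p)) = (\<Sum>p\<le>Suc l. ?T (l choose p) p (Suc l - p))"
    by simp
  also have "\<dots> = ?T 1 0 (Suc l) + (\<Sum>p\<le>l. ?T (l choose Suc p) (Suc p) (l - p))"
    by (subst sum.atMost_Suc_shift) simp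
  also have "\<dots> + (\<Sum>p\<le>l. ?T (l choose p) (Suc p) (l - p)) =
       ?T 1 0 (Suc l) + (\<Sum>p\<le>l. ?T (Suc l choose Suc p) (Suc p) (l - p))"
  proof -
    have "?T (Suc l choose Suc p) (Suc p) (l - p) =
        ?T (l choose Suc p) (Suc p) (l - p) + ?T (l choose p) (Suc p) (l - p)" for p
      by (simp add: distrib_right flip: fps_const_add)
    then show ?thesis by (simp add: sum.distrib add.assoc)
  qed
  also have "\<dots> = (\<Sum>p\<le>Suc l. ?T (Suc l choose p) p (Suc l - p))"
    by (subst sum.atMost_Suc_shift) simp
  finally show ?case .
qed simp

lemma deriv_funpow_add: "(fps_deriv ^^ i) ((fps_deriv ^^ j) f) = (fps_deriv ^^ (i + j)) f"
  by (simp add: funpow_add)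

lemma ahat_assoc_coeff:
  "(\<Sum>i\<le>q. nbinom \<nu> (p + q - i) * of_nat (p + q - i choose p) * nbinom \<mu> i)
    = nbinom \<nu> p * nbinom (\<nu> + p + \<mu>) q"
proof -
  have "nbinom \<nu> (p + q - i) * of_nat (p + q - i choose p) * nbinom \<mu> i =
        nbinom \<nu> p * (nbinom \<mu> i * nbinom (\<nu> + p) (q - i))" if "i \<le> q" for i
  proof -
    have "nbinom \<nu> (p + q - i) * of_nat (p + q - i choose p) =
       nbinom \<nu> p * ((- of_nat \<nu> - of_nat p) gchoose (q - i))"
      using gbinomial_trinomial_revision[of p "p + q - i" "- of_nat \<nu> :: complex"] that
      by (simp add: binomial_gbinomial of_nat_diff)
    then show ?thesis by (simp add: algebra_simps)
  qed
  then have "(\<Sum>i\<le>q. nbinom \<nu> (p + q - i) * of_nat (p + q - i choose p) * nbinom \<mu> i)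
    = nbinom \<nu> p * (\<Sum>i\<le>q. nbinom \<mu> i * nbinom (\<nu> + p) (q - i))"
    unfolding sum_distrib_left by (intro sum.cong refl) auto
  also have "(\<Sum>i\<le>q. nbinom \<mu> i * nbinom (\<nu> + p) (q - i)) = nbinom (\<nu> + p + \<mu>) q"
    using gbinomial_Vandermonde[of "- of_nat \<mu> :: complex" "- of_nat (\<nu> + p)" q]
    by (simp add: atLeast0AtMost algebra_simps)
  finally show ?thesis .
qed

instantiation ahat :: ring_1
begin

definition "0 = Ahat (\<lambda>_. 0)"
definition "1 = Ahat (\<lambda>n. if n = 0 then 1 else 0)"
definition "x + y = Ahat (\<lambda>n. acoeff x n + acoeff y n)"
definition "- x = Ahat (\<lambda>n. - acoeff x n)"
definition "x - y = Ahat (\<lambda>n. acoeff x n - acoeff y n)"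

text \<open>From $ba = ab - b^2$ one gets
  $b^\nu T(a) = \sum_j {-\nu \choose j} T^{(j)}(a) b^{\nu+j}$, which extends by continuity to the product.
  See \<open>a_b_relation\<close>, \<open>b_filt_mult\<close> and \<open>trunc\<close> below.\<close>
definition "x * y = Ahat (\<lambda>n. \<Sum>(\<nu>, j, \<mu>)\<in>triples n.
   fps_const (nbinom \<nu> j) * acoeff x \<nu> * (fps_deriv ^^ j) (acoeff y \<mu>))"

lemma ahat_mult_assoc: "(x * y) * z = x * (y * z)" for x y z :: ahat
proof (rule ahat_eqI)
  fix n :: nat
  define P Q R where "P = acoeff x" and "Q = acoeff y" and "R = acoeff z"
  define D :: "nat \<Rightarrow> complex fps \<Rightarrow> complex fps" where "D j = fps_deriv ^^ j" for j
  define U where "U = {(\<nu>, p, \<mu>, q, \<rho>). \<nu> + p + \<mu> + q + \<rho> = n}"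
  have finU: "finite U"
    by (rule finite_subset[of _ "{..n} \<times> {..n} \<times> {..n} \<times> {..n} \<times> {..n}"]) (auto simp: U_def)
  have "acoeff ((x * y) * z) n =
     (\<Sum>(m, i, \<rho>)\<in>triples n. \<Sum>(\<nu>, j, \<mu>)\<in>triples m.
        fps_const (nbinom m i * nbinom \<nu> j) * P \<nu> * D j (Q \<mu>) * D i (R \<rho>))"
    by (simp add: times_ahat_def P_def Q_def R_def D_def sum_distrib_left sum_distrib_right
          case_prod_unfold mult_ac flip: fps_const_mult)
  also have "\<dots> = (\<Sum>((m, i, \<rho>), (\<nu>, j, \<mu>))\<in>(SIGMA t:triples n. triples (fst t)).
        fps_const (nbinom m i * nbinom \<nu> j) * P \<nu> * D j (Q \<mu>) * D i (R \<rho>))"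
    by (subst sum.Sigma [symmetric]) (auto simp: case_prod_unfold)
  also have "\<dots> = (\<Sum>(\<nu>, p, \<mu>, q, \<rho>)\<in>U.
        fps_const (nbinom (\<nu> + p + \<mu>) q * nbinom \<nu> p) * P \<nu> * D p (Q \<mu>) * D q (R \<rho>))"
    by (rule sum.reindex_bij_witness[of _
          "\<lambda>(\<nu>, p, \<mu>, q, \<rho>). ((\<nu> + p + \<mu>, q, \<rho>), (\<nu>, p, \<mu>))"
          "\<lambda>((m, i, \<rho>), (\<nu>, j, \<mu>)). (\<nu>, j, \<mu>, i, \<rho>)"])
       (auto simp: U_def triples_def)
  finally have L: "acoeff ((x * y) * z) n = \<dots>" .
  have "acoeff (x * (y * z)) n =
     (\<Sum>(\<nu>, l, m)\<in>triples n. \<Sum>(\<mu>, i, \<rho>)\<in>triples m. \<Sum>p\<le>l.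
        fps_const (nbinom \<nu> l * nbinom \<mu> i * of_nat (l choose p)) * P \<nu> * D p (Q \<mu>) * D (l - p + i) (R \<rho>))"
  proof -
    have "D l (fps_const c * Q \<mu> * D i (R \<rho>)) =
        (\<Sum>p\<le>l. fps_const (c * of_nat (l choose p)) * D p (Q \<mu>) * D (l - p + i) (R \<rho>))" for l c \<mu> i \<rho>
      by (simp only: D_def mult.assoc deriv_const_mult)
         (simp add: deriv_mult deriv_funpow_add sum_distrib_left mult.assoc flip: fps_const_mult)
    note 1 = this
    have "acoeff (x * (y * z)) n = (\<Sum>(\<nu>, l, m)\<in>triples n. \<Sum>(\<mu>, i, \<rho>)\<in>triples m.
        fps_const (nbinom \<nu> l) * P \<nu> * D l (fps_const (nbinom \<mu> i) * Q \<mu> * D i (R \<rho>)))"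
      by (simp add: times_ahat_def P_def Q_def R_def D_def deriv_sum sum_distrib_left case_prod_unfold)
    then show ?thesis
      unfolding 1 by (simp add: case_prod_unfold sum_distrib_left mult_ac flip: fps_const_mult)
  qed
  also have "\<dots> = (\<Sum>((\<nu>, l, m), (\<mu>, i, \<rho>), p)\<in>(SIGMA t:triples n. triples (snd (snd t)) \<times> {..fst (snd t)}).
        fps_const (nbinom \<nu> l * nbinom \<mu> i * of_nat (l choose p)) * P \<nu> * D p (Q \<mu>) * D (l - p + i) (R \<rho>))"
    by (subst sum.Sigma [symmetric]) (auto simp: case_prod_unfold sum.cartesian_product intro!: sum.cong)
  also have "\<dots> = (\<Sum>((\<nu>, p, \<mu>, q, \<rho>), i)\<in>(SIGMA t:U. {..fst (snd (snd (snd t)))}).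
        fps_const (nbinom \<nu> (p + q - i) * of_nat (p + q - i choose p) * nbinom \<mu> i) * P \<nu> * D p (Q \<mu>) * D q (R \<rho>))"
    by (rule sum.reindex_bij_witness[of _
          "\<lambda>((\<nu>, p, \<mu>, q, \<rho>), i). ((\<nu>, p + q - i, \<mu> + i + \<rho>), (\<mu>, i, \<rho>), p)"
          "\<lambda>((\<nu>, l, m), (\<mu>, i, \<rho>), p). ((\<nu>, p, \<mu>, l - p + i, \<rho>), i)"])
       (auto simp: U_def triples_def mult_ac)
  also have "\<dots> = (\<Sum>(\<nu>, p, \<mu>, q, \<rho>)\<in>U. \<Sum>i\<le>q.
        fps_const (nbinom \<nu> (p + q - i) * of_nat (p + q - i choose p) * nbinom \<mu> i) * P \<nu> * D p (Q \<mu>) * D q (R \<rho>))"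
    using finU by (subst sum.Sigma [symmetric]) (auto simp: case_prod_unfold)
  also have "\<dots> = (\<Sum>(\<nu>, p, \<mu>, q, \<rho>)\<in>U.
        fps_const (nbinom (\<nu> + p + \<mu>) q * nbinom \<nu> p) * P \<nu> * D p (Q \<mu>) * D q (R \<rho>))"
  proof (intro sum.cong refl, clarify)
    fix \<nu> p \<mu> q \<rho>
    have "fps_const (nbinom (\<nu> + p + \<mu>) q * nbinom \<nu> p) =
       (\<Sum>i\<le>q. fps_const (nbinom \<nu> (p + q - i) * of_nat (p + q - i choose p) * nbinom \<mu> i))"
      unfolding sum_fps_const ahat_assoc_coeff by (simp add: mult.commute)
    then show "(\<Sum>i\<le>q. fps_const (nbinom \<nu> (p + q - i) * of_nat (p + q - i choose p) * nbinom \<mu> i)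
         * P \<nu> * D p (Q \<mu>) * D q (R \<rho>)) =
       fps_const (nbinom (\<nu> + p + \<mu>) q * nbinom \<nu> p) * P \<nu> * D p (Q \<mu>) * D q (R \<rho>)"
      by (simp add: sum_distrib_right)
  qed
  finally show "acoeff ((x * y) * z) n = acoeff (x * (y * z)) n"
    using L by simp
qed

lemma ahat_one_mult: "1 * x = x" for x :: ahat
proof (rule ahat_eqI)
  fix n :: nat
  have "acoeff (1 * x) n = (\<Sum>t\<in>triples n. if t = (0, 0, n) then acoeff x n else 0)"
    unfolding times_ahat_def ahat.sel
    by (intro sum.cong refl) (auto simp: one_ahat_def triples_def gbinomial_0_left split: if_splits)
  then show "acoeff (1 * x) n = acoeff x n"
    using triples_mem(1)[of n] by simp
qed

lemma ahat_mult_one: "x * 1 = x" for x :: ahat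
proof (rule ahat_eqI)
  fix n :: nat
  have "acoeff (x * 1) n = (\<Sum>t\<in>triples n. if t = (n, 0, 0) then acoeff x n else 0)"
    unfolding times_ahat_def ahat.sel
    by (intro sum.cong refl) (auto simp: one_ahat_def triples_def deriv_0 deriv_1 split: if_splits)
  then show "acoeff (x * 1) n = acoeff x n"
    using triples_mem(2)[of n] by simp
qed

instance
proof
  fix x y z :: ahat
  show "x * y * z = x * (y * z)" by (rule ahat_mult_assoc)
  show "1 * x = x" "x * 1 = x" by (rule ahat_one_mult ahat_mult_one)+
  show "(x + y) * z = x * z + y * z" "x * (y + z) = x * y + x * z"
    by (rule ahat_eqI, simp add: times_ahat_def plus_ahat_def case_prod_unfold
        distrib_left distrib_right sum.distrib deriv_add)+
  show "(0::ahat) \<noteq> 1"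
    by (auto simp: zero_ahat_def one_ahat_def dest!: fun_cong[of _ _ 0])
qed (auto intro!: ahat_eqI simp: zero_ahat_def plus_ahat_def uminus_ahat_def minus_ahat_def)

end

definition ahat_a :: "complex fps \<Rightarrow> ahat"
  where "ahat_a T = Ahat (\<lambda>\<nu>. if \<nu> = 0 then T else 0)"

definition ahat_b :: "complex fps \<Rightarrow> ahat"
  where "ahat_b S = Ahat (\<lambda>\<nu>. fps_const (fps_nth S \<nu>))"

abbreviation a_elt :: ahat where "a_elt \<equiv> ahat_a fps_X"
abbreviation b_elt :: ahat where "b_elt \<equiv> ahat_b fps_X"

definition b_filt :: "nat \<Rightarrow> ahat set"
  where "b_filt n = {x. \<forall>i<n. acoeff x i = 0}"

lemma acoeff_simps [simp]:
  "acoeff 0 n = 0" "acoeff 1 n = (if n = 0 then 1 else 0)" "acoeff (x + y) n = acoeff x n + acoeff y n"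
  "acoeff (- x) n = - acoeff x n" "acoeff (x - y) n = acoeff x n - acoeff y n"
  "acoeff (ahat_a T) n = (if n = 0 then T else 0)"
  "acoeff (ahat_b S) n = fps_const (fps_nth S n)"
  by (auto simp: zero_ahat_def one_ahat_def plus_ahat_def uminus_ahat_def minus_ahat_def ahat_a_def ahat_b_def)

lemma acoeff_sum [simp]: "acoeff (sum f A) n = (\<Sum>t\<in>A. acoeff (f t) n)"
  by (induction A rule: infinite_finite_induct) auto

lemma acoeff_mult: "acoeff (x * y) n = (\<Sum>(\<nu>, j, \<mu>)\<in>triples n.
   fps_const (nbinom \<nu> j) * acoeff x \<nu> * (fps_deriv ^^ j) (acoeff y \<mu>))"
  by (simp add: times_ahat_def)

lemma acoeff_a_mult [simp]: "acoeff (ahat_a S * x) n = S * acoeff x n"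
proof -
  have "acoeff (ahat_a S * x) n = (\<Sum>t\<in>triples n. if t = (0, 0, n) then S * acoeff x n else 0)"
    unfolding acoeff_mult
    by (intro sum.cong refl) (auto simp: triples_def gbinomial_0_left split: if_splits)
  then show ?thesis using triples_mem(1)[of n] by simp
qed

lemma acoeff_mult_b [simp]: "acoeff (x * b_elt) n = (if n = 0 then 0 else acoeff x (n - 1))"
proof -
  have const: "(fps_deriv ^^ j) (fps_const c) = (if j = 0 then fps_const c else 0)" for j and c :: complex
    using deriv_const_mult[of j c 1] by (simp add: deriv_1)
  have "acoeff (x * b_elt) n = (\<Sum>t\<in>triples n. if t = (n - 1, 0, 1) then acoeff x (n - 1) else 0)"
    unfolding acoeff_mult
    by (intro sum.cong refl) (auto simp: triples_def const split: if_splits)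
  also have "\<dots> = (if n = 0 then 0 else acoeff x (n - 1))"
    by (subst sum.delta[OF finite_triples]) (auto simp: triples_def)
  finally show ?thesis .
qed

lemma acoeff_mult_b_power: "acoeff (x * b_elt ^ m) n = (if n < m then 0 else acoeff x (n - m))"
proof (induction m arbitrary: n)
  case (Suc m)
  have "x * b_elt ^ Suc m = (x * b_elt ^ m) * b_elt"
    by (simp only: power_Suc2 mult.assoc)
  then show ?case using Suc by (auto simp del: power_Suc)
qed simp

lemma acoeff_b_mult_a: "acoeff (b_elt * ahat_a T) n =
   (if n = 0 then 0 else fps_const ((-1) ^ (n - 1)) * (fps_deriv ^^ (n - 1)) T)"
proof -
  have g: "(- 1 :: complex) gchoose j = (-1) ^ j" for j
    using gbinomial_minus[of "1::complex" j] by (simp add: binomial_gbinomial[symmetric])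
  have "acoeff (b_elt * ahat_a T) n = (\<Sum>t\<in>triples n. if t = (1, n - 1, 0) then
      fps_const ((-1) ^ (n - 1)) * (fps_deriv ^^ (n - 1)) T else 0)"
    unfolding acoeff_mult
    by (intro sum.cong refl) (auto simp: triples_def g deriv_0 split: if_splits)
  also have "\<dots> = (if n = 0 then 0 else fps_const ((-1) ^ (n - 1)) * (fps_deriv ^^ (n - 1)) T)"
    by (subst sum.delta[OF finite_triples]) (auto simp: triples_def)
  finally show ?thesis .
qed

lemma b_a_commute: "b_elt * ahat_a T = ahat_a T * b_elt - b_elt * ahat_a (fps_deriv T) * b_elt"
proof (rule ahat_eqI)
  fix n
  consider "n = 0" | "n = 1" | m where "n = Suc (Suc m)"
    by (metis One_nat_def not0_implies_Suc)
  then show "acoeff (b_elt * ahat_a T) n =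
      acoeff (ahat_a T * b_elt - b_elt * ahat_a (fps_deriv T) * b_elt) n"
    by cases (simp_all add: acoeff_b_mult_a funpow_swap1 flip: fps_const_neg)
qed

lemma ahat_a_simps:
  "ahat_a 0 = 0" "ahat_a 1 = 1" "ahat_a (S + T) = ahat_a S + ahat_a T" "ahat_a (S * T) = ahat_a S * ahat_a T"
  "ahat_a (- S) = - ahat_a S"
  by (rule ahat_eqI, simp)+

lemma a_b_relation: "a_elt * b_elt - b_elt * a_elt = b_elt ^ 2"
  using b_a_commute[of fps_X] by (simp add: power2_eq_square ahat_a_simps)

lemma b_filt_mult: "x \<in> b_filt m \<Longrightarrow> y \<in> b_filt n \<Longrightarrow> x * y \<in> b_filt (m + n)"
  unfolding b_filt_def mem_Collect_eq acoeff_mult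
proof (intro allI impI sum.neutral ballI, clarify)
  fix i \<nu> j \<mu>
  assume *: "\<forall>i<m. acoeff x i = 0" "\<forall>i<n. acoeff y i = 0" "i < m + n" "(\<nu>, j, \<mu>) \<in> triples i"
  then have "\<nu> < m \<or> \<mu> < n" by (auto simp: triples_def)
  with * show "fps_const (nbinom \<nu> j) * acoeff x \<nu> * (fps_deriv ^^ j) (acoeff y \<mu>) = 0"
    by (auto simp: deriv_0)
qed

lemma b_filt_0 [simp]: "x \<in> b_filt 0"
  by (simp add: b_filt_def)

lemma b_filt_mono: "x \<in> b_filt m \<Longrightarrow> n \<le> m \<Longrightarrow> x \<in> b_filt n"
  by (auto simp: b_filt_def)

lemma b_filt_ideal: "x \<in> b_filt n \<Longrightarrow> x * y \<in> b_filt n" "x \<in> b_filt n \<Longrightarrow> y * x \<in> b_filt n"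
  using b_filt_mult[of x n y 0] b_filt_mult[of y 0 x n] by auto

lemma b_filt_diff: "x \<in> b_filt n \<Longrightarrow> y \<in> b_filt n \<Longrightarrow> x - y \<in> b_filt n"
  by (auto simp: b_filt_def)

lemma b_filt_eqI: "(\<And>n. x - y \<in> b_filt n) \<Longrightarrow> x = y"
  by (rule ahat_eqI) (force simp: b_filt_def)

text \<open>The filtration \<^const>\<open>b_filt\<close> is the $b$-adic one.\<close>
lemma b_filt_eq: "b_filt n = range (\<lambda>x. x * b_elt ^ n)"
proof safe
  fix x assume x: "x \<in> b_filt n"
  have "x = Ahat (\<lambda>i. acoeff x (i + n)) * b_elt ^ n"
    using x by (intro ahat_eqI) (simp add: acoeff_mult_b_power b_filt_def)
  then show "x \<in> range (\<lambda>x. x * b_elt ^ n)" by blast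
qed (simp add: b_filt_def acoeff_mult_b_power)

definition b_continuous :: "(ahat \<Rightarrow> ahat) \<Rightarrow> bool"
  where "b_continuous F \<longleftrightarrow> (\<forall>n. \<exists>m. \<forall>x y. x - y \<in> b_filt m \<longrightarrow> F x - F y \<in> b_filt n)"

lemma trunc: "x - (\<Sum>\<nu><N. ahat_a (acoeff x \<nu>) * b_elt ^ \<nu>) \<in> b_filt N"
proof -
  have "acoeff (\<Sum>\<nu><N. ahat_a (acoeff x \<nu>) * b_elt ^ \<nu>) i = acoeff x i" if "i < N" for i
  proof -
    have "acoeff (\<Sum>\<nu><N. ahat_a (acoeff x \<nu>) * b_elt ^ \<nu>) i =
        (\<Sum>\<nu><N. if \<nu> = i then acoeff x i else 0)"
      unfolding acoeff_sum acoeff_mult_b_power by (intro sum.cong) auto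
    with that show ?thesis by simp
  qed
  then show ?thesis by (simp add: b_filt_def)
qed

lemma additive_sum:
  assumes "\<And>x y. F (x + y) = F x + F (y :: ahat)"
  shows "F (sum f A) = (\<Sum>t\<in>A. F (f t) :: ahat)"
proof -
  have "F 0 = 0" using assms[of 0 0] by simp
  then show ?thesis by (induction A rule: infinite_finite_induct) (auto simp: assms)
qed

lemma b_continuous_eqI:
  assumes F: "b_continuous F" "\<And>x y. F (x + y) = F x + F y"
    and G: "b_continuous G" "\<And>x y. G (x + y) = G x + G y"
    and eq: "\<And>T \<nu>. F (ahat_a T * b_elt ^ \<nu>) = G (ahat_a T * b_elt ^ \<nu>)"
  shows "F x = G x"
proof (rule b_filt_eqI)
  fix n
  obtain m1 where m1: "\<And>x y. x - y \<in> b_filt m1 \<Longrightarrow> F x - F y \<in> b_filt n"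
    using F(1) unfolding b_continuous_def by blast
  obtain m2 where m2: "\<And>x y. x - y \<in> b_filt m2 \<Longrightarrow> G x - G y \<in> b_filt n"
    using G(1) unfolding b_continuous_def by blast
  define y where "y = (\<Sum>\<nu><max m1 m2. ahat_a (acoeff x \<nu>) * b_elt ^ \<nu>)"
  have "x - y \<in> b_filt (max m1 m2)" unfolding y_def by (rule trunc)
  then have "F x - F y \<in> b_filt n" "G x - G y \<in> b_filt n"
    by (auto intro!: m1 m2 elim: b_filt_mono)
  then have "F x - F y - (G x - G y) \<in> b_filt n" by (rule b_filt_diff)
  moreover have "F y = G y"
    unfolding y_def additive_sum[of F, OF F(2)] additive_sum[of G, OF G(2)] eq ..
  ultimately show "F x - G x \<in> b_filt n" by simp
qed

definition change_of_variable :: "complex fps \<Rightarrow> bool"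
  where "change_of_variable \<theta> \<longleftrightarrow> fps_nth \<theta> 0 = 0 \<and> fps_nth (fps_deriv \<theta>) 0 \<noteq> 0"

text \<open>$\mathbb{C}$-linearity is the case of constant \<open>T\<close> of the condition on \<open>ahat_a T\<close>.\<close>
definition is_change_aut :: "complex fps \<Rightarrow> (ahat \<Rightarrow> ahat) \<Rightarrow> bool"
  where "is_change_aut \<theta> F \<longleftrightarrow> bij F \<and> b_continuous F \<and> F 1 = 1 \<and>
    (\<forall>x y. F (x + y) = F x + F y) \<and> (\<forall>x y. F (x * y) = F x * F y) \<and>
    (\<forall>T. F (ahat_a T) = ahat_a (fps_compose T \<theta>)) \<and>
    F b_elt = b_elt * ahat_a (fps_deriv \<theta>)"

definition change_aut :: "complex fps \<Rightarrow> ahat \<Rightarrow> ahat"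
  where "change_aut \<theta> = (THE F. is_change_aut \<theta> F)"

text \<open>Existence and uniqueness: the automorphism sends $\sum_\nu P_\nu(a) b^\nu$ to
  $\sum_\nu P_\nu(\theta(a)) (b\,\theta'(a))^\nu$.\<close>

definition Theta :: "complex fps \<Rightarrow> ahat \<Rightarrow> ahat"
  where "Theta \<theta> x = Ahat (\<lambda>n. \<Sum>\<nu>\<le>n.
    acoeff (ahat_a (fps_compose (acoeff x \<nu>) \<theta>) * (b_elt * ahat_a (fps_deriv \<theta>)) ^ \<nu>) n)"

context
  fixes \<theta> :: "complex fps" and \<beta> :: ahat
  assumes \<theta>0: "fps_nth \<theta> 0 = 0"
  defines "\<beta> \<equiv> b_elt * ahat_a (fps_deriv \<theta>)"
begin

lemma beta_power_filt: "\<beta> ^ n \<in> b_filt n"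
proof (induction n)
  case (Suc n)
  have "b_elt \<in> b_filt 1" by (auto simp: b_filt_def)
  then have "\<beta> \<in> b_filt 1" unfolding \<beta>_def by (rule b_filt_ideal)
  from b_filt_mult[OF this Suc] show ?case by simp
qed simp

lemma Theta_add: "Theta \<theta> (x + y) = Theta \<theta> x + Theta \<theta> y"
  by (rule ahat_eqI)
     (simp add: Theta_def fps_compose_add_distrib ahat_a_simps distrib_right sum.distrib)

lemma Theta_diff: "Theta \<theta> (x - y) = Theta \<theta> x - Theta \<theta> y"
  using Theta_add[of "x - y" y] by (simp add: algebra_simps)

lemma Theta_filt: "x \<in> b_filt n \<Longrightarrow> Theta \<theta> x \<in> b_filt n"
  by (auto simp: Theta_def b_filt_def ahat_a_simps intro!: sum.neutral)

lemma Theta_continuous: "b_continuous (Theta \<theta>)"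
  unfolding b_continuous_def by (auto simp flip: Theta_diff intro: Theta_filt)

lemma Theta_monom: "Theta \<theta> (ahat_a T * b_elt ^ m) = ahat_a (fps_compose T \<theta>) * \<beta> ^ m"
proof (rule ahat_eqI)
  fix n
  let ?y = "ahat_a (fps_compose T \<theta>) * \<beta> ^ m"
  have "acoeff (Theta \<theta> (ahat_a T * b_elt ^ m)) n = (\<Sum>\<nu>\<le>n. if \<nu> = m then acoeff ?y n else 0)"
    unfolding Theta_def ahat.sel \<beta>_def[symmetric]
    by (intro sum.cong refl) (auto simp: acoeff_mult_b_power)
  also have "\<dots> = acoeff ?y n"
    using b_filt_ideal(2)[OF beta_power_filt, of "ahat_a (fps_compose T \<theta>)" m]
    by (auto simp: b_filt_def)
  finally show "acoeff (Theta \<theta> (ahat_a T * b_elt ^ m)) n = acoeff ?y n" .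
qed

lemma Theta_a: "Theta \<theta> (ahat_a T) = ahat_a (fps_compose T \<theta>)"
  using Theta_monom[of T 0] by simp

lemma Theta_a_mult: "Theta \<theta> (ahat_a S * x) = ahat_a (fps_compose S \<theta>) * Theta \<theta> x"
proof (rule ahat_eqI)
  fix n
  show "acoeff (Theta \<theta> (ahat_a S * x)) n = acoeff (ahat_a (fps_compose S \<theta>) * Theta \<theta> x) n"
    by (simp add: Theta_def fps_compose_mult_distrib[OF \<theta>0] sum_distrib_left mult.assoc)
qed

lemma continuous_mult_right:
  assumes "b_continuous F" shows "b_continuous (\<lambda>x. F x * c)"
  unfolding b_continuous_def left_diff_distrib[symmetric]
  using assms b_filt_ideal(1) unfolding b_continuous_def by blast

lemma continuous_mult_left:
  assumes "b_continuous F" shows "b_continuous (\<lambda>x. c * F x)"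
  unfolding b_continuous_def right_diff_distrib[symmetric]
  using assms b_filt_ideal(2) unfolding b_continuous_def by blast

lemma continuous_Theta_mult_right: "b_continuous (\<lambda>x. Theta \<theta> (x * c))"
  unfolding b_continuous_def Theta_diff[symmetric] left_diff_distrib[symmetric]
  using Theta_filt b_filt_ideal(1) by blast

lemma continuous_Theta_mult_left: "b_continuous (\<lambda>x. Theta \<theta> (c * x))"
  unfolding b_continuous_def Theta_diff[symmetric] right_diff_distrib[symmetric]
  using Theta_filt b_filt_ideal(2) by blast

lemma Theta_mult_b: "Theta \<theta> (x * b_elt) = Theta \<theta> x * \<beta>"
proof (rule b_continuous_eqI[where F = "\<lambda>x. Theta \<theta> (x * b_elt)" and G = "\<lambda>x. Theta \<theta> x * \<beta>"])
  fix T \<nu>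
  show "Theta \<theta> (ahat_a T * b_elt ^ \<nu> * b_elt) = Theta \<theta> (ahat_a T * b_elt ^ \<nu>) * \<beta>"
    using Theta_monom[of T "Suc \<nu>"] Theta_monom[of T \<nu>] by (simp only: power_Suc2 mult.assoc)
qed (simp_all add: Theta_add distrib_right continuous_Theta_mult_right
       continuous_mult_right Theta_continuous)

lemma Theta_mult_b_power: "Theta \<theta> (x * b_elt ^ n) = Theta \<theta> x * \<beta> ^ n"
proof (induction n)
  case (Suc n)
  have "Theta \<theta> (x * b_elt ^ Suc n) = Theta \<theta> (x * b_elt ^ n * b_elt)"
    by (simp only: power_Suc2 mult.assoc)
  also have "\<dots> = Theta \<theta> x * \<beta> ^ n * \<beta>"
    by (simp only: Theta_mult_b Suc)
  also have "\<dots> = Theta \<theta> x * \<beta> ^ Suc n"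
    by (simp only: power_Suc2 mult.assoc)
  finally show ?case .
qed simp

lemma Theta_b_a: "Theta \<theta> (b_elt * ahat_a T) = \<beta> * ahat_a (fps_compose T \<theta>)"
proof (rule b_filt_eqI)
  define \<delta> where "\<delta> T = Theta \<theta> (b_elt * ahat_a T) - \<beta> * ahat_a (fps_compose T \<theta>)" for T
  have \<delta>: "\<delta> T = - (\<delta> (fps_deriv T) * \<beta>)" for T
  proof -
    have 1: "Theta \<theta> (b_elt * ahat_a T) =
        ahat_a (fps_compose T \<theta>) * \<beta> - Theta \<theta> (b_elt * ahat_a (fps_deriv T)) * \<beta>"
      by (subst b_a_commute) (simp only: Theta_diff Theta_mult_b Theta_a)
    have "\<beta> * ahat_a (fps_compose T \<theta>) = b_elt * ahat_a (fps_deriv \<theta> * fps_compose T \<theta>)"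
      by (simp add: \<beta>_def ahat_a_simps mult.assoc)
    also have "fps_deriv \<theta> * fps_compose T \<theta> = fps_compose T \<theta> * fps_deriv \<theta>"
      by (rule mult.commute)
    also have "b_elt * ahat_a (fps_compose T \<theta> * fps_deriv \<theta>) =
        b_elt * ahat_a (fps_compose T \<theta>) * ahat_a (fps_deriv \<theta>)"
      by (simp add: ahat_a_simps mult.assoc)
    also have "\<dots> = ahat_a (fps_compose T \<theta>) * \<beta> -
        b_elt * ahat_a (fps_compose (fps_deriv T) \<theta> * fps_deriv \<theta>) * \<beta>"
      by (subst b_a_commute) (simp add: fps_compose_deriv[OF \<theta>0] \<beta>_def left_diff_distrib mult.assoc)
    also have "fps_compose (fps_deriv T) \<theta> * fps_deriv \<theta> = fps_deriv \<theta> * fps_compose (fps_deriv T) \<theta>"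
      by (rule mult.commute)
    also have "b_elt * ahat_a (fps_deriv \<theta> * fps_compose (fps_deriv T) \<theta>) =
        \<beta> * ahat_a (fps_compose (fps_deriv T) \<theta>)"
      by (simp add: \<beta>_def ahat_a_simps mult.assoc)
    finally show ?thesis
      unfolding \<delta>_def 1 by (simp add: left_diff_distrib)
  qed
  fix n
  have "\<delta> T \<in> b_filt n" for T
  proof (induction n arbitrary: T)
    case (Suc n)
    have "\<beta> \<in> b_filt 1" using beta_power_filt[of 1] by simp
    from b_filt_mult[OF Suc this] have "\<delta> (fps_deriv T) * \<beta> \<in> b_filt (Suc n)" by simp
    then show ?case by (subst \<delta>) (simp add: b_filt_def)
  qed simp
  then show "Theta \<theta> (b_elt * ahat_a T) - \<beta> * ahat_a (fps_compose T \<theta>) \<in> b_filt n"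
    by (simp add: \<delta>_def)
qed

lemma Theta_b_mult: "Theta \<theta> (b_elt * x) = \<beta> * Theta \<theta> x"
proof (rule b_continuous_eqI[where F = "\<lambda>x. Theta \<theta> (b_elt * x)" and G = "\<lambda>x. \<beta> * Theta \<theta> x"])
  fix T \<nu>
  show "Theta \<theta> (b_elt * (ahat_a T * b_elt ^ \<nu>)) = \<beta> * Theta \<theta> (ahat_a T * b_elt ^ \<nu>)"
    by (simp only: mult.assoc[symmetric] Theta_mult_b_power Theta_b_a Theta_a)
qed (simp_all add: Theta_add distrib_left continuous_Theta_mult_left
       continuous_mult_left Theta_continuous)

lemma Theta_mult: "Theta \<theta> (x * y) = Theta \<theta> x * Theta \<theta> y"
proof (rule b_continuous_eqI[where F = "\<lambda>x. Theta \<theta> (x * y)" and G = "\<lambda>x. Theta \<theta> x * Theta \<theta> y"])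
  have "Theta \<theta> (b_elt ^ n * y) = \<beta> ^ n * Theta \<theta> y" for n
    by (induction n) (simp_all add: Theta_b_mult mult.assoc)
  then show "Theta \<theta> (ahat_a T * b_elt ^ \<nu> * y) = Theta \<theta> (ahat_a T * b_elt ^ \<nu>) * Theta \<theta> y" for T \<nu>
    using Theta_monom[of 1 \<nu>] by (simp add: mult.assoc Theta_a_mult ahat_a_simps)
qed (simp_all add: Theta_add distrib_right continuous_Theta_mult_right
       continuous_mult_right Theta_continuous)

end

lemma is_change_aut_Theta:
  assumes \<theta>: "change_of_variable \<theta>"
  shows "is_change_aut \<theta> (Theta \<theta>)"
proof -
  have inv: "Theta \<sigma> (Theta \<tau> x) = x"
    if \<sigma>: "fps_nth \<sigma> 0 = 0" and \<tau>: "fps_nth \<tau> 0 = 0" and \<tau>\<sigma>: "fps_compose \<tau> \<sigma> = fps_X" for \<sigma> \<tau> x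
  proof (rule b_continuous_eqI[where F = "\<lambda>x. Theta \<sigma> (Theta \<tau> x)" and G = "\<lambda>x. x"])
    show "b_continuous (\<lambda>x. Theta \<sigma> (Theta \<tau> x))"
      using Theta_continuous[OF \<sigma>] Theta_continuous[OF \<tau>] unfolding b_continuous_def by metis
    show "b_continuous (\<lambda>x. x)"
      unfolding b_continuous_def by blast
    have b: "Theta \<sigma> (Theta \<tau> b_elt) = b_elt"
    proof -
      have "Theta \<tau> b_elt = b_elt * ahat_a (fps_deriv \<tau>)"
        using Theta_b_a[OF \<tau>, of 1] by (simp add: ahat_a_simps)
      then have "Theta \<sigma> (Theta \<tau> b_elt) =
          b_elt * ahat_a (fps_compose (fps_deriv \<tau>) \<sigma> * fps_deriv \<sigma>)"
        by (simp add: Theta_b_a[OF \<sigma>] mult.assoc mult.commute[of _ "fps_deriv \<sigma>"] ahat_a_simps)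
      also have "fps_compose (fps_deriv \<tau>) \<sigma> * fps_deriv \<sigma> = 1"
        using fps_compose_deriv[OF \<sigma>, of \<tau>] \<tau>\<sigma> by simp
      finally show ?thesis by (simp add: ahat_a_simps)
    qed
    have one: "Theta \<sigma> 1 = 1" "Theta \<tau> 1 = 1"
      using Theta_a[OF \<sigma>, of 1] Theta_a[OF \<tau>, of 1] by (simp_all add: ahat_a_simps)
    have bp: "Theta \<sigma> (Theta \<tau> (b_elt ^ n)) = b_elt ^ n" for n
      by (induction n) (simp_all add: Theta_mult[OF \<sigma>] Theta_mult[OF \<tau>] b one)
    show "Theta \<sigma> (Theta \<tau> (ahat_a T * b_elt ^ \<nu>)) = ahat_a T * b_elt ^ \<nu>" for T \<nu>
      by (simp add: Theta_mult[OF \<sigma>] Theta_mult[OF \<tau>] bp Theta_a[OF \<sigma>] Theta_a[OF \<tau>]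
          fps_compose_assoc[OF \<sigma> \<tau>, symmetric] \<tau>\<sigma>)
  qed (simp_all add: Theta_add[OF \<sigma>] Theta_add[OF \<tau>])
  have \<theta>0: "fps_nth \<theta> 0 = 0" and \<theta>1: "fps_nth \<theta> 1 \<noteq> 0"
    using \<theta> by (auto simp: change_of_variable_def)
  have i0: "fps_nth (fps_inv \<theta>) 0 = 0"
    by (simp add: fps_inv_def)
  have "bij (Theta \<theta>)"
    by (rule o_bij[where g = "Theta (fps_inv \<theta>)"])
       (auto simp: fun_eq_iff inv[OF i0 \<theta>0 fps_inv_right[OF \<theta>0 \<theta>1]] inv[OF \<theta>0 i0 fps_inv[OF \<theta>0 \<theta>1]])
  moreover have "Theta \<theta> 1 = 1"
    using Theta_a[OF \<theta>0, of 1] by (simp add: ahat_a_simps)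
  moreover have "Theta \<theta> b_elt = b_elt * ahat_a (fps_deriv \<theta>)"
    using Theta_b_a[OF \<theta>0, of 1] by (simp add: ahat_a_simps)
  ultimately show ?thesis
    by (simp add: is_change_aut_def Theta_continuous[OF \<theta>0] Theta_add[OF \<theta>0] Theta_mult[OF \<theta>0] Theta_a[OF \<theta>0])
qed

lemma is_change_aut_unique:
  assumes F: "is_change_aut \<theta> F" and G: "is_change_aut \<theta> G"
  shows "F = G"
proof
  fix x
  have mult: "F (x * y) = F x * F y" "G (x * y) = G x * G y" for x y
    using F G by (simp_all add: is_change_aut_def)
  have eq: "F 1 = G 1" "F b_elt = G b_elt" "F (ahat_a T) = G (ahat_a T)" for T
    using F G by (simp_all add: is_change_aut_def)
  have p: "F (b_elt ^ n) = G (b_elt ^ n)" for n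
    by (induction n) (simp_all only: power_0 power_Suc mult eq)
  show "F x = G x"
  proof (rule b_continuous_eqI[of F G])
    show "F (ahat_a T * b_elt ^ \<nu>) = G (ahat_a T * b_elt ^ \<nu>)" for T \<nu>
      by (simp only: mult eq p)
  qed (use F G in \<open>simp_all add: is_change_aut_def\<close>)
qed

lemma change_aut:
  assumes "change_of_variable \<theta>"
  shows "is_change_aut \<theta> (change_aut \<theta>)" "change_aut \<theta> = Theta \<theta>"
proof -
  show "change_aut \<theta> = Theta \<theta>"
    unfolding change_aut_def
    by (rule the_equality, rule is_change_aut_Theta[OF assms],
        rule is_change_aut_unique, assumption, rule is_change_aut_Theta[OF assms])
  then show "is_change_aut \<theta> (change_aut \<theta>)"
    using is_change_aut_Theta[OF assms] by simp
qed

definition left_module :: "(ahat, 'e) module \<Rightarrow> bool"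
  where "left_module M \<longleftrightarrow> abelian_group M \<and>
    (\<forall>\<alpha>. \<forall>e\<in>carrier M. \<alpha> \<odot>\<^bsub>M\<^esub> e \<in> carrier M) \<and>
    (\<forall>\<alpha>. \<forall>e\<in>carrier M. \<forall>f\<in>carrier M. \<alpha> \<odot>\<^bsub>M\<^esub> (e \<oplus>\<^bsub>M\<^esub> f) = \<alpha> \<odot>\<^bsub>M\<^esub> e \<oplus>\<^bsub>M\<^esub> \<alpha> \<odot>\<^bsub>M\<^esub> f) \<and>
    (\<forall>\<alpha> \<alpha>'. \<forall>e\<in>carrier M. (\<alpha> + \<alpha>') \<odot>\<^bsub>M\<^esub> e = \<alpha> \<odot>\<^bsub>M\<^esub> e \<oplus>\<^bsub>M\<^esub> \<alpha>' \<odot>\<^bsub>M\<^esub> e) \<and>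
    (\<forall>\<alpha> \<alpha>'. \<forall>e\<in>carrier M. (\<alpha> * \<alpha>') \<odot>\<^bsub>M\<^esub> e = \<alpha> \<odot>\<^bsub>M\<^esub> (\<alpha>' \<odot>\<^bsub>M\<^esub> e)) \<and>
    (\<forall>e\<in>carrier M. 1 \<odot>\<^bsub>M\<^esub> e = e)"

definition submodule_of :: "(ahat, 'e) module \<Rightarrow> 'e set \<Rightarrow> bool"
  where "submodule_of M G \<longleftrightarrow> G \<subseteq> carrier M \<and> \<zero>\<^bsub>M\<^esub> \<in> G \<and>
    (\<forall>e\<in>G. \<forall>f\<in>G. e \<oplus>\<^bsub>M\<^esub> f \<in> G) \<and> (\<forall>\<alpha>. \<forall>e\<in>G. \<alpha> \<odot>\<^bsub>M\<^esub> e \<in> G)"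

definition module_embedding :: "(ahat, 'e) module \<Rightarrow> (ahat, 'f) module \<Rightarrow> ('e \<Rightarrow> 'f) \<Rightarrow> bool"
  where "module_embedding M N \<iota> \<longleftrightarrow> \<iota> ` carrier M \<subseteq> carrier N \<and> inj_on \<iota> (carrier M) \<and>
    (\<forall>e\<in>carrier M. \<forall>f\<in>carrier M. \<iota> (e \<oplus>\<^bsub>M\<^esub> f) = \<iota> e \<oplus>\<^bsub>N\<^esub> \<iota> f) \<and>
    (\<forall>\<alpha>. \<forall>e\<in>carrier M. \<iota> (\<alpha> \<odot>\<^bsub>M\<^esub> e) = \<alpha> \<odot>\<^bsub>N\<^esub> \<iota> e)"

definition twist_module :: "complex fps \<Rightarrow> (ahat, 'e) module \<Rightarrow> (ahat, 'e) module"
  where "twist_module \<theta> M = M\<lparr>smult := \<lambda>\<alpha> e. change_aut \<theta> \<alpha> \<odot>\<^bsub>M\<^esub> e\<rparr>"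

text \<open>\<open>M\<close> is free of rank \<open>n\<close> over $\mathbb{C}[[b]]$.\<close>
definition free_b_rank :: "(ahat, 'e) module \<Rightarrow> nat \<Rightarrow> bool"
  where "free_b_rank M n \<longleftrightarrow> (\<exists>u. (\<forall>i<n. u i \<in> carrier M) \<and>
    (\<forall>e\<in>carrier M. \<exists>!S. (\<forall>i\<ge>n. S i = 0) \<and>
       e = (\<Oplus>\<^bsub>M\<^esub>i\<in>{..<n}. ahat_b (S i) \<odot>\<^bsub>M\<^esub> u i)))"

definition simple_pole :: "(ahat, 'e) module \<Rightarrow> bool"
  where "simple_pole M \<longleftrightarrow> left_module M \<and> (\<exists>n. free_b_rank M n) \<and>
    (\<forall>e\<in>carrier M. \<exists>f\<in>carrier M. a_elt \<odot>\<^bsub>M\<^esub> e = b_elt \<odot>\<^bsub>M\<^esub> f)"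

text \<open>Being a submodule of a simple pole module is expressed by an embedding. The type
  \<^typ>\<open>nat \<Rightarrow> complex fps\<close> of the elements of the target is no restriction: a module which is free
  of rank \<open>n\<close> over $\mathbb{C}[[b]]$ is isomorphic to one with underlying set $\mathbb{C}[[b]]^n$.\<close>
definition regular :: "(ahat, 'e) module \<Rightarrow> bool"
  where "regular M \<longleftrightarrow> left_module M \<and>
    (\<exists>(N :: (ahat, nat \<Rightarrow> complex fps) module) \<iota>. simple_pole N \<and> module_embedding M N \<iota>)"

text \<open>The saturation of \<open>S\<close> by $b^{-1}a$ inside a simple pole module \<open>N\<close>, that is, the smallest
  simple pole submodule containing \<open>S\<close>; freeness over $\mathbb{C}[[b]]$ is automatic for
  submodules of \<open>N\<close>. It does not depend on \<open>N\<close>, since $N$ embeds in $N[b^{-1}]$.\<close>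
definition saturation :: "(ahat, 'e) module \<Rightarrow> 'e set \<Rightarrow> 'e set"
  where "saturation N S = \<Inter>{G. submodule_of N G \<and> S \<subseteq> G \<and>
    (\<forall>e\<in>G. \<exists>f\<in>G. a_elt \<odot>\<^bsub>N\<^esub> e = b_elt \<odot>\<^bsub>N\<^esub> f)}"

definition b_inv_a :: "(ahat, 'e) module \<Rightarrow> 'e \<Rightarrow> 'e"
  where "b_inv_a N e = (THE f. f \<in> carrier N \<and> b_elt \<odot>\<^bsub>N\<^esub> f = a_elt \<odot>\<^bsub>N\<^esub> e)"

text \<open>$p(-b^{-1}a) = 0$ on $G/bG$.\<close>
definition annihilates :: "(ahat, 'e) module \<Rightarrow> 'e set \<Rightarrow> complex poly \<Rightarrow> bool"
  where "annihilates N G p \<longleftrightarrow> (\<forall>e\<in>G.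
    (\<Oplus>\<^bsub>N\<^esub>i\<in>{..degree p}. ahat_a (fps_const (coeff p i * (-1) ^ i)) \<odot>\<^bsub>N\<^esub> (b_inv_a N ^^ i) e)
      \<in> (\<lambda>f. b_elt \<odot>\<^bsub>N\<^esub> f) ` G)"

definition bernstein_poly :: "(ahat, 'e) module \<Rightarrow> complex poly"
  where "bernstein_poly M = (THE p.
    \<exists>(N :: (ahat, nat \<Rightarrow> complex fps) module) \<iota>. simple_pole N \<and> module_embedding M N \<iota> \<and>
      lead_coeff p = 1 \<and> annihilates N (saturation N (\<iota> ` carrier M)) p \<and>
      (\<forall>q. annihilates N (saturation N (\<iota> ` carrier M)) q \<longrightarrow> p dvd q))"

definition geometric :: "(ahat, 'e) module \<Rightarrow> bool"
  where "geometric M \<longleftrightarrow> regular M \<and>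
    (\<forall>z. poly (bernstein_poly M) z = 0 \<longrightarrow> (\<exists>q :: rat. q < 0 \<and> z = of_rat q))"

definition fresco :: "(ahat, 'e) module \<Rightarrow> nat \<Rightarrow> bool"
  where "fresco M k \<longleftrightarrow> geometric M \<and> free_b_rank M k \<and>
    (\<exists>e\<in>carrier M. carrier M = range (\<lambda>\<alpha>. \<alpha> \<odot>\<^bsub>M\<^esub> e))"

definition complex_space :: "nat \<Rightarrow> (nat \<Rightarrow> complex) topology"
  where "complex_space n = product_topology (\<lambda>_. euclidean) {..<n}"

definition holomorphic_fun :: "nat \<Rightarrow> (nat \<Rightarrow> complex) set \<Rightarrow> ((nat \<Rightarrow> complex) \<Rightarrow> complex) \<Rightarrow> bool"
  where "holomorphic_fun n D F \<longleftrightarrow> (\<forall>z\<in>D. \<exists>c :: nat \<Rightarrow> complex. \<forall>\<epsilon>>0. \<exists>\<delta>>0. \<forall>w\<in>D.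
    (\<forall>i<n. norm (w i - z i) < \<delta>) \<longrightarrow>
      norm (F w - F z - (\<Sum>i<n. c i * (w i - z i))) \<le> \<epsilon> * (\<Sum>i<n. norm (w i - z i)))"

definition analytic_subset :: "nat \<Rightarrow> (nat \<Rightarrow> complex) set \<Rightarrow> (nat \<Rightarrow> complex) set \<Rightarrow> bool"
  where "analytic_subset n D A \<longleftrightarrow> A \<subseteq> D \<and> (\<forall>z\<in>D. \<exists>D' \<F>.
    openin (complex_space n) D' \<and> z \<in> D' \<and> D' \<subseteq> D \<and> finite \<F> \<and>
    (\<forall>F\<in>\<F>. holomorphic_fun n D' F) \<and> A \<inter> D' = {w\<in>D'. \<forall>F\<in>\<F>. F w = 0})"

text \<open>A function on an open set is represented by its extension by zero to the whole type.\<close>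
definition restr :: "'x set \<Rightarrow> ('x \<Rightarrow> 'c) \<Rightarrow> 'x \<Rightarrow> 'c::zero"
  where "restr W f = (\<lambda>x. if x \<in> W then f x else 0)"

text \<open>As the space is reduced, its structure sheaf \<open>Ox\<close> is a sheaf of complex valued functions:
  locally, those induced by holomorphic functions on the ambient space of a local model.\<close>
definition reduced_complex_space :: "'x topology \<Rightarrow> ('x set \<Rightarrow> ('x \<Rightarrow> complex) set) \<Rightarrow> bool"
  where "reduced_complex_space X Ox \<longleftrightarrow> Hausdorff_space X \<and>
    (\<forall>U f. openin X U \<and> f \<in> Ox U \<longrightarrow> (\<forall>x. x \<notin> U \<longrightarrow> f x = 0)) \<and>
    (\<forall>U W f. openin X U \<and> openin X W \<and> W \<subseteq> U \<and> f \<in> Ox U \<longrightarrow> restr W f \<in> Ox W) \<and>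
    (\<forall>U f. openin X U \<and> (\<forall>x. x \<notin> U \<longrightarrow> f x = 0) \<and>
       (\<forall>x\<in>U. \<exists>W. openin X W \<and> x \<in> W \<and> W \<subseteq> U \<and> restr W f \<in> Ox W) \<longrightarrow> f \<in> Ox U) \<and>
    (\<forall>p\<in>topspace X. \<exists>V n D A h. openin X V \<and> p \<in> V \<and>
       openin (complex_space n) D \<and> analytic_subset n D A \<and>
       homeomorphic_map (subtopology X V) (subtopology (complex_space n) A) h \<and>
       (\<forall>W. openin X W \<and> W \<subseteq> V \<longrightarrow>
          Ox W = {f. (\<forall>x. x \<notin> W \<longrightarrow> f x = 0) \<and>
            (\<forall>x\<in>W. \<exists>D' F. openin (complex_space n) D' \<and> h x \<in> D' \<and> holomorphic_fun n D' F \<and>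
               (\<forall>y\<in>W. h y \<in> D' \<longrightarrow> f y = F (h y)))}))"

text \<open>Sections over \<open>U\<close> of $\mathcal{O}_X[[b]]$, as functions with values in $\mathbb{C}[[b]]$.\<close>
definition ob_sections :: "('x set \<Rightarrow> ('x \<Rightarrow> complex) set) \<Rightarrow> 'x set \<Rightarrow> ('x \<Rightarrow> complex fps) set"
  where "ob_sections Ox U = {g. \<forall>n. (\<lambda>x. fps_nth (g x) n) \<in> Ox U}"

record ('x, 's) ahat_sheaf =
  sect :: "'x set \<Rightarrow> (ahat, 's) module"
  rest :: "'x set \<Rightarrow> 'x set \<Rightarrow> 's \<Rightarrow> 's"
  ob_act :: "'x set \<Rightarrow> ('x \<Rightarrow> complex fps) \<Rightarrow> 's \<Rightarrow> 's"

abbreviation secs :: "('x, 's) ahat_sheaf \<Rightarrow> 'x set \<Rightarrow> 's set"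
  where "secs E U \<equiv> carrier (sect E U)"

text \<open>Compatibility: the two actions agree on $\mathbb{C}[[b]]$, and \<open>ahat\<close> acts
  $\mathcal{O}_X$-linearly.\<close>
definition ob_module :: "('x set \<Rightarrow> ('x \<Rightarrow> complex) set) \<Rightarrow> ('x, 's) ahat_sheaf \<Rightarrow> 'x set \<Rightarrow> bool"
  where "ob_module Ox E U \<longleftrightarrow> left_module (sect E U) \<and>
    (\<forall>g\<in>ob_sections Ox U. \<forall>s\<in>secs E U. ob_act E U g s \<in> secs E U) \<and>
    (\<forall>g\<in>ob_sections Ox U. \<forall>s\<in>secs E U. \<forall>t\<in>secs E U.
       ob_act E U g (s \<oplus>\<^bsub>sect E U\<^esub> t) = ob_act E U g s \<oplus>\<^bsub>sect E U\<^esub> ob_act E U g t) \<and>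
    (\<forall>g\<in>ob_sections Ox U. \<forall>h\<in>ob_sections Ox U. \<forall>s\<in>secs E U.
       ob_act E U (\<lambda>x. g x + h x) s = ob_act E U g s \<oplus>\<^bsub>sect E U\<^esub> ob_act E U h s \<and>
       ob_act E U (\<lambda>x. g x * h x) s = ob_act E U g (ob_act E U h s)) \<and>
    (\<forall>S. \<forall>s\<in>secs E U. ob_act E U (restr U (\<lambda>_. S)) s = ahat_b S \<odot>\<^bsub>sect E U\<^esub> s) \<and>
    (\<forall>f\<in>Ox U. \<forall>\<alpha>. \<forall>s\<in>secs E U.
       ob_act E U (\<lambda>x. fps_const (f x)) (\<alpha> \<odot>\<^bsub>sect E U\<^esub> s) =
       \<alpha> \<odot>\<^bsub>sect E U\<^esub> ob_act E U (\<lambda>x. fps_const (f x)) s)"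

definition is_ahat_sheaf ::
  "'x topology \<Rightarrow> ('x set \<Rightarrow> ('x \<Rightarrow> complex) set) \<Rightarrow> ('x, 's) ahat_sheaf \<Rightarrow> bool"
  where "is_ahat_sheaf X Ox E \<longleftrightarrow>
    (\<forall>U. openin X U \<longrightarrow> ob_module Ox E U \<and> (\<forall>s\<in>secs E U. rest E U U s = s)) \<and>
    (\<forall>U W. openin X U \<and> openin X W \<and> W \<subseteq> U \<longrightarrow> (\<forall>s\<in>secs E U.
       rest E U W s \<in> secs E W \<and>
       (\<forall>t\<in>secs E U. rest E U W (s \<oplus>\<^bsub>sect E U\<^esub> t) = rest E U W s \<oplus>\<^bsub>sect E W\<^esub> rest E U W t) \<and>
       (\<forall>\<alpha>. rest E U W (\<alpha> \<odot>\<^bsub>sect E U\<^esub> s) = \<alpha> \<odot>\<^bsub>sect E W\<^esub> rest E U W s) \<and>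
       (\<forall>g\<in>ob_sections Ox U. rest E U W (ob_act E U g s) = ob_act E W (restr W g) (rest E U W s)) \<and>
       (\<forall>W'. openin X W' \<and> W' \<subseteq> W \<longrightarrow> rest E W W' (rest E U W s) = rest E U W' s))) \<and>
    (\<forall>\<U>. (\<forall>W\<in>\<U>. openin X W) \<longrightarrow>
       (\<forall>s\<in>secs E (\<Union>\<U>). \<forall>t\<in>secs E (\<Union>\<U>).
          (\<forall>W\<in>\<U>. rest E (\<Union>\<U>) W s = rest E (\<Union>\<U>) W t) \<longrightarrow> s = t) \<and>
       (\<forall>\<sigma>. (\<forall>W\<in>\<U>. \<sigma> W \<in> secs E W) \<and>
          (\<forall>W\<in>\<U>. \<forall>W'\<in>\<U>. rest E W (W \<inter> W') (\<sigma> W) = rest E W' (W \<inter> W') (\<sigma> W')) \<longrightarrow>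
          (\<exists>s\<in>secs E (\<Union>\<U>). \<forall>W\<in>\<U>. rest E (\<Union>\<U>) W s = \<sigma> W)))"

text \<open>Isomorphism of the restrictions to the open set \<open>V\<close>.\<close>
definition sheaf_iso_on :: "'x topology \<Rightarrow> ('x set \<Rightarrow> ('x \<Rightarrow> complex) set) \<Rightarrow> 'x set \<Rightarrow>
    ('x, 's) ahat_sheaf \<Rightarrow> ('x, 't) ahat_sheaf \<Rightarrow> bool"
  where "sheaf_iso_on X Ox V E F \<longleftrightarrow> (\<exists>\<eta>. \<forall>W. openin X W \<and> W \<subseteq> V \<longrightarrow>
    bij_betw (\<eta> W) (secs E W) (secs F W) \<and>
    (\<forall>s\<in>secs E W.
       (\<forall>t\<in>secs E W. \<eta> W (s \<oplus>\<^bsub>sect E W\<^esub> t) = \<eta> W s \<oplus>\<^bsub>sect F W\<^esub> \<eta> W t) \<and>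
       (\<forall>\<alpha>. \<eta> W (\<alpha> \<odot>\<^bsub>sect E W\<^esub> s) = \<alpha> \<odot>\<^bsub>sect F W\<^esub> \<eta> W s) \<and>
       (\<forall>g\<in>ob_sections Ox W. \<eta> W (ob_act E W g s) = ob_act F W g (\<eta> W s)) \<and>
       (\<forall>W'. openin X W' \<and> W' \<subseteq> W \<longrightarrow> \<eta> W' (rest E W W' s) = rest F W W' (\<eta> W s))))"

definition subsheaf_on :: "'x topology \<Rightarrow> ('x set \<Rightarrow> ('x \<Rightarrow> complex) set) \<Rightarrow> 'x set \<Rightarrow>
    ('x, 's) ahat_sheaf \<Rightarrow> ('x set \<Rightarrow> 's set) \<Rightarrow> bool"
  where "subsheaf_on X Ox V F S \<longleftrightarrow> (\<forall>W. openin X W \<and> W \<subseteq> V \<longrightarrow>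
    submodule_of (sect F W) (S W) \<and>
    (\<forall>g\<in>ob_sections Ox W. \<forall>s\<in>S W. ob_act F W g s \<in> S W) \<and>
    (\<forall>W' s. openin X W' \<and> W' \<subseteq> W \<and> s \<in> S W \<longrightarrow> rest F W W' s \<in> S W') \<and>
    (\<forall>s\<in>secs F W. (\<forall>x\<in>W. \<exists>W'. openin X W' \<and> x \<in> W' \<and> W' \<subseteq> W \<and> rest F W W' s \<in> S W') \<longrightarrow> s \<in> S W))"

text \<open>The subsheaf over \<open>V\<close> generated by a section \<open>\<phi>\<close> over \<open>V\<close>.\<close>
definition generated_sheaf :: "'x topology \<Rightarrow> ('x set \<Rightarrow> ('x \<Rightarrow> complex) set) \<Rightarrow> 'x set \<Rightarrow>
    ('x, 's) ahat_sheaf \<Rightarrow> 's \<Rightarrow> ('x, 's) ahat_sheaf"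
  where "generated_sheaf X Ox V F \<phi> = F\<lparr>sect := \<lambda>W. (sect F W)\<lparr>carrier :=
    \<Inter>{S W | S. subsheaf_on X Ox V F S \<and> \<phi> \<in> S V}\<rparr>\<rparr>"

text \<open>Elements of $\Xi^{(N)}_\lambda \otimes V$ with $V = \mathbb{C}^m$: \<open>s j i\<close> is the coefficient in
  $\mathbb{C}[[b]]$ of $e_j \otimes v_i$, for a basis $(v_i)$ of $V$. The action of $a$ comes from
  $a e_j = \lambda b e_j + b e_{j-1}$ and $a S(b) - S(b) a = b^2 S'(b)$.\<close>

definition xi_a :: "complex \<Rightarrow> (nat \<Rightarrow> nat \<Rightarrow> complex fps) \<Rightarrow> nat \<Rightarrow> nat \<Rightarrow> complex fps"
  where "xi_a lam s = (\<lambda>j i.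
    fps_const lam * fps_X * s j i + fps_X * s (Suc j) i + fps_X ^ 2 * fps_deriv (s j i))"

text \<open>$\sum_\nu P_\nu(a) b^\nu s$. The sums are finite in each degree in $b$ since $a$ raises the order.\<close>
definition xi_act :: "complex \<Rightarrow> ahat \<Rightarrow> (nat \<Rightarrow> nat \<Rightarrow> complex fps) \<Rightarrow> nat \<Rightarrow> nat \<Rightarrow> complex fps"
  where "xi_act lam \<alpha> s = (\<lambda>j i. Abs_fps (\<lambda>d. \<Sum>\<nu>\<le>d. \<Sum>n\<le>d.
    fps_nth (acoeff \<alpha> \<nu>) n * fps_nth ((xi_a lam ^^ n) (\<lambda>j i. fps_X ^ \<nu> * s j i) j i) d))"

definition xi_module :: "complex \<Rightarrow> nat \<Rightarrow> nat \<Rightarrow> (ahat, nat \<Rightarrow> nat \<Rightarrow> complex fps) module"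
  where "xi_module lam N m = \<lparr>carrier = {s. \<forall>j i. \<not> (j \<le> N \<and> i < m) \<longrightarrow> s j i = 0},
    mult = undefined, one = undefined, zero = 0, add = (+), smult = xi_act lam\<rparr>"

text \<open>Sections of $\Xi^{(N)}_{\lambda,X} \otimes V$ over \<open>U\<close> are the functions on \<open>U\<close> with values in
  $\Xi^{(N)}_\lambda \otimes V$ all of whose coefficients are in $\mathcal{O}_X(U)$; evaluation at \<open>x\<close>
  is \<open>\<lambda>s. s x\<close>.\<close>
definition xi_sheaf :: "('x set \<Rightarrow> ('x \<Rightarrow> complex) set) \<Rightarrow> complex \<Rightarrow> nat \<Rightarrow> nat \<Rightarrow>
    ('x, 'x \<Rightarrow> nat \<Rightarrow> nat \<Rightarrow> complex fps) ahat_sheaf"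
  where "xi_sheaf Ox lam N m = \<lparr>
    sect = (\<lambda>U. \<lparr>carrier = {s. (\<forall>x. s x \<in> carrier (xi_module lam N m)) \<and>
        (\<forall>j i. (\<lambda>x. s x j i) \<in> ob_sections Ox U)},
      mult = undefined, one = undefined, zero = 0, add = (+), smult = \<lambda>\<alpha> s x. xi_act lam \<alpha> (s x)\<rparr>),
    rest = (\<lambda>U W. restr W),
    ob_act = (\<lambda>U g s x j i. g x * s x j i)\<rparr>"

definition value_at :: "'x topology \<Rightarrow> 'x set \<Rightarrow> ('x, 'x \<Rightarrow> 'c) ahat_sheaf \<Rightarrow> 'x \<Rightarrow> 'c set"
  where "value_at X V F x = {s x | s W. openin X W \<and> x \<in> W \<and> W \<subseteq> V \<and> s \<in> secs F W}"

definition admissible :: "'x topology \<Rightarrow> ('x set \<Rightarrow> ('x \<Rightarrow> complex) set) \<Rightarrow> complex \<Rightarrow> nat \<Rightarrow> nat \<Rightarrow>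
    nat \<Rightarrow> 'x set \<Rightarrow> ('x \<Rightarrow> nat \<Rightarrow> nat \<Rightarrow> complex fps) \<Rightarrow> bool"
  where "admissible X Ox lam N m k V \<phi> \<longleftrightarrow>
    (let \<Xi> = xi_sheaf Ox lam N m; G = generated_sheaf X Ox V \<Xi> \<phi> in
      \<phi> \<in> secs \<Xi> V \<and>
      (\<forall>W. openin X W \<and> W \<subseteq> V \<longrightarrow> (\<forall>s\<in>secs G W.
         \<exists>!g. (\<forall>j<k. g j \<in> ob_sections Ox W) \<and> (\<forall>j\<ge>k. g j = 0) \<and>
           s = (\<Sum>j<k. ob_act \<Xi> W (g j) (rest \<Xi> V W (a_elt ^ j \<odot>\<^bsub>sect \<Xi> V\<^esub> \<phi>))))) \<and>
      (\<forall>x\<in>V. fresco ((xi_module lam N m)\<lparr>carrier := value_at X V G x\<rparr>) k))"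

definition holomorphic_family :: "'x topology \<Rightarrow> ('x set \<Rightarrow> ('x \<Rightarrow> complex) set) \<Rightarrow> rat \<Rightarrow> nat \<Rightarrow>
    ('x, 's) ahat_sheaf \<Rightarrow> bool"
  where "holomorphic_family X Ox lam k E \<longleftrightarrow> is_ahat_sheaf X Ox E \<and>
    (\<forall>p\<in>topspace X. \<exists>V N m \<phi>. openin X V \<and> p \<in> V \<and>
       admissible X Ox (of_rat lam) N m k V \<phi> \<and>
       sheaf_iso_on X Ox V E (generated_sheaf X Ox V (xi_sheaf Ox (of_rat lam) N m) \<phi>))"

text \<open>The twisted sheaf: $\mathcal{O}_X$ acts as before and $b$ acts as \<open>\<beta> = change_aut \<theta> b_elt\<close>, so that
  $\sum_n f_n b^n$ acts on \<open>s\<close> by the limit of the partial sums of $\sum_n f_n \beta^n s$ for the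
  $\beta$-adic topology (which is the $b$-adic one, as $\beta$ is $b$ times a unit).
  The limit exists and is unique when the sheaf is locally free of finite rank over
  $\mathcal{O}_X[[b]]$.\<close>
definition twist_sheaf :: "complex fps \<Rightarrow> ('x, 's) ahat_sheaf \<Rightarrow> ('x, 's) ahat_sheaf"
  where "twist_sheaf \<theta> E = E\<lparr>
    sect := \<lambda>U. twist_module \<theta> (sect E U),
    ob_act := \<lambda>U g s. let \<beta> = change_aut \<theta> b_elt in
      THE t. t \<in> secs E U \<and> (\<forall>d. \<exists>u\<in>secs E U. t =
        (\<Oplus>\<^bsub>sect E U\<^esub>n\<in>{..<d}. ob_act E U (\<lambda>x. fps_const (fps_nth (g x) n)) (\<beta> ^ n \<odot>\<^bsub>sect E U\<^esub> s))
        \<oplus>\<^bsub>sect E U\<^esub> \<beta> ^ d \<odot>\<^bsub>sect E U\<^esub> u)\<rparr>"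

text \<open>Sections over \<open>W\<close> of $\mathfrak{M}_x E$, up to shrinking the neighbourhood \<open>W\<close> of \<open>x\<close>.\<close>
definition max_ideal_span :: "('x set \<Rightarrow> ('x \<Rightarrow> complex) set) \<Rightarrow> ('x, 's) ahat_sheaf \<Rightarrow>
    'x \<Rightarrow> 'x set \<Rightarrow> 's set"
  where "max_ideal_span Ox E x W = \<Inter>{S. \<zero>\<^bsub>sect E W\<^esub> \<in> S \<and>
    (\<forall>s\<in>S. \<forall>t\<in>S. s \<oplus>\<^bsub>sect E W\<^esub> t \<in> S) \<and>
    (\<forall>f\<in>Ox W. \<forall>t\<in>secs E W. f x = 0 \<longrightarrow> ob_act E W (\<lambda>y. fps_const (f y)) t \<in> S)}"

definition fibre_rel :: "'x topology \<Rightarrow> ('x set \<Rightarrow> ('x \<Rightarrow> complex) set) \<Rightarrow> ('x, 's) ahat_sheaf \<Rightarrow>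
    'x \<Rightarrow> (('x set \<times> 's) \<times> ('x set \<times> 's)) set"
  where "fibre_rel X Ox E x = {((U, s), (U', s')).
    openin X U \<and> x \<in> U \<and> s \<in> secs E U \<and> openin X U' \<and> x \<in> U' \<and> s' \<in> secs E U' \<and>
    (\<exists>W. openin X W \<and> x \<in> W \<and> W \<subseteq> U \<inter> U' \<and>
       rest E U W s \<ominus>\<^bsub>sect E W\<^esub> rest E U' W s' \<in> max_ideal_span Ox E x W)}"

text \<open>The fibre $E(x) = E_x / \mathfrak{M}_x E_x$; its elements are classes of sections on
  neighbourhoods of \<open>x\<close>.\<close>
definition fibre :: "'x topology \<Rightarrow> ('x set \<Rightarrow> ('x \<Rightarrow> complex) set) \<Rightarrow> ('x, 's) ahat_sheaf \<Rightarrow>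
    'x \<Rightarrow> (ahat, ('x set \<times> 's) set) module"
  where "fibre X Ox E x = (let R = fibre_rel X Ox E x in
    \<lparr>carrier = {(U, s). openin X U \<and> x \<in> U \<and> s \<in> secs E U} // R,
     mult = undefined, one = undefined,
     zero = R `` {(topspace X, \<zero>\<^bsub>sect E (topspace X)\<^esub>)},
     add = \<lambda>A B. \<Union>(U, s)\<in>A. \<Union>(U', s')\<in>B.
       R `` {(U \<inter> U', rest E U (U \<inter> U') s \<oplus>\<^bsub>sect E (U \<inter> U')\<^esub> rest E U' (U \<inter> U') s')},
     smult = \<lambda>\<alpha> A. \<Union>(U, s)\<in>A. R `` {(U, \<alpha> \<odot>\<^bsub>sect E U\<^esub> s)}\<rparr>)"

end

theory Submission
  imports Defs
begin

text \<open>The module $\Xi^{(N)}_\lambda$ is a module of formal functions of a variable \<open>s\<close>: \<open>a\<close> is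
multiplication by \<open>s\<close>, \<open>b\<close> is integration from \<open>0\<close>, and
$e_j = s^{\lambda-1} (\log s)^j / j!$. In this picture a change of variable \<open>\<theta>\<close> acts by
substitution $f \mapsto f \circ \theta$. Substitution turns \<open>a\<close> into \<open>\<theta>(a)\<close> and \<open>b\<close> into
\<open>\<beta> = b \<theta>'(a)\<close>, and up to a constant factor and a translation of the logarithm it sends $e_j$ to
$u^{\lambda-1} \sum_i \frac{v^i}{i!} e_{j-i}$, where \<open>\<theta>(s) = \<theta>'(0) s u(s)\<close> and \<open>v = log u\<close>.
These elements can be written down formally, and the linear map \<open>Phi\<close> which they define satisfies
\<open>Phi (z s) = Theta z (Phi s)\<close> for all \<open>z\<close> in the algebra (\<open>act_theta_eps\<close>, \<open>Phi_act\<close>). On the part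
of order \<open>d\<close> in \<open>b\<close> its leading term is multiplication by \<open>\<theta>'(0)^d\<close> (\<open>Phi_lead\<close>), so \<open>Phi\<close> is
bijective, and its inverse \<open>Psi\<close> is found degree by degree. Every coefficient of \<open>Phi s\<close> or \<open>Psi s\<close>
is a finite linear combination of coefficients of \<open>s\<close>; hence both maps preserve holomorphy
(\<open>xsec_Phi\<close>, \<open>xsec_Psi\<close>). In short, $\theta_* \Xi \cong \Xi$.

Now let \<open>\<phi>\<close> be a \<open>k\<close>-admissible section and \<open>G\<close> the sheaf which it generates. Put
\<open>\<psi> = Psi \<phi>\<close>. Through \<open>Psi\<close> the twisted sheaf of \<open>G\<close> becomes a subsheaf \<open>P\<close> of \<open>\<Xi>\<close>, and it has to
be shown that \<open>P\<close> is generated by \<open>\<psi>\<close> and is free on the powers \<open>a^j \<psi>\<close>, \<open>j < k\<close>; equivalently, that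
every section of \<open>G\<close> is a \<open>\<beta>\<close>-adic combination of the sections \<open>\<theta>(a)^j \<phi>\<close>. The point is that \<open>a\<close>
is nilpotent on \<open>E(x) / b E(x)\<close>. Otherwise the relation expressing \<open>a^k \<phi>\<close> through the lower powers
would read \<open>a^i u(a) \<phi> \<in> b E(x)\<close> with \<open>i < k\<close> and an invertible series \<open>u(a)\<close>, so that
\<open>a^i \<phi> \<in> b E(x)\<close> (\<open>fib_coeff_zero\<close>). Hence \<open>a^k \<phi>\<close> lies in \<open>b G\<close>, modulo \<open>b G\<close> the powers of
\<open>\<theta>(a)\<close> span the same space as those of \<open>a\<close>, and since \<open>b\<close> and \<open>\<beta>\<close> differ by a unit the division
can be iterated (\<open>beta_expansion\<close>, \<open>P_span\<close>). Uniqueness of the coefficients is checked in each fibre, where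
\<open>k\<close> generators of a free module of rank \<open>k\<close> form a basis (\<open>spanning_b_basis\<close>).

The fibres of \<open>P\<close> are isomorphic to the twisted fibres of \<open>G\<close>, and twisting preserves frescos
(\<open>fresco_twist\<close>): the powers of \<open>b\<close> and of \<open>\<beta>\<close> generate the same filtration, so freeness and rank are
kept, a submodule is stable under \<open>b^{-1} a\<close> iff it is stable under \<open>\<beta>^{-1} \<theta>(a)\<close>, and the two
operators agree modulo \<open>b\<close> because \<open>\<theta>(a) = \<theta>'(0) a + \<dots>\<close> and \<open>\<beta> = b (\<theta>'(0) + \<dots>)\<close>. So the Bernstein
polynomial does not change.

The action of $\mathcal{O}_X[[b]]$ on the twisted sheaf is defined by \<open>\<beta>\<close>-adic limits. A local
isomorphism of \<open>E\<close> with some \<open>G\<close>, followed by \<open>Psi\<close>, turns such a limit into multiplication by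
a power series in \<open>b\<close>; there it exists and is unique, and by uniqueness the local limits glue
(\<open>lim_ex1\<close>). Therefore the twisted sheaf is a sheaf of modules, locally isomorphic to the sheaf
generated by \<open>\<psi>\<close> (\<open>sheaf_iso_twist\<close>). Functions in $\mathcal{O}_X$ act as before, so the maximal
ideals cut out the same classes and the fibre of the twisted sheaf is the twisted fibre
(\<open>fibre_twist\<close>).\<close>

section \<open>Commutation rules\<close>

abbreviation scalar :: "complex \<Rightarrow> ahat"
  where "scalar c \<equiv> ahat_a (fps_const c)"

lemma scalar_commute: "x * scalar c = scalar c * x"
proof (rule ahat_eqI)
  fix n
  have const: "(fps_deriv ^^ j) (fps_const c) = (if j = 0 then fps_const c else 0)" for j
    using deriv_const_mult[of j c 1] by (simp add: deriv_1)
  have "acoeff (x * scalar c) n = (\<Sum>t\<in>triples n. if t = (n, 0, 0) then fps_const c * acoeff x n else 0)"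
    unfolding acoeff_mult
    by (intro sum.cong refl) (auto simp: triples_def const deriv_0 mult.commute split: if_splits)
  then show "acoeff (x * scalar c) n = acoeff (scalar c * x) n"
    using triples_mem(2)[of n] by simp
qed

lemma scalar_mult: "scalar c * scalar d = scalar (c * d)"
  by (simp flip: ahat_a_simps)

lemma scalar_simps: "scalar 0 = 0" "scalar 1 = 1"
  using ahat_a_simps(1,2) by simp_all

lemma ahat_b_add: "ahat_b (S + T) = ahat_b S + ahat_b T"
  by (rule ahat_eqI) simp

lemma ahat_b_const: "ahat_b (fps_const c) = scalar c"
  by (rule ahat_eqI) simp

lemma ahat_b_0: "ahat_b 0 = 0"
  by (rule ahat_eqI) simp

lemma ahat_b_mult: "ahat_b (S * T) = ahat_b S * ahat_b T"
proof (rule ahat_eqI)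
  fix n
  have const: "(fps_deriv ^^ j) (fps_const c) = (if j = 0 then fps_const c else 0)" for j and c :: complex
    using deriv_const_mult[of j c 1] by (simp add: deriv_1)
  have "acoeff (ahat_b S * ahat_b T) n =
     (\<Sum>(\<nu>, j, \<mu>)\<in>triples n. if j = 0 then fps_const (fps_nth S \<nu> * fps_nth T \<mu>) else 0)"
    unfolding acoeff_mult by (intro sum.cong refl) (auto simp: const)
  also have "\<dots> = (\<Sum>(\<nu>, j, \<mu>)\<in>{t\<in>triples n. fst (snd t) = 0}. fps_const (fps_nth S \<nu> * fps_nth T \<mu>))"
    by (subst sum.inter_filter) (auto intro!: sum.cong)
  also have "\<dots> = (\<Sum>i=0..n. fps_const (fps_nth S i * fps_nth T (n - i)))"
    by (rule sum.reindex_bij_witness[of _ "\<lambda>i. (i, 0, n - i)" fst]) (auto simp: triples_def)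
  finally show "acoeff (ahat_b (S * T)) n = acoeff (ahat_b S * ahat_b T) n"
    by (simp add: fps_mult_nth sum_fps_const)
qed

lemma ahat_b_X_power: "ahat_b (fps_X ^ n) = b_elt ^ n"
  by (induction n) (simp_all add: ahat_b_mult ahat_b_const[of 1, simplified] ahat_a_simps)

lemma ahat_a_power: "ahat_a T ^ n = ahat_a (T ^ n)"
  by (induction n) (simp_all add: ahat_a_simps)

lemma ahat_a_sum: "ahat_a (\<Sum>l\<in>A. F l) = (\<Sum>l\<in>A. ahat_a (F l))"
  by (induction A rule: infinite_finite_induct) (simp_all add: ahat_a_simps)

lemma fps_split: "S = fps_const (fps_nth S 0) + fps_X * fps_shift 1 (S :: complex fps)"
  by (rule fps_ext) simp

lemma ahat_b_split: "ahat_b S = scalar (fps_nth S 0) + b_elt * ahat_b (fps_shift 1 S)"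
  by (subst fps_split) (simp add: ahat_b_add ahat_b_mult ahat_b_const)

lemma ahat_b_expand:
  "ahat_b S = (\<Sum>n<d. scalar (fps_nth S n) * b_elt ^ n) + b_elt ^ d * ahat_b (fps_shift d S)"
proof (induction d)
  case (Suc d)
  have "ahat_b (fps_shift d S) = scalar (fps_nth S d) + b_elt * ahat_b (fps_shift (Suc d) S)"
  proof -
    have "fps_shift 1 (fps_shift d S) = fps_shift (Suc d) S"
      by (rule fps_ext) simp
    then show ?thesis by (subst ahat_b_split) simp
  qed
  then show ?case
    by (subst Suc) (simp only: sum.lessThan_Suc distrib_left scalar_commute power_Suc2 mult.assoc add.assoc)
qed simp

lemma b_continuousI:
  assumes "\<And>x y. F (x + y) = F x + F y" and "\<And>n x. x \<in> b_filt n \<Longrightarrow> F x \<in> b_filt n"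
  shows "b_continuous F"
proof -
  have "F (x - y) = F x - F y" for x y
    using assms(1)[of "x - y" y] by (simp add: algebra_simps)
  then show ?thesis
    unfolding b_continuous_def using assms(2) by metis
qed

definition ahat_deriv :: "ahat \<Rightarrow> ahat"
  where "ahat_deriv x = Ahat (\<lambda>\<nu>. fps_deriv (acoeff x \<nu>))"

lemma acoeff_ahat_deriv [simp]: "acoeff (ahat_deriv x) \<nu> = fps_deriv (acoeff x \<nu>)"
  by (simp add: ahat_deriv_def)

text \<open>Moving \<open>b\<close> from the right of a factor to its left costs a correction in the derivative, from
\<open>T(a) b - b T(a) = b T'(a) b\<close>. Thus left multiples of powers of \<open>b\<close> are right multiples, which is how
all divisibility by \<open>b\<close> below is obtained.\<close>
lemma mult_b_eq: "x * b_elt = b_elt * (x + ahat_deriv x * b_elt)"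
proof (rule b_continuous_eqI[where F = "\<lambda>x. x * b_elt" and G = "\<lambda>x. b_elt * (x + ahat_deriv x * b_elt)"])
  have add: "ahat_deriv (x + y) = ahat_deriv x + ahat_deriv y" for x y
    by (rule ahat_eqI) simp
  show "b_elt * (x + y + ahat_deriv (x + y) * b_elt) =
      b_elt * (x + ahat_deriv x * b_elt) + b_elt * (y + ahat_deriv y * b_elt)" for x y
    by (simp add: add algebra_simps)
  show "b_continuous (\<lambda>x. x * b_elt)"
    by (rule b_continuousI) (auto simp: distrib_right intro: b_filt_ideal)
  show "b_continuous (\<lambda>x. b_elt * (x + ahat_deriv x * b_elt))"
  proof (rule b_continuousI)
    fix n x assume x: "x \<in> b_filt n"
    then have "ahat_deriv x \<in> b_filt n" by (simp add: b_filt_def)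
    then have "ahat_deriv x * b_elt \<in> b_filt n" by (rule b_filt_ideal)
    with x have "x + ahat_deriv x * b_elt \<in> b_filt n" unfolding b_filt_def by simp
    then show "b_elt * (x + ahat_deriv x * b_elt) \<in> b_filt n" by (rule b_filt_ideal)
  qed (simp add: add algebra_simps)
  fix T \<nu>
  have "ahat_deriv (ahat_a T * b_elt ^ \<nu>) = ahat_a (fps_deriv T) * b_elt ^ \<nu>"
    by (rule ahat_eqI) (simp add: acoeff_mult_b_power)
  then have "b_elt * (ahat_a T * b_elt ^ \<nu> + ahat_deriv (ahat_a T * b_elt ^ \<nu>) * b_elt) =
      (b_elt * ahat_a T + b_elt * ahat_a (fps_deriv T) * b_elt) * b_elt ^ \<nu>"
    by (simp add: distrib_left distrib_right mult.assoc power_commutes)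
  also have "\<dots> = ahat_a T * b_elt ^ \<nu> * b_elt"
    by (subst b_a_commute) (simp add: mult.assoc power_commutes)
  finally show "ahat_a T * b_elt ^ \<nu> * b_elt =
      b_elt * (ahat_a T * b_elt ^ \<nu> + ahat_deriv (ahat_a T * b_elt ^ \<nu>) * b_elt)" ..
qed (simp add: distrib_right)

lemma a_mult_b_eq: "ahat_a T * b_elt = b_elt * ahat_a T + b_elt * ahat_a (fps_deriv T) * b_elt"
  using b_a_commute[of T] by simp

lemma mult_b_power_swap: "\<exists>y. x * b_elt ^ n = b_elt ^ n * y"
proof (induction n arbitrary: x)
  case (Suc n)
  obtain y where "(x + ahat_deriv x * b_elt) * b_elt ^ n = b_elt ^ n * y"
    using Suc by blast
  then have "x * b_elt ^ Suc n = b_elt ^ Suc n * y"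
    by (simp only: power_Suc mult.assoc) (simp only: mult.assoc[symmetric] mult_b_eq[of x], simp only: mult.assoc)
  then show ?case by blast
qed auto

text \<open>Right multiplication by \<open>a\<close> in terms of coefficients, from \<open>b^n a = a b^n - n b^(n+1)\<close>.\<close>
lemma acoeff_mult_a:
  "acoeff (x * a_elt) n = fps_X * acoeff x n - (if n = 0 then 0 else of_nat (n - 1) * acoeff x (n - 1))"
proof -
  have X: "(fps_deriv ^^ j) (fps_X :: complex fps) = (if j = 0 then fps_X else if j = 1 then 1 else 0)" for j
  proof (cases j)
    case (Suc i)
    have "(fps_deriv ^^ j) (fps_X :: complex fps) = (fps_deriv ^^ i) 1"
      unfolding Suc funpow_Suc_right by simp
    then show ?thesis using Suc by (simp add: deriv_1)
  qed simp
  have "acoeff (x * a_elt) n = (\<Sum>t\<in>triples n.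
      (if t = (n, 0, 0) then fps_X * acoeff x n else 0) +
      (if t = (n - 1, 1, 0) then fps_const (- of_nat (n - 1)) * acoeff x (n - 1) else 0))"
    unfolding acoeff_mult
    by (intro sum.cong refl) (auto simp: triples_def X deriv_0 mult.commute split: if_splits)
  also have "\<dots> = fps_X * acoeff x n + (if n = 0 then 0 else fps_const (- of_nat (n - 1)) * acoeff x (n - 1))"
    by (simp only: sum.distrib sum.delta finite_triples) (auto simp: triples_def)
  also have "fps_const (- of_nat (n - 1) :: complex) = - of_nat (n - 1)"
    by (simp only: fps_const_neg[symmetric] fps_of_nat)
  finally show ?thesis by (simp add: algebra_simps)
qed

lemma a_ahat_b: "a_elt * ahat_b S = ahat_b S * a_elt + ahat_b (fps_X ^ 2 * fps_deriv S)"
proof (rule ahat_eqI)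
  fix n
  consider "n = 0" | "n = 1" | m where "n = Suc (Suc m)"
    by (metis One_nat_def not0_implies_Suc)
  then show "acoeff (a_elt * ahat_b S) n =
      acoeff (ahat_b S * a_elt + ahat_b (fps_X ^ 2 * fps_deriv S)) n"
    by cases (simp_all add: acoeff_mult_a fps_X_power_mult_nth fps_X_power_mult_right_nth mult.commute fps_of_nat[symmetric] algebra_simps)
qed

section \<open>The action on the asymptotic expansion module\<close>

type_synonym expansion = "nat \<Rightarrow> nat \<Rightarrow> complex fps"

lemma sum_fun_apply: "(\<Sum>x\<in>A. f x) j = (\<Sum>x\<in>A. f x j)"
  by (induction A rule: infinite_finite_induct) auto

lemma sum_additive:
  fixes F :: "'a::ab_group_add \<Rightarrow> 'b::ab_group_add"
  assumes "\<And>x y. F (x + y) = F x + F y"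
  shows "F (\<Sum>t\<in>T. f t) = (\<Sum>t\<in>T. F (f t))"
proof -
  have "F 0 = 0" using assms[of 0 0] by simp
  then show ?thesis by (induction T rule: infinite_finite_induct) (simp_all add: assms)
qed

definition xi_b :: "expansion \<Rightarrow> expansion"
  where "xi_b s = (\<lambda>j i. fps_X * s j i)"

text \<open>The \<open>b\<close>-adic filtration of \<open>\<Xi>\<close>. It is exhaustive and separated, and both \<open>a\<close> and \<open>b\<close> raise
it by one; identities between the actions are therefore proved modulo every \<open>xi_ord d\<close>.\<close>
definition xi_ord :: "nat \<Rightarrow> expansion set"
  where "xi_ord d = {s. \<forall>j i n. n < d \<longrightarrow> fps_nth (s j i) n = 0}"

lemma xi_b_funpow: "(xi_b ^^ n) s = (\<lambda>j i. fps_X ^ n * s j i)"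
  by (induction n) (auto simp: xi_b_def mult.assoc)

lemma xi_a_add: "xi_a lam (s + t) = xi_a lam s + xi_a lam t"
  by (intro ext) (simp add: xi_a_def algebra_simps)

lemma xi_b_add: "xi_b (s + t) = xi_b s + xi_b t"
  by (intro ext) (simp add: xi_b_def algebra_simps)

lemma xi_a_cmult: "xi_a lam (\<lambda>j i. fps_const c * s j i) = (\<lambda>j i. fps_const c * xi_a lam s j i)"
  by (intro ext) (simp add: xi_a_def algebra_simps)

lemma xi_a_funpow_add: "(xi_a lam ^^ n) (s + t) = (xi_a lam ^^ n) s + (xi_a lam ^^ n) t"
  by (induction n) (simp_all only: funpow.simps o_apply id_apply xi_a_add)

lemma xi_a_funpow_cmult:
  "(xi_a lam ^^ n) (\<lambda>j i. fps_const c * s j i) = (\<lambda>j i. fps_const c * (xi_a lam ^^ n) s j i)"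
  by (induction n) (simp_all only: funpow.simps o_apply id_apply xi_a_cmult)

lemma xi_b_funpow_add: "(xi_b ^^ n) (s + t) = (xi_b ^^ n) s + (xi_b ^^ n) t"
  by (induction n) (simp_all only: funpow.simps o_apply id_apply xi_b_add)

lemma xi_b_xi_a: "xi_b (xi_a lam s) = xi_a lam (xi_b s) - xi_b (xi_b s)"
  by (intro ext) (simp add: xi_a_def xi_b_def algebra_simps power2_eq_square)

lemma xi_b_funpow_xi_a:
  "(xi_b ^^ \<nu>) (xi_a lam s) = xi_a lam ((xi_b ^^ \<nu>) s) + (\<lambda>j i. fps_const (- of_nat \<nu>) * (xi_b ^^ Suc \<nu>) s j i)"
proof (induction \<nu>)
  case (Suc \<nu>)
  have "xi_b (\<lambda>j i. fps_const (- of_nat \<nu>) * (xi_b ^^ Suc \<nu>) s j i) =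
      (\<lambda>j i. fps_const (- of_nat \<nu>) * (xi_b ^^ Suc (Suc \<nu>)) s j i)"
    by (intro ext) (simp add: xi_b_def mult_ac)
  then have "(xi_b ^^ Suc \<nu>) (xi_a lam s) = xi_a lam ((xi_b ^^ Suc \<nu>) s) - (xi_b ^^ Suc (Suc \<nu>)) s
     + (\<lambda>j i. fps_const (- of_nat \<nu>) * (xi_b ^^ Suc (Suc \<nu>)) s j i)"
    unfolding funpow.simps o_apply Suc xi_b_add xi_b_xi_a by simp
  also have "\<dots> = xi_a lam ((xi_b ^^ Suc \<nu>) s) +
      (\<lambda>j i. fps_const (- of_nat (Suc \<nu>)) * (xi_b ^^ Suc (Suc \<nu>)) s j i)"
  proof (intro ext)
    fix j i
    have "fps_const (- of_nat (Suc \<nu>)) * (xi_b ^^ Suc (Suc \<nu>)) s j i =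
        fps_const (- of_nat \<nu>) * (xi_b ^^ Suc (Suc \<nu>)) s j i - (xi_b ^^ Suc (Suc \<nu>)) s j i"
      by (rule fps_ext) (simp add: algebra_simps)
    then show "(xi_a lam ((xi_b ^^ Suc \<nu>) s) - (xi_b ^^ Suc (Suc \<nu>)) s
         + (\<lambda>j i. fps_const (- of_nat \<nu>) * (xi_b ^^ Suc (Suc \<nu>)) s j i)) j i =
       (xi_a lam ((xi_b ^^ Suc \<nu>) s) +
         (\<lambda>j i. fps_const (- of_nat (Suc \<nu>)) * (xi_b ^^ Suc (Suc \<nu>)) s j i)) j i"
      by simp
  qed
  finally show ?case .
qed (auto intro!: ext)

lemma xi_ord_add: "s \<in> xi_ord d \<Longrightarrow> t \<in> xi_ord d \<Longrightarrow> s + t \<in> xi_ord d"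
  and xi_ord_diff: "s \<in> xi_ord d \<Longrightarrow> t \<in> xi_ord d \<Longrightarrow> s - t \<in> xi_ord d"
  and xi_ord_zero [simp]: "0 \<in> xi_ord d"
  and xi_ord_0 [simp]: "s \<in> xi_ord 0"
  by (auto simp: xi_ord_def)

lemma xi_ord_mono: "s \<in> xi_ord d \<Longrightarrow> e \<le> d \<Longrightarrow> s \<in> xi_ord e"
  by (auto simp: xi_ord_def)

lemma xi_ord_separated: "(\<And>d. s \<in> xi_ord d) \<Longrightarrow> s = 0"
  by (intro ext fps_ext) (force simp: xi_ord_def)

lemma xi_a_ord: "s \<in> xi_ord d \<Longrightarrow> xi_a lam s \<in> xi_ord (Suc d)"
  by (auto simp: xi_ord_def xi_a_def mult.assoc fps_X_power_mult_nth)

lemma xi_b_ord: "s \<in> xi_ord d \<Longrightarrow> xi_b s \<in> xi_ord (Suc d)"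
  by (auto simp: xi_ord_def xi_b_def)

lemma xi_monom_ord: "s \<in> xi_ord d \<Longrightarrow> (xi_a lam ^^ n) ((xi_b ^^ \<nu>) s) \<in> xi_ord (d + n + \<nu>)"
proof (induction n)
  case 0
  then show ?case by (induction \<nu>) (auto intro: xi_b_ord)
qed (auto intro: xi_a_ord)

lemma sum_extend_bounds:
  fixes f :: "nat \<Rightarrow> nat \<Rightarrow> 'a::comm_monoid_add"
  assumes "\<And>\<nu> n. \<nu> + n > d \<Longrightarrow> f \<nu> n = 0" "d \<le> K" "d \<le> L"
  shows "(\<Sum>\<nu>\<le>d. \<Sum>n\<le>d. f \<nu> n) = (\<Sum>\<nu>\<le>K. \<Sum>n\<le>L. f \<nu> n)"
  unfolding sum.cartesian_product
proof (rule sum.mono_neutral_left)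
  show "\<forall>t\<in>{..K} \<times> {..L} - {..d} \<times> {..d}. (case t of (\<nu>, n) \<Rightarrow> f \<nu> n) = 0"
    by (auto simp: not_le intro!: assms(1))
qed (use assms in auto)

text \<open>In degree \<open>d\<close> only the monomials of total degree at most \<open>d\<close> in \<open>a\<close> and \<open>b\<close> contribute, so the
bounds of the double sum can be enlarged at will. This makes index shifts harmless.\<close>
lemma xi_act_nth:
  assumes "d \<le> K" "d \<le> L"
  shows "fps_nth (xi_act lam x s j i) d = (\<Sum>\<nu>\<le>K. \<Sum>n\<le>L.
    fps_nth (acoeff x \<nu>) n * fps_nth ((xi_a lam ^^ n) ((xi_b ^^ \<nu>) s) j i) d)"
proof -
  have "fps_nth ((xi_a lam ^^ n) ((xi_b ^^ \<nu>) s) j i) d = 0" if "d < \<nu> + n" for \<nu> n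
    using xi_monom_ord[where s = s and d = 0 and lam = lam and n = n and \<nu> = \<nu>] that by (auto simp: xi_ord_def)
  then show ?thesis
    unfolding xi_act_def xi_b_funpow[symmetric] fps_nth_Abs_fps
    by (intro sum_extend_bounds) (use assms in auto)
qed

lemma xi_act_add_left: "xi_act lam (x + y) s = xi_act lam x s + xi_act lam y s"
  by (intro ext fps_ext) (simp add: xi_act_def sum.distrib algebra_simps)

lemma xi_act_add_right: "xi_act lam x (s + t) = xi_act lam x s + xi_act lam x t"
  by (intro ext fps_ext)
     (simp add: xi_act_nth[OF order.refl order.refl] xi_b_funpow_add xi_a_funpow_add sum.distrib algebra_simps)

lemma xi_act_cmult_right:
  "xi_act lam x (\<lambda>j i. fps_const c * s j i) = (\<lambda>j i. fps_const c * xi_act lam x s j i)"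
proof (intro ext fps_ext)
  fix j i d
  have "(xi_b ^^ \<nu>) (\<lambda>j i. fps_const c * s j i) = (\<lambda>j i. fps_const c * (xi_b ^^ \<nu>) s j i)" for \<nu>
    by (auto simp: xi_b_funpow mult_ac)
  then show "fps_nth (xi_act lam x (\<lambda>j i. fps_const c * s j i) j i) d =
      fps_nth (fps_const c * xi_act lam x s j i) d"
    by (simp add: xi_act_nth[OF order.refl order.refl] xi_a_funpow_cmult sum_distrib_left mult_ac)
qed

lemma xi_act_scalar_mult: "xi_act lam (scalar c * x) s = (\<lambda>j i. fps_const c * xi_act lam x s j i)"
  by (intro ext fps_ext) (simp add: xi_act_def sum_distrib_left mult_ac)

lemma sum_if_const: "(\<Sum>n\<in>A. if P then f n else 0) = (if P then \<Sum>n\<in>A. f n else 0)"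
  by simp

lemma xi_act_one: "xi_act lam 1 s = s"
proof (intro ext fps_ext)
  fix j i d
  have coeff_eq: "fps_nth (acoeff 1 \<nu>) n * fps_nth ((xi_a lam ^^ n) ((xi_b ^^ \<nu>) s) j i) d =
      (if \<nu> = 0 then (if n = 0 then fps_nth (s j i) d else 0) else 0)" for \<nu> n
    by auto
  have "fps_nth (xi_act lam 1 s j i) d =
      (\<Sum>\<nu>\<le>d. if \<nu> = 0 then (\<Sum>n\<le>d. if n = 0 then fps_nth (s j i) d else 0) else 0)"
    unfolding xi_act_nth[OF order.refl order.refl] coeff_eq
      sum_if_const ..
  also have "\<dots> = fps_nth (s j i) d"
    by simp
  finally show "fps_nth (xi_act lam 1 s j i) d = fps_nth (s j i) d" .
qed

lemma xi_act_scalar: "xi_act lam (scalar c) s = (\<lambda>j i. fps_const c * s j i)"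
  using xi_act_scalar_mult[of lam c 1 s] by (simp add: xi_act_one)

lemma xi_act_zero_left: "xi_act lam 0 s = 0"
  using xi_act_add_left[of lam 0 0 s] by simp

lemma xi_act_zero_right: "xi_act lam x 0 = 0"
  using xi_act_add_right[of lam x 0 0] by simp

lemma xi_act_sum_left: "xi_act lam (\<Sum>t\<in>T. x t) s = (\<Sum>t\<in>T. xi_act lam (x t) s)"
  by (rule sum_additive[of "\<lambda>x. xi_act lam x s"]) (rule xi_act_add_left)

lemma xi_act_sum_right: "xi_act lam x (\<Sum>t\<in>T. f t) = (\<Sum>t\<in>T. xi_act lam x (f t))"
  by (rule sum_additive[of "xi_act lam x"]) (rule xi_act_add_right)

lemma xi_act_mult_b: "xi_act lam (x * b_elt) s = xi_act lam x (xi_b s)"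
proof (intro ext fps_ext)
  fix j i d
  have "fps_nth (xi_act lam (x * b_elt) s j i) d = (\<Sum>\<nu>\<le>Suc d. \<Sum>n\<le>d.
      fps_nth (acoeff (x * b_elt) \<nu>) n * fps_nth ((xi_a lam ^^ n) ((xi_b ^^ \<nu>) s) j i) d)"
    by (rule xi_act_nth) auto
  also have "\<dots> = (\<Sum>\<nu>\<le>d. \<Sum>n\<le>d.
      fps_nth (acoeff x \<nu>) n * fps_nth ((xi_a lam ^^ n) ((xi_b ^^ \<nu>) (xi_b s)) j i) d)"
    by (subst sum.atMost_Suc_shift) (simp add: funpow_swap1)
  also have "\<dots> = fps_nth (xi_act lam x (xi_b s) j i) d"
    by (rule xi_act_nth[symmetric]) auto
  finally show "fps_nth (xi_act lam (x * b_elt) s j i) d = fps_nth (xi_act lam x (xi_b s) j i) d" .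
qed

lemma xi_act_mult_a: "xi_act lam (x * a_elt) s = xi_act lam x (xi_a lam s)"
proof (intro ext fps_ext)
  fix j i d
  define m where "m n \<nu> = fps_nth ((xi_a lam ^^ n) ((xi_b ^^ \<nu>) s) j i) d" for n \<nu>
  define c where "c \<nu> n = fps_nth (acoeff x \<nu>) n" for \<nu> n
  have "fps_nth (xi_act lam (x * a_elt) s j i) d =
     (\<Sum>\<nu>\<le>Suc d. \<Sum>n\<le>Suc d. (if n = 0 then 0 else c \<nu> (n - 1)) * m n \<nu>) -
     (\<Sum>\<nu>\<le>Suc d. \<Sum>n\<le>Suc d. (if \<nu> = 0 then 0 else of_nat (\<nu> - 1) * c (\<nu> - 1) n) * m n \<nu>)"
    unfolding xi_act_nth[of d "Suc d" "Suc d", OF le_SucI[OF order.refl] le_SucI[OF order.refl]] sum_subtractf[symmetric]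
    by (intro sum.cong refl)
       (auto simp: acoeff_mult_a m_def c_def algebra_simps simp flip: fps_of_nat)
  also have "(\<Sum>\<nu>\<le>Suc d. \<Sum>n\<le>Suc d. (if n = 0 then 0 else c \<nu> (n - 1)) * m n \<nu>) =
     (\<Sum>\<nu>\<le>Suc d. \<Sum>n\<le>d. c \<nu> n * m (Suc n) \<nu>)"
    by (subst sum.atMost_Suc_shift) simp
  also have "\<dots> = (\<Sum>\<nu>\<le>d. \<Sum>n\<le>d. c \<nu> n * m (Suc n) \<nu>)"
  proof -
    have "m (Suc n) (Suc d) = 0" for n
      using xi_monom_ord[where s = s and d = 0 and lam = lam and n = "Suc n" and \<nu> = "Suc d"] by (auto simp: xi_ord_def m_def)
    then show ?thesis by simp
  qed
  also have "(\<Sum>\<nu>\<le>Suc d. \<Sum>n\<le>Suc d. (if \<nu> = 0 then 0 else of_nat (\<nu> - 1) * c (\<nu> - 1) n) * m n \<nu>) =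
     (\<Sum>\<nu>\<le>d. \<Sum>n\<le>d. of_nat \<nu> * c \<nu> n * m n (Suc \<nu>))"
  proof -
    have "m (Suc d) (Suc \<nu>) = 0" for \<nu>
      using xi_monom_ord[where s = s and d = 0 and lam = lam and n = "Suc d" and \<nu> = "Suc \<nu>"] by (auto simp: xi_ord_def m_def)
    then show ?thesis by (subst sum.atMost_Suc_shift) simp
  qed
  also have "(\<Sum>\<nu>\<le>d. \<Sum>n\<le>d. c \<nu> n * m (Suc n) \<nu>) - (\<Sum>\<nu>\<le>d. \<Sum>n\<le>d. of_nat \<nu> * c \<nu> n * m n (Suc \<nu>)) =
     (\<Sum>\<nu>\<le>d. \<Sum>n\<le>d. c \<nu> n * (m (Suc n) \<nu> - of_nat \<nu> * m n (Suc \<nu>)))"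
    by (simp add: sum_subtractf algebra_simps)
  also have "\<dots> = fps_nth (xi_act lam x (xi_a lam s) j i) d"
    unfolding xi_act_nth[OF order.refl order.refl]
    by (intro sum.cong refl)
       (simp add: m_def c_def xi_b_funpow_xi_a xi_a_funpow_add xi_a_funpow_cmult funpow_swap1 del: fps_const_neg)
  finally show "fps_nth (xi_act lam (x * a_elt) s j i) d = fps_nth (xi_act lam x (xi_a lam s) j i) d" .
qed

text \<open>Elements of total degree at least \<open>d\<close> in \<open>a\<close> and \<open>b\<close>. Modulo this filtration every element is a
finite combination of monomials, which reduces identities such as associativity of the action to \<open>a\<close>
and \<open>b\<close>; the \<open>b\<close>-adic filtration would leave power series in \<open>a\<close>.\<close>
definition total_filt :: "nat \<Rightarrow> ahat set"
  where "total_filt d = {x. \<forall>\<nu> n. \<nu> + n < d \<longrightarrow> fps_nth (acoeff x \<nu>) n = 0}"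

lemma fps_deriv_funpow_nth_0:
  fixes f :: "complex fps"
  assumes "\<And>q. q < r \<Longrightarrow> fps_nth f q = 0" "p + j < r"
  shows "fps_nth ((fps_deriv ^^ j) f) p = 0"
  using assms by (induction j arbitrary: p) auto

text \<open>Each derivative in the product formula lowers the degree in \<open>a\<close> by one but comes with a further
factor \<open>b\<close>, so the total degree does not drop.\<close>
lemma total_filt_left_ideal:
  assumes "y \<in> total_filt d"
  shows "x * y \<in> total_filt d"
  unfolding total_filt_def
proof clarify
  fix m p assume mp: "m + p < d"
  have "fps_nth (fps_const (nbinom \<nu> j) * acoeff x \<nu> * (fps_deriv ^^ j) (acoeff y \<mu>)) p = 0"
    if t: "(\<nu>, j, \<mu>) \<in> triples m" for \<nu> j \<mu>
  proof -
    have "fps_nth ((fps_deriv ^^ j) (acoeff y \<mu>)) q = 0" if "q \<le> p" for q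
      using assms t mp that
      by (intro fps_deriv_funpow_nth_0[of "d - \<mu>"]) (auto simp: total_filt_def triples_def)
    then show ?thesis by (simp add: fps_mult_nth)
  qed
  then show "fps_nth (acoeff (x * y) m) p = 0"
    unfolding acoeff_mult fps_sum_nth by (intro sum.neutral) auto
qed

lemma xi_act_total_filt:
  assumes "x \<in> total_filt e" "s \<in> xi_ord q"
  shows "xi_act lam x s \<in> xi_ord (e + q)"
  unfolding xi_ord_def
proof clarify
  fix j i d assume d: "d < e + q"
  have "fps_nth (acoeff x \<nu>) n * fps_nth ((xi_a lam ^^ n) ((xi_b ^^ \<nu>) s) j i) d = 0" for \<nu> n
  proof (cases "\<nu> + n < e")
    case False
    then show ?thesis
      using xi_monom_ord[OF assms(2), where lam = lam and n = n and \<nu> = \<nu>] d by (auto simp: xi_ord_def)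
  qed (use assms in \<open>auto simp: total_filt_def\<close>)
  then show "fps_nth (xi_act lam x s j i) d = 0"
    unfolding xi_act_nth[OF order.refl order.refl] by (intro sum.neutral ballI)
qed

lemma total_filt_0 [simp]: "x \<in> total_filt 0"
  by (simp add: total_filt_def)

lemma xi_act_ord: "s \<in> xi_ord q \<Longrightarrow> xi_act lam x s \<in> xi_ord q"
  using xi_act_total_filt[of x 0 s q] by simp

lemma xi_act_diff_right: "xi_act lam x (s - t) = xi_act lam x s - xi_act lam x t"
  using xi_act_add_right[of lam x "s - t" t] by (simp add: algebra_simps)

lemma total_filt_trunc:
  "x - (\<Sum>\<nu><d. \<Sum>n<d. scalar (fps_nth (acoeff x \<nu>) n) * (a_elt ^ n * b_elt ^ \<nu>)) \<in> total_filt d"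
proof -
  have coeff_eq: "fps_nth (acoeff (scalar c * (ahat_a (fps_X ^ n) * b_elt ^ \<nu>)) m) p =
      (if \<nu> = m then (if n = p then c else 0) else 0)" for c n \<nu> m p
    by (auto simp: acoeff_mult_b_power)
  have "fps_nth (acoeff (\<Sum>\<nu><d. \<Sum>n<d. scalar (fps_nth (acoeff x \<nu>) n) * (a_elt ^ n * b_elt ^ \<nu>)) m) p =
      fps_nth (acoeff x m) p" if "m + p < d" for m p
  proof -
    have "fps_nth (acoeff (\<Sum>\<nu><d. \<Sum>n<d. scalar (fps_nth (acoeff x \<nu>) n) * (a_elt ^ n * b_elt ^ \<nu>)) m) p =
        (\<Sum>\<nu><d. if \<nu> = m then (\<Sum>n<d. if n = p then fps_nth (acoeff x \<nu>) n else 0) else 0)"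
      unfolding ahat_a_power acoeff_sum fps_sum_nth coeff_eq sum_if_const ..
    with that show ?thesis by simp
  qed
  then show ?thesis by (simp add: total_filt_def)
qed

text \<open>For \<open>y\<close> a monomial the identity holds because the action is defined by applying \<open>a\<close> and \<open>b\<close> in
turn; monomials are dense for the total degree, and both sides are continuous.\<close>
lemma xi_act_mult: "xi_act lam (x * y) s = xi_act lam x (xi_act lam y s)"
proof -
  have powers: "xi_act lam (z * (a_elt ^ n * b_elt ^ \<nu>)) s = xi_act lam z ((xi_a lam ^^ n) ((xi_b ^^ \<nu>) s))" for z n \<nu>
  proof -
    have "xi_act lam (w * b_elt ^ \<nu>) s = xi_act lam w ((xi_b ^^ \<nu>) s)" for w s
      by (induction \<nu> arbitrary: s)
         (simp_all add: xi_act_mult_b funpow_swap1 flip: mult.assoc power_Suc2 del: power_Suc,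
          metis funpow_swap1 mult.assoc power_Suc2 xi_act_mult_b)
    moreover have "xi_act lam (w * a_elt ^ n) s = xi_act lam w ((xi_a lam ^^ n) s)" for w s
      by (induction n arbitrary: s)
         (simp_all add: xi_act_mult_a funpow_swap1 flip: mult.assoc power_Suc2 del: power_Suc,
          metis funpow_swap1 mult.assoc power_Suc2 xi_act_mult_a)
    ultimately show ?thesis by (simp flip: mult.assoc)
  qed
  have monom: "xi_act lam (x * (scalar c * (a_elt ^ n * b_elt ^ \<nu>))) s =
      xi_act lam x (xi_act lam (scalar c * (a_elt ^ n * b_elt ^ \<nu>)) s)" for c n \<nu>
  proof -
    have "x * (scalar c * (a_elt ^ n * b_elt ^ \<nu>)) = scalar c * (x * (a_elt ^ n * b_elt ^ \<nu>))"
      by (simp add: scalar_commute flip: mult.assoc)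
    moreover have "xi_act lam (a_elt ^ n * b_elt ^ \<nu>) s = (xi_a lam ^^ n) ((xi_b ^^ \<nu>) s)"
      using powers[of 1 n \<nu>] by (simp add: xi_act_one)
    ultimately show ?thesis
      by (simp add: xi_act_scalar_mult powers xi_act_cmult_right)
  qed
  have sum: "xi_act lam (x * (\<Sum>t\<in>T. f t)) s = xi_act lam x (xi_act lam (\<Sum>t\<in>T. f t) s)"
    if "\<And>t. t \<in> T \<Longrightarrow> xi_act lam (x * f t) s = xi_act lam x (xi_act lam (f t) s)" for T :: "nat set" and f
    using that by (induction T rule: infinite_finite_induct)
      (simp_all add: xi_act_zero_left xi_act_zero_right distrib_left xi_act_add_left xi_act_add_right)
  have "xi_act lam (x * y) s - xi_act lam x (xi_act lam y s) \<in> xi_ord d" for d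
  proof -
    define t where "t = (\<Sum>\<nu><d. \<Sum>n<d. scalar (fps_nth (acoeff y \<nu>) n) * (a_elt ^ n * b_elt ^ \<nu>))"
    have r: "y - t \<in> total_filt d" unfolding t_def by (rule total_filt_trunc)
    have t: "xi_act lam (x * t) s = xi_act lam x (xi_act lam t s)"
      unfolding t_def by (intro sum monom)
    have "xi_act lam (x * y) s - xi_act lam x (xi_act lam y s) =
        xi_act lam (x * (t + (y - t))) s - xi_act lam x (xi_act lam (t + (y - t)) s)"
      by simp
    also have "\<dots> = xi_act lam (x * (y - t)) s - xi_act lam x (xi_act lam (y - t) s)"
      by (simp only: distrib_left xi_act_add_left xi_act_add_right t) simp
    also have "\<dots> \<in> xi_ord d"
      using xi_act_total_filt[OF r, of s 0 lam] xi_act_total_filt[OF total_filt_left_ideal[OF r], of s 0 lam x]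
      by (auto intro: xi_ord_diff xi_act_ord)
    finally show ?thesis .
  qed
  then show ?thesis using xi_ord_separated by fastforce
qed

lemma xi_act_a: "xi_act lam a_elt s = xi_a lam s"
  using xi_act_mult_a[of lam 1 s] by (simp add: xi_act_one)

lemma xi_act_b: "xi_act lam b_elt s = xi_b s"
  using xi_act_mult_b[of lam 1 s] by (simp add: xi_act_one)

lemma xi_act_ahat_b: "xi_act lam (ahat_b S) s = (\<lambda>j i. S * s j i)"
proof (intro ext fps_ext)
  fix j i d
  have "fps_nth (xi_act lam (ahat_b S) s j i) d =
      (\<Sum>\<nu>\<le>d. \<Sum>n\<le>d. if n = 0 then fps_nth S \<nu> * fps_nth (s j i) (d - \<nu>) else 0)"
    unfolding xi_act_nth[OF order.refl order.refl]
    by (intro sum.cong refl) (auto simp: xi_b_funpow fps_X_power_mult_nth)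
  then show "fps_nth (xi_act lam (ahat_b S) s j i) d = fps_nth (S * s j i) d"
    by (simp add: fps_mult_nth atLeast0AtMost)
qed

section \<open>Changes of variable\<close>

locale variable_change =
  fixes \<theta> :: "complex fps"
  assumes change: "change_of_variable \<theta>"
begin

abbreviation beta :: ahat
  where "beta \<equiv> b_elt * ahat_a (fps_deriv \<theta>)"

abbreviation lead :: complex
  where "lead \<equiv> fps_nth \<theta> 1"

lemma theta_nth_0: "fps_nth \<theta> 0 = 0" and lead_nonzero: "lead \<noteq> 0"
  using change by (auto simp: change_of_variable_def)

lemma change_aut_eq: "change_aut \<theta> = Theta \<theta>"
  using change by (rule change_aut(2))

lemmas Theta_simps = Theta_add[OF theta_nth_0] Theta_diff[OF theta_nth_0] Theta_mult[OF theta_nth_0]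

lemma Theta_ahat_a: "Theta \<theta> (ahat_a T) = ahat_a (fps_compose T \<theta>)"
  by (rule Theta_a[OF theta_nth_0])

lemma Theta_scalar: "Theta \<theta> (scalar c) = scalar c"
  by (simp add: Theta_ahat_a)

lemma Theta_0: "Theta \<theta> 0 = 0" and Theta_1: "Theta \<theta> 1 = 1"
  using Theta_ahat_a[of 0] Theta_ahat_a[of 1] by (simp_all add: ahat_a_simps)

lemma Theta_a_elt: "Theta \<theta> a_elt = ahat_a \<theta>"
  by (simp add: Theta_ahat_a theta_nth_0)

lemma Theta_b_elt: "Theta \<theta> b_elt = beta"
  using Theta_b_a[OF theta_nth_0, of 1] by (simp add: ahat_a_simps)

lemma Theta_power: "Theta \<theta> (x ^ n) = Theta \<theta> x ^ n"
  by (induction n) (simp_all add: Theta_simps Theta_1)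

lemma bij_Theta: "bij (Theta \<theta>)"
  using is_change_aut_Theta[OF change] by (simp add: is_change_aut_def)

text \<open>The elements \<open>b\<close> and \<open>\<beta>\<close> differ by a unit on the right, and so do their powers. They define the
same adic filtration, on the algebra and on every left module.\<close>
lemma b_elt_eq_beta: "b_elt = beta * ahat_a (inverse (fps_deriv \<theta>))"
proof -
  have "fps_deriv \<theta> * inverse (fps_deriv \<theta>) = 1"
    using lead_nonzero by (intro inverse_mult_eq_1') simp
  then show ?thesis by (simp add: mult.assoc ahat_a_simps flip: ahat_a_simps(4))
qed

lemma beta_power_eq: "\<exists>x. beta ^ n = b_elt ^ n * x"
proof (induction n)
  case (Suc n)
  then obtain x where x: "beta ^ n = b_elt ^ n * x" by blast
  obtain y where y: "x * b_elt ^ 1 = b_elt ^ 1 * y" using mult_b_power_swap by blast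
  have "beta ^ Suc n = b_elt ^ n * (x * b_elt) * ahat_a (fps_deriv \<theta>)"
    by (simp only: power_Suc2 x mult.assoc)
  also have "\<dots> = b_elt ^ Suc n * (y * ahat_a (fps_deriv \<theta>))"
    using y by (simp only: power_Suc2 power_one_right mult.assoc)
  finally show ?case by blast
qed simp

lemma b_power_eq: "\<exists>x. b_elt ^ n = beta ^ n * x"
proof (induction n)
  case (Suc n)
  then obtain x where x: "b_elt ^ n = beta ^ n * x" by blast
  obtain y where y: "x * b_elt ^ 1 = b_elt ^ 1 * y" using mult_b_power_swap by blast
  have "b_elt ^ Suc n = beta ^ n * (x * b_elt)"
    by (simp only: power_Suc2 x mult.assoc)
  also have "\<dots> = beta ^ n * (b_elt * y)"
    using y by simp
  also have "\<dots> = beta ^ n * (beta * ahat_a (inverse (fps_deriv \<theta>)) * y)"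
    by (subst b_elt_eq_beta) (rule refl)
  also have "\<dots> = beta ^ Suc n * (ahat_a (inverse (fps_deriv \<theta>)) * y)"
    by (simp only: power_Suc2 mult.assoc)
  finally show ?case by blast
qed simp

subsection \<open>Logarithm and powers of the unit\<close>

definition unit_part :: "complex fps"
  where "unit_part = fps_const (1 / lead) * fps_shift 1 \<theta>"

text \<open>The logarithm of \<open>unit_part\<close>, obtained by integrating its logarithmic derivative.\<close>
definition log_unit :: "complex fps"
  where "log_unit = fps_integral0 (fps_deriv unit_part * inverse unit_part)"

definition unit_powr :: "complex \<Rightarrow> complex fps"
  where "unit_powr \<mu> = fps_compose (fps_exp \<mu>) log_unit"

lemma theta_eq: "\<theta> = fps_X * (fps_const lead * unit_part)"
proof -
  have "fps_const lead * unit_part = fps_shift 1 \<theta>"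
    using lead_nonzero by (simp add: unit_part_def flip: mult.assoc)
  then show ?thesis
    by (intro fps_ext) (auto simp: theta_nth_0)
qed

lemma unit_part_0: "fps_nth unit_part 0 = 1"
  using lead_nonzero by (simp add: unit_part_def)

lemma log_unit_0: "fps_nth log_unit 0 = 0"
  by (simp add: log_unit_def)

lemma deriv_log_unit: "unit_part * fps_deriv log_unit = fps_deriv unit_part"
proof -
  have "unit_part * inverse unit_part = 1"
    by (intro inverse_mult_eq_1') (simp add: unit_part_0)
  then show ?thesis
    by (simp add: log_unit_def fps_deriv_fps_integral mult.left_commute)
qed

lemma unit_powr_0: "fps_nth (unit_powr \<mu>) 0 = 1"
  by (simp add: unit_powr_def)

lemma deriv_unit_powr: "fps_deriv (unit_powr \<mu>) = fps_const \<mu> * unit_powr \<mu> * fps_deriv log_unit"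
  by (simp add: unit_powr_def fps_compose_deriv[OF log_unit_0] fps_compose_mult_distrib[OF log_unit_0])

end

section \<open>The semilinear automorphism\<close>

locale expansion_change = variable_change \<theta> for \<theta> :: "complex fps" +
  fixes lam :: complex and N m :: nat
begin

abbreviation act :: "ahat \<Rightarrow> expansion \<Rightarrow> expansion"
  where "act \<equiv> xi_act lam"

abbreviation carr :: "expansion set"
  where "carr \<equiv> carrier (xi_module lam N m)"

text \<open>The coefficients of $\theta^{\lambda-1} (\log \theta)^j / j!$ with respect to
$s^{\lambda-1} (\log s)^{j-i} / (j-i)!$, after the constant $\theta'(0)^{\lambda-1}$ is dropped and
\<open>log \<theta>\<close> is replaced by \<open>log s + log u\<close>: both changes commute with \<open>a\<close> and \<open>b\<close>, and without them the
leading coefficient of \<open>eps j l\<close> is 1.\<close>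
definition log_coeff :: "nat \<Rightarrow> complex fps"
  where "log_coeff i = fps_const (1 / fact i) * (unit_powr (lam - 1) * log_unit ^ i)"

definition e :: "nat \<Rightarrow> nat \<Rightarrow> expansion"
  where "e j l = (\<lambda>j' i. if j' = j \<and> i = l then 1 else 0)"

text \<open>The image of \<open>e j l\<close> under the substitution of \<open>\<theta>\<close> for the variable.\<close>
definition eps :: "nat \<Rightarrow> nat \<Rightarrow> expansion"
  where "eps j l = (\<Sum>i\<le>j. act (ahat_a (log_coeff i)) (e (j - i) l))"

lemma log_coeff_0: "fps_nth (log_coeff i) 0 = (if i = 0 then 1 else 0)"
  by (simp add: log_coeff_def unit_powr_0 log_unit_0)

lemma deriv_log_coeff:
  "unit_part * fps_deriv (log_coeff i) = fps_deriv unit_part *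
     (fps_const (lam - 1) * log_coeff i + (if i = 0 then 0 else log_coeff (i - 1)))"
proof (cases i)
  case 0
  have "unit_part * fps_deriv (log_coeff 0) = (unit_part * fps_deriv log_unit) * (fps_const (lam - 1) * unit_powr (lam - 1))"
    by (simp add: log_coeff_def deriv_unit_powr mult_ac)
  then show ?thesis unfolding deriv_log_unit by (simp add: 0 log_coeff_def)
next
  case (Suc k)
  have f: "fps_const (1 / fact i) * of_nat (Suc k) = (fps_const (1 / fact k) :: complex fps)"
  proof -
    have "1 / fact i * of_nat (Suc k) = (1 / fact k :: complex)"
      by (simp add: Suc del: of_nat_Suc)
    then show ?thesis by (simp only: fps_of_nat[symmetric] fps_const_mult)
  qed
  have "fps_deriv (log_unit ^ i) = of_nat (Suc k) * log_unit ^ k * fps_deriv log_unit"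
    unfolding Suc fps_deriv_power by (simp only: diff_Suc_1 fps_of_nat mult_ac)
  then have "unit_part * fps_deriv (log_coeff i) = (unit_part * fps_deriv log_unit) *
     (fps_const (lam - 1) * log_coeff i + (fps_const (1 / fact i) * of_nat (Suc k)) * (unit_powr (lam - 1) * log_unit ^ k))"
    by (simp only: log_coeff_def fps_deriv_mult fps_deriv_const deriv_unit_powr) (simp add: algebra_simps)
  then show ?thesis unfolding deriv_log_unit f by (simp add: Suc log_coeff_def)
qed

lemma act_a_e: "act a_elt (e j l) = act b_elt (act (scalar lam) (e j l) + (if j = 0 then 0 else e (j - 1) l))"
  unfolding xi_act_a xi_act_b xi_act_scalar
  by (intro ext) (auto simp: xi_a_def xi_b_def e_def distrib_left)

text \<open>In terms of functions, \<open>s T(s) e_j\<close> is the integral of its derivative, and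
$(s\,T\,s^{\lambda-1} (\log s)^j / j!)' = (s T' + \lambda T) e_j + T e_{j-1}$.\<close>
lemma act_aT_e: "act (ahat_a (fps_X * T)) (e j l) =
   act (b_elt * ahat_a (fps_X * fps_deriv T + fps_const lam * T)) (e j l) +
   act (b_elt * ahat_a T) (if j = 0 then 0 else e (j - 1) l)"
proof -
  define w where "w = act (scalar lam) (e j l) + (if j = 0 then 0 else e (j - 1) l)"
  have "act (ahat_a (fps_X * T)) (e j l) = act (ahat_a T * b_elt) w"
    by (simp add: mult.commute[of fps_X] ahat_a_simps xi_act_mult act_a_e w_def)
  also have "\<dots> = act (b_elt * ahat_a T) w + act (b_elt * ahat_a (fps_deriv T)) (act b_elt w)"
    by (simp add: a_mult_b_eq xi_act_add_left xi_act_mult)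
  also have "act b_elt w = act a_elt (e j l)"
    by (simp add: act_a_e w_def)
  also have "act (b_elt * ahat_a (fps_deriv T)) (act a_elt (e j l)) = act (b_elt * ahat_a (fps_X * fps_deriv T)) (e j l)"
    by (simp add: mult.commute[of fps_X] ahat_a_simps mult.assoc flip: xi_act_mult)
  also have "act (b_elt * ahat_a T) w = act (b_elt * ahat_a (fps_const lam * T)) (e j l) +
      act (b_elt * ahat_a T) (if j = 0 then 0 else e (j - 1) l)"
    by (simp add: w_def xi_act_add_right mult.commute[of "fps_const lam"] ahat_a_simps mult.assoc flip: xi_act_mult)
  finally show ?thesis
    by (simp only: ahat_a_simps distrib_left xi_act_add_left) (simp only: add_ac)
qed

text \<open>The chain rule for $\theta^\lambda (\log\theta)^i/i!$, whose derivative is \<open>\<theta>'\<close> times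
$\lambda \theta^{\lambda-1} (\log\theta)^i/i! + \theta^{\lambda-1} (\log\theta)^{i-1}/(i-1)!$, read off on
coefficients.\<close>
lemma log_coeff_ode:
  "fps_X * fps_deriv (fps_const lead * unit_part * log_coeff i) + fps_const lam * (fps_const lead * unit_part * log_coeff i) =
   fps_deriv \<theta> * (fps_const lam * log_coeff i) +
   (if i = 0 then 0 else fps_X * fps_const lead * fps_deriv unit_part * log_coeff (i - 1))"
proof -
  define t where "t = (if i = 0 then 0 else log_coeff (i - 1))"
  have \<theta>: "fps_deriv \<theta> = fps_const lead * (unit_part + fps_X * fps_deriv unit_part)"
    by (subst theta_eq) (simp add: algebra_simps)
  have "fps_deriv (fps_const lead * unit_part * log_coeff i) =
      fps_const lead * (fps_deriv unit_part * log_coeff i + unit_part * fps_deriv (log_coeff i))"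
    by (simp add: algebra_simps)
  also have "\<dots> = fps_const lead * fps_deriv unit_part * (fps_const lam * log_coeff i + t)"
    unfolding deriv_log_coeff t_def[symmetric]
    by (simp add: algebra_simps flip: fps_const_sub)
  finally have "fps_X * fps_deriv (fps_const lead * unit_part * log_coeff i) + fps_const lam * (fps_const lead * unit_part * log_coeff i) =
      fps_deriv \<theta> * (fps_const lam * log_coeff i) + fps_X * fps_const lead * fps_deriv unit_part * t"
    by (simp add: \<theta> algebra_simps)
  then show ?thesis by (simp add: t_def)
qed

text \<open>The relation \<open>a e_j = \<lambda> b e_j + b e_(j-1)\<close> after substitution: the elements \<open>eps j l\<close> satisfy the
defining relations of \<open>\<Xi>\<close> for \<open>\<theta>(a)\<close> and \<open>\<beta>\<close>.\<close>
lemma act_theta_eps: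
  "act (ahat_a \<theta>) (eps j l) = act beta (act (scalar lam) (eps j l) + (if j = 0 then 0 else eps (j - 1) l))"
proof -
  define B C where "B i = act (b_elt * ahat_a (fps_X * fps_const lead * fps_deriv unit_part * log_coeff i))"
    and "C i = act (b_elt * ahat_a (fps_const lead * unit_part * log_coeff i))" for i
  have 1: "act (ahat_a \<theta>) (act (ahat_a (log_coeff i)) (e (j - i) l)) =
      act beta (act (scalar lam) (act (ahat_a (log_coeff i)) (e (j - i) l))) +
      (if i = 0 then 0 else B (i - 1) (e (j - i) l)) + (if j - i = 0 then 0 else C i (e (j - i - 1) l))" for i
  proof -
    have "act (ahat_a \<theta>) (act (ahat_a (log_coeff i)) (e (j - i) l)) =
      act (ahat_a (fps_X * (fps_const lead * unit_part * log_coeff i))) (e (j - i) l)"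
      by (subst (1) theta_eq) (simp only: xi_act_mult[symmetric] ahat_a_simps(4)[symmetric] mult.assoc)
    also have "\<dots> = act (b_elt * ahat_a (fps_deriv \<theta> * (fps_const lam * log_coeff i) +
        (if i = 0 then 0 else fps_X * fps_const lead * fps_deriv unit_part * log_coeff (i - 1)))) (e (j - i) l) +
        act (b_elt * ahat_a (fps_const lead * unit_part * log_coeff i)) (if j - i = 0 then 0 else e (j - i - 1) l)"
      unfolding act_aT_e log_coeff_ode ..
    also have "\<dots> = act beta (act (scalar lam) (act (ahat_a (log_coeff i)) (e (j - i) l))) +
      (if i = 0 then 0 else B (i - 1) (e (j - i) l)) + (if j - i = 0 then 0 else C i (e (j - i - 1) l))"
      by (auto simp: B_def C_def ahat_a_simps distrib_left xi_act_add_left xi_act_mult xi_act_zero_left xi_act_zero_right)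
    finally show ?thesis .
  qed
  \<comment> \<open>the two error terms, shifted by one index against each other, add up to a multiple of \<beta>\<close>
  have BC: "B i s + C i s = act beta (act (ahat_a (log_coeff i)) s)" for i s
  proof -
    have "fps_deriv \<theta> = fps_const lead * (fps_X * fps_deriv unit_part + unit_part)"
      by (subst theta_eq) (simp add: algebra_simps)
    then have "fps_X * fps_const lead * fps_deriv unit_part * log_coeff i + fps_const lead * unit_part * log_coeff i =
        fps_deriv \<theta> * log_coeff i"
      by (simp add: algebra_simps)
    then show ?thesis
      by (simp add: B_def C_def xi_act_mult[symmetric] mult.assoc
          ahat_a_simps(4)[symmetric] flip: xi_act_add_left distrib_left ahat_a_simps(3))
  qed
  have "act (ahat_a \<theta>) (eps j l) = act beta (act (scalar lam) (eps j l)) +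
      ((\<Sum>i\<le>j. if i = 0 then 0 else B (i - 1) (e (j - i) l)) + (\<Sum>i\<le>j. if j - i = 0 then 0 else C i (e (j - i - 1) l)))"
    by (simp only: eps_def xi_act_sum_right 1 sum.distrib add.assoc)
  also have "(\<Sum>i\<le>j. if i = 0 then 0 else B (i - 1) (e (j - i) l)) + (\<Sum>i\<le>j. if j - i = 0 then 0 else C i (e (j - i - 1) l)) =
      act beta (if j = 0 then 0 else eps (j - 1) l)"
  proof (cases j)
    case (Suc k)
    have "(\<Sum>i\<le>j. if i = 0 then 0 else B (i - 1) (e (j - i) l)) = (\<Sum>i\<le>k. B i (e (k - i) l))"
      unfolding Suc by (subst sum.atMost_Suc_shift) simp
    moreover have "(\<Sum>i\<le>j. if j - i = 0 then 0 else C i (e (j - i - 1) l)) = (\<Sum>i\<le>k. C i (e (k - i) l))"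
      unfolding Suc sum.atMost_Suc by (auto intro!: sum.cong simp: Suc_diff_le)
    ultimately show ?thesis
      by (simp only: sum.distrib[symmetric] BC) (simp add: Suc eps_def xi_act_sum_right)
  qed (simp add: xi_act_zero_right)
  finally show ?thesis by (simp only: xi_act_add_right)
qed

lemma carr_iff: "s \<in> carr \<longleftrightarrow> (\<forall>j i. \<not> (j \<le> N \<and> i < m) \<longrightarrow> s j i = 0)"
  by (simp add: xi_module_def)

lemma carr_zero: "0 \<in> carr"
  and carr_add: "s \<in> carr \<Longrightarrow> t \<in> carr \<Longrightarrow> s + t \<in> carr"
  and carr_diff: "s \<in> carr \<Longrightarrow> t \<in> carr \<Longrightarrow> s - t \<in> carr"
  by (auto simp: carr_iff)

lemma carr_sum: "(\<And>t. t \<in> T \<Longrightarrow> f t \<in> carr) \<Longrightarrow> (\<Sum>t\<in>T. f t) \<in> carr"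
  by (induction T rule: infinite_finite_induct) (auto intro: carr_add carr_zero)

lemma carr_act:
  assumes "s \<in> carr"
  shows "act x s \<in> carr"
proof -
  have "(xi_b ^^ \<nu>) s \<in> carr" for \<nu>
    using assms by (simp add: xi_b_funpow carr_iff)
  then have "(xi_a lam ^^ n) ((xi_b ^^ \<nu>) s) \<in> carr" for n \<nu>
    by (induction n) (auto simp: carr_iff xi_a_def)
  then show ?thesis
    by (auto simp: carr_iff xi_act_def simp flip: xi_b_funpow intro!: fps_ext)
qed

lemma e_carr: "j \<le> N \<Longrightarrow> l < m \<Longrightarrow> e j l \<in> carr"
  by (auto simp: e_def carr_iff)

lemma eps_carr: "j \<le> N \<Longrightarrow> l < m \<Longrightarrow> eps j l \<in> carr"
  unfolding eps_def by (intro carr_sum carr_act e_carr) auto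

text \<open>Substitution of \<open>\<theta>\<close>: the extension of \<open>e j l \<mapsto> eps j l\<close> which turns power series in \<open>b\<close> into power
series in \<open>\<beta>\<close>.\<close>
definition Phi :: "expansion \<Rightarrow> expansion"
  where "Phi s = (\<Sum>j\<le>N. \<Sum>l<m. act (Theta \<theta> (ahat_b (s j l))) (eps j l))"

lemma Phi_carr: "Phi s \<in> carr"
  unfolding Phi_def by (intro carr_sum carr_act eps_carr) auto

lemma Phi_add: "Phi (s + t) = Phi s + Phi t"
  by (simp add: Phi_def ahat_b_add Theta_simps xi_act_add_left sum.distrib)

lemma Phi_zero: "Phi 0 = 0"
  using Phi_add[of 0 0] by simp

lemma Phi_diff: "Phi (s - t) = Phi s - Phi t"
  using Phi_add[of "s - t" t] by (simp add: algebra_simps)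

lemma Phi_ahat_b: "Phi (act (ahat_b S) s) = act (Theta \<theta> (ahat_b S)) (Phi s)"
  by (simp add: Phi_def xi_act_ahat_b ahat_b_mult Theta_simps xi_act_mult xi_act_sum_right)

lemma Phi_a:
  assumes "s \<in> carr"
  shows "Phi (act a_elt s) = act (ahat_a \<theta>) (Phi s)"
proof -
  define g where "g j l = act (Theta \<theta> (ahat_b (s j l))) (act beta (eps (j - 1) l))" for j l
  define r where "r j l = act (Theta \<theta> (ahat_b (s j l)) * beta * scalar lam) (eps j l) +
     act (Theta \<theta> (ahat_b (fps_X ^ 2 * fps_deriv (s j l)))) (eps j l)" for j l
  have 1: "act (Theta \<theta> (ahat_b (act a_elt s j l))) (eps j l) = r j l + g (Suc j) l" for j l
  proof -
    have "ahat_b (act a_elt s j l) = ahat_b (s j l) * b_elt * scalar lam + ahat_b (s (Suc j) l) * b_elt +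
        ahat_b (fps_X ^ 2 * fps_deriv (s j l))"
      unfolding xi_act_a xi_a_def ahat_b_add ahat_b_const[symmetric] ahat_b_mult[symmetric]
      by (simp only: mult_ac)
    then show ?thesis
      by (simp add: Theta_simps Theta_b_elt Theta_scalar xi_act_add_left r_def g_def xi_act_mult add_ac)
  qed
  have 2: "act (ahat_a \<theta>) (act (Theta \<theta> (ahat_b (s j l))) (eps j l)) = r j l + (if j = 0 then 0 else g j l)" for j l
  proof -
    have "ahat_a \<theta> * Theta \<theta> (ahat_b (s j l)) = Theta \<theta> (a_elt * ahat_b (s j l))"
      by (simp add: Theta_simps Theta_a_elt)
    also have "\<dots> = Theta \<theta> (ahat_b (s j l)) * ahat_a \<theta> + Theta \<theta> (ahat_b (fps_X ^ 2 * fps_deriv (s j l)))"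
      by (simp add: a_ahat_b Theta_simps Theta_a_elt)
    finally have "act (ahat_a \<theta>) (act (Theta \<theta> (ahat_b (s j l))) (eps j l)) =
        act (Theta \<theta> (ahat_b (s j l))) (act (ahat_a \<theta>) (eps j l)) +
        act (Theta \<theta> (ahat_b (fps_X ^ 2 * fps_deriv (s j l)))) (eps j l)"
      by (simp only: xi_act_mult[symmetric] xi_act_add_left[symmetric])
    then show ?thesis
      by (simp add: act_theta_eps xi_act_add_right xi_act_mult r_def g_def xi_act_zero_right add_ac)
  qed
  \<comment> \<open>the logarithms have degree at most N, so nothing is lost by the shift of index\<close>
  have last: "g (Suc N) l = 0" for l
    using assms by (simp add: g_def carr_iff ahat_b_0 Theta_0 xi_act_zero_left)
  have "(\<Sum>j\<le>N. \<Sum>l<m. g (Suc j) l) = (\<Sum>j\<le>Suc N. \<Sum>l<m. if j = 0 then 0 else g j l)"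
    by (subst sum.atMost_Suc_shift) simp
  also have "\<dots> = (\<Sum>j\<le>N. \<Sum>l<m. if j = 0 then 0 else g j l)"
    by (simp add: last)
  finally have shift: "(\<Sum>j\<le>N. \<Sum>l<m. g (Suc j) l) = (\<Sum>j\<le>N. \<Sum>l<m. if j = 0 then 0 else g j l)" .
  show ?thesis
    unfolding Phi_def xi_act_sum_right 1 2 by (simp only: sum.distrib shift)
qed

subsection \<open>Leading terms\<close>

lemma xi_ord_sum: "(\<And>t. t \<in> T \<Longrightarrow> f t \<in> xi_ord d) \<Longrightarrow> (\<Sum>t\<in>T. f t) \<in> xi_ord d"
  by (induction T rule: infinite_finite_induct) (auto intro: xi_ord_add)

lemma act_b_power_ord: "s \<in> xi_ord q \<Longrightarrow> act (b_elt ^ d) s \<in> xi_ord (d + q)"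
  by (induction d) (auto simp: xi_act_one xi_act_mult xi_act_b intro: xi_b_ord)

lemma act_beta_power_ord: "s \<in> xi_ord q \<Longrightarrow> act (beta ^ d) s \<in> xi_ord (d + q)"
  by (induction d) (auto simp: xi_act_one xi_act_mult xi_act_b intro!: xi_b_ord xi_act_ord)

text \<open>A power series in \<open>a\<close> acts by its constant term up to higher order, since \<open>a\<close> raises the order. The
next lemmas deduce the leading terms of \<open>\<beta>^d\<close> and of power series in \<open>\<beta>\<close>.\<close>
lemma act_a_lead: "s \<in> xi_ord q \<Longrightarrow> act (ahat_a T) s - act (scalar (fps_nth T 0)) s \<in> xi_ord (Suc q)"
proof -
  assume s: "s \<in> xi_ord q"
  have "ahat_a (T - fps_const (fps_nth T 0)) \<in> total_filt 1"
    by (simp add: total_filt_def)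
  then have "act (ahat_a (T - fps_const (fps_nth T 0))) s \<in> xi_ord (1 + q)"
    using s by (rule xi_act_total_filt)
  moreover have "act (ahat_a T) s = act (ahat_a (T - fps_const (fps_nth T 0))) s + act (scalar (fps_nth T 0)) s"
    by (simp flip: xi_act_add_left ahat_a_simps(3))
  ultimately show ?thesis by simp
qed

lemma act_beta_lead: "s \<in> xi_ord q \<Longrightarrow> act beta s - act (scalar lead) (act b_elt s) \<in> xi_ord (Suc (Suc q))"
proof -
  assume "s \<in> xi_ord q"
  from act_a_lead[OF this, of "fps_deriv \<theta>"]
  have "act b_elt (act (ahat_a (fps_deriv \<theta>)) s - act (scalar lead) s) \<in> xi_ord (Suc (Suc q))"
    unfolding xi_act_b by (intro xi_b_ord) simp
  also have "act b_elt (act (ahat_a (fps_deriv \<theta>)) s - act (scalar lead) s) =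
      act beta s - act (scalar lead) (act b_elt s)"
    by (simp only: xi_act_diff_right xi_act_mult[symmetric] scalar_commute)
  finally show ?thesis .
qed

lemma act_beta_power_lead:
  assumes s: "s \<in> xi_ord q"
  shows "act (beta ^ d) s - act (scalar (lead ^ d)) (act (b_elt ^ d) s) \<in> xi_ord (Suc (d + q))"
proof (induction d)
  case (Suc d)
  let ?t = "act (scalar (lead ^ d)) (act (b_elt ^ d) s)"
  have IH: "act (beta ^ d) s - ?t \<in> xi_ord (Suc (d + q))" by (rule Suc)
  have "act beta (act (beta ^ d) s - ?t) \<in> xi_ord (Suc (Suc (d + q)))"
    using act_beta_power_ord[OF IH, of 1] by (simp only: power_one_right plus_1_eq_Suc add_Suc)
  moreover have "act beta ?t - act (scalar lead) (act b_elt ?t) \<in> xi_ord (Suc (Suc (d + q)))"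
    by (intro act_beta_lead xi_act_ord act_b_power_ord s)
  ultimately have "act beta (act (beta ^ d) s - ?t) + (act beta ?t - act (scalar lead) (act b_elt ?t))
      \<in> xi_ord (Suc (Suc (d + q)))"
    by (rule xi_ord_add)
  moreover have "act (scalar lead) (act b_elt ?t) = act (scalar (lead ^ Suc d)) (act (b_elt ^ Suc d) s)"
  proof -
    have "scalar lead * (b_elt * (scalar (lead ^ d) * b_elt ^ d)) = scalar (lead ^ Suc d) * b_elt ^ Suc d"
      by (simp only: mult.assoc[symmetric] scalar_commute[of b_elt] power_Suc scalar_mult[symmetric] ahat_a_simps(4))
    then show ?thesis by (simp only: xi_act_mult[symmetric])
  qed
  moreover have "act beta (act (beta ^ d) s) = act (beta ^ Suc d) s"
    by (simp only: xi_act_mult power_Suc)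
  ultimately show "act (beta ^ Suc d) s - act (scalar (lead ^ Suc d)) (act (b_elt ^ Suc d) s)
      \<in> xi_ord (Suc (Suc d + q))"
    by (simp only: xi_act_diff_right add_Suc diff_add_eq_diff_diff_swap add_diff_eq diff_add_cancel)
qed (simp add: ahat_a_simps xi_act_one xi_ord_def)

lemma act_Theta_ahat_b_lead:
  assumes "s \<in> xi_ord q"
  shows "act (Theta \<theta> (ahat_b S)) s - act (scalar (fps_nth S 0)) s \<in> xi_ord (Suc q)"
proof -
  have "act (Theta \<theta> (ahat_b S)) s = act (scalar (fps_nth S 0)) s + act (beta ^ 1) (act (Theta \<theta> (ahat_b (fps_shift 1 S))) s)"
    by (subst ahat_b_split) (simp add: Theta_simps Theta_scalar Theta_b_elt xi_act_add_left xi_act_mult)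
  then show ?thesis
    using act_beta_power_ord[OF xi_act_ord[OF assms], of 1] by simp
qed

lemma eps_lead: "eps j l - e j l \<in> xi_ord 1"
proof -
  have "eps j l - e j l = (\<Sum>i\<le>j. act (ahat_a (log_coeff i)) (e (j - i) l) - act (scalar (fps_nth (log_coeff i) 0)) (e (j - i) l))"
  proof -
    have "(\<Sum>i\<le>j. act (scalar (fps_nth (log_coeff i) 0)) (e (j - i) l)) = (\<Sum>i\<le>j. if i = 0 then e j l else 0)"
      by (intro sum.cong refl) (auto simp: log_coeff_0 scalar_simps ahat_a_simps xi_act_one xi_act_zero_left)
    then show ?thesis by (simp add: sum_subtractf eps_def)
  qed
  also have "\<dots> \<in> xi_ord (Suc 0)"
    by (intro xi_ord_sum act_a_lead) simp
  finally show ?thesis by simp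
qed

text \<open>On the graded pieces, \<open>eps j l\<close> is \<open>e j l\<close> and \<open>\<beta>\<close> is \<open>\<theta>'(0) b\<close>. This triangularity makes \<open>Phi\<close>
invertible.\<close>
lemma Phi_lead:
  assumes s: "s \<in> carr" "s \<in> xi_ord d"
  shows "Phi s - act (scalar (lead ^ d)) s \<in> xi_ord (Suc d)"
proof -
  define S where "S j l = fps_shift d (s j l)" for j l
  have X: "s j l = fps_X ^ d * S j l" for j l
    using s(2) by (intro fps_ext) (auto simp: S_def xi_ord_def fps_X_power_mult_nth)
  have 1: "act (Theta \<theta> (ahat_b (s j l))) (eps j l) - act (scalar (lead ^ d)) (act (b_elt ^ d) (act (scalar (fps_nth (S j l) 0)) (e j l)))
      \<in> xi_ord (Suc d)" for j l
  proof -
    let ?u = "act (Theta \<theta> (ahat_b (S j l))) (eps j l)" and ?w = "act (scalar (fps_nth (S j l) 0)) (e j l)"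
    have "?u - act (scalar (fps_nth (S j l) 0)) (eps j l) \<in> xi_ord 1"
      using act_Theta_ahat_b_lead[of "eps j l" 0] by simp
    moreover have "act (scalar (fps_nth (S j l) 0)) (eps j l - e j l) \<in> xi_ord 1"
      by (intro xi_act_ord eps_lead)
    ultimately have "?u - act (scalar (fps_nth (S j l) 0)) (eps j l) + act (scalar (fps_nth (S j l) 0)) (eps j l - e j l) \<in> xi_ord 1"
      by (rule xi_ord_add)
    then have "?u - ?w \<in> xi_ord 1" by (simp add: xi_act_diff_right)
    then have "act (beta ^ d) (?u - ?w) \<in> xi_ord (d + 1)"
      by (rule act_beta_power_ord)
    moreover have "act (beta ^ d) ?w - act (scalar (lead ^ d)) (act (b_elt ^ d) ?w) \<in> xi_ord (d + 1)"
      using act_beta_power_lead[of ?w 0 d] by simp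
    ultimately have "act (beta ^ d) (?u - ?w) + (act (beta ^ d) ?w - act (scalar (lead ^ d)) (act (b_elt ^ d) ?w)) \<in> xi_ord (d + 1)"
      by (rule xi_ord_add)
    then show ?thesis
      by (simp add: xi_act_diff_right X ahat_b_mult Theta_simps ahat_b_X_power Theta_power Theta_b_elt xi_act_mult)
  qed
  define h where "h = (\<Sum>j\<le>N. \<Sum>l<m. act (b_elt ^ d) (act (scalar (fps_nth (S j l) 0)) (e j l)))"
  have "Phi s - act (scalar (lead ^ d)) h \<in> xi_ord (Suc d)"
    unfolding Phi_def h_def xi_act_sum_right sum_subtractf[symmetric] by (intro xi_ord_sum 1)
  moreover have "h - s \<in> xi_ord (Suc d)"
    unfolding xi_ord_def mem_Collect_eq
  proof (intro allI impI)
    fix j i n assume n: "n < Suc d"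
    have "h j i = (\<Sum>j'\<le>N. if j' = j then (\<Sum>l<m. if l = i then fps_X ^ d * fps_const (fps_nth (S j i) 0) else 0) else 0)"
      unfolding h_def sum_fun_apply sum_if_const[symmetric]
      by (intro sum.cong refl) (auto simp: ahat_b_X_power[symmetric] xi_act_ahat_b xi_act_scalar e_def)
    also have "\<dots> = (if j \<le> N \<and> i < m then fps_X ^ d * fps_const (fps_nth (S j i) 0) else 0)"
      by simp
    finally show "fps_nth ((h - s) j i) n = 0"
      using s n by (auto simp: carr_iff X fps_X_power_mult_nth)
  qed
  then have "act (scalar (lead ^ d)) (h - s) \<in> xi_ord (Suc d)"
    by (rule xi_act_ord)
  ultimately have "Phi s - act (scalar (lead ^ d)) h + act (scalar (lead ^ d)) (h - s) \<in> xi_ord (Suc d)"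
    by (rule xi_ord_add)
  then show ?thesis by (simp add: xi_act_diff_right)
qed

lemma Phi_ord:
  assumes "s \<in> carr" "s \<in> xi_ord d"
  shows "Phi s \<in> xi_ord d"
  using xi_ord_add[OF xi_ord_mono[OF Phi_lead[OF assms], of d] xi_act_ord[OF assms(2), of lam "scalar (lead ^ d)"]]
  by simp

text \<open>The automorphism preserves the total degree: \<open>\<theta>(a)\<close> has no constant term and \<open>\<beta>\<close> is a multiple of
\<open>b\<close>.\<close>
lemma act_Theta_total_filt:
  assumes "x \<in> total_filt d"
  shows "act (Theta \<theta> x) s \<in> xi_ord d"
proof -
  have Xa: "act (ahat_a (fps_compose T \<theta>)) t \<in> xi_ord (k + q)"
    if "\<And>n. n < k \<Longrightarrow> fps_nth T n = 0" "t \<in> xi_ord q" for T k t q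
  proof -
    have "T = fps_X ^ k * fps_shift k T"
      using that(1) by (intro fps_ext) (auto simp: fps_X_power_mult_nth)
    then have "fps_compose T \<theta> = \<theta> ^ k * fps_compose (fps_shift k T) \<theta>"
      by (metis fps_X_power_compose fps_compose_mult_distrib theta_nth_0)
    moreover have "fps_nth (\<theta> ^ k * fps_compose (fps_shift k T) \<theta>) n = 0" if "n < k" for n
      using that startsby_zero_power_prefix[OF theta_nth_0, of k] by (simp add: fps_mult_nth)
    ultimately have "ahat_a (fps_compose T \<theta>) \<in> total_filt k"
      by (simp add: total_filt_def)
    then show ?thesis using that(2) by (rule xi_act_total_filt)
  qed
  have "x - (\<Sum>\<nu><d. ahat_a (acoeff x \<nu>) * b_elt ^ \<nu>) \<in> b_filt d"
    by (rule trunc)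
  then obtain y where "x - (\<Sum>\<nu><d. ahat_a (acoeff x \<nu>) * b_elt ^ \<nu>) = y * b_elt ^ d"
    unfolding b_filt_eq by blast
  then have x: "x = (\<Sum>\<nu><d. ahat_a (acoeff x \<nu>) * b_elt ^ \<nu>) + y * b_elt ^ d"
    by (simp add: algebra_simps)
  have "act (Theta \<theta> x) s = (\<Sum>\<nu><d. act (ahat_a (fps_compose (acoeff x \<nu>) \<theta>)) (act (beta ^ \<nu>) s)) +
      act (Theta \<theta> y) (act (beta ^ d) s)"
    by (subst x) (simp add: Theta_simps additive_sum[of "Theta \<theta>", OF Theta_add[OF theta_nth_0]] Theta_ahat_a Theta_power
        Theta_b_elt xi_act_add_left xi_act_sum_left xi_act_mult)
  also have "\<dots> \<in> xi_ord d"
  proof (intro xi_ord_add xi_ord_sum)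
    show "act (Theta \<theta> y) (act (beta ^ d) s) \<in> xi_ord d"
      using act_beta_power_ord[of s 0 d] by (simp add: xi_act_ord)
    fix \<nu> assume \<nu>: "\<nu> \<in> {..<d}"
    have "act (ahat_a (fps_compose (acoeff x \<nu>) \<theta>)) (act (beta ^ \<nu>) s) \<in> xi_ord (d - \<nu> + \<nu>)"
      using assms act_beta_power_ord[of s 0 \<nu>] by (intro Xa) (auto simp: total_filt_def)
    then show "act (ahat_a (fps_compose (acoeff x \<nu>) \<theta>)) (act (beta ^ \<nu>) s) \<in> xi_ord d"
      using \<nu> by simp
  qed
  finally show ?thesis .
qed

text \<open>For monomials this follows from the cases of \<open>a\<close> and \<open>b\<close>; both sides are continuous for the total
degree.\<close>
lemma Phi_act:
  assumes s: "s \<in> carr"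
  shows "Phi (act x s) = act (Theta \<theta> x) (Phi s)"
proof -
  have b: "Phi (act b_elt t) = act beta (Phi t)" for t
    using Phi_ahat_b[of fps_X t] by (simp add: Theta_b_elt)
  have bn: "Phi (act (b_elt ^ n) s) = act (beta ^ n) (Phi s)" for n
    by (induction n) (simp_all add: xi_act_one xi_act_mult b)
  have an: "Phi (act (a_elt ^ n) t) = act (ahat_a \<theta> ^ n) (Phi t)" if "t \<in> carr" for t n
    using that by (induction n) (simp_all add: xi_act_one xi_act_mult Phi_a carr_act)
  have sc: "Phi (act (scalar c) t) = act (scalar c) (Phi t)" for c t
    using Phi_ahat_b[of "fps_const c" t] by (simp add: ahat_b_const Theta_scalar)
  have monom: "Phi (act (scalar c * (a_elt ^ n * b_elt ^ \<nu>)) s) = act (Theta \<theta> (scalar c * (a_elt ^ n * b_elt ^ \<nu>))) (Phi s)"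
    for c n \<nu>
    by (simp add: xi_act_mult sc an bn carr_act s Theta_simps Theta_scalar Theta_power Theta_a_elt Theta_b_elt)
  have sum: "Phi (act (\<Sum>t\<in>T. f t) s) = act (Theta \<theta> (\<Sum>t\<in>T. f t)) (Phi s)"
    if "\<And>t. t \<in> T \<Longrightarrow> Phi (act (f t) s) = act (Theta \<theta> (f t)) (Phi s)" for T :: "nat set" and f
    using that by (induction T rule: infinite_finite_induct)
      (simp_all add: xi_act_zero_left Theta_0 Phi_zero xi_act_add_left Phi_add Theta_simps)
  have "Phi (act x s) - act (Theta \<theta> x) (Phi s) \<in> xi_ord d" for d
  proof -
    define t where "t = (\<Sum>\<nu><d. \<Sum>n<d. scalar (fps_nth (acoeff x \<nu>) n) * (a_elt ^ n * b_elt ^ \<nu>))"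
    have r: "x - t \<in> total_filt d" unfolding t_def by (rule total_filt_trunc)
    have t: "Phi (act t s) = act (Theta \<theta> t) (Phi s)"
      unfolding t_def by (intro sum monom)
    have "Phi (act x s) - act (Theta \<theta> x) (Phi s) = Phi (act (t + (x - t)) s) - act (Theta \<theta> (t + (x - t))) (Phi s)"
      by simp
    also have "\<dots> = Phi (act (x - t) s) - act (Theta \<theta> (x - t)) (Phi s)"
      by (simp only: xi_act_add_left Phi_add Theta_add[OF theta_nth_0] t) simp
    also have "\<dots> \<in> xi_ord d"
      using xi_act_total_filt[OF r, of s 0 lam]
      by (intro xi_ord_diff act_Theta_total_filt Phi_ord carr_act r s) simp
    finally show ?thesis .
  qed
  then show ?thesis using xi_ord_separated by fastforce
qed

subsection \<open>Inverse\<close>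

lemma Phi_inj:
  assumes "s \<in> carr" "t \<in> carr" "Phi s = Phi t"
  shows "s = t"
proof -
  have "s - t \<in> xi_ord d" for d
  proof (induction d)
    case (Suc d)
    have "Phi (s - t) - act (scalar (lead ^ d)) (s - t) \<in> xi_ord (Suc d)"
      using assms Suc by (intro Phi_lead carr_diff)
    then show ?case
      using assms lead_nonzero by (auto simp: Phi_diff xi_act_scalar xi_ord_def)
  qed simp
  then show ?thesis using xi_ord_separated by fastforce
qed

definition hom_part :: "nat \<Rightarrow> expansion \<Rightarrow> expansion"
  where "hom_part d t = (\<lambda>j i. fps_const (fps_nth (t j i) d / lead ^ d) * fps_X ^ d)"

text \<open>Successive approximation of a preimage under \<open>Phi\<close>: \<open>remainder t d\<close> has order \<open>d\<close>, and its leading part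
divided by \<open>\<theta>'(0)^d\<close> is the term of degree \<open>d\<close> of the preimage. The recursion is explicit so that it
can be applied to holomorphic sections coefficient by coefficient.\<close>
fun remainder :: "expansion \<Rightarrow> nat \<Rightarrow> expansion"
  where "remainder t 0 = t"
  | "remainder t (Suc d) = remainder t d - Phi (hom_part d (remainder t d))"

definition Psi :: "expansion \<Rightarrow> expansion"
  where "Psi t = (\<lambda>j i. Abs_fps (\<lambda>d. fps_nth (remainder t d j i) d / lead ^ d))"

lemma hom_part_nth: "fps_nth (hom_part d t j i) n = (if n = d then fps_nth (t j i) d / lead ^ d else 0)"
  by (simp add: hom_part_def fps_X_power_mult_right_nth)

lemma hom_part_carr: "t \<in> carr \<Longrightarrow> hom_part d t \<in> carr"
  by (auto simp: hom_part_def carr_iff)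

lemma remainder_carr: "t \<in> carr \<Longrightarrow> remainder t d \<in> carr"
  by (induction d) (auto intro: carr_diff Phi_carr)

lemma Psi_carr: "t \<in> carr \<Longrightarrow> Psi t \<in> carr"
  using remainder_carr[of t] by (auto simp: Psi_def carr_iff intro!: fps_ext)

lemma remainder_ord: "t \<in> carr \<Longrightarrow> remainder t d \<in> xi_ord d"
proof (induction d)
  case (Suc d)
  let ?r = "remainder t d" and ?h = "hom_part d (remainder t d)"
  have "?h \<in> xi_ord d"
    by (auto simp: hom_part_def xi_ord_def)
  then have "Phi ?h - act (scalar (lead ^ d)) ?h \<in> xi_ord (Suc d)"
    using Suc.prems by (intro Phi_lead hom_part_carr remainder_carr)
  moreover have "?r - act (scalar (lead ^ d)) ?h \<in> xi_ord (Suc d)"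
    using Suc lead_nonzero by (auto simp: xi_ord_def xi_act_scalar hom_part_def fps_X_power_mult_right_nth less_Suc_eq)
  ultimately have "(?r - act (scalar (lead ^ d)) ?h) - (Phi ?h - act (scalar (lead ^ d)) ?h) \<in> xi_ord (Suc d)"
    by (rule xi_ord_diff[rotated])
  then show "remainder t (Suc d) \<in> xi_ord (Suc d)" by simp
qed simp

lemma Phi_Psi:
  assumes "t \<in> carr"
  shows "Phi (Psi t) = t"
proof -
  have "t - Phi (Psi t) \<in> xi_ord d" for d
  proof -
    \<comment> \<open>the partial sum of degree below d of the preimage\<close>
    define p where "p = (\<Sum>n<d. hom_part n (remainder t n))"
    have "remainder t d = t - Phi p"
      unfolding p_def
    proof (induction d)
      case (Suc d)
      then show ?case by (simp only: remainder.simps sum.lessThan_Suc Phi_add diff_diff_add)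
    next
      case 0
      show "remainder t 0 = t - Phi (\<Sum>n<0. hom_part n (remainder t n))"
        by (simp add: Phi_zero)
    qed
    then have "t - Phi p \<in> xi_ord d" using remainder_ord[OF assms, of d] by simp
    moreover have p: "p \<in> carr"
      unfolding p_def using assms by (intro carr_sum hom_part_carr remainder_carr)
    have "Psi t - p \<in> xi_ord d"
      by (simp add: xi_ord_def Psi_def p_def sum_fun_apply fps_sum_nth hom_part_nth)
    then have "Phi (Psi t - p) \<in> xi_ord d"
      using p assms by (intro Phi_ord carr_diff Psi_carr)
    ultimately have "(t - Phi p) - Phi (Psi t - p) \<in> xi_ord d"
      by (rule xi_ord_diff)
    then show ?thesis by (simp add: Phi_diff)
  qed
  then show ?thesis using xi_ord_separated by fastforce
qed

lemma Psi_Phi: "s \<in> carr \<Longrightarrow> Psi (Phi s) = s"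
  by (rule Phi_inj) (auto intro: Psi_carr Phi_carr Phi_Psi)

text \<open>Terms of degree above \<open>d\<close> do not matter because \<open>\<beta>^n\<close> raises the order by \<open>n\<close>. The combination is
finite with constant coefficients, so \<open>Phi\<close> maps holomorphic sections to holomorphic sections.\<close>
lemma Phi_nth: "fps_nth (Phi s j i) d = (\<Sum>j'\<le>N. \<Sum>l<m. \<Sum>n<Suc d.
    fps_nth (s j' l) n * fps_nth (act (beta ^ n) (eps j' l) j i) d)"
proof -
  have "fps_nth (act (Theta \<theta> (ahat_b S)) t j i) d =
      (\<Sum>n<Suc d. fps_nth S n * fps_nth (act (beta ^ n) t j i) d)" for S t
  proof -
    have "act (Theta \<theta> (ahat_b S)) t = (\<Sum>n<Suc d. act (scalar (fps_nth S n)) (act (beta ^ n) t)) +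
        act (beta ^ Suc d) (act (Theta \<theta> (ahat_b (fps_shift (Suc d) S))) t)"
      by (subst ahat_b_expand[of S "Suc d"])
         (simp only: Theta_simps additive_sum[of "Theta \<theta>", OF Theta_add[OF theta_nth_0]] Theta_scalar Theta_power
           Theta_b_elt xi_act_add_left xi_act_sum_left xi_act_mult)
    moreover have "act (beta ^ Suc d) (act (Theta \<theta> (ahat_b (fps_shift (Suc d) S))) t) \<in> xi_ord (Suc d)"
      using act_beta_power_ord[of _ 0 "Suc d"] by simp
    ultimately show ?thesis
      by (simp add: xi_ord_def sum_fun_apply fps_sum_nth xi_act_scalar del: sum.lessThan_Suc)
  qed
  then show ?thesis
    by (simp add: Phi_def sum_fun_apply fps_sum_nth del: sum.lessThan_Suc)
qed

end

section \<open>Modules\<close>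

locale ahat_module =
  fixes M :: "(ahat, 'e) module" (structure)
  assumes left_module: "left_module M"
begin

sublocale abelian_group M
  using left_module by (simp add: left_module_def)

lemma smult_closed [simp, intro]: "e \<in> carrier M \<Longrightarrow> x \<odot> e \<in> carrier M"
  and smult_r_distr: "e \<in> carrier M \<Longrightarrow> f \<in> carrier M \<Longrightarrow> x \<odot> (e \<oplus> f) = x \<odot> e \<oplus> x \<odot> f"
  and smult_l_distr: "e \<in> carrier M \<Longrightarrow> (x + y) \<odot> e = x \<odot> e \<oplus> y \<odot> e"
  and smult_mult: "e \<in> carrier M \<Longrightarrow> (x * y) \<odot> e = x \<odot> (y \<odot> e)"
  and smult_one: "e \<in> carrier M \<Longrightarrow> 1 \<odot> e = e"
  using left_module by (simp_all add: left_module_def)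

lemma smult_l_null: "e \<in> carrier M \<Longrightarrow> 0 \<odot> e = \<zero>"
  using smult_l_distr[of e 0 0] by (metis add.r_cancel_one' add_0 smult_closed)

lemma smult_r_null: "x \<odot> \<zero> = \<zero>"
  using smult_r_distr[of \<zero> \<zero> x] by (metis add.r_cancel_one' l_zero smult_closed zero_closed)

lemma smult_minus_one: "e \<in> carrier M \<Longrightarrow> (- 1) \<odot> e = \<ominus> e"
  using smult_l_distr[of e "- 1" 1] smult_l_null[of e]
  by (metis add.left_inverse smult_closed smult_one minus_equality)

lemma smult_r_minus: "e \<in> carrier M \<Longrightarrow> x \<odot> (\<ominus> e) = \<ominus> (x \<odot> e)"
  by (metis add.inv_closed minus_equality l_neg smult_closed smult_r_distr smult_r_null)

lemma eq_of_minus: "x \<ominus> y = \<zero> \<Longrightarrow> x \<in> carrier M \<Longrightarrow> y \<in> carrier M \<Longrightarrow> x = y"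
  using minus_equality[of x "\<ominus> y"] by (simp add: minus_eq)

lemma smult_finsum:
  assumes "finite A" "\<And>i. i \<in> A \<Longrightarrow> f i \<in> carrier M"
  shows "x \<odot> (\<Oplus>i\<in>A. f i) = (\<Oplus>i\<in>A. x \<odot> f i)"
  using assms
proof (induction A)
  case (insert i A)
  then have "finsum M f A \<in> carrier M" by (intro finsum_closed) auto
  then show ?case using insert by (simp add: smult_r_distr)
qed (simp add: smult_r_null)

definition b_lin :: "(nat \<Rightarrow> 'e) \<Rightarrow> nat \<Rightarrow> (nat \<Rightarrow> complex fps) \<Rightarrow> 'e"
  where "b_lin u n S = (\<Oplus>i\<in>{..<n}. ahat_b (S i) \<odot> u i)"

lemma b_lin_closed: "(\<And>i. i < n \<Longrightarrow> u i \<in> carrier M) \<Longrightarrow> b_lin u n S \<in> carrier M"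
  unfolding b_lin_def by (intro finsum_closed) auto

lemma b_lin_add:
  assumes "\<And>i. i < n \<Longrightarrow> u i \<in> carrier M"
  shows "b_lin u n (\<lambda>i. S i + T i) = b_lin u n S \<oplus> b_lin u n T"
  using assms by (simp add: b_lin_def ahat_b_add smult_l_distr finsum_addf cong: finsum_cong)

lemma b_lin_mult:
  assumes "\<And>i. i < n \<Longrightarrow> u i \<in> carrier M"
  shows "b_lin u n (\<lambda>i. R * S i) = ahat_b R \<odot> b_lin u n S"
  unfolding b_lin_def using assms
  by (subst smult_finsum) (auto simp: ahat_b_mult smult_mult intro!: finsum_cong')

lemma b_lin_zero:
  assumes "\<And>i. i < n \<Longrightarrow> u i \<in> carrier M"
  shows "b_lin u n (\<lambda>i. 0) = \<zero>"
  using assms by (simp add: b_lin_def ahat_b_0 smult_l_null cong: finsum_cong)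

lemma b_lin_cong: "(\<And>i. i < n \<Longrightarrow> S i = T i) \<Longrightarrow> (\<And>i. i < n \<Longrightarrow> u i \<in> carrier M) \<Longrightarrow> b_lin u n S = b_lin u n T"
  unfolding b_lin_def by (intro finsum_cong') auto

lemma b_lin_split:
  assumes "\<And>i. i < n \<Longrightarrow> u i \<in> carrier M"
  shows "b_lin u n S = b_lin u n (\<lambda>i. fps_const (fps_nth (S i) 0)) \<oplus> b_elt \<odot> b_lin u n (\<lambda>i. fps_shift 1 (S i))"
proof -
  have "b_lin u n S = b_lin u n (\<lambda>i. fps_const (fps_nth (S i) 0) + fps_X * fps_shift 1 (S i))"
    by (simp only: fps_split[symmetric])
  then show ?thesis
    by (simp only: b_lin_add[OF assms] b_lin_mult[OF assms])
qed

definition b_basis :: "nat \<Rightarrow> (nat \<Rightarrow> 'e) \<Rightarrow> bool"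
  where "b_basis n u \<longleftrightarrow> (\<forall>i<n. u i \<in> carrier M) \<and>
    (\<forall>e\<in>carrier M. \<exists>!S. (\<forall>i\<ge>n. S i = 0) \<and> e = b_lin u n S)"

lemma free_b_rank_iff: "free_b_rank M n \<longleftrightarrow> (\<exists>u. b_basis n u)"
  by (simp add: free_b_rank_def b_basis_def b_lin_def)

text \<open>A description of \<open>\<complex>[[b]]\<close>-bases in which \<open>b\<close> can be replaced by another element: \<open>x\<close> is injective, the
\<open>x\<close>-adic filtration is separated and \<open>u\<close> induces a basis of the quotient by \<open>x\<close>. Completeness
is built in, as power series in \<open>b\<close> act on every module.\<close>
definition adic_basis :: "ahat \<Rightarrow> nat \<Rightarrow> (nat \<Rightarrow> 'e) \<Rightarrow> bool"
  where "adic_basis x n u \<longleftrightarrow> (\<forall>i<n. u i \<in> carrier M) \<and>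
    (\<forall>e\<in>carrier M. x \<odot> e = \<zero> \<longrightarrow> e = \<zero>) \<and>
    (\<forall>e\<in>carrier M. (\<forall>d. \<exists>f\<in>carrier M. e = x ^ d \<odot> f) \<longrightarrow> e = \<zero>) \<and>
    (\<forall>e\<in>carrier M. \<exists>c. \<exists>f\<in>carrier M. e = b_lin u n (\<lambda>i. fps_const (c i)) \<oplus> x \<odot> f) \<and>
    (\<forall>c. \<forall>f\<in>carrier M. b_lin u n (\<lambda>i. fps_const (c i)) \<oplus> x \<odot> f = \<zero> \<longrightarrow> (\<forall>i<n. c i = 0))"

lemma b_basis_inject:
  assumes "b_basis n u" "b_lin u n S = b_lin u n T" "i < n"
  shows "S i = T i"
proof -
  have u: "\<And>i. i < n \<Longrightarrow> u i \<in> carrier M" using assms by (simp add: b_basis_def)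
  define S' T' where "S' = (\<lambda>i. if i < n then S i else 0)" and "T' = (\<lambda>i. if i < n then T i else 0)"
  have S': "b_lin u n S = b_lin u n S'" and T': "b_lin u n T = b_lin u n T'"
    by (auto simp: S'_def T'_def intro!: b_lin_cong u)
  have "\<exists>!R. (\<forall>i\<ge>n. R i = 0) \<and> b_lin u n S = b_lin u n R"
    using assms(1) b_lin_closed[of n u S, OF u] by (simp add: b_basis_def)
  then have "S' = T'"
    using S' T' assms(2) by (metis S'_def T'_def not_le)
  then show ?thesis using assms(3) by (metis S'_def T'_def)
qed

lemma b_basis_obtain:
  assumes "b_basis n u" "e \<in> carrier M"
  obtains S where "e = b_lin u n S"
  using assms unfolding b_basis_def by blast

lemma b_basis_imp_adic_basis:
  assumes u: "b_basis n u"
  shows "adic_basis b_elt n u"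
proof -
  have uc: "\<And>i. i < n \<Longrightarrow> u i \<in> carrier M" using u by (simp add: b_basis_def)
  have zero: "S i = 0" if "b_lin u n S = \<zero>" "i < n" for S i
    using b_basis_inject[OF u, of S "\<lambda>i. 0"] b_lin_zero[of n u, OF uc] that by simp
  have bX: "b_elt ^ d \<odot> b_lin u n S = b_lin u n (\<lambda>i. fps_X ^ d * S i)" for S d
    by (simp add: b_lin_mult[of n u, OF uc] ahat_b_X_power)
  show ?thesis
    unfolding adic_basis_def
  proof (intro conjI ballI allI impI)
    fix e assume e: "e \<in> carrier M" "b_elt \<odot> e = \<zero>"
    obtain S where S: "e = b_lin u n S" using b_basis_obtain[OF u e(1)] .
    then have "b_lin u n (\<lambda>i. fps_X * S i) = \<zero>"
      using e(2) b_lin_mult[of n u fps_X S, OF uc] by simp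
    then have "S i = 0" if "i < n" for i
      using zero[of _ i] that by fastforce
    then have "e = b_lin u n (\<lambda>i. 0)" unfolding S by (intro b_lin_cong uc) auto
    then show "e = \<zero>" by (simp add: b_lin_zero[of n u, OF uc])
  next
    fix e assume e: "e \<in> carrier M" "\<forall>d. \<exists>f\<in>carrier M. e = b_elt ^ d \<odot> f"
    obtain S where S: "e = b_lin u n S" using b_basis_obtain[OF u e(1)] .
    have "S i = 0" if "i < n" for i
    proof (rule fps_ext)
      fix d
      obtain f where f: "f \<in> carrier M" "e = b_elt ^ Suc d \<odot> f" using e(2) by blast
      obtain T where T: "f = b_lin u n T" using b_basis_obtain[OF u f(1)] .
      have "b_lin u n S = b_lin u n (\<lambda>i. fps_X ^ Suc d * T i)"
        using f(2) unfolding S T bX .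
      then have "S i = fps_X ^ Suc d * T i" using b_basis_inject[OF u _ that] by blast
      then show "fps_nth (S i) d = fps_nth 0 d"
        by (simp add: fps_X_power_mult_nth del: power_Suc)
    qed
    then have "e = b_lin u n (\<lambda>i. 0)" unfolding S by (intro b_lin_cong uc) auto
    then show "e = \<zero>" by (simp add: b_lin_zero[of n u, OF uc])
  next
    fix e assume e: "e \<in> carrier M"
    obtain S where S: "e = b_lin u n S" using b_basis_obtain[OF u e(1)] .
    show "\<exists>c. \<exists>f\<in>carrier M. e = b_lin u n (\<lambda>i. fps_const (c i)) \<oplus> b_elt \<odot> f"
    proof (intro exI bexI)
      show "e = b_lin u n (\<lambda>i. fps_const (fps_nth (S i) 0)) \<oplus> b_elt \<odot> b_lin u n (\<lambda>i. fps_shift 1 (S i))"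
        unfolding S by (rule b_lin_split) (rule uc)
      show "b_lin u n (\<lambda>i. fps_shift 1 (S i)) \<in> carrier M"
        by (rule b_lin_closed) (rule uc)
    qed
  next
    fix c f i assume f: "f \<in> carrier M" "b_lin u n (\<lambda>i. fps_const (c i)) \<oplus> b_elt \<odot> f = \<zero>" and i: "i < n"
    obtain T where T: "f = b_lin u n T" using b_basis_obtain[OF u f(1)] .
    have "b_lin u n (\<lambda>i. fps_const (c i) + fps_X * T i) = \<zero>"
      using f(2) by (simp only: T b_lin_add[of n u, OF uc] b_lin_mult[of n u, OF uc])
    then have "fps_const (c i) + fps_X * T i = 0" using zero[OF _ i] by blast
    then have "fps_nth (fps_const (c i) + fps_X * T i) 0 = 0" by simp
    then show "c i = 0" by simp
  qed (use uc in auto)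
qed

text \<open>Dividing by \<open>b\<close> with remainder again and again yields the coefficients; the resulting combination
differs from the given element by something divisible by all powers of \<open>b\<close>.\<close>
lemma adic_basis_imp_b_basis:
  assumes "adic_basis b_elt n u"
  shows "b_basis n u"
proof -
  have uc: "\<And>i. i < n \<Longrightarrow> u i \<in> carrier M"
    and inj: "\<And>e. e \<in> carrier M \<Longrightarrow> b_elt \<odot> e = \<zero> \<Longrightarrow> e = \<zero>"
    and sep: "\<And>e. e \<in> carrier M \<Longrightarrow> (\<And>d. \<exists>f\<in>carrier M. e = b_elt ^ d \<odot> f) \<Longrightarrow> e = \<zero>"
    and ex: "\<And>e. e \<in> carrier M \<Longrightarrow> \<exists>c. \<exists>f\<in>carrier M. e = b_lin u n (\<lambda>i. fps_const (c i)) \<oplus> b_elt \<odot> f"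
    and uniq: "\<And>c f i. f \<in> carrier M \<Longrightarrow> b_lin u n (\<lambda>i. fps_const (c i)) \<oplus> b_elt \<odot> f = \<zero> \<Longrightarrow> i < n \<Longrightarrow> c i = 0"
    using assms unfolding adic_basis_def by blast+
  have lc: "b_lin u n S \<in> carrier M" for S
    by (rule b_lin_closed) (rule uc)
  have zero: "S i = 0" if "b_lin u n S = \<zero>" "i < n" for S i
  proof -
    have "b_lin u n (\<lambda>i. fps_shift d (S i)) = \<zero>" for d
    proof (induction d)
      case (Suc d)
      let ?S = "\<lambda>i. fps_shift d (S i)"
      have split: "b_lin u n ?S = b_lin u n (\<lambda>i. fps_const (fps_nth (?S i) 0)) \<oplus> b_elt \<odot> b_lin u n (\<lambda>i. fps_shift 1 (?S i))"
        by (rule b_lin_split[of n u, OF uc])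
      then have "b_lin u n (\<lambda>i. fps_const (fps_nth (?S i) 0)) \<oplus> b_elt \<odot> b_lin u n (\<lambda>i. fps_shift 1 (?S i)) = \<zero>"
        using Suc by (rule trans[OF sym])
      from uniq[where c = "\<lambda>i. fps_nth (?S i) 0", OF lc this]
      have "fps_nth (?S i) 0 = 0" if "i < n" for i
        using that by simp
      then have "b_lin u n (\<lambda>i. fps_const (fps_nth (?S i) 0)) = b_lin u n (\<lambda>i. 0)"
        by (intro b_lin_cong uc) auto
      then have "b_elt \<odot> b_lin u n (\<lambda>i. fps_shift 1 (?S i)) = \<zero>"
        using split Suc lc by (simp add: b_lin_zero[of n u, OF uc])
      then have "b_lin u n (\<lambda>i. fps_shift 1 (?S i)) = \<zero>" by (rule inj[OF lc])
      moreover have "fps_shift 1 (?S i) = fps_shift (Suc d) (S i)" for i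
        by (rule fps_ext) simp
      ultimately show ?case by simp
    qed (use that in simp)
    note sh = this
    show ?thesis
    proof (rule fps_ext)
      fix d
      have "b_lin u n (\<lambda>i. fps_const (fps_nth (fps_shift d (S i)) 0)) \<oplus>
          b_elt \<odot> b_lin u n (\<lambda>i. fps_shift 1 (fps_shift d (S i))) = \<zero>"
        using b_lin_split[of n u "\<lambda>i. fps_shift d (S i)", OF uc] sh[of d] by simp
      from uniq[where c = "\<lambda>i. fps_nth (fps_shift d (S i)) 0", OF lc this that(2)] show "fps_nth (S i) d = fps_nth 0 d" by simp
    qed
  qed
  have "\<exists>!S. (\<forall>i\<ge>n. S i = 0) \<and> e = b_lin u n S" if e: "e \<in> carrier M" for e
  proof -
    have "\<forall>g\<in>carrier M. \<exists>cf. snd cf \<in> carrier M \<and> g = b_lin u n (\<lambda>i. fps_const (fst cf i)) \<oplus> b_elt \<odot> snd cf"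
      using ex by fastforce
    then obtain r where r: "\<And>g. g \<in> carrier M \<Longrightarrow> snd (r g) \<in> carrier M \<and>
        g = b_lin u n (\<lambda>i. fps_const (fst (r g) i)) \<oplus> b_elt \<odot> snd (r g)"
      by metis
    \<comment> \<open>the successive quotients of the division by b; S collects the remainders\<close>
    define g where "g d = ((\<lambda>h. snd (r h)) ^^ d) e" for d
    have g: "g d \<in> carrier M" for d
      unfolding g_def by (induction d) (auto simp: e r)
    have gS: "g d = b_lin u n (\<lambda>i. fps_const (fst (r (g d)) i)) \<oplus> b_elt \<odot> g (Suc d)" for d
    proof -
      have eq: "g (Suc d) = snd (r (g d))" by (simp add: g_def)
      from conjunct2[OF r[OF g[of d]]] show ?thesis unfolding eq .
    qed
    define S where "S i = (if i < n then Abs_fps (\<lambda>d. fst (r (g d)) i) else 0)" for i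
    define T where "T d = g d \<ominus> b_lin u n (\<lambda>i. fps_shift d (S i))" for d
    have Tc: "T d \<in> carrier M" for d
      unfolding T_def using g lc by auto
    have T: "T d = b_elt \<odot> T (Suc d)" for d
    proof -
      have 1: "b_lin u n (\<lambda>i. fps_shift d (S i)) =
          b_lin u n (\<lambda>i. fps_const (fst (r (g d)) i)) \<oplus> b_elt \<odot> b_lin u n (\<lambda>i. fps_shift (Suc d) (S i))"
      proof -
        have "b_lin u n (\<lambda>i. fps_const (fps_nth (fps_shift d (S i)) 0)) = b_lin u n (\<lambda>i. fps_const (fst (r (g d)) i))"
          by (intro b_lin_cong uc) (auto simp: S_def)
        moreover have "fps_shift 1 (fps_shift d (S i)) = fps_shift (Suc d) (S i)" for i
          by (rule fps_ext) simp
        ultimately show ?thesis using b_lin_split[of n u "\<lambda>i. fps_shift d (S i)", OF uc] by simp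
      qed
      have *: "(x \<oplus> y) \<ominus> (x \<oplus> z) = y \<ominus> z" if "x \<in> carrier M" "y \<in> carrier M" "z \<in> carrier M" for x y z
      proof -
        have "(x \<oplus> y) \<ominus> (x \<oplus> z) = (x \<oplus> \<ominus> x) \<oplus> (y \<oplus> \<ominus> z)"
          using that by (simp add: minus_eq minus_add a_ac)
        then show ?thesis using that by (simp add: r_neg minus_eq)
      qed
      have "T d = b_elt \<odot> g (Suc d) \<ominus> b_elt \<odot> b_lin u n (\<lambda>i. fps_shift (Suc d) (S i))"
        unfolding T_def by (subst gS, subst 1, rule *) (auto intro: lc g)
      also have "\<dots> = b_elt \<odot> T (Suc d)"
        using g lc by (simp add: T_def minus_eq smult_r_distr smult_r_minus)
      finally show ?thesis .
    qed
    have T0: "T 0 = b_elt ^ d \<odot> T d" for d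
    proof (induction d)
      case (Suc d)
      have "T 0 = b_elt ^ d \<odot> (b_elt \<odot> T (Suc d))" using Suc T[of d] by simp
      then show ?case using Tc by (simp only: power_Suc2 smult_mult)
    qed (simp add: smult_one Tc)
    have "T 0 = \<zero>"
    proof (rule sep[OF Tc])
      show "\<exists>f\<in>carrier M. T 0 = b_elt ^ d \<odot> f" for d
        by (intro bexI[of _ "T d"] T0 Tc)
    qed
    then have eq: "e = b_lin u n S"
      using lc[of S] e eq_of_minus[of e "b_lin u n S"] by (simp add: T_def g_def)
    show ?thesis
    proof (intro ex1I[of _ S] conjI)
      show "\<forall>i\<ge>n. S i = 0" by (simp add: S_def)
      show "e = b_lin u n S" by (rule eq)
      fix S' assume S': "(\<forall>i\<ge>n. S' i = 0) \<and> e = b_lin u n S'"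
      have "b_lin u n (\<lambda>i. S i + - S' i) = \<zero>"
      proof -
        have "b_lin u n (\<lambda>i. fps_const (- 1) * S' i) = ahat_b (fps_const (- 1)) \<odot> b_lin u n S'"
          by (rule b_lin_mult[of n u, OF uc])
        also have "ahat_b (fps_const (- 1)) = - 1"
        proof -
          have "scalar (- 1) = - 1"
            by (simp only: fps_const_neg[symmetric] ahat_a_simps fps_const_1_eq_1)
          then show ?thesis by (simp only: ahat_b_const)
        qed
        finally have "b_lin u n (\<lambda>i. - S' i) = \<ominus> b_lin u n S'"
          by (simp add: smult_minus_one lc flip: fps_const_neg)
        then show ?thesis using b_lin_add[of n u S "\<lambda>i. - S' i", OF uc] S' eq lc e
          by (metis r_neg)
      qed
      then have "S i = S' i" if "i < n" for i
        using zero[OF _ that] by fastforce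
      then show "S' = S"
        using S' by (intro ext) (case_tac "x < n", auto simp: S_def)
    qed
  qed
  then show ?thesis using uc by (simp add: b_basis_def)
qed

lemma adic_basis_iff: "b_basis n u \<longleftrightarrow> adic_basis b_elt n u"
  using b_basis_imp_adic_basis adic_basis_imp_b_basis by blast

text \<open>Each condition depends only on the right ideals generated by the powers of \<open>x\<close>, except injectivity,
for which \<open>y\<close> has to be \<open>x\<close> times a left invertible element.\<close>
lemma adic_basis_change:
  assumes x: "adic_basis x n u"
    and xy: "\<And>d. \<exists>z. x ^ d = y ^ d * z" and yx: "\<And>d. \<exists>z. y ^ d = x ^ d * z"
    and unit: "y = x * v" "v' * v = 1"
  shows "adic_basis y n u"
proof -
  have yx1: "\<exists>z. y = x * z" and xy1: "\<exists>z. x = y * z"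
    using yx[of 1] xy[of 1] by simp_all
  show ?thesis
    unfolding adic_basis_def
  proof (intro conjI ballI allI impI)
    fix i assume "i < n"
    then show "u i \<in> carrier M" using x by (simp add: adic_basis_def)
  next
    fix e assume e: "e \<in> carrier M" "y \<odot> e = \<zero>"
    have "x \<odot> (v \<odot> e) = \<zero>"
      using e by (simp add: unit(1) smult_mult)
    then have "v \<odot> e = \<zero>"
      using e(1) x by (simp add: adic_basis_def)
    then have "(v' * v) \<odot> e = \<zero>"
      using e(1) by (simp only: smult_mult smult_r_null)
    then show "e = \<zero>" using e(1) by (simp add: unit(2) smult_one)
  next
    fix e assume e: "e \<in> carrier M" "\<forall>d. \<exists>f\<in>carrier M. e = y ^ d \<odot> f"
    have "\<exists>f\<in>carrier M. e = x ^ d \<odot> f" for d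
    proof -
      obtain f z where "f \<in> carrier M" "e = y ^ d \<odot> f" "y ^ d = x ^ d * z"
        using e(2) yx[of d] by blast
      then show ?thesis
        by (intro bexI[of _ "z \<odot> f"]) (simp_all only: smult_mult smult_closed)
    qed
    then show "e = \<zero>" using e x by (simp add: adic_basis_def)
  next
    fix e assume e: "e \<in> carrier M"
    then have "\<exists>c. \<exists>f\<in>carrier M. e = b_lin u n (\<lambda>i. fps_const (c i)) \<oplus> x \<odot> f"
      using x by (simp add: adic_basis_def)
    then obtain c f where f: "f \<in> carrier M" "e = b_lin u n (\<lambda>i. fps_const (c i)) \<oplus> x \<odot> f"
      by blast
    obtain z where z: "x = y * z" using xy1 by blast
    show "\<exists>c. \<exists>f\<in>carrier M. e = b_lin u n (\<lambda>i. fps_const (c i)) \<oplus> y \<odot> f"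
      using f by (intro exI[of _ c] bexI[of _ "z \<odot> f"]) (simp_all add: z smult_mult)
  next
    fix c f i assume f: "f \<in> carrier M" "b_lin u n (\<lambda>i. fps_const (c i)) \<oplus> y \<odot> f = \<zero>" and i: "i < n"
    obtain z where z: "y = x * z" using yx1 by blast
    have "b_lin u n (\<lambda>i. fps_const (c i)) \<oplus> x \<odot> (z \<odot> f) = \<zero>"
      using f by (simp add: z smult_mult)
    moreover have "\<forall>c. \<forall>f\<in>carrier M. b_lin u n (\<lambda>i. fps_const (c i)) \<oplus> x \<odot> f = \<zero> \<longrightarrow> (\<forall>i<n. c i = 0)"
      using x by (simp add: adic_basis_def)
    ultimately show "c i = 0"
      using i smult_closed[OF f(1)] by blast
  qed
qed

end

subsection \<open>Generators of a free module\<close>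

text \<open>Sequences of complex numbers serve as a vector space in which the quotient of a module by \<open>b\<close> can be
embedded by its coordinates.\<close>
interpretation seq: vector_space "\<lambda>(c::complex) (f::nat \<Rightarrow> complex) i. c * f i"
  by unfold_locales (auto simp: algebra_simps)

text \<open>Modulo \<open>b\<close>, a generating family of \<open>k\<close> elements spans a space of dimension \<open>k\<close>, so it is linearly
independent there.\<close>
lemma (in ahat_module) spanning_independent:
  assumes u: "b_basis k u" and w: "\<And>j. j < k \<Longrightarrow> w j \<in> carrier M"
    and span: "\<And>e. e \<in> carrier M \<Longrightarrow> \<exists>S. e = b_lin w k S"
    and zero: "b_lin w k (\<lambda>j. fps_const (c j)) = b_elt \<odot> f" "f \<in> carrier M" and j: "j < k"
  shows "c j = 0"
proof (rule ccontr)
  assume cj: "c j \<noteq> 0"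
  have uc: "\<And>i. i < k \<Longrightarrow> u i \<in> carrier M" using u by (simp add: b_basis_def)
  define coords where "coords e = (SOME S. e = b_lin u k S)" for e
  have coords: "e = b_lin u k (coords e)" if e: "e \<in> carrier M" for e
  proof -
    obtain S where "e = b_lin u k S" using b_basis_obtain[OF u e] .
    then show ?thesis unfolding coords_def by (rule someI[of "\<lambda>S. e = b_lin u k S"])
  qed
  \<comment> \<open>the class modulo b, in the coordinates of the basis u\<close>
  define \<kappa> where "\<kappa> e = (\<lambda>i. if i < k then fps_nth (coords e i) 0 else 0)" for e
  have \<kappa>_lin: "\<kappa> (b_lin u k S) = (\<lambda>i. if i < k then fps_nth (S i) 0 else 0)" for S
  proof
    fix i
    have "coords (b_lin u k S) i = S i" if "i < k"
    proof -
      have "b_lin u k S \<in> carrier M" by (rule b_lin_closed) (rule uc)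
      from b_basis_inject[OF u coords[OF this, symmetric] that] show ?thesis .
    qed
    then show "\<kappa> (b_lin u k S) i = (if i < k then fps_nth (S i) 0 else 0)"
      by (simp add: \<kappa>_def)
  qed
  have \<kappa>_add: "\<kappa> (e \<oplus> g) = \<kappa> e + \<kappa> g" if "e \<in> carrier M" "g \<in> carrier M" for e g
  proof -
    have "e \<oplus> g = b_lin u k (\<lambda>i. coords e i + coords g i)"
      using b_lin_add[of k u "coords e" "coords g"] uc coords[OF that(1), symmetric] coords[OF that(2), symmetric] by simp
    then show ?thesis by (simp add: \<kappa>_lin) (auto simp: \<kappa>_def)
  qed
  have \<kappa>_b: "\<kappa> (ahat_b S \<odot> e) = (\<lambda>i. fps_nth S 0 * \<kappa> e i)" if "e \<in> carrier M" for e S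
  proof -
    have "ahat_b S \<odot> e = b_lin u k (\<lambda>i. S * coords e i)"
      using b_lin_mult[of k u S "coords e"] uc coords[OF that, symmetric] by simp
    then show ?thesis by (simp add: \<kappa>_lin) (auto simp: \<kappa>_def)
  qed
  have \<kappa>_w: "\<kappa> (b_lin w n S) = (\<Sum>j<n. (\<lambda>i. fps_nth (S j) 0 * \<kappa> (w j) i))" if "n \<le> k" for S n
    using that
  proof (induction n)
    case 0
    have "\<zero> = b_lin u k (\<lambda>i. 0)" using b_lin_zero[of k u] uc by simp
    then have "\<kappa> \<zero> = 0" by (simp add: \<kappa>_lin) (auto simp: fun_eq_iff)
    then show ?case by (simp add: b_lin_def)
  next
    case (Suc n)
    have "b_lin w (Suc n) S = ahat_b (S n) \<odot> w n \<oplus> b_lin w n S"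
      unfolding b_lin_def lessThan_Suc using Suc.prems w by (subst finsum_insert) auto
    moreover have "b_lin w n S \<in> carrier M" "w n \<in> carrier M"
      using Suc.prems w by (auto intro!: b_lin_closed)
    ultimately show ?case using Suc by (simp add: \<kappa>_add \<kappa>_b add.commute)
  qed
  define W where "W = (\<lambda>j. \<kappa> (w j)) ` ({..<k} - {j})"
  define unit :: "nat \<Rightarrow> nat \<Rightarrow> complex" where "unit i = (\<lambda>l. if l = i then 1 else 0)" for i
  have wj: "\<kappa> (w j) \<in> seq.span W"
  proof -
    have "\<kappa> (b_elt \<odot> f) = 0"
      using \<kappa>_b[OF zero(2), of fps_X] by (auto simp: fun_eq_iff)
    then have "(\<Sum>j<k. (\<lambda>i. c j * \<kappa> (w j) i)) = 0"
      using \<kappa>_w[of k "\<lambda>j. fps_const (c j)"] zero(1) by simp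
    then have "(\<lambda>i. c j * \<kappa> (w j) i) + (\<Sum>j\<in>{..<k} - {j}. (\<lambda>i. c j * \<kappa> (w j) i)) = 0"
      using sum.remove[of "{..<k}" j "\<lambda>j. (\<lambda>i. c j * \<kappa> (w j) i)"] j by simp
    then have "(\<lambda>i. c j * \<kappa> (w j) i) = - (\<Sum>j\<in>{..<k} - {j}. (\<lambda>i. c j * \<kappa> (w j) i))"
      by (simp only: add_eq_0_iff2)
    also have "\<dots> \<in> seq.span W"
      by (intro seq.span_neg seq.span_sum seq.span_scale seq.span_base) (auto simp: W_def)
    finally have "(\<lambda>i. (1 / c j) * (c j * \<kappa> (w j) i)) \<in> seq.span W"
      by (rule seq.span_scale)
    then show ?thesis using cj by simp
  qed
  have units: "unit ` {..<k} \<subseteq> seq.span W"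
  proof clarify
    fix i assume i: "i < k"
    obtain S where S: "u i = b_lin w k S" using span[OF uc[OF i]] by blast
    have "u i = b_lin u k (\<lambda>l. if l = i then 1 else 0)"
    proof -
      have "b_lin u k (\<lambda>l. if l = i then 1 else 0) = (\<Oplus>l\<in>{..<k}. if i = l then u l else \<zero>)"
        unfolding b_lin_def using uc ahat_b_const[of 1]
        by (intro finsum_cong') (auto simp: ahat_b_0 smult_l_null ahat_a_simps smult_one)
      also have "\<dots> = u i"
        by (rule finsum_singleton) (use i uc in auto)
      finally show ?thesis ..
    qed
    then have "\<kappa> (u i) = unit i"
      using i by (simp add: \<kappa>_lin unit_def) auto
    then have "unit i = (\<Sum>j<k. (\<lambda>i. fps_nth (S j) 0 * \<kappa> (w j) i))"
      using \<kappa>_w[of k S] S by simp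
    also have "\<dots> \<in> seq.span W"
    proof (intro seq.span_sum seq.span_scale)
      fix l assume "l \<in> {..<k}"
      then show "\<kappa> (w l) \<in> seq.span W"
        using wj by (cases "l = j") (auto intro!: seq.span_base simp: W_def)
    qed
    finally show "unit i \<in> seq.span W" .
  qed
  have inj: "inj_on unit {..<k}"
    by (auto simp: inj_on_def unit_def fun_eq_iff split: if_splits)
  have "\<not> seq.dependent (unit ` {..<k})"
  proof
    assume "seq.dependent (unit ` {..<k})"
    then obtain r where r: "\<exists>v\<in>unit ` {..<k}. r v \<noteq> 0" "(\<Sum>v\<in>unit ` {..<k}. (\<lambda>i. r v * v i)) = 0"
      using seq.dependent_finite[of "unit ` {..<k}"] by auto
    have "r (unit i) = 0" if "i < k" for i
    proof -
      have "(\<Sum>v\<in>unit ` {..<k}. (\<lambda>i. r v * v i)) i = (\<Sum>l<k. r (unit l) * unit l i)"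
        by (simp add: sum_fun_apply sum.reindex[OF inj])
      also have "\<dots> = (\<Sum>l<k. if l = i then r (unit i) else 0)"
        by (intro sum.cong) (auto simp: unit_def)
      finally show ?thesis using r(2) that by simp
    qed
    then show False using r(1) by auto
  qed
  then have "card (unit ` {..<k}) \<le> card W"
    using seq.independent_span_bound[of W "unit ` {..<k}"] units by (simp add: W_def)
  moreover have "card W \<le> k - 1"
    unfolding W_def using card_image_le[of "{..<k} - {j}" "\<lambda>j. \<kappa> (w j)"] j by simp
  ultimately show False using j by (simp add: card_image[OF inj])
qed

section \<open>Twisting modules\<close>

lemma (in ahat_module) submodule_closed:
  assumes "submodule_of M G"
  shows "e \<in> G \<Longrightarrow> e \<in> carrier M" "\<zero> \<in> G" "e \<in> G \<Longrightarrow> f \<in> G \<Longrightarrow> e \<oplus> f \<in> G" "e \<in> G \<Longrightarrow> x \<odot> e \<in> G"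
  using assms by (auto simp: submodule_of_def)

lemma (in ahat_module) submodule_finsum:
  assumes "submodule_of M G" "finite A" "\<And>i. i \<in> A \<Longrightarrow> f i \<in> G"
  shows "finsum M f A \<in> G"
  using assms(2,3)
proof (induction A)
  case (insert i A)
  then have "finsum M f (insert i A) = f i \<oplus> finsum M f A"
    by (intro finsum_insert) (auto intro: submodule_closed(1)[OF assms(1)])
  then show ?case using insert by (auto intro: submodule_closed[OF assms(1)])
qed (auto intro: submodule_closed[OF assms(1)])

text \<open>Submodules stable under \<open>b^{-1} a\<close>, so that the saturation is the least one containing a given set.\<close>
definition pole_submodule :: "(ahat, 'e) module \<Rightarrow> 'e set \<Rightarrow> bool"
  where "pole_submodule N G \<longleftrightarrow> submodule_of N G \<and>
    (\<forall>e\<in>G. \<exists>f\<in>G. a_elt \<odot>\<^bsub>N\<^esub> e = b_elt \<odot>\<^bsub>N\<^esub> f)"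

lemma saturation_eq: "saturation N S = \<Inter>{G. pole_submodule N G \<and> S \<subseteq> G}"
  by (auto simp: saturation_def pole_submodule_def)

lemma simple_pole_iff: "simple_pole N \<longleftrightarrow> left_module N \<and> (\<exists>n. free_b_rank N n) \<and> pole_submodule N (carrier N)"
proof -
  have "submodule_of N (carrier N)" if "left_module N"
  proof -
    interpret ahat_module N by unfold_locales (rule that)
    show ?thesis by (auto simp: submodule_of_def)
  qed
  then show ?thesis by (auto simp: simple_pole_def pole_submodule_def)
qed

context variable_change
begin

abbreviation tw :: "(ahat, 'e) module \<Rightarrow> (ahat, 'e) module"
  where "tw \<equiv> twist_module \<theta>"

lemma twist_simps [simp]:
  "carrier (tw M) = carrier M" "add (tw M) = add M" "zero (tw M) = zero M"
  "x \<odot>\<^bsub>tw M\<^esub> e = Theta \<theta> x \<odot>\<^bsub>M\<^esub> e"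
  by (simp_all add: twist_module_def change_aut_eq)

lemma finsum_twist [simp]: "finsum (tw M) f A = finsum M f A"
  by (simp add: finsum_def)

lemma left_module_twist:
  assumes "left_module M"
  shows "left_module (tw M)"
proof -
  have "abelian_group (tw M)"
    using assms by (simp add: left_module_def abelian_group_def abelian_monoid_def abelian_group_axioms_def)
  then show ?thesis
    using assms by (simp add: left_module_def Theta_simps Theta_1)
qed

lemma beta_eq_unit: "ahat_a (inverse (fps_deriv \<theta>)) * ahat_a (fps_deriv \<theta>) = 1"
proof -
  have "inverse (fps_deriv \<theta>) * fps_deriv \<theta> = 1"
    using lead_nonzero by (intro inverse_mult_eq_1) simp
  then show ?thesis by (simp add: ahat_a_simps flip: ahat_a_simps(4))
qed

text \<open>A basis for \<open>b\<close> is also one for \<open>\<beta>\<close>, because they differ by a unit. In the twisted module \<open>\<beta>\<close> is the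
action of \<open>b\<close>.\<close>
lemma adic_basis_twist:
  assumes "left_module M" "ahat_module.adic_basis M b_elt n u"
  shows "ahat_module.adic_basis (tw M) b_elt n u"
proof -
  interpret ahat_module M by unfold_locales (rule assms(1))
  interpret T: ahat_module "tw M" by unfold_locales (rule left_module_twist[OF assms(1)])
  have "adic_basis beta n u"
    using assms(2) b_power_eq beta_power_eq refl beta_eq_unit by (rule adic_basis_change)
  moreover have "T.b_lin u n (\<lambda>i. fps_const (c i)) = b_lin u n (\<lambda>i. fps_const (c i))" for c
    by (simp add: T.b_lin_def b_lin_def ahat_b_const Theta_scalar)
  ultimately show ?thesis
    by (simp add: T.adic_basis_def adic_basis_def Theta_power Theta_b_elt)
qed

lemma free_b_rank_twist:
  assumes "left_module M" "free_b_rank M n"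
  shows "free_b_rank (tw M) n"
proof -
  interpret ahat_module M by unfold_locales (rule assms(1))
  interpret T: ahat_module "tw M" by unfold_locales (rule left_module_twist[OF assms(1)])
  show ?thesis
    using assms(2) adic_basis_twist[OF assms(1)]
    by (auto simp: free_b_rank_iff T.free_b_rank_iff adic_basis_iff T.adic_basis_iff)
qed

lemma theta_eq_mult: "ahat_a \<theta> = ahat_a (fps_shift 1 \<theta>) * a_elt"
proof -
  have "\<theta> = fps_shift 1 \<theta> * fps_X"
    by (intro fps_ext) (auto simp: theta_nth_0)
  then show ?thesis by (metis ahat_a_simps(4))
qed

lemma submodule_twist: "submodule_of M G \<Longrightarrow> submodule_of (tw M) G"
  by (simp add: submodule_of_def)

text \<open>If \<open>a e = b f\<close>, then \<open>\<theta>(a) e\<close> is a multiple of \<open>b f\<close> on the left, hence \<open>b\<close> and so \<open>\<beta>\<close> times an element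
of the submodule.\<close>
lemma pole_submodule_twist:
  assumes "left_module M" "pole_submodule M G"
  shows "pole_submodule (tw M) G"
proof -
  interpret ahat_module M by unfold_locales (rule assms(1))
  have G: "submodule_of M G" and pole: "\<And>e. e \<in> G \<Longrightarrow> \<exists>f\<in>G. a_elt \<odot>\<^bsub>M\<^esub> e = b_elt \<odot>\<^bsub>M\<^esub> f"
    using assms(2) by (simp_all add: pole_submodule_def)
  note Gc = submodule_closed[OF G]
  have "\<exists>f\<in>G. ahat_a \<theta> \<odot>\<^bsub>M\<^esub> e = beta \<odot>\<^bsub>M\<^esub> f" if e: "e \<in> G" for e
  proof -
    obtain f where f: "f \<in> G" "a_elt \<odot>\<^bsub>M\<^esub> e = b_elt \<odot>\<^bsub>M\<^esub> f" using pole[OF e] by blast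
    define z where "z = ahat_a (inverse (fps_deriv \<theta>)) *
      (ahat_a (fps_shift 1 \<theta>) + ahat_deriv (ahat_a (fps_shift 1 \<theta>)) * b_elt)"
    have "ahat_a \<theta> \<odot>\<^bsub>M\<^esub> e = (ahat_a (fps_shift 1 \<theta>) * b_elt) \<odot>\<^bsub>M\<^esub> f"
      using Gc(1)[OF e] Gc(1)[OF f(1)] f(2) by (simp only: theta_eq_mult smult_mult)
    also have "ahat_a (fps_shift 1 \<theta>) * b_elt = beta * z"
      unfolding mult_b_eq[of "ahat_a (fps_shift 1 \<theta>)"] z_def
      by (subst b_elt_eq_beta) (simp only: mult.assoc)
    finally have "ahat_a \<theta> \<odot>\<^bsub>M\<^esub> e = beta \<odot>\<^bsub>M\<^esub> (z \<odot>\<^bsub>M\<^esub> f)"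
      using Gc(1)[OF f(1)] by (simp only: smult_mult)
    then show ?thesis using Gc(4)[OF f(1)] by blast
  qed
  then show ?thesis
    using submodule_twist[OF G] by (simp add: pole_submodule_def Theta_a_elt Theta_b_elt)
qed

lemma simple_pole_twist: "simple_pole N \<Longrightarrow> simple_pole (tw N)"
  using left_module_twist[of N] free_b_rank_twist[of N] pole_submodule_twist[of N "carrier N"]
  by (auto simp: simple_pole_iff)

lemma module_embedding_twist: "module_embedding M N \<iota> \<Longrightarrow> module_embedding (tw M) (tw N) \<iota>"
  by (simp add: module_embedding_def)

end

subsection \<open>The inverse change of variable\<close>

lemma (in variable_change) variable_change_inv: "variable_change (fps_inv \<theta>)"
proof -
  have "fps_compose (fps_inv \<theta>) \<theta> = fps_X"
    using theta_nth_0 lead_nonzero by (rule fps_inv)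
  then have "fps_nth (fps_compose (fps_inv \<theta>) \<theta>) 1 = 1" by simp
  moreover have "fps_nth (fps_compose (fps_inv \<theta>) \<theta>) 1 = fps_nth (fps_inv \<theta>) 1 * lead"
    by (simp add: fps_compose_nth theta_nth_0)
  ultimately have "fps_nth (fps_inv \<theta>) 1 \<noteq> 0" by auto
  then show ?thesis
    by unfold_locales (simp add: change_of_variable_def fps_inv_def)
qed

text \<open>Composing the automorphisms of \<open>\<theta>\<close> and of its inverse series gives one with the characteristic
properties of the automorphism for the variable \<open>a\<close> itself. Twisting by the inverse series
therefore undoes the twist, and implications about twists become equivalences.\<close>
lemma (in variable_change) Theta_inv: "Theta \<theta> (Theta (fps_inv \<theta>) x) = x"
proof -
  interpret I: variable_change "fps_inv \<theta>" by (rule variable_change_inv)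
  have inv: "fps_compose (fps_inv \<theta>) \<theta> = fps_X"
    using theta_nth_0 lead_nonzero by (rule fps_inv)
  have "is_change_aut fps_X (\<lambda>x. Theta \<theta> (Theta (fps_inv \<theta>) x))"
    unfolding is_change_aut_def
  proof (intro conjI allI)
    show "bij (\<lambda>x. Theta \<theta> (Theta (fps_inv \<theta>) x))"
      using bij_comp[OF I.bij_Theta bij_Theta] by (simp add: comp_def)
    show "b_continuous (\<lambda>x. Theta \<theta> (Theta (fps_inv \<theta>) x))"
      by (rule b_continuousI)
         (auto simp: Theta_simps I.Theta_simps intro!: Theta_filt[OF theta_nth_0] Theta_filt[OF I.theta_nth_0])
    show "Theta \<theta> (Theta (fps_inv \<theta>) (ahat_a T)) = ahat_a (fps_compose T fps_X)" for T
      by (simp add: I.Theta_ahat_a Theta_ahat_a fps_compose_assoc[OF theta_nth_0 I.theta_nth_0, symmetric] inv)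
    have "Theta \<theta> (Theta (fps_inv \<theta>) b_elt) = b_elt * ahat_a (fps_deriv \<theta> * fps_compose (fps_deriv (fps_inv \<theta>)) \<theta>)"
      by (simp add: I.Theta_b_elt Theta_simps Theta_b_elt Theta_ahat_a mult.assoc ahat_a_simps)
    also have "fps_deriv \<theta> * fps_compose (fps_deriv (fps_inv \<theta>)) \<theta> = fps_deriv fps_X"
      unfolding inv[symmetric] fps_compose_deriv[OF theta_nth_0] by (rule mult.commute)
    finally show "Theta \<theta> (Theta (fps_inv \<theta>) b_elt) = b_elt * ahat_a (fps_deriv fps_X)" .
  qed (simp_all add: Theta_simps I.Theta_simps Theta_1 I.Theta_1)
  moreover have "is_change_aut fps_X (\<lambda>x. x)"
    unfolding is_change_aut_def
    by (auto simp: ahat_a_simps intro: b_continuousI bij_id[unfolded id_def])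
  ultimately show ?thesis by (metis is_change_aut_unique)
qed

lemma (in variable_change) twist_inv: "twist_module (fps_inv \<theta>) (tw M) = M"
proof -
  interpret I: variable_change "fps_inv \<theta>" by (rule variable_change_inv)
  show ?thesis
    by (cases M) (simp add: twist_module_def change_aut_eq I.change_aut_eq Theta_inv)
qed

subsection \<open>The Bernstein polynomial\<close>

locale pole_module =
  fixes N :: "(ahat, 'e) module" (structure)
  assumes simple_pole: "simple_pole N"
begin

sublocale ahat_module N
  using simple_pole by unfold_locales (simp add: simple_pole_def)

lemma b_inject: "e \<in> carrier N \<Longrightarrow> f \<in> carrier N \<Longrightarrow> b_elt \<odot> e = b_elt \<odot> f \<Longrightarrow> e = f"
proof -
  assume e: "e \<in> carrier N" "f \<in> carrier N" "b_elt \<odot> e = b_elt \<odot> f"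
  obtain n u where "adic_basis b_elt n u"
    using simple_pole by (auto simp: simple_pole_def free_b_rank_iff adic_basis_iff)
  moreover have "b_elt \<odot> (e \<ominus> f) = \<zero>"
    using e by (simp add: minus_eq smult_r_distr smult_r_minus r_neg)
  ultimately have "e \<ominus> f = \<zero>" using e by (simp add: adic_basis_def)
  then show "e = f" using e by (rule_tac eq_of_minus) auto
qed

lemma b_inv_a:
  assumes "e \<in> carrier N"
  shows "b_inv_a N e \<in> carrier N" "b_elt \<odot> b_inv_a N e = a_elt \<odot> e"
proof -
  obtain f where f: "f \<in> carrier N" "a_elt \<odot> e = b_elt \<odot> f"
    using simple_pole assms by (auto simp: simple_pole_def)
  have "b_inv_a N e \<in> carrier N \<and> b_elt \<odot> b_inv_a N e = a_elt \<odot> e"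
    unfolding b_inv_a_def
  proof (rule theI[of _ f])
    fix g assume "g \<in> carrier N \<and> b_elt \<odot> g = a_elt \<odot> e"
    then show "g = f" using f b_inject[of g f] by simp
  qed (use f in auto)
  then show "b_inv_a N e \<in> carrier N" "b_elt \<odot> b_inv_a N e = a_elt \<odot> e" by auto
qed

lemma b_inv_a_eqI: "e \<in> carrier N \<Longrightarrow> f \<in> carrier N \<Longrightarrow> b_elt \<odot> f = a_elt \<odot> e \<Longrightarrow> b_inv_a N e = f"
  using b_inv_a[of e] b_inject[of "b_inv_a N e" f] by simp

lemma b_inv_a_pole:
  assumes "pole_submodule N G" "e \<in> G"
  shows "b_inv_a N e \<in> G"
proof -
  have G: "submodule_of N G" using assms by (simp add: pole_submodule_def)
  obtain f where "f \<in> G" "a_elt \<odot> e = b_elt \<odot> f"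
    using assms by (auto simp: pole_submodule_def)
  then have "b_inv_a N e = f"
    using assms by (intro b_inv_a_eqI) (auto dest: submodule_closed(1)[OF G])
  then show ?thesis using \<open>f \<in> G\<close> by simp
qed

lemma b_inv_a_add: "e \<in> carrier N \<Longrightarrow> f \<in> carrier N \<Longrightarrow> b_inv_a N (e \<oplus> f) = b_inv_a N e \<oplus> b_inv_a N f"
  by (intro b_inv_a_eqI) (simp_all add: b_inv_a smult_r_distr)

text \<open>Since \<open>a b = b a + b^2\<close>, the operator \<open>b^{-1} a\<close> preserves \<open>b N\<close> and thus acts modulo \<open>b\<close>.\<close>
lemma b_inv_a_b: "e \<in> carrier N \<Longrightarrow> b_inv_a N (b_elt \<odot> e) = b_elt \<odot> (b_inv_a N e \<oplus> e)"
proof (rule b_inv_a_eqI)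
  assume e: "e \<in> carrier N"
  have "a_elt * b_elt = b_elt * a_elt + b_elt * b_elt"
    using a_b_relation by (simp add: power2_eq_square algebra_simps)
  then have "a_elt \<odot> (b_elt \<odot> e) = b_elt \<odot> (a_elt \<odot> e) \<oplus> b_elt \<odot> (b_elt \<odot> e)"
    using e by (simp add: smult_l_distr flip: smult_mult)
  also have "\<dots> = b_elt \<odot> (b_elt \<odot> (b_inv_a N e \<oplus> e))"
    using e by (simp add: smult_r_distr b_inv_a)
  finally show "b_elt \<odot> (b_elt \<odot> (b_inv_a N e \<oplus> e)) = a_elt \<odot> (b_elt \<odot> e)" ..
qed (auto simp: b_inv_a)

lemma submodule_mult_b:
  assumes "submodule_of N G" "e \<in> G"
  shows "\<exists>f\<in>G. x \<odot> (b_elt \<odot> e) = b_elt \<odot> f"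
proof -
  note Gc = submodule_closed[OF assms(1)]
  have "x \<odot> (b_elt \<odot> e) = b_elt \<odot> ((x + ahat_deriv x * b_elt) \<odot> e)"
    using Gc(1)[OF assms(2)] by (simp only: smult_mult[symmetric] mult_b_eq[of x])
  then show ?thesis using Gc(4)[OF assms(2)] by blast
qed

lemma saturation_pole:
  assumes "S \<subseteq> carrier N"
  shows "pole_submodule N (saturation N S)"
proof -
  define \<G> where "\<G> = {G. pole_submodule N G \<and> S \<subseteq> G}"
  have sat: "saturation N S = \<Inter>\<G>"
    by (auto simp: saturation_def \<G>_def pole_submodule_def)
  have ne: "carrier N \<in> \<G>"
    using assms simple_pole by (simp add: \<G>_def simple_pole_iff)
  have sub: "submodule_of N G" if "G \<in> \<G>" for G
    using that by (simp add: \<G>_def pole_submodule_def)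
  have "submodule_of N (\<Inter>\<G>)"
    unfolding submodule_of_def using ne sub by (auto simp: submodule_of_def)
  moreover have "\<exists>f\<in>\<Inter>\<G>. a_elt \<odot> e = b_elt \<odot> f" if "e \<in> \<Inter>\<G>" for e
  proof (intro bexI)
    show "b_inv_a N e \<in> \<Inter>\<G>"
      using that by (auto simp: \<G>_def intro: b_inv_a_pole)
    show "a_elt \<odot> e = b_elt \<odot> b_inv_a N e"
      using that ne b_inv_a[of e] by auto
  qed
  ultimately show ?thesis by (simp add: sat pole_submodule_def)
qed

end

locale pole_twist = variable_change \<theta> + pole_module N
  for \<theta> :: "complex fps" and N :: "(ahat, 'e) module" (structure)
begin

abbreviation N' :: "(ahat, 'e) module"
  where "N' \<equiv> tw N"

sublocale T: pole_module N'
  by unfold_locales (rule simple_pole_twist[OF simple_pole])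

lemma pole_twist_inv: "pole_twist (fps_inv \<theta>) N'"
  using variable_change_inv T.pole_module_axioms by (rule pole_twist.intro)

text \<open>The Bernstein polynomial is unchanged by a twist because \<open>\<beta>^{-1} \<theta>(a)\<close> and \<open>b^{-1} a\<close> agree modulo \<open>b\<close>.
With \<open>\<theta> = a \<tau>(a)\<close>, the element \<open>\<theta>(a) e\<close> is \<open>\<tau>(a) b f\<close> for \<open>f = b^{-1} a e\<close>, that is,
\<open>b \<tau>(a) f\<close> modulo \<open>b^2\<close>; division by \<open>b \<theta>'(a)\<close> leaves \<open>(\<tau> / \<theta>')(a) f\<close>, where \<open>\<tau> / \<theta>'\<close> has constant
term 1 and \<open>a f\<close> is divisible by \<open>b\<close>.\<close>
lemma b_inv_a_twist:
  assumes G: "pole_submodule N G" and e: "e \<in> G"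
  shows "\<exists>z\<in>G. b_inv_a N' e = b_inv_a N e \<oplus> b_elt \<odot> z"
proof -
  have sub: "submodule_of N G" using G by (simp add: pole_submodule_def)
  note Gc = submodule_closed[OF sub]
  have ec: "e \<in> carrier N" using Gc e by blast
  define f where "f = b_inv_a N e"
  define f' where "f' = b_inv_a N' e"
  have f: "f \<in> G" "b_elt \<odot> f = a_elt \<odot> e" and fc: "f \<in> carrier N"
    using b_inv_a_pole[OF G e] b_inv_a[OF ec] by (simp_all add: f_def)
  have f': "f' \<in> carrier N" "beta \<odot> f' = ahat_a \<theta> \<odot> e"
    using T.b_inv_a[of e] ec by (simp_all add: f'_def Theta_a_elt Theta_b_elt)
  define \<tau> \<iota> where "\<tau> = fps_shift 1 \<theta>" and "\<iota> = inverse (fps_deriv \<theta>)"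
  have "b_elt \<odot> (ahat_a (fps_deriv \<theta>) \<odot> f') = ahat_a \<theta> \<odot> e"
    using f' by (simp add: smult_mult)
  also have "\<dots> = (ahat_a \<tau> * a_elt) \<odot> e"
    by (simp only: theta_eq_mult \<tau>_def)
  also have "\<dots> = (ahat_a \<tau> * b_elt) \<odot> f"
    using f ec fc by (simp add: smult_mult)
  also have "\<dots> = b_elt \<odot> ((ahat_a \<tau> + ahat_deriv (ahat_a \<tau>) * b_elt) \<odot> f)"
    using fc by (simp only: mult_b_eq[of "ahat_a \<tau>"] smult_mult)
  finally have "ahat_a (fps_deriv \<theta>) \<odot> f' = (ahat_a \<tau> + ahat_deriv (ahat_a \<tau>) * b_elt) \<odot> f"
    using f' fc by (rule_tac b_inject) auto
  then have "(ahat_a \<iota> * ahat_a (fps_deriv \<theta>)) \<odot> f' = (ahat_a \<iota> * (ahat_a \<tau> + ahat_deriv (ahat_a \<tau>) * b_elt)) \<odot> f"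
    using f' fc by (simp only: smult_mult)
  then have f'_eq: "f' = (ahat_a (\<iota> * \<tau>)) \<odot> f \<oplus> (ahat_a \<iota> * ahat_deriv (ahat_a \<tau>)) \<odot> (b_elt \<odot> f)"
    using f' fc by (simp add: beta_eq_unit \<iota>_def smult_one distrib_left smult_l_distr ahat_a_simps smult_mult)
  \<comment> \<open>\<theta> = a \<tau>(a), so \<tau> and \<theta>' have the same constant term\<close>
  have c: "fps_nth (\<iota> * \<tau>) 0 = 1"
    using lead_nonzero by (simp add: \<iota>_def \<tau>_def)
  define \<rho> where "\<rho> = fps_shift 1 (\<iota> * \<tau>)"
  have "\<iota> * \<tau> = 1 + \<rho> * fps_X"
    using fps_split[of "\<iota> * \<tau>"] c by (simp add: \<rho>_def mult.commute)
  then have "(ahat_a (\<iota> * \<tau>)) \<odot> f = f \<oplus> ahat_a \<rho> \<odot> (a_elt \<odot> f)"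
    using fc by (simp add: ahat_a_simps smult_l_distr smult_mult smult_one)
  moreover obtain g where g: "g \<in> G" "a_elt \<odot> f = b_elt \<odot> g"
    using G f by (auto simp: pole_submodule_def)
  moreover obtain g1 where g1: "g1 \<in> G" "ahat_a \<rho> \<odot> (b_elt \<odot> g) = b_elt \<odot> g1"
    using submodule_mult_b[OF sub g(1)] by blast
  moreover obtain g2 where g2: "g2 \<in> G" "(ahat_a \<iota> * ahat_deriv (ahat_a \<tau>)) \<odot> (b_elt \<odot> f) = b_elt \<odot> g2"
    using submodule_mult_b[OF sub f(1)] by blast
  ultimately have "f' = f \<oplus> b_elt \<odot> (g1 \<oplus> g2)"
    using f'_eq fc Gc(1) by (simp add: smult_r_distr a_assoc)
  then show ?thesis
    using Gc(3)[OF g1(1) g2(1)] by (auto simp: f'_def f_def)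
qed

lemma b_inv_a_funpow_twist:
  assumes G: "pole_submodule N G" and e: "e \<in> G"
  shows "(b_inv_a N ^^ i) e \<in> G \<and> (\<exists>z\<in>G. (b_inv_a N' ^^ i) e = (b_inv_a N ^^ i) e \<oplus> b_elt \<odot> z)"
proof (induction i)
  case 0
  have "submodule_of N G" using G by (simp add: pole_submodule_def)
  then show ?case
    using e by (auto simp: smult_r_null intro!: bexI[of _ \<zero>] dest: submodule_closed(1) intro: submodule_closed(2))
next
  case (Suc i)
  have sub: "submodule_of N G" using G by (simp add: pole_submodule_def)
  note Gc = submodule_closed[OF sub]
  define d where "d = (b_inv_a N ^^ i) e"
  obtain z where z: "z \<in> G" "(b_inv_a N' ^^ i) e = d \<oplus> b_elt \<odot> z" and d: "d \<in> G"
    using Suc by (auto simp: d_def)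
  have bz: "b_elt \<odot> z \<in> G" using Gc z by blast
  obtain z1 where z1: "z1 \<in> G" "b_inv_a N' d = b_inv_a N d \<oplus> b_elt \<odot> z1"
    using b_inv_a_twist[OF G d] by blast
  obtain z2 where z2: "z2 \<in> G" "b_inv_a N' (b_elt \<odot> z) = b_inv_a N (b_elt \<odot> z) \<oplus> b_elt \<odot> z2"
    using b_inv_a_twist[OF G bz] by blast
  have d': "b_inv_a N d \<in> G" and z': "b_inv_a N z \<in> G"
    using b_inv_a_pole[OF G] d z by auto
  have "b_inv_a N' (d \<oplus> b_elt \<odot> z) = b_inv_a N' d \<oplus> b_inv_a N' (b_elt \<odot> z)"
    using T.b_inv_a_add[of d "b_elt \<odot> z"] d bz Gc(1) by simp
  also have "\<dots> = b_inv_a N d \<oplus> b_elt \<odot> (z1 \<oplus> ((b_inv_a N z \<oplus> z) \<oplus> z2))"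
    using z1 z2 z z' d' Gc(1) by (simp add: b_inv_a_b smult_r_distr a_assoc)
  finally have "b_inv_a N' (d \<oplus> b_elt \<odot> z) = b_inv_a N d \<oplus> b_elt \<odot> (z1 \<oplus> ((b_inv_a N z \<oplus> z) \<oplus> z2))" .
  moreover have "z1 \<oplus> ((b_inv_a N z \<oplus> z) \<oplus> z2) \<in> G"
    using z1 z2 z z' by (intro Gc(3))
  ultimately show ?case
    using d' z(2) by (auto simp flip: d_def)
qed

lemma annihilates_twist:
  assumes G: "pole_submodule N G" and ann: "annihilates N G p"
  shows "annihilates N' G p"
  unfolding annihilates_def
proof
  fix e assume e: "e \<in> G"
  have sub: "submodule_of N G" using G by (simp add: pole_submodule_def)
  note Gc = submodule_closed[OF sub]
  define c where "c i = coeff p i * (- 1) ^ i" for i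
  obtain z where z: "\<And>i. z i \<in> G" "\<And>i. (b_inv_a N' ^^ i) e = (b_inv_a N ^^ i) e \<oplus> b_elt \<odot> z i"
    using b_inv_a_funpow_twist[OF G e] by metis
  have d: "(b_inv_a N ^^ i) e \<in> G" for i using b_inv_a_funpow_twist[OF G e] by blast
  obtain g where g: "g \<in> G" "(\<Oplus>i\<in>{..degree p}. scalar (c i) \<odot> (b_inv_a N ^^ i) e) = b_elt \<odot> g"
    using ann e by (auto simp: annihilates_def c_def)
  have "scalar (c i) \<odot> (b_inv_a N' ^^ i) e = scalar (c i) \<odot> (b_inv_a N ^^ i) e \<oplus> b_elt \<odot> (scalar (c i) \<odot> z i)" for i
    using z(1)[of i] d[of i] Gc(1) unfolding z(2)
    by (simp add: smult_r_distr scalar_commute flip: smult_mult)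
  then have "(\<Oplus>i\<in>{..degree p}. scalar (c i) \<odot> (b_inv_a N' ^^ i) e) =
      (\<Oplus>i\<in>{..degree p}. scalar (c i) \<odot> (b_inv_a N ^^ i) e) \<oplus> (\<Oplus>i\<in>{..degree p}. b_elt \<odot> (scalar (c i) \<odot> z i))"
    using Gc(1)[OF d] Gc(1)[OF z(1)] by (simp add: finsum_addf)
  also have "\<dots> = b_elt \<odot> (g \<oplus> (\<Oplus>i\<in>{..degree p}. scalar (c i) \<odot> z i))"
    using g Gc(1)[OF z(1)] Gc(1)[OF g(1)] by (simp add: smult_r_distr smult_finsum finsum_closed)
  also have "\<dots> = beta \<odot> (ahat_a (inverse (fps_deriv \<theta>)) \<odot> (g \<oplus> (\<Oplus>i\<in>{..degree p}. scalar (c i) \<odot> z i)))"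
    using Gc(1)[OF z(1)] Gc(1)[OF g(1)] by (simp add: finsum_closed b_elt_eq_beta[symmetric] flip: smult_mult)
  finally have "(\<Oplus>i\<in>{..degree p}. scalar (c i) \<odot> (b_inv_a N' ^^ i) e) = \<dots>" .
  moreover have "ahat_a (inverse (fps_deriv \<theta>)) \<odot> (g \<oplus> (\<Oplus>i\<in>{..degree p}. scalar (c i) \<odot> z i)) \<in> G"
    using g z by (intro Gc submodule_finsum[OF sub]) auto
  ultimately show "(\<Oplus>\<^bsub>N'\<^esub>i\<in>{..degree p}. scalar (coeff p i * (- 1) ^ i) \<odot>\<^bsub>N'\<^esub> (b_inv_a N' ^^ i) e)
      \<in> (\<lambda>f. b_elt \<odot>\<^bsub>N'\<^esub> f) ` G"
    by (simp add: Theta_scalar Theta_b_elt c_def)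
qed

lemma saturation_twist: "saturation N' S = saturation N S"
proof -
  interpret I: pole_twist "fps_inv \<theta>" N' by (rule pole_twist_inv)
  have "pole_submodule N' G \<longleftrightarrow> pole_submodule N G" for G
    using pole_submodule_twist[OF left_module, of G] I.pole_submodule_twist[OF T.left_module, of G]
    by (auto simp: twist_inv)
  then show ?thesis by (simp only: saturation_eq)
qed

lemma annihilates_twist_iff:
  assumes "S \<subseteq> carrier N"
  shows "annihilates N' (saturation N' S) p \<longleftrightarrow> annihilates N (saturation N S) p"
proof
  interpret I: pole_twist "fps_inv \<theta>" N' by (rule pole_twist_inv)
  assume "annihilates N' (saturation N' S) p"
  moreover have "pole_submodule N' (saturation N' S)"
    using assms by (intro T.saturation_pole) simp
  ultimately have "annihilates (twist_module (fps_inv \<theta>) N') (saturation N' S) p"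
    by (rule I.annihilates_twist[rotated])
  then show "annihilates N (saturation N S) p"
    by (simp only: twist_inv saturation_twist)
next
  assume "annihilates N (saturation N S) p"
  then show "annihilates N' (saturation N' S) p"
    unfolding saturation_twist by (intro annihilates_twist saturation_pole assms)
qed

end

text \<open>The condition that characterises the Bernstein polynomial. It is stated for a polynomial \<open>p\<close> so that
its invariance can be proved without knowing that such a \<open>p\<close> exists or is unique.\<close>
definition bernstein_property :: "(ahat, 'e) module \<Rightarrow> complex poly \<Rightarrow> bool"
  where "bernstein_property M p \<longleftrightarrow>
    (\<exists>(N :: (ahat, nat \<Rightarrow> complex fps) module) \<iota>. simple_pole N \<and> module_embedding M N \<iota> \<and>
      lead_coeff p = 1 \<and> annihilates N (saturation N (\<iota> ` carrier M)) p \<and>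
      (\<forall>q. annihilates N (saturation N (\<iota> ` carrier M)) q \<longrightarrow> p dvd q))"

lemma bernstein_poly_eq: "bernstein_poly M = (THE p. bernstein_property M p)"
  by (simp add: bernstein_poly_def bernstein_property_def)

context variable_change
begin

lemma bernstein_property_twist:
  assumes "bernstein_property M p"
  shows "bernstein_property (tw M) p"
proof -
  obtain N :: "(ahat, nat \<Rightarrow> complex fps) module" and \<iota>
    where N: "simple_pole N" "module_embedding M N \<iota>" "lead_coeff p = 1"
      "annihilates N (saturation N (\<iota> ` carrier M)) p"
      "\<And>q. annihilates N (saturation N (\<iota> ` carrier M)) q \<Longrightarrow> p dvd q"
    using assms unfolding bernstein_property_def by blast
  interpret pole_twist \<theta> N by unfold_locales (rule N(1))
  have "\<iota> ` carrier M \<subseteq> carrier N" using N(2) by (simp add: module_embedding_def)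
  note ann = annihilates_twist_iff[OF this]
  show ?thesis
    unfolding bernstein_property_def
    by (intro exI[of _ "tw N"] exI[of _ \<iota>])
       (use N ann simple_pole_twist[OF N(1)] module_embedding_twist[OF N(2)] in simp)
qed

lemma bernstein_poly_twist: "bernstein_poly (tw M) = bernstein_poly M"
proof -
  interpret I: variable_change "fps_inv \<theta>" by (rule variable_change_inv)
  have "bernstein_property (tw M) p \<longleftrightarrow> bernstein_property M p" for p
    using bernstein_property_twist[of M p] I.bernstein_property_twist[of "tw M" p]
    by (auto simp: twist_inv)
  then show ?thesis by (simp add: bernstein_poly_eq)
qed

theorem fresco_twist:
  assumes "fresco M k"
  shows "fresco (tw M) k"
proof -
  have M: "left_module M" and reg: "regular M" and free: "free_b_rank M k"
    and roots: "\<And>z. poly (bernstein_poly M) z = 0 \<Longrightarrow> \<exists>q :: rat. q < 0 \<and> z = of_rat q"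
    using assms by (auto simp: fresco_def geometric_def regular_def)
  obtain e where e: "e \<in> carrier M" "carrier M = range (\<lambda>x. x \<odot>\<^bsub>M\<^esub> e)"
    using assms by (auto simp: fresco_def)
  obtain N :: "(ahat, nat \<Rightarrow> complex fps) module" and \<iota> where "simple_pole N" "module_embedding M N \<iota>"
    using reg by (auto simp: regular_def)
  then have "simple_pole (tw N)" "module_embedding (tw M) (tw N) \<iota>"
    by (auto intro: simple_pole_twist module_embedding_twist)
  then have "regular (tw M)"
    using left_module_twist[OF M] unfolding regular_def by blast
  moreover have "carrier (tw M) = range (\<lambda>x. x \<odot>\<^bsub>tw M\<^esub> e)"
  proof -
    have "range (\<lambda>x. x \<odot>\<^bsub>tw M\<^esub> e) = (\<lambda>x. x \<odot>\<^bsub>M\<^esub> e) ` range (Theta \<theta>)"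
      by (auto simp: image_image)
    then show ?thesis using bij_Theta e(2) by (simp add: bij_is_surj)
  qed
  ultimately show ?thesis
    using free_b_rank_twist[OF M free] roots e(1)
    unfolding fresco_def geometric_def bernstein_poly_twist twist_simps(1) by blast
qed

end

subsection \<open>Isomorphisms\<close>

lemma module_embedding_comp:
  "module_embedding M N f \<Longrightarrow> module_embedding N P g \<Longrightarrow> module_embedding M P (\<lambda>x. g (f x))"
  by (auto simp: module_embedding_def inj_on_def image_subset_iff)

lemma module_embedding_inv:
  assumes "module_embedding M N f" "f ` carrier M = carrier N" "left_module M"
  shows "module_embedding N M (inv_into (carrier M) f)"
proof -
  interpret ahat_module M by unfold_locales (rule assms(3))
  have inv: "inv_into (carrier M) f y \<in> carrier M" "f (inv_into (carrier M) f y) = y" if "y \<in> carrier N" for y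
    using that assms(2) by (auto simp: inv_into_into f_inv_into_f)
  have eq: "inv_into (carrier M) f y = x" if "x \<in> carrier M" "f x = y" for x y
    using assms(1) that by (auto simp: module_embedding_def inv_into_f_f)
  show ?thesis
    unfolding module_embedding_def
  proof (intro conjI ballI allI)
    show "inj_on (inv_into (carrier M) f) (carrier N)"
      using assms(2) by (simp add: inj_on_inv_into)
  qed (use inv assms(1) in \<open>auto simp: module_embedding_def intro!: eq\<close>)
qed

text \<open>An isomorphism transports embeddings into simple pole modules, and the images in those are the same
sets; so all the data that define a fresco are transported.\<close>
theorem fresco_iso:
  assumes M: "left_module M" and f: "module_embedding M M' f" "f ` carrier M = carrier M'" and fresco: "fresco M' k"
  shows "fresco M k"
proof -
  have M': "left_module M'" using fresco by (simp add: fresco_def geometric_def regular_def)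
  interpret ahat_module M by unfold_locales (rule M)
  interpret M': ahat_module M' by unfold_locales (rule M')
  define g where "g = inv_into (carrier M) f"
  have g: "module_embedding M' M g"
    unfolding g_def using f M by (rule module_embedding_inv)
  have fg: "f (g y) = y" "g y \<in> carrier M" if "y \<in> carrier M'" for y
    using that f(2) by (auto simp: g_def f_inv_into_f inv_into_into)
  have inj: "inj_on f (carrier M)" and f_add: "\<And>x y. x \<in> carrier M \<Longrightarrow> y \<in> carrier M \<Longrightarrow> f (x \<oplus>\<^bsub>M\<^esub> y) = f x \<oplus>\<^bsub>M'\<^esub> f y"
    and f_smult: "\<And>z x. x \<in> carrier M \<Longrightarrow> f (z \<odot>\<^bsub>M\<^esub> x) = z \<odot>\<^bsub>M'\<^esub> f x"
    using f(1) by (auto simp: module_embedding_def)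
  have gim: "g ` carrier M' = carrier M"
    unfolding f(2)[symmetric] g_def image_image using inj by (simp add: inv_into_f_f)
  have "bernstein_property M p \<longleftrightarrow> bernstein_property M' p" for p
  proof
    assume "bernstein_property M p"
    then obtain N :: "(ahat, nat \<Rightarrow> complex fps) module" and \<iota> where
      N: "simple_pole N" "module_embedding M N \<iota>" "lead_coeff p = 1"
      "annihilates N (saturation N (\<iota> ` carrier M)) p"
      "\<And>q. annihilates N (saturation N (\<iota> ` carrier M)) q \<Longrightarrow> p dvd q"
      unfolding bernstein_property_def by blast
    moreover have "(\<lambda>x. \<iota> (g x)) ` carrier M' = \<iota> ` carrier M"
      unfolding gim[symmetric] by (simp add: image_image)
    ultimately show "bernstein_property M' p"
      unfolding bernstein_property_def
      by (intro exI[of _ N] exI[of _ "\<lambda>x. \<iota> (g x)"]) (auto intro: module_embedding_comp[OF g])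
  next
    assume "bernstein_property M' p"
    then obtain N :: "(ahat, nat \<Rightarrow> complex fps) module" and \<iota> where
      N: "simple_pole N" "module_embedding M' N \<iota>" "lead_coeff p = 1"
      "annihilates N (saturation N (\<iota> ` carrier M')) p"
      "\<And>q. annihilates N (saturation N (\<iota> ` carrier M')) q \<Longrightarrow> p dvd q"
      unfolding bernstein_property_def by blast
    moreover have "(\<lambda>x. \<iota> (f x)) ` carrier M = \<iota> ` carrier M'"
      unfolding f(2)[symmetric] by (simp add: image_image)
    ultimately show "bernstein_property M p"
      unfolding bernstein_property_def
      by (intro exI[of _ N] exI[of _ "\<lambda>x. \<iota> (f x)"]) (auto intro: module_embedding_comp[OF f(1)])
  qed
  then have bern: "bernstein_poly M = bernstein_poly M'"
    by (simp add: bernstein_poly_eq)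
  have reg: "regular M"
  proof -
    obtain N :: "(ahat, nat \<Rightarrow> complex fps) module" and \<iota> where "simple_pole N" "module_embedding M' N \<iota>"
      using fresco by (auto simp: fresco_def geometric_def regular_def)
    then show ?thesis
      using M module_embedding_comp[OF f(1)] unfolding regular_def by blast
  qed
  obtain u where u: "M'.b_basis k u"
    using fresco by (auto simp: fresco_def M'.free_b_rank_iff)
  have uc: "u i \<in> carrier M'" if "i < k" for i
    using u that by (simp add: M'.b_basis_def)
  have f_lin: "f (b_lin (\<lambda>i. g (u i)) n S) = M'.b_lin u n S" if "n \<le> k" for n S
    using that
  proof (induction n)
    case 0
    have "f \<zero>\<^bsub>M\<^esub> \<oplus>\<^bsub>M'\<^esub> f \<zero>\<^bsub>M\<^esub> = f \<zero>\<^bsub>M\<^esub>" using f_add[of "\<zero>\<^bsub>M\<^esub>" "\<zero>\<^bsub>M\<^esub>"] by simp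
    moreover have "f \<zero>\<^bsub>M\<^esub> \<in> carrier M'" using f by blast
    ultimately have "f \<zero>\<^bsub>M\<^esub> = \<zero>\<^bsub>M'\<^esub>" by simp
    then show ?case by (simp add: b_lin_def M'.b_lin_def)
  next
    case (Suc n)
    have "b_lin (\<lambda>i. g (u i)) (Suc n) S = ahat_b (S n) \<odot>\<^bsub>M\<^esub> g (u n) \<oplus>\<^bsub>M\<^esub> b_lin (\<lambda>i. g (u i)) n S"
      unfolding b_lin_def lessThan_Suc using Suc.prems uc fg by (subst finsum_insert) auto
    moreover have "M'.b_lin u (Suc n) S = ahat_b (S n) \<odot>\<^bsub>M'\<^esub> u n \<oplus>\<^bsub>M'\<^esub> M'.b_lin u n S"
      unfolding M'.b_lin_def lessThan_Suc using Suc.prems uc by (subst M'.finsum_insert) auto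
    moreover have "b_lin (\<lambda>i. g (u i)) n S \<in> carrier M"
      using Suc.prems uc fg by (intro b_lin_closed) auto
    ultimately show ?case
      using Suc uc[of n] fg[of "u n"] by (simp add: f_add f_smult)
  qed
  have "b_basis k (\<lambda>i. g (u i))"
    unfolding b_basis_def
  proof (intro conjI ballI allI impI)
    fix e assume e: "e \<in> carrier M"
    have eq: "e = b_lin (\<lambda>i. g (u i)) k S \<longleftrightarrow> f e = M'.b_lin u k S" for S
    proof -
      have "b_lin (\<lambda>i. g (u i)) k S \<in> carrier M"
        using uc fg by (intro b_lin_closed) auto
      then show ?thesis using e inj f_lin[of k S] by (metis inj_on_def order_refl)
    qed
    have "f e \<in> carrier M'" using e f(2) by blast
    then have "\<exists>!S. (\<forall>i\<ge>k. S i = 0) \<and> f e = M'.b_lin u k S"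
      using u by (simp add: M'.b_basis_def)
    then show "\<exists>!S. (\<forall>i\<ge>k. S i = 0) \<and> e = b_lin (\<lambda>i. g (u i)) k S"
      by (simp only: eq)
  qed (use uc fg in auto)
  then have "free_b_rank M k" by (auto simp: free_b_rank_iff)
  moreover obtain e where e: "e \<in> carrier M'" "carrier M' = range (\<lambda>x. x \<odot>\<^bsub>M'\<^esub> e)"
    using fresco by (auto simp: fresco_def)
  moreover have "carrier M = range (\<lambda>x. x \<odot>\<^bsub>M\<^esub> g e)"
  proof -
    have "g (z \<odot>\<^bsub>M'\<^esub> e) = z \<odot>\<^bsub>M\<^esub> g e" for z
      using g e(1) by (simp add: module_embedding_def)
    then have "(\<lambda>x. x \<odot>\<^bsub>M\<^esub> g e) ` UNIV = g ` carrier M'"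
      unfolding e(2) by (simp add: image_image)
    then show ?thesis by (simp add: gim)
  qed
  ultimately show ?thesis
    using reg fresco fg(2)[OF e(1)] unfolding fresco_def geometric_def bern by blast
qed

section \<open>The structure sheaf\<close>

definition has_differential :: "nat \<Rightarrow> (nat \<Rightarrow> complex) set \<Rightarrow> ((nat \<Rightarrow> complex) \<Rightarrow> complex) \<Rightarrow>
    (nat \<Rightarrow> complex) \<Rightarrow> (nat \<Rightarrow> complex) \<Rightarrow> bool"
  where "has_differential n D F z c \<longleftrightarrow> (\<forall>\<epsilon>>0. \<exists>\<delta>>0. \<forall>w\<in>D.
    (\<forall>i<n. norm (w i - z i) < \<delta>) \<longrightarrow>
      norm (F w - F z - (\<Sum>i<n. c i * (w i - z i))) \<le> \<epsilon> * (\<Sum>i<n. norm (w i - z i)))"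

lemma holomorphic_fun_iff: "holomorphic_fun n D F \<longleftrightarrow> (\<forall>z\<in>D. \<exists>c. has_differential n D F z c)"
  by (simp only: holomorphic_fun_def has_differential_def)

lemma has_differentialD:
  assumes "has_differential n D F z c" "\<epsilon> > 0"
  shows "\<exists>\<delta>>0. \<forall>w\<in>D. (\<forall>i<n. norm (w i - z i) < \<delta>) \<longrightarrow>
      norm (F w - F z - (\<Sum>i<n. c i * (w i - z i))) \<le> \<epsilon> * (\<Sum>i<n. norm (w i - z i))"
  using assms(1)[unfolded has_differential_def, rule_format, OF assms(2)] .

lemma has_differentialI:
  assumes "\<And>\<epsilon>. \<epsilon> > 0 \<Longrightarrow> \<exists>\<delta>>0. \<forall>w\<in>D. (\<forall>i<n. norm (w i - z i) < \<delta>) \<longrightarrow>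
      norm (F w - F z - (\<Sum>i<n. c i * (w i - z i))) \<le> \<epsilon> * (\<Sum>i<n. norm (w i - z i))"
  shows "has_differential n D F z c"
  unfolding has_differential_def using assms by (intro allI impI)

lemma holomorphic_fun_subset:
  assumes "holomorphic_fun n D F" "D' \<subseteq> D"
  shows "holomorphic_fun n D' F"
  unfolding holomorphic_fun_iff
proof
  fix z assume "z \<in> D'"
  then obtain c where c: "has_differential n D F z c"
    using assms unfolding holomorphic_fun_iff by blast
  have "has_differential n D' F z c"
  proof (rule has_differentialI)
    fix \<epsilon> :: real assume "\<epsilon> > 0"
    from has_differentialD[OF c this] show "\<exists>\<delta>>0. \<forall>w\<in>D'. (\<forall>i<n. norm (w i - z i) < \<delta>) \<longrightarrow>
      norm (F w - F z - (\<Sum>i<n. c i * (w i - z i))) \<le> \<epsilon> * (\<Sum>i<n. norm (w i - z i))"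
      by (elim exE conjE, rule_tac x = \<delta> in exI) (use assms(2) in auto)
  qed
  then show "\<exists>c. has_differential n D' F z c" by (rule exI[of _ c])
qed

lemma holomorphic_fun_const: "holomorphic_fun n D (\<lambda>_. c)"
  unfolding holomorphic_fun_def
  by (intro ballI exI[of _ "\<lambda>_. 0"] allI impI exI[of _ 1] conjI) (auto intro!: mult_nonneg_nonneg sum_nonneg)

lemma holomorphic_fun_add:
  assumes F: "holomorphic_fun n D F" and G: "holomorphic_fun n D G"
  shows "holomorphic_fun n D (\<lambda>z. F z + G z)"
  unfolding holomorphic_fun_iff
proof
  fix z assume z: "z \<in> D"
  let ?N = "\<lambda>w. \<Sum>i<n. norm (w i - z i)"
  obtain c where c: "has_differential n D F z c"
    using F z unfolding holomorphic_fun_iff by blast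
  obtain d where d: "has_differential n D G z d"
    using G z unfolding holomorphic_fun_iff by blast
  show "\<exists>c. has_differential n D (\<lambda>z. F z + G z) z c"
  proof (intro exI[of _ "\<lambda>i. c i + d i"] has_differentialI)
    fix \<epsilon> :: real assume e: "\<epsilon> > 0"
    obtain \<delta>1 where \<delta>1: "\<delta>1 > 0" "\<forall>w\<in>D. (\<forall>i<n. norm (w i - z i) < \<delta>1) \<longrightarrow>
        norm (F w - F z - (\<Sum>i<n. c i * (w i - z i))) \<le> \<epsilon> / 2 * ?N w"
      using has_differentialD[OF c half_gt_zero[OF e]] by (elim exE conjE)
    obtain \<delta>2 where \<delta>2: "\<delta>2 > 0" "\<forall>w\<in>D. (\<forall>i<n. norm (w i - z i) < \<delta>2) \<longrightarrow>
        norm (G w - G z - (\<Sum>i<n. d i * (w i - z i))) \<le> \<epsilon> / 2 * ?N w"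
      using has_differentialD[OF d half_gt_zero[OF e]] by (elim exE conjE)
    show "\<exists>\<delta>>0. \<forall>w\<in>D. (\<forall>i<n. norm (w i - z i) < \<delta>) \<longrightarrow>
      norm (F w + G w - (F z + G z) - (\<Sum>i<n. (c i + d i) * (w i - z i))) \<le> \<epsilon> * ?N w"
    proof (intro exI[of _ "min \<delta>1 \<delta>2"] conjI ballI impI)
      fix w assume w: "w \<in> D" "\<forall>i<n. norm (w i - z i) < min \<delta>1 \<delta>2"
      have "F w + G w - (F z + G z) - (\<Sum>i<n. (c i + d i) * (w i - z i)) =
          (F w - F z - (\<Sum>i<n. c i * (w i - z i))) + (G w - G z - (\<Sum>i<n. d i * (w i - z i)))"
        by (simp add: algebra_simps sum.distrib sum_subtractf)
      also have "norm \<dots> \<le> \<epsilon> / 2 * ?N w + \<epsilon> / 2 * ?N w"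
        using w by (intro order.trans[OF norm_triangle_ineq] add_mono \<delta>1(2)[rule_format] \<delta>2(2)[rule_format]) auto
      finally show "norm (F w + G w - (F z + G z) - (\<Sum>i<n. (c i + d i) * (w i - z i))) \<le> \<epsilon> * ?N w"
        by simp
    qed (use \<delta>1 \<delta>2 in auto)
  qed
qed

text \<open>The product rule. Besides the errors of the two linear approximations there is the product of the
increments; each increment is bounded by a multiple of the distance, so this term is of second order.
The three contributions are kept below \<open>\<epsilon> / 3\<close> each.\<close>
lemma holomorphic_fun_mult:
  assumes F: "holomorphic_fun n D F" and G: "holomorphic_fun n D G"
  shows "holomorphic_fun n D (\<lambda>z. F z * G z)"
  unfolding holomorphic_fun_iff
proof
  fix z assume z: "z \<in> D"
  let ?N = "\<lambda>w. \<Sum>i<n. norm (w i - z i)"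
  obtain c where c: "has_differential n D F z c"
    using F z unfolding holomorphic_fun_iff by blast
  obtain d where d: "has_differential n D G z d"
    using G z unfolding holomorphic_fun_iff by blast
  have lin: "norm (H w - H z) \<le> ((\<Sum>i<n. norm (h i)) + r) * ?N w"
    if "norm (H w - H z - (\<Sum>i<n. h i * (w i - z i))) \<le> r * ?N w" for H h w and r :: real
  proof -
    have "norm (\<Sum>i<n. h i * (w i - z i)) \<le> (\<Sum>i<n. norm (h i) * ?N w)"
      by (intro sum_norm_le) (auto simp: norm_mult intro!: mult_left_mono member_le_sum)
    then have "norm (\<Sum>i<n. h i * (w i - z i)) \<le> (\<Sum>i<n. norm (h i)) * ?N w"
      by (simp add: sum_distrib_right)
    then show ?thesis
      using that norm_triangle_ineq[of "H w - H z - (\<Sum>i<n. h i * (w i - z i))" "\<Sum>i<n. h i * (w i - z i)"]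
      by (simp add: algebra_simps)
  qed
  show "\<exists>c. has_differential n D (\<lambda>z. F z * G z) z c"
  proof (intro exI[of _ "\<lambda>i. F z * d i + G z * c i"] has_differentialI)
    fix \<epsilon> :: real assume e: "\<epsilon> > 0"
    define r where "r = \<epsilon> / (3 * (norm (F z) + norm (G z) + 1))"
    have pos: "norm (F z) + norm (G z) + 1 > 0"
      using norm_ge_zero[of "F z"] norm_ge_zero[of "G z"] by linarith
    have r: "r > 0" unfolding r_def using e pos by simp
    have rF: "norm (F z) * r \<le> \<epsilon> / 3" and rG: "norm (G z) * r \<le> \<epsilon> / 3"
    proof -
      have "(norm (F z) + norm (G z) + 1) * r = \<epsilon> / 3"
        unfolding r_def using pos by (simp add: field_simps)
      moreover have "norm (F z) * r \<le> (norm (F z) + norm (G z) + 1) * r"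
        "norm (G z) * r \<le> (norm (F z) + norm (G z) + 1) * r"
        using r by (auto intro!: mult_right_mono)
      ultimately show "norm (F z) * r \<le> \<epsilon> / 3" "norm (G z) * r \<le> \<epsilon> / 3" by linarith+
    qed
    define K where "K = ((\<Sum>i<n. norm (c i)) + r) * ((\<Sum>i<n. norm (d i)) + r)"
    have cr: "(\<Sum>i<n. norm (c i)) + r \<ge> 0" and dr: "(\<Sum>i<n. norm (d i)) + r \<ge> 0"
      using r by (auto intro!: add_nonneg_nonneg sum_nonneg)
    then have K: "K \<ge> 0" by (simp add: K_def)
    define \<delta>3 where "\<delta>3 = \<epsilon> / (3 * (K * real n + 1))"
    have Kn: "K * real n + 1 > 0" using K by (simp add: add_nonneg_pos)
    have \<delta>3: "\<delta>3 > 0" unfolding \<delta>3_def using e Kn by simp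
    have K3: "K * (real n * \<delta>3) \<le> \<epsilon> / 3"
    proof -
      have "(K * real n + 1) * \<delta>3 = \<epsilon> / 3"
        unfolding \<delta>3_def using Kn by (simp add: field_simps)
      moreover have "K * (real n * \<delta>3) \<le> (K * real n + 1) * \<delta>3"
        using \<delta>3 by (simp add: algebra_simps)
      ultimately show ?thesis by linarith
    qed
    obtain \<delta>1 where \<delta>1: "\<delta>1 > 0" "\<forall>w\<in>D. (\<forall>i<n. norm (w i - z i) < \<delta>1) \<longrightarrow>
        norm (F w - F z - (\<Sum>i<n. c i * (w i - z i))) \<le> r * ?N w"
      using has_differentialD[OF c r] by (elim exE conjE)
    obtain \<delta>2 where \<delta>2: "\<delta>2 > 0" "\<forall>w\<in>D. (\<forall>i<n. norm (w i - z i) < \<delta>2) \<longrightarrow>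
        norm (G w - G z - (\<Sum>i<n. d i * (w i - z i))) \<le> r * ?N w"
      using has_differentialD[OF d r] by (elim exE conjE)
    show "\<exists>\<delta>>0. \<forall>w\<in>D. (\<forall>i<n. norm (w i - z i) < \<delta>) \<longrightarrow>
      norm (F w * G w - F z * G z - (\<Sum>i<n. (F z * d i + G z * c i) * (w i - z i))) \<le> \<epsilon> * ?N w"
    proof (intro exI[of _ "min \<delta>1 (min \<delta>2 \<delta>3)"] conjI ballI impI)
      fix w assume w: "w \<in> D" "\<forall>i<n. norm (w i - z i) < min \<delta>1 (min \<delta>2 \<delta>3)"
      define eF eG where "eF = F w - F z - (\<Sum>i<n. c i * (w i - z i))" and "eG = G w - G z - (\<Sum>i<n. d i * (w i - z i))"
      have eF: "norm eF \<le> r * ?N w" and eG: "norm eG \<le> r * ?N w"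
        unfolding eF_def eG_def using w by (auto intro!: \<delta>1(2)[rule_format] \<delta>2(2)[rule_format])
      have N0: "?N w \<ge> 0" by (intro sum_nonneg) auto
      have "?N w \<le> (\<Sum>i<n. \<delta>3)" using w by (intro sum_mono) (auto intro: less_imp_le)
      then have N: "?N w \<le> real n * \<delta>3" by simp
      have "F w * G w - F z * G z - (\<Sum>i<n. (F z * d i + G z * c i) * (w i - z i)) =
          F z * eG + G z * eF + (F w - F z) * (G w - G z)"
        by (simp add: eF_def eG_def algebra_simps sum.distrib sum_subtractf sum_distrib_left)
      also have "norm \<dots> \<le> norm (F z) * norm eG + norm (G z) * norm eF + norm (F w - F z) * norm (G w - G z)"
        by (metis (no_types, opaque_lifting) add_right_mono norm_mult norm_triangle_ineq order_trans)
      also have "\<dots> \<le> \<epsilon> / 3 * ?N w + \<epsilon> / 3 * ?N w + \<epsilon> / 3 * ?N w"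
      proof (intro add_mono)
        have "norm (F z) * norm eG \<le> norm (F z) * (r * ?N w)" using eG by (intro mult_left_mono) auto
        also have "\<dots> = (norm (F z) * r) * ?N w" by simp
        also have "\<dots> \<le> \<epsilon> / 3 * ?N w" using rF N0 by (intro mult_right_mono)
        finally show "norm (F z) * norm eG \<le> \<epsilon> / 3 * ?N w" .
        have "norm (G z) * norm eF \<le> norm (G z) * (r * ?N w)" using eF by (intro mult_left_mono) auto
        also have "\<dots> = (norm (G z) * r) * ?N w" by simp
        also have "\<dots> \<le> \<epsilon> / 3 * ?N w" using rG N0 by (intro mult_right_mono)
        finally show "norm (G z) * norm eF \<le> \<epsilon> / 3 * ?N w" .
        have "norm (F w - F z) * norm (G w - G z) \<le>
            (((\<Sum>i<n. norm (c i)) + r) * ?N w) * (((\<Sum>i<n. norm (d i)) + r) * ?N w)"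
          using eF eG cr dr N0 by (intro mult_mono lin) (auto simp: eF_def eG_def)
        also have "\<dots> = (K * ?N w) * ?N w" by (simp add: K_def algebra_simps)
        also have "\<dots> \<le> (K * (real n * \<delta>3)) * ?N w"
          using N K N0 by (intro mult_right_mono mult_left_mono)
        also have "\<dots> \<le> \<epsilon> / 3 * ?N w" using K3 N0 by (intro mult_right_mono)
        finally show "norm (F w - F z) * norm (G w - G z) \<le> \<epsilon> / 3 * ?N w" .
      qed
      also have "\<dots> = \<epsilon> * ?N w" by simp
      finally show "norm (F w * G w - F z * G z - (\<Sum>i<n. (F z * d i + G z * c i) * (w i - z i))) \<le> \<epsilon> * ?N w" .
    qed (use \<delta>1 \<delta>2 \<delta>3 in auto)
  qed
qed

locale reduced_space =
  fixes X :: "'x topology" and Ox :: "'x set \<Rightarrow> ('x \<Rightarrow> complex) set"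
  assumes reduced: "reduced_complex_space X Ox"
begin

lemma reduced_parts:
  "\<forall>U f. openin X U \<and> f \<in> Ox U \<longrightarrow> (\<forall>x. x \<notin> U \<longrightarrow> f x = 0)"
  "\<forall>U W f. openin X U \<and> openin X W \<and> W \<subseteq> U \<and> f \<in> Ox U \<longrightarrow> restr W f \<in> Ox W"
  "\<forall>U f. openin X U \<and> (\<forall>x. x \<notin> U \<longrightarrow> f x = 0) \<and>
       (\<forall>x\<in>U. \<exists>W. openin X W \<and> x \<in> W \<and> W \<subseteq> U \<and> restr W f \<in> Ox W) \<longrightarrow> f \<in> Ox U"
proof -
  note r = reduced[unfolded reduced_complex_space_def]
  show "\<forall>U f. openin X U \<and> f \<in> Ox U \<longrightarrow> (\<forall>x. x \<notin> U \<longrightarrow> f x = 0)"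
    by (rule conjunct1[OF conjunct2[OF r]])
  show "\<forall>U W f. openin X U \<and> openin X W \<and> W \<subseteq> U \<and> f \<in> Ox U \<longrightarrow> restr W f \<in> Ox W"
    by (rule conjunct1[OF conjunct2[OF conjunct2[OF r]]])
  show "\<forall>U f. openin X U \<and> (\<forall>x. x \<notin> U \<longrightarrow> f x = 0) \<and>
       (\<forall>x\<in>U. \<exists>W. openin X W \<and> x \<in> W \<and> W \<subseteq> U \<and> restr W f \<in> Ox W) \<longrightarrow> f \<in> Ox U"
    by (rule conjunct1[OF conjunct2[OF conjunct2[OF conjunct2[OF r]]]])
qed

lemma Ox_outside: "openin X U \<Longrightarrow> f \<in> Ox U \<Longrightarrow> x \<notin> U \<Longrightarrow> f x = 0"
  using reduced_parts(1) by blast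

lemma Ox_restr: "openin X U \<Longrightarrow> openin X W \<Longrightarrow> W \<subseteq> U \<Longrightarrow> f \<in> Ox U \<Longrightarrow> restr W f \<in> Ox W"
  using reduced_parts(2) by blast

lemma Ox_local:
  assumes "openin X U" "\<And>x. x \<notin> U \<Longrightarrow> f x = 0"
    and "\<And>x. x \<in> U \<Longrightarrow> \<exists>W. openin X W \<and> x \<in> W \<and> W \<subseteq> U \<and> restr W f \<in> Ox W"
  shows "f \<in> Ox U"
  using assms by (intro reduced_parts(3)[rule_format]) auto

definition local_fun :: "nat \<Rightarrow> ('x \<Rightarrow> nat \<Rightarrow> complex) \<Rightarrow> 'x set \<Rightarrow> ('x \<Rightarrow> complex) \<Rightarrow> bool"
  where "local_fun n h W f \<longleftrightarrow> (\<forall>x\<in>W. \<exists>D F. openin (complex_space n) D \<and> h x \<in> D \<and> holomorphic_fun n D F \<and>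
               (\<forall>y\<in>W. h y \<in> D \<longrightarrow> f y = F (h y)))"

lemma chart:
  assumes "p \<in> topspace X"
  obtains V n h where "openin X V" "p \<in> V" "h ` V \<subseteq> topspace (complex_space n)"
    "\<forall>W f. openin X W \<and> W \<subseteq> V \<longrightarrow> (f \<in> Ox W \<longleftrightarrow> (\<forall>x. x \<notin> W \<longrightarrow> f x = 0) \<and> local_fun n h W f)"
proof -
  have "\<forall>p\<in>topspace X. \<exists>V n D A h. openin X V \<and> p \<in> V \<and>
       openin (complex_space n) D \<and> analytic_subset n D A \<and>
       homeomorphic_map (subtopology X V) (subtopology (complex_space n) A) h \<and>
       (\<forall>W. openin X W \<and> W \<subseteq> V \<longrightarrow>
          Ox W = {f. (\<forall>x. x \<notin> W \<longrightarrow> f x = 0) \<and>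
            (\<forall>x\<in>W. \<exists>D' F. openin (complex_space n) D' \<and> h x \<in> D' \<and> holomorphic_fun n D' F \<and>
               (\<forall>y\<in>W. h y \<in> D' \<longrightarrow> f y = F (h y)))})"
    using reduced unfolding reduced_complex_space_def by (elim conjE)
  from bspec[OF this assms] obtain V n D A h where V: "openin X V" "p \<in> V"
       "homeomorphic_map (subtopology X V) (subtopology (complex_space n) A) h"
       "\<forall>W. openin X W \<and> W \<subseteq> V \<longrightarrow>
          Ox W = {f. (\<forall>x. x \<notin> W \<longrightarrow> f x = 0) \<and>
            (\<forall>x\<in>W. \<exists>D' F. openin (complex_space n) D' \<and> h x \<in> D' \<and> holomorphic_fun n D' F \<and>
               (\<forall>y\<in>W. h y \<in> D' \<longrightarrow> f y = F (h y)))}"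
    by (elim exE conjE)
  have "h ` topspace (subtopology X V) = topspace (subtopology (complex_space n) A)"
    using V(3) by (rule homeomorphic_imp_surjective_map)
  then have "h ` V \<subseteq> topspace (complex_space n)"
    using openin_subset[OF V(1)] by (simp add: Int_absorb1)
  moreover have "f \<in> Ox W \<longleftrightarrow> (\<forall>x. x \<notin> W \<longrightarrow> f x = 0) \<and> local_fun n h W f" if "openin X W" "W \<subseteq> V" for W f
    using V(4) that by (simp add: local_fun_def)
  ultimately show ?thesis using V(1,2) by (intro that) auto
qed

text \<open>Sections of the structure sheaf are locally induced by holomorphic functions on a local model, so
an operation on values that preserves holomorphic functions preserves sections. The value at
\<open>(0, 0)\<close> matters because sections are extended by zero.\<close>
lemma Ox_binary:
  assumes holo: "\<And>n D F G. holomorphic_fun n D F \<Longrightarrow> holomorphic_fun n D G \<Longrightarrow> holomorphic_fun n D (\<lambda>z. q (F z) (G z))"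
    and zero: "q 0 0 = 0"
    and U: "openin X U" and f: "f \<in> Ox U" and g: "g \<in> Ox U"
  shows "(\<lambda>x. q (f x) (g x)) \<in> Ox U"
proof (rule Ox_local[OF U])
  fix x assume "x \<notin> U"
  then show "q (f x) (g x) = 0" using Ox_outside[OF U f, of x] Ox_outside[OF U g, of x] zero by simp
next
  fix x assume x: "x \<in> U"
  then have "x \<in> topspace X" using openin_subset[OF U] by blast
  then obtain V n h where V: "openin X V" "x \<in> V"
    "\<forall>W f. openin X W \<and> W \<subseteq> V \<longrightarrow> (f \<in> Ox W \<longleftrightarrow> (\<forall>x. x \<notin> W \<longrightarrow> f x = 0) \<and> local_fun n h W f)"
    by (rule chart) blast
  define W where "W = U \<inter> V"
  have W: "openin X W" "W \<subseteq> V" "W \<subseteq> U" "x \<in> W" using U V x by (auto simp: W_def)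
  have "local_fun n h W (restr W f)" "local_fun n h W (restr W g)"
    using Ox_restr[OF U W(1,3) f] Ox_restr[OF U W(1,3) g] V(3)[rule_format, OF conjI[OF W(1,2)]] by auto
  then have "local_fun n h W (restr W (\<lambda>x. q (f x) (g x)))"
    unfolding local_fun_def
  proof (intro ballI)
    fix y assume lf: "\<forall>x\<in>W. \<exists>D F. openin (complex_space n) D \<and> h x \<in> D \<and> holomorphic_fun n D F \<and>
          (\<forall>y\<in>W. h y \<in> D \<longrightarrow> restr W f y = F (h y))"
      and lg: "\<forall>x\<in>W. \<exists>D F. openin (complex_space n) D \<and> h x \<in> D \<and> holomorphic_fun n D F \<and>
          (\<forall>y\<in>W. h y \<in> D \<longrightarrow> restr W g y = F (h y))"
      and y: "y \<in> W"
    obtain D1 F where F: "openin (complex_space n) D1" "h y \<in> D1" "holomorphic_fun n D1 F"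
        "\<forall>y\<in>W. h y \<in> D1 \<longrightarrow> restr W f y = F (h y)" using lf y by meson
    obtain D2 G where G: "openin (complex_space n) D2" "h y \<in> D2" "holomorphic_fun n D2 G"
        "\<forall>y\<in>W. h y \<in> D2 \<longrightarrow> restr W g y = G (h y)" using lg y by meson
    have "holomorphic_fun n (D1 \<inter> D2) (\<lambda>z. q (F z) (G z))"
      using F(3) G(3) by (intro holo) (auto elim: holomorphic_fun_subset)
    moreover have "\<forall>y\<in>W. h y \<in> D1 \<inter> D2 \<longrightarrow> restr W (\<lambda>x. q (f x) (g x)) y = q (F (h y)) (G (h y))"
      using F(4) G(4) by (simp add: restr_def)
    ultimately show "\<exists>D F. openin (complex_space n) D \<and> h y \<in> D \<and> holomorphic_fun n D F \<and>
          (\<forall>y\<in>W. h y \<in> D \<longrightarrow> restr W (\<lambda>x. q (f x) (g x)) y = F (h y))"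
      using F G by (intro exI[of _ "D1 \<inter> D2"] exI[of _ "\<lambda>z. q (F z) (G z)"]) auto
  qed
  then have "restr W (\<lambda>x. q (f x) (g x)) \<in> Ox W"
    using V(3)[rule_format, OF conjI[OF W(1,2)]] by (simp add: restr_def)
  then show "\<exists>W. openin X W \<and> x \<in> W \<and> W \<subseteq> U \<and> restr W (\<lambda>x. q (f x) (g x)) \<in> Ox W"
    using W by blast
qed

lemma Ox_add: "openin X U \<Longrightarrow> f \<in> Ox U \<Longrightarrow> g \<in> Ox U \<Longrightarrow> (\<lambda>x. f x + g x) \<in> Ox U"
  by (rule Ox_binary[where q = "(+)"]) (auto intro: holomorphic_fun_add)

lemma Ox_mult: "openin X U \<Longrightarrow> f \<in> Ox U \<Longrightarrow> g \<in> Ox U \<Longrightarrow> (\<lambda>x. f x * g x) \<in> Ox U"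
  by (rule Ox_binary[where q = "(*)"]) (auto intro: holomorphic_fun_mult)

lemma Ox_const:
  assumes U: "openin X U"
  shows "restr U (\<lambda>_. c) \<in> Ox U"
proof (rule Ox_local[OF U])
  fix x assume x: "x \<in> U"
  then have "x \<in> topspace X" using openin_subset[OF U] by blast
  then obtain V n h where V: "openin X V" "x \<in> V" "h ` V \<subseteq> topspace (complex_space n)"
    "\<forall>W f. openin X W \<and> W \<subseteq> V \<longrightarrow> (f \<in> Ox W \<longleftrightarrow> (\<forall>x. x \<notin> W \<longrightarrow> f x = 0) \<and> local_fun n h W f)"
    by (rule chart)
  define W where "W = U \<inter> V"
  have W: "openin X W" "W \<subseteq> V" "W \<subseteq> U" "x \<in> W" using U V x by (auto simp: W_def)
  have "local_fun n h W (restr W (restr U (\<lambda>_. c)))"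
    unfolding local_fun_def
    by (intro ballI exI[of _ "topspace (complex_space n)"] exI[of _ "\<lambda>_. c"])
       (use W V(3) in \<open>auto simp: restr_def intro: holomorphic_fun_const\<close>)
  then have "restr W (restr U (\<lambda>_. c)) \<in> Ox W"
    using V(4)[rule_format, OF conjI[OF W(1,2)]] by (simp add: restr_def)
  then show "\<exists>W. openin X W \<and> x \<in> W \<and> W \<subseteq> U \<and> restr W (restr U (\<lambda>_. c)) \<in> Ox W"
    using W by blast
qed (simp add: restr_def)

lemma Ox_zero: "openin X U \<Longrightarrow> (\<lambda>_. 0) \<in> Ox U"
  using Ox_const[of U 0] by (simp add: restr_def)

lemma Ox_cmult:
  assumes "openin X U" "f \<in> Ox U"
  shows "(\<lambda>x. c * f x) \<in> Ox U"
proof -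
  have "(\<lambda>x. c * f x) = (\<lambda>x. restr U (\<lambda>_. c) x * f x)"
    using Ox_outside[OF assms] by (auto simp: restr_def)
  then show ?thesis using Ox_mult[OF assms(1) Ox_const[OF assms(1)] assms(2)] by simp
qed

lemma Ox_sum: "openin X U \<Longrightarrow> (\<And>t. t \<in> T \<Longrightarrow> f t \<in> Ox U) \<Longrightarrow> (\<lambda>x. \<Sum>t\<in>T. f t x) \<in> Ox U"
  by (induction T rule: infinite_finite_induct) (auto intro: Ox_zero Ox_add)

lemma Ox_diff: "openin X U \<Longrightarrow> f \<in> Ox U \<Longrightarrow> g \<in> Ox U \<Longrightarrow> (\<lambda>x. f x - g x) \<in> Ox U"
  using Ox_add[of U f "\<lambda>x. (- 1) * g x"] Ox_cmult[of U g "- 1"] by simp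

abbreviation ob :: "'x set \<Rightarrow> ('x \<Rightarrow> complex fps) set"
  where "ob \<equiv> ob_sections Ox"

lemma obI: "(\<And>n. (\<lambda>x. fps_nth (g x) n) \<in> Ox U) \<Longrightarrow> g \<in> ob U"
  by (simp add: ob_sections_def)

lemma obD: "g \<in> ob U \<Longrightarrow> (\<lambda>x. fps_nth (g x) n) \<in> Ox U"
  by (simp add: ob_sections_def)

lemma ob_outside: "openin X U \<Longrightarrow> g \<in> ob U \<Longrightarrow> x \<notin> U \<Longrightarrow> g x = 0"
  using Ox_outside[OF _ obD, of U g x] by (intro fps_ext) simp

lemma ob_add: "openin X U \<Longrightarrow> g \<in> ob U \<Longrightarrow> h \<in> ob U \<Longrightarrow> (\<lambda>x. g x + h x) \<in> ob U"
  by (intro obI) (simp add: Ox_add obD)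

lemma ob_diff: "openin X U \<Longrightarrow> g \<in> ob U \<Longrightarrow> h \<in> ob U \<Longrightarrow> (\<lambda>x. g x - h x) \<in> ob U"
  by (intro obI) (simp add: Ox_diff obD)

lemma ob_mult: "openin X U \<Longrightarrow> g \<in> ob U \<Longrightarrow> h \<in> ob U \<Longrightarrow> (\<lambda>x. g x * h x) \<in> ob U"
  by (intro obI) (simp add: fps_mult_nth Ox_sum Ox_mult obD)

lemma ob_zero: "openin X U \<Longrightarrow> (\<lambda>_. 0) \<in> ob U"
  by (intro obI) (simp add: Ox_zero)

lemma ob_const: "openin X U \<Longrightarrow> restr U (\<lambda>_. S) \<in> ob U"
proof (rule obI)
  fix n assume "openin X U"
  then show "(\<lambda>x. fps_nth (restr U (\<lambda>_. S) x) n) \<in> Ox U"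
    using Ox_const[of U "fps_nth S n"] by (simp add: restr_def if_distrib[of "\<lambda>g. fps_nth g n"] cong: if_cong)
qed

lemma ob_cmult: "openin X U \<Longrightarrow> g \<in> ob U \<Longrightarrow> (\<lambda>x. S * g x) \<in> ob U"
  by (intro obI) (simp add: fps_mult_nth Ox_sum Ox_cmult obD)

lemma ob_fps_const: "openin X U \<Longrightarrow> f \<in> Ox U \<Longrightarrow> (\<lambda>x. fps_const (f x)) \<in> ob U"
proof (rule obI)
  fix n assume "openin X U" "f \<in> Ox U"
  then show "(\<lambda>x. fps_nth (fps_const (f x)) n) \<in> Ox U"
    by (cases n) (simp_all add: Ox_zero)
qed

lemma ob_Abs_fps: "(\<And>n. (\<lambda>x. c x n) \<in> Ox U) \<Longrightarrow> (\<lambda>x. Abs_fps (c x)) \<in> ob U"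
  by (intro obI) simp

lemma ob_shift: "g \<in> ob U \<Longrightarrow> (\<lambda>x. fps_shift d (g x)) \<in> ob U"
  by (intro obI) (simp add: obD)

lemma ob_restr:
  assumes "openin X U" "openin X W" "W \<subseteq> U" "g \<in> ob U"
  shows "restr W g \<in> ob W"
proof (rule obI)
  fix n
  have "restr W (\<lambda>x. fps_nth (g x) n) \<in> Ox W"
    using assms by (intro Ox_restr[of U]) (auto intro: obD)
  moreover have "restr W (\<lambda>x. fps_nth (g x) n) = (\<lambda>x. fps_nth (restr W g x) n)"
    by (auto simp: restr_def)
  ultimately show "(\<lambda>x. fps_nth (restr W g x) n) \<in> Ox W" by simp
qed

end

section \<open>Sections of the expansion sheaf\<close>

locale expansion_family = expansion_change \<theta> lam N m + reduced_space X Ox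
  for \<theta> :: "complex fps" and lam :: complex and N m :: nat
    and X :: "'x topology" and Ox :: "'x set \<Rightarrow> ('x \<Rightarrow> complex) set"
begin

abbreviation Xi :: "('x, 'x \<Rightarrow> expansion) ahat_sheaf"
  where "Xi \<equiv> xi_sheaf Ox lam N m"

abbreviation xsec :: "'x set \<Rightarrow> ('x \<Rightarrow> expansion) set"
  where "xsec \<equiv> secs Xi"

lemma xsec_iff: "s \<in> xsec U \<longleftrightarrow> (\<forall>x. s x \<in> carr) \<and> (\<forall>j i. (\<lambda>x. s x j i) \<in> ob U)"
  by (simp add: xi_sheaf_def)

lemma xi_sheaf_simps [simp]:
  "add (sect Xi U) = (+)" "zero (sect Xi U) = 0" "z \<odot>\<^bsub>sect Xi U\<^esub> s = (\<lambda>x. act z (s x))"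
  "rest Xi U W = restr W"
  by (simp_all add: xi_sheaf_def)

lemma xi_sheaf_ob_act [simp]: "ob_act Xi U g s = (\<lambda>x. act (ahat_b (g x)) (s x))"
  by (simp add: xi_sheaf_def xi_act_ahat_b)

lemma xsec_carr: "s \<in> xsec U \<Longrightarrow> s x \<in> carr"
  by (simp add: xsec_iff)

lemma xsec_ob: "s \<in> xsec U \<Longrightarrow> (\<lambda>x. s x j i) \<in> ob U"
  by (simp add: xsec_iff)

lemma xsec_outside: "openin X U \<Longrightarrow> s \<in> xsec U \<Longrightarrow> x \<notin> U \<Longrightarrow> s x = 0"
  using ob_outside[OF _ xsec_ob, of U s x] by (intro ext) simp

lemma xsec_zero: "openin X U \<Longrightarrow> (\<lambda>x. 0) \<in> xsec U"
  by (simp add: xsec_iff carr_zero ob_zero)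

lemma xsec_add: "openin X U \<Longrightarrow> s \<in> xsec U \<Longrightarrow> t \<in> xsec U \<Longrightarrow> (\<lambda>x. s x + t x) \<in> xsec U"
  unfolding xsec_iff using carr_add by (simp add: ob_add)

lemma xsec_diff: "openin X U \<Longrightarrow> s \<in> xsec U \<Longrightarrow> t \<in> xsec U \<Longrightarrow> (\<lambda>x. s x - t x) \<in> xsec U"
  unfolding xsec_iff using carr_diff by (simp add: ob_diff)

lemma xsec_ob_act: "openin X U \<Longrightarrow> g \<in> ob U \<Longrightarrow> s \<in> xsec U \<Longrightarrow> (\<lambda>x. act (ahat_b (g x)) (s x)) \<in> xsec U"
  by (auto simp: xsec_iff xi_act_ahat_b ob_mult carr_iff)

lemma xi_a_apply: "xi_a lam s j i = fps_const lam * fps_X * s j i + fps_X * s (Suc j) i + fps_X ^ 2 * fps_deriv (s j i)"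
  by (simp add: xi_a_def)

text \<open>Every coefficient of \<open>z s\<close> is a finite combination of coefficients of \<open>a^n b^\<nu> s\<close>, which in turn arise
from the coefficients of \<open>s\<close> by linear operations with constant coefficients.\<close>
lemma xsec_act:
  assumes U: "openin X U" and s: "s \<in> xsec U"
  shows "(\<lambda>x. act z (s x)) \<in> xsec U"
proof -
  have b_power: "\<forall>j i. (\<lambda>x. (xi_b ^^ \<nu>) (s x) j i) \<in> ob U" for \<nu>
    using s by (simp add: xi_b_funpow ob_cmult[OF U] xsec_ob)
  have 1: "\<forall>j i. (\<lambda>x. (xi_a lam ^^ n) ((xi_b ^^ \<nu>) (s x)) j i) \<in> ob U" for n \<nu>
  proof (induction n)
    case (Suc n)
    have IH: "\<forall>j i. (\<lambda>x. (xi_a lam ^^ n) ((xi_b ^^ \<nu>) (s x)) j i) \<in> ob U" by (rule Suc)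
    show ?case
    proof (intro allI)
      fix j i
      have "(\<lambda>x. fps_const lam * fps_X * t x + fps_X * u x + fps_X ^ 2 * fps_deriv (t x)) \<in> ob U"
        if t: "t \<in> ob U" and u: "u \<in> ob U" for t u
      proof -
        have "(\<lambda>x. fps_deriv (t x)) \<in> ob U"
          by (rule obI) (simp add: Ox_cmult[OF U] obD[OF t] del: of_nat_Suc)
        then show ?thesis
          using t u by (intro ob_add[OF U] ob_cmult[OF U])
      qed
      then show "(\<lambda>x. (xi_a lam ^^ Suc n) ((xi_b ^^ \<nu>) (s x)) j i) \<in> ob U"
        using IH by (simp add: xi_a_apply)
    qed
  next
    case 0
    show "\<forall>j i. (\<lambda>x. (xi_a lam ^^ 0) ((xi_b ^^ \<nu>) (s x)) j i) \<in> ob U" using b_power by simp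
  qed
  have "(\<lambda>x. act z (s x) j i) \<in> ob U" for j i
    unfolding xi_act_def xi_b_funpow[symmetric]
    using 1 by (intro ob_Abs_fps Ox_sum[OF U] Ox_cmult[OF U] obD) auto
  then show ?thesis using s carr_act by (simp add: xsec_iff)
qed

lemma xsec_restr:
  assumes "openin X U" "openin X W" "W \<subseteq> U" "s \<in> xsec U"
  shows "restr W s \<in> xsec W"
proof -
  have "(\<lambda>x. restr W s x j i) = restr W (\<lambda>x. s x j i)" for j i
    by (auto simp: restr_def)
  then show ?thesis
    using assms xsec_carr[OF assms(4)] carr_zero by (auto simp: xsec_iff ob_restr) (auto simp: restr_def)
qed

lemma xsec_Phi:
  assumes U: "openin X U" and s: "s \<in> xsec U"
  shows "(\<lambda>x. Phi (s x)) \<in> xsec U"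
proof -
  have "(\<lambda>x. fps_nth (Phi (s x) j i) d) \<in> Ox U" for j i d
  proof -
    have "(\<lambda>x. fps_nth (s x j' l) n * c) \<in> Ox U" for j' l n c
      using Ox_cmult[OF U obD[OF xsec_ob[OF s]], of c] by (simp add: mult.commute)
    then show ?thesis
      unfolding Phi_nth by (intro Ox_sum[OF U]) auto
  qed
  then show ?thesis using Phi_carr by (simp add: xsec_iff obI)
qed

lemma xsec_Psi:
  assumes U: "openin X U" and s: "s \<in> xsec U"
  shows "(\<lambda>x. Psi (s x)) \<in> xsec U"
proof -
  have rem: "(\<lambda>x. remainder (s x) d) \<in> xsec U" for d
  proof (induction d)
    case (Suc d)
    have "(\<lambda>x. hom_part d (remainder (s x) d) j i) \<in> ob U" for j i
    proof (rule obI)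
      fix n
      have "(\<lambda>x. (1 / lead ^ d) * fps_nth (remainder (s x) d j i) d) \<in> Ox U"
        using Suc by (intro Ox_cmult[OF U] obD xsec_ob)
      then show "(\<lambda>x. fps_nth (hom_part d (remainder (s x) d) j i) n) \<in> Ox U"
        using Ox_zero[OF U]
        by (cases "n = d") (simp_all add: hom_part_nth)
    qed
    then have "(\<lambda>x. hom_part d (remainder (s x) d)) \<in> xsec U"
      using xsec_carr[OF Suc] hom_part_carr by (simp add: xsec_iff)
    then have "(\<lambda>x. remainder (s x) d - Phi (hom_part d (remainder (s x) d))) \<in> xsec U"
      using Suc by (intro xsec_diff xsec_Phi U)
    then show "(\<lambda>x. remainder (s x) (Suc d)) \<in> xsec U" by simp
  qed (simp add: s)
  have "(\<lambda>x. (1 / lead ^ d) * fps_nth (remainder (s x) d j i) d) \<in> Ox U" for j i d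
    using rem by (intro Ox_cmult[OF U] obD xsec_ob)
  then have "(\<lambda>x. Psi (s x) j i) \<in> ob U" for j i
    unfolding Psi_def by (intro ob_Abs_fps) simp
  then show ?thesis using Psi_carr[OF xsec_carr[OF s]] by (simp add: xsec_iff)
qed

section \<open>Generated subsheaves\<close>

abbreviation gen :: "'x set \<Rightarrow> ('x \<Rightarrow> expansion) \<Rightarrow> 'x set \<Rightarrow> ('x \<Rightarrow> expansion) set"
  where "gen V \<phi> \<equiv> secs (generated_sheaf X Ox V Xi \<phi>)"

lemma gen_eq: "gen V \<phi> W = \<Inter>{S W | S. subsheaf_on X Ox V Xi S \<and> \<phi> \<in> S V}"
  by (simp add: generated_sheaf_def)

lemma subsheaf_on_iff: "subsheaf_on X Ox V Xi S \<longleftrightarrow> (\<forall>W. openin X W \<and> W \<subseteq> V \<longrightarrow>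
    S W \<subseteq> xsec W \<and> (\<lambda>x. 0) \<in> S W \<and> (\<forall>s\<in>S W. \<forall>t\<in>S W. (\<lambda>x. s x + t x) \<in> S W) \<and>
    (\<forall>z. \<forall>s\<in>S W. (\<lambda>x. act z (s x)) \<in> S W) \<and>
    (\<forall>g\<in>ob W. \<forall>s\<in>S W. (\<lambda>x. act (ahat_b (g x)) (s x)) \<in> S W) \<and>
    (\<forall>W' s. openin X W' \<and> W' \<subseteq> W \<and> s \<in> S W \<longrightarrow> restr W' s \<in> S W') \<and>
    (\<forall>s\<in>xsec W. (\<forall>x\<in>W. \<exists>W'. openin X W' \<and> x \<in> W' \<and> W' \<subseteq> W \<and> restr W' s \<in> S W') \<longrightarrow> s \<in> S W))"
proof -
  have "s + t = (\<lambda>x. s x + t x)" "(0 :: 'x \<Rightarrow> expansion) = (\<lambda>x. 0)" for s t :: "'x \<Rightarrow> expansion"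
    by (rule plus_fun_def zero_fun_def)+
  then show ?thesis
    by (simp add: subsheaf_on_def submodule_of_def)
qed

lemma subsheaf_onD:
  assumes "subsheaf_on X Ox V Xi S" "openin X W" "W \<subseteq> V"
  shows "s \<in> S W \<Longrightarrow> s \<in> xsec W" "(\<lambda>x. 0) \<in> S W"
    "s \<in> S W \<Longrightarrow> t \<in> S W \<Longrightarrow> (\<lambda>x. s x + t x) \<in> S W"
    "s \<in> S W \<Longrightarrow> (\<lambda>x. act z (s x)) \<in> S W"
    "g \<in> ob W \<Longrightarrow> s \<in> S W \<Longrightarrow> (\<lambda>x. act (ahat_b (g x)) (s x)) \<in> S W"
    "openin X W' \<Longrightarrow> W' \<subseteq> W \<Longrightarrow> s \<in> S W \<Longrightarrow> restr W' s \<in> S W'"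
    "s \<in> xsec W \<Longrightarrow> (\<And>x. x \<in> W \<Longrightarrow> \<exists>W'. openin X W' \<and> x \<in> W' \<and> W' \<subseteq> W \<and> restr W' s \<in> S W') \<Longrightarrow> s \<in> S W"
  using assms(1)[unfolded subsheaf_on_iff, rule_format, OF conjI[OF assms(2,3)]] by auto

text \<open>The family over which the intersection defining the generated sheaf is taken is nonempty.\<close>
lemma subsheaf_on_xsec: "subsheaf_on X Ox V Xi xsec"
  unfolding subsheaf_on_iff
  by (auto intro: xsec_zero xsec_add xsec_act xsec_ob_act xsec_restr)

lemma subsheaf_on_gen:
  assumes \<phi>: "\<phi> \<in> xsec V"
  shows "subsheaf_on X Ox V Xi (gen V \<phi>)"
  unfolding subsheaf_on_iff
proof (intro allI impI, elim conjE)
  fix W assume W: "openin X W" "W \<subseteq> V"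
  define \<S> where "\<S> = {S. subsheaf_on X Ox V Xi S \<and> \<phi> \<in> S V}"
  have gen: "gen V \<phi> W = (\<Inter>S\<in>\<S>. S W)" for W
    by (auto simp: gen_eq \<S>_def)
  have ne: "xsec \<in> \<S>" using subsheaf_on_xsec \<phi> by (simp add: \<S>_def)
  have D: "S \<in> \<S> \<Longrightarrow> subsheaf_on X Ox V Xi S" for S by (simp add: \<S>_def)
  show "gen V \<phi> W \<subseteq> xsec W \<and> (\<lambda>x. 0) \<in> gen V \<phi> W \<and> (\<forall>s\<in>gen V \<phi> W. \<forall>t\<in>gen V \<phi> W. (\<lambda>x. s x + t x) \<in> gen V \<phi> W) \<and>
    (\<forall>z. \<forall>s\<in>gen V \<phi> W. (\<lambda>x. act z (s x)) \<in> gen V \<phi> W) \<and>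
    (\<forall>g\<in>ob W. \<forall>s\<in>gen V \<phi> W. (\<lambda>x. act (ahat_b (g x)) (s x)) \<in> gen V \<phi> W) \<and>
    (\<forall>W' s. openin X W' \<and> W' \<subseteq> W \<and> s \<in> gen V \<phi> W \<longrightarrow> restr W' s \<in> gen V \<phi> W') \<and>
    (\<forall>s\<in>xsec W. (\<forall>x\<in>W. \<exists>W'. openin X W' \<and> x \<in> W' \<and> W' \<subseteq> W \<and> restr W' s \<in> gen V \<phi> W') \<longrightarrow> s \<in> gen V \<phi> W)"
    unfolding gen
  proof (intro conjI ballI allI impI)
    show "(\<Inter>S\<in>\<S>. S W) \<subseteq> xsec W" using ne by (rule INF_lower)
    show "(\<lambda>x. 0) \<in> (\<Inter>S\<in>\<S>. S W)"
      by (intro INT_I subsheaf_onD(2)[OF D W])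
    fix s assume s: "s \<in> (\<Inter>S\<in>\<S>. S W)"
    show "(\<lambda>x. s x + t x) \<in> (\<Inter>S\<in>\<S>. S W)" if "t \<in> (\<Inter>S\<in>\<S>. S W)" for t
      by (intro INT_I subsheaf_onD(3)[OF D W]) (use s that in simp_all)
    show "(\<lambda>x. act z (s x)) \<in> (\<Inter>S\<in>\<S>. S W)" for z
      by (intro INT_I subsheaf_onD(4)[OF D W]) (use s in simp_all)
    show "(\<lambda>x. act (ahat_b (g x)) (s x)) \<in> (\<Inter>S\<in>\<S>. S W)" if "g \<in> ob W" for g
      by (intro INT_I subsheaf_onD(5)[OF D W]) (use s that in simp_all)
  next
    fix W' s assume s: "openin X W' \<and> W' \<subseteq> W \<and> s \<in> (\<Inter>S\<in>\<S>. S W)"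
    show "restr W' s \<in> (\<Inter>S\<in>\<S>. S W')"
    proof (rule INT_I)
      fix S assume S: "S \<in> \<S>"
      show "restr W' s \<in> S W'"
        by (rule subsheaf_onD(6)[OF D[OF S] W]) (use s S in auto)
    qed
  next
    fix s assume s: "s \<in> xsec W" and loc: "\<forall>x\<in>W. \<exists>W'. openin X W' \<and> x \<in> W' \<and> W' \<subseteq> W \<and> restr W' s \<in> (\<Inter>S\<in>\<S>. S W')"
    show "s \<in> (\<Inter>S\<in>\<S>. S W)"
    proof (rule INT_I)
      fix S assume S: "S \<in> \<S>"
      have "\<exists>W'. openin X W' \<and> x \<in> W' \<and> W' \<subseteq> W \<and> restr W' s \<in> S W'" if "x \<in> W" for x
        using bspec[OF loc that] S by (elim exE) (rule_tac x = W' in exI, auto)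
      then show "s \<in> S W"
        by (rule subsheaf_onD(7)[OF D[OF S] W s])
    qed
  qed
qed

lemma section_in_gen: "\<phi> \<in> gen V \<phi> V"
  by (auto simp: gen_eq)

lemma gen_least: "subsheaf_on X Ox V Xi S \<Longrightarrow> \<phi> \<in> S V \<Longrightarrow> gen V \<phi> W \<subseteq> S W"
  by (auto simp: gen_eq)

text \<open>Combinations of the powers \<open>a^j \<phi>\<close> with coefficients in $\mathcal{O}_X[[b]]$, extended by zero off the
domain of the coefficients.\<close>
definition comb :: "('x \<Rightarrow> expansion) \<Rightarrow> nat \<Rightarrow> (nat \<Rightarrow> 'x \<Rightarrow> complex fps) \<Rightarrow> 'x \<Rightarrow> expansion"
  where "comb \<phi> k g = (\<lambda>x. \<Sum>j<k. act (ahat_b (g j x)) (act (a_elt ^ j) (\<phi> x)))"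

lemma comb_in_subsheaf:
  assumes S: "subsheaf_on X Ox V Xi S" and \<phi>: "\<phi> \<in> S V" and V: "openin X V" and W: "openin X W" "W \<subseteq> V"
    and g: "\<And>j. j < k \<Longrightarrow> g j \<in> ob W"
  shows "comb \<phi> k g \<in> S W"
  using g
proof (induction k)
  case 0
  show "comb \<phi> 0 g \<in> S W" using subsheaf_onD(2)[OF S W] by (simp add: comb_def)
next
  case (Suc k)
  have "restr W (\<lambda>x. act (a_elt ^ k) (\<phi> x)) \<in> S W"
    using \<phi> by (intro subsheaf_onD(6)[OF S V order.refl W] subsheaf_onD(4)[OF S V order.refl])
  then have "(\<lambda>x. act (ahat_b (g k x)) (restr W (\<lambda>x. act (a_elt ^ k) (\<phi> x)) x)) \<in> S W"
    using Suc.prems by (intro subsheaf_onD(5)[OF S W]) auto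
  also have "(\<lambda>x. act (ahat_b (g k x)) (restr W (\<lambda>x. act (a_elt ^ k) (\<phi> x)) x)) =
      (\<lambda>x. act (ahat_b (g k x)) (act (a_elt ^ k) (\<phi> x)))"
    using ob_outside[OF W(1) Suc.prems[of k]]
    by (auto simp: restr_def ahat_b_0 xi_act_zero_left)
  finally have "(\<lambda>x. comb \<phi> k g x + act (ahat_b (g k x)) (act (a_elt ^ k) (\<phi> x))) \<in> S W"
    using Suc by (intro subsheaf_onD(3)[OF S W]) auto
  then show "comb \<phi> (Suc k) g \<in> S W" by (simp add: comb_def)
qed

lemma comb_eq_sum:
  assumes W: "openin X W" and g: "\<And>j. j < k \<Longrightarrow> g j \<in> ob W"
  shows "(\<Sum>j<k. ob_act Xi W (g j) (rest Xi V W (a_elt ^ j \<odot>\<^bsub>sect Xi V\<^esub> \<phi>))) = comb \<phi> k g"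
proof
  fix x
  have "act (ahat_b (g j x)) (restr W (\<lambda>x. act (a_elt ^ j) (\<phi> x)) x) = act (ahat_b (g j x)) (act (a_elt ^ j) (\<phi> x))"
    if "j < k" for j
    using ob_outside[OF W g[OF that], of x] by (auto simp: restr_def ahat_b_0 xi_act_zero_left)
  then show "(\<Sum>j<k. ob_act Xi W (g j) (rest Xi V W (a_elt ^ j \<odot>\<^bsub>sect Xi V\<^esub> \<phi>))) x = comb \<phi> k g x"
    unfolding sum_fun_apply[where j = x] comb_def by (intro sum.cong) auto
qed

abbreviation fib :: "'x set \<Rightarrow> ('x \<Rightarrow> expansion) \<Rightarrow> 'x \<Rightarrow> expansion set"
  where "fib V \<phi> x \<equiv> value_at X V (generated_sheaf X Ox V Xi \<phi>) x"

lemma fib_iff: "v \<in> fib V \<phi> x \<longleftrightarrow> (\<exists>s W. v = s x \<and> openin X W \<and> x \<in> W \<and> W \<subseteq> V \<and> s \<in> gen V \<phi> W)"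
  by (auto simp: value_at_def)

lemma admissible_iff: "admissible X Ox lam N m k V \<phi> \<longleftrightarrow> \<phi> \<in> xsec V \<and>
      (\<forall>W. openin X W \<and> W \<subseteq> V \<longrightarrow> (\<forall>s\<in>gen V \<phi> W.
         \<exists>!g. (\<forall>j<k. g j \<in> ob W) \<and> (\<forall>j\<ge>k. g j = 0) \<and> s = comb \<phi> k g)) \<and>
      (\<forall>x\<in>V. fresco ((xi_module lam N m)\<lparr>carrier := fib V \<phi> x\<rparr>) k)"
proof -
  have "(\<exists>!g. (\<forall>j<k. g j \<in> ob W) \<and> (\<forall>j\<ge>k. g j = 0) \<and>
      s = (\<Sum>j<k. ob_act Xi W (g j) (rest Xi V W (a_elt ^ j \<odot>\<^bsub>sect Xi V\<^esub> \<phi>)))) \<longleftrightarrow>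
     (\<exists>!g. (\<forall>j<k. g j \<in> ob W) \<and> (\<forall>j\<ge>k. g j = 0) \<and> s = comb \<phi> k g)" if "openin X W" for W s
    by (rule arg_cong[where f = Ex1], rule ext, intro conj_cong refl, subst comb_eq_sum[OF that]) auto
  then show ?thesis
    unfolding admissible_def Let_def
    by (intro conj_cong refl iff_allI imp_cong ball_cong) simp_all
qed

end

section \<open>Sections spanning a family of frescos\<close>

lemma (in ahat_module) spanning_b_basis:
  assumes u: "b_basis k u" and w: "\<And>j. j < k \<Longrightarrow> w j \<in> carrier M"
    and span: "\<And>e. e \<in> carrier M \<Longrightarrow> \<exists>S. e = b_lin w k S"
  shows "b_basis k w"
proof (rule adic_basis_imp_b_basis)
  have lc: "b_lin w k S \<in> carrier M" for S
    by (rule b_lin_closed) (rule w)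
  note adic = b_basis_imp_adic_basis[OF u, unfolded adic_basis_def]
  show "adic_basis b_elt k w"
    unfolding adic_basis_def
  proof (intro conjI)
    show "\<forall>i<k. w i \<in> carrier M" using w by blast
    show "\<forall>e\<in>carrier M. b_elt \<odot> e = \<zero> \<longrightarrow> e = \<zero>"
      by (rule conjunct1[OF conjunct2[OF adic]])
    show "\<forall>e\<in>carrier M. (\<forall>d. \<exists>f\<in>carrier M. e = b_elt ^ d \<odot> f) \<longrightarrow> e = \<zero>"
      by (rule conjunct1[OF conjunct2[OF conjunct2[OF adic]]])
    show "\<forall>e\<in>carrier M. \<exists>c. \<exists>f\<in>carrier M. e = b_lin w k (\<lambda>i. fps_const (c i)) \<oplus> b_elt \<odot> f"
    proof
      fix e assume "e \<in> carrier M"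
      then obtain S where S: "e = b_lin w k S" using span by blast
      have "e = b_lin w k (\<lambda>i. fps_const (fps_nth (S i) 0)) \<oplus> b_elt \<odot> b_lin w k (\<lambda>i. fps_shift 1 (S i))"
        unfolding S by (rule b_lin_split) (rule w)
      then show "\<exists>c. \<exists>f\<in>carrier M. e = b_lin w k (\<lambda>i. fps_const (c i)) \<oplus> b_elt \<odot> f"
        by (intro exI[of _ "\<lambda>i. fps_nth (S i) 0"] bexI[OF _ lc])
    qed
    show "\<forall>c. \<forall>f\<in>carrier M. b_lin w k (\<lambda>i. fps_const (c i)) \<oplus> b_elt \<odot> f = \<zero> \<longrightarrow> (\<forall>i<k. c i = 0)"
    proof (intro allI ballI impI)
      fix c f i assume f: "f \<in> carrier M" "b_lin w k (\<lambda>i. fps_const (c i)) \<oplus> b_elt \<odot> f = \<zero>" and i: "i < k"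
      have "b_lin w k (\<lambda>i. fps_const (c i)) = \<ominus> (b_elt \<odot> f)"
        using minus_equality[OF f(2)] f(1) lc by simp
      then have "b_lin w k (\<lambda>i. fps_const (c i)) = b_elt \<odot> (\<ominus> f)"
        using f(1) by (simp add: smult_r_minus)
      from spanning_independent[OF u w span this _ i] show "c i = 0"
        using f(1) by simp
    qed
  qed
qed

lemma diff_eq_uminusI: "x = s + y \<Longrightarrow> z = s - x \<Longrightarrow> z = - (y :: 'a::ab_group_add)"
  by simp

lemma left_module_fresco: "fresco M k \<Longrightarrow> left_module M"
  by (simp add: fresco_def geometric_def regular_def)

lemma xi_module_simps [simp]:
  "add (xi_module lam N m) = (+)" "zero (xi_module lam N m) = 0" "z \<odot>\<^bsub>xi_module lam N m\<^esub> s = xi_act lam z s"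
  by (simp_all add: xi_module_def)

text \<open>Admissibility without uniqueness of the coefficients, which is recovered in \<open>admissible\<close>. The
property in this form is easier to establish for the transported section.\<close>
locale spanned_section = expansion_family \<theta> lam N m X Ox
  for \<theta> :: "complex fps" and lam :: complex and N m :: nat
    and X :: "'x topology" and Ox :: "'x set \<Rightarrow> ('x \<Rightarrow> complex) set" +
  fixes k :: nat and V :: "'x set" and \<phi> :: "'x \<Rightarrow> expansion"
  assumes V: "openin X V" and \<phi>: "\<phi> \<in> xsec V"
    and span: "\<And>W s. openin X W \<Longrightarrow> W \<subseteq> V \<Longrightarrow> s \<in> gen V \<phi> W \<Longrightarrow>
      \<exists>g. (\<forall>j<k. g j \<in> ob W) \<and> s = comb \<phi> k g"
    and fresco: "\<And>x. x \<in> V \<Longrightarrow> fresco ((xi_module lam N m)\<lparr>carrier := fib V \<phi> x\<rparr>) k"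
begin

abbreviation G :: "'x set \<Rightarrow> ('x \<Rightarrow> expansion) set"
  where "G \<equiv> gen V \<phi>"

abbreviation fibM :: "'x \<Rightarrow> (ahat, expansion) module"
  where "fibM x \<equiv> (xi_module lam N m)\<lparr>carrier := fib V \<phi> x\<rparr>"

lemma subsheaf_G: "subsheaf_on X Ox V Xi G"
  by (rule subsheaf_on_gen[OF \<phi>])

lemma comb_G: "openin X W \<Longrightarrow> W \<subseteq> V \<Longrightarrow> (\<And>j. j < k' \<Longrightarrow> g j \<in> ob W) \<Longrightarrow> comb \<phi> k' g \<in> G W"
  by (rule comb_in_subsheaf[OF subsheaf_G section_in_gen V])

text \<open>A germ of a section is a combination of the powers of \<open>a\<close>, and conversely constants give sections with
prescribed values.\<close>
lemma fib_mem:
  assumes x: "x \<in> V"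
  shows "v \<in> fib V \<phi> x \<longleftrightarrow> (\<exists>S. v = (\<Sum>j<k. act (ahat_b (S j)) (act (a_elt ^ j) (\<phi> x))))"
proof
  assume "v \<in> fib V \<phi> x"
  then obtain s W where s: "v = s x" "openin X W" "W \<subseteq> V" "s \<in> G W"
    unfolding fib_iff by (elim exE conjE)
  then obtain g where "s = comb \<phi> k g" using span by blast
  then have "v = (\<Sum>j<k. act (ahat_b (g j x)) (act (a_elt ^ j) (\<phi> x)))"
    using s(1) by (simp add: comb_def)
  then show "\<exists>S. v = (\<Sum>j<k. act (ahat_b (S j)) (act (a_elt ^ j) (\<phi> x)))"
    by (intro exI[of _ "\<lambda>j. g j x"])
next
  assume "\<exists>S. v = (\<Sum>j<k. act (ahat_b (S j)) (act (a_elt ^ j) (\<phi> x)))"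
  then obtain S where S: "v = (\<Sum>j<k. act (ahat_b (S j)) (act (a_elt ^ j) (\<phi> x)))" by blast
  have "comb \<phi> k (\<lambda>j. restr V (\<lambda>_. S j)) \<in> G V"
    using V by (intro comb_G ob_const) auto
  moreover have "v = comb \<phi> k (\<lambda>j. restr V (\<lambda>_. S j)) x"
    unfolding S comb_def using x by (simp add: restr_def)
  ultimately show "v \<in> fib V \<phi> x"
    unfolding fib_iff using V x by (intro exI conjI) auto
qed

lemma ahat_module_fib: "x \<in> V \<Longrightarrow> ahat_module (fibM x)"
  by unfold_locales (rule left_module_fresco[OF fresco])

lemma fibM_simps [simp]:
  "carrier (fibM x) = fib V \<phi> x" "add (fibM x) = (+)" "zero (fibM x) = 0" "z \<odot>\<^bsub>fibM x\<^esub> s = act z s"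
  by simp_all

lemma fib_act: "x \<in> V \<Longrightarrow> v \<in> fib V \<phi> x \<Longrightarrow> act z v \<in> fib V \<phi> x"
  using ahat_module.smult_closed[OF ahat_module_fib, of x v z] by simp

lemma fib_add: "x \<in> V \<Longrightarrow> v \<in> fib V \<phi> x \<Longrightarrow> w \<in> fib V \<phi> x \<Longrightarrow> v + w \<in> fib V \<phi> x"
proof -
  assume x: "x \<in> V" and v: "v \<in> fib V \<phi> x" "w \<in> fib V \<phi> x"
  interpret F: ahat_module "fibM x" by (rule ahat_module_fib[OF x])
  show ?thesis using F.a_closed[of v w] v by simp
qed

lemma section_in_fib: "x \<in> V \<Longrightarrow> \<phi> x \<in> fib V \<phi> x"
  unfolding fib_iff using V section_in_gen by blast

lemma power_section_in_fib: "x \<in> V \<Longrightarrow> act z (\<phi> x) \<in> fib V \<phi> x"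
  by (rule fib_act[OF _ section_in_fib])

lemma finsum_fib:
  assumes x: "x \<in> V" and "finite A" "\<And>i. i \<in> A \<Longrightarrow> f i \<in> fib V \<phi> x"
  shows "finsum (fibM x) f A = (\<Sum>i\<in>A. f i)"
proof -
  interpret F: ahat_module "fibM x" by (rule ahat_module_fib[OF x])
  show ?thesis
    using assms(2,3)
  proof (induction A)
    case (insert i A)
    then have "finsum (fibM x) f (insert i A) = f i \<oplus>\<^bsub>fibM x\<^esub> finsum (fibM x) f A"
      by (intro F.finsum_insert) auto
    then show "finsum (fibM x) f (insert i A) = (\<Sum>i\<in>insert i A. f i)" using insert by simp
  next
    case empty
    show "finsum (fibM x) f {} = (\<Sum>i\<in>{}. f i)" by simp
  qed
qed

lemma b_lin_fib:
  assumes x: "x \<in> V" and w: "\<And>j. j < n \<Longrightarrow> w j \<in> fib V \<phi> x"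
  shows "ahat_module.b_lin (fibM x) w n S = (\<Sum>j<n. act (ahat_b (S j)) (w j))"
proof -
  interpret F: ahat_module "fibM x" by (rule ahat_module_fib[OF x])
  show ?thesis
    unfolding F.b_lin_def fibM_simps(4) using w by (intro finsum_fib[OF x] fib_act[OF x]) auto
qed

lemma fib_basis:
  assumes x: "x \<in> V"
  shows "ahat_module.b_basis (fibM x) k (\<lambda>j. act (a_elt ^ j) (\<phi> x))"
proof -
  interpret F: ahat_module "fibM x" by (rule ahat_module_fib[OF x])
  obtain u where u: "F.b_basis k u"
    using fresco[OF x] by (auto simp: fresco_def F.free_b_rank_iff)
  show ?thesis
  proof (rule F.spanning_b_basis[OF u])
    show "\<exists>S. v = F.b_lin (\<lambda>j. act (a_elt ^ j) (\<phi> x)) k S" if v: "v \<in> carrier (fibM x)" for v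
    proof -
      obtain S where "v = (\<Sum>j<k. act (ahat_b (S j)) (act (a_elt ^ j) (\<phi> x)))"
        using v fib_mem[OF x, of v] by auto
      then show ?thesis
        by (intro exI[of _ S]) (simp only: b_lin_fib[OF x power_section_in_fib[OF x]])
    qed
  qed (simp add: power_section_in_fib[OF x])
qed

text \<open>The fibre is free of rank \<open>k\<close> and generated by \<open>k\<close> elements, so these form a basis.\<close>
lemma fib_unique:
  assumes x: "x \<in> V"
    and eq: "(\<Sum>j<k. act (ahat_b (S j)) (act (a_elt ^ j) (\<phi> x))) = (\<Sum>j<k. act (ahat_b (T j)) (act (a_elt ^ j) (\<phi> x)))"
    and j: "j < k"
  shows "S j = T j"
proof -
  interpret F: ahat_module "fibM x" by (rule ahat_module_fib[OF x])
  show ?thesis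
    by (rule F.b_basis_inject[OF fib_basis[OF x] _ j])
       (simp only: b_lin_fib[OF x power_section_in_fib[OF x]] eq)
qed

lemma admissible: "admissible X Ox lam N m k V \<phi>"
  unfolding admissible_iff
proof (intro conjI allI impI ballI)
  fix W s assume W: "openin X W \<and> W \<subseteq> V" and s: "s \<in> G W"
  obtain g where g: "\<And>j. j < k \<Longrightarrow> g j \<in> ob W" "s = comb \<phi> k g" using span[of W s] W s by blast
  define g' where "g' = (\<lambda>j. if j < k then g j else 0)"
  show "\<exists>!g. (\<forall>j<k. g j \<in> ob W) \<and> (\<forall>j\<ge>k. g j = 0) \<and> s = comb \<phi> k g"
  proof (intro ex1I[of _ g'] conjI)
    show "\<forall>j<k. g' j \<in> ob W" "\<forall>j\<ge>k. g' j = 0" using g by (auto simp: g'_def)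
    show sg': "s = comb \<phi> k g'" unfolding g(2) comb_def by (intro ext sum.cong) (auto simp: g'_def)
    fix h assume h: "(\<forall>j<k. h j \<in> ob W) \<and> (\<forall>j\<ge>k. h j = 0) \<and> s = comb \<phi> k h"
    show "h = g'"
    proof (intro ext)
      fix j x
      show "h j x = g' j x"
      proof (cases "j < k \<and> x \<in> W")
        case True
        have "comb \<phi> k h x = comb \<phi> k g' x" using h sg' by simp
        then show ?thesis using True W unfolding comb_def by (intro fib_unique[of x]) auto
      next
        case False
        then show ?thesis using h g ob_outside[of W "h j" x] ob_outside[of W "g j" x] W by (auto simp: g'_def)
      qed
    qed
  qed
qed (use \<phi> fresco in auto)

subsection \<open>Nilpotency of a modulo b\<close>

text \<open>Nilpotency of \<open>a\<close> on the quotient of a fibre by \<open>b\<close>. Modulo \<open>b\<close> the relation says that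
\<open>P(a) \<phi>(x) = 0\<close> for the polynomial \<open>P = \<Sum>_j S_j(0) a^j - a^k\<close>. If its lowest term had degree
\<open>i < k\<close>, then \<open>P\<close> would be \<open>a^i\<close> times a unit of \<open>\<complex>[[a]]\<close>, and \<open>a^i \<phi>(x)\<close> would be divisible by
\<open>b\<close> although it belongs to a basis.\<close>
lemma fib_coeff_zero:
  assumes x: "x \<in> V" and eq: "act (a_elt ^ k) (\<phi> x) = (\<Sum>j<k. act (ahat_b (S j)) (act (a_elt ^ j) (\<phi> x)))"
    and j: "j < k"
  shows "fps_nth (S j) 0 = 0"
proof (rule ccontr)
  assume nz: "fps_nth (S j) 0 \<noteq> 0"
  interpret F: ahat_module "fibM x" by (rule ahat_module_fib[OF x])
  define w where "w j = act (a_elt ^ j) (\<phi> x)" for j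
  define i where "i = (LEAST j. j < k \<and> fps_nth (S j) 0 \<noteq> 0)"
  have i: "i < k" "fps_nth (S i) 0 \<noteq> 0"
    using LeastI[of "\<lambda>j. j < k \<and> fps_nth (S j) 0 \<noteq> 0" j] j nz by (auto simp: i_def)
  have below: "fps_nth (S l) 0 = 0" if "l < i" for l
    using not_less_Least[of l "\<lambda>j. j < k \<and> fps_nth (S j) 0 \<noteq> 0"] that i(1) by (auto simp: i_def)
  define P where "P = (\<Sum>l<k. fps_const (fps_nth (S l) 0) * fps_X ^ l) - fps_X ^ k"
  have P_nth: "fps_nth P n = (if n < k then fps_nth (S n) 0 else if n = k then - 1 else 0)" for n
  proof -
    have "fps_nth (\<Sum>l<k. fps_const (fps_nth (S l) 0) * fps_X ^ l) n = (\<Sum>l<k. if l = n then fps_nth (S n) 0 else 0)"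
      unfolding fps_sum_nth by (intro sum.cong) auto
    then show ?thesis by (auto simp: P_def)
  qed
  \<comment> \<open>the unit u with P = u a^i\<close>
  define u where "u = fps_shift i P"
  have P: "P = u * fps_X ^ i"
    unfolding u_def using below i(1) by (intro fps_ext) (auto simp: fps_X_power_mult_right_nth P_nth)
  have "inverse u * u = 1"
    using i by (intro inverse_mult_eq_1) (simp add: u_def P_nth)
  then have Xi_eq: "fps_X ^ i = inverse u * P"
    unfolding P by (simp flip: mult.assoc)
  define f where "f = (\<Sum>l<k. act (ahat_b (fps_shift 1 (S l))) (w l))"
  have f: "f \<in> fib V \<phi> x" using fib_mem[OF x] by (auto simp: f_def w_def)
  have "act (ahat_b (S l)) (w l) = act (scalar (fps_nth (S l) 0)) (w l) + act b_elt (act (ahat_b (fps_shift 1 (S l))) (w l))" for l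
    by (subst ahat_b_split) (simp add: xi_act_add_left xi_act_mult)
  then have "w k = (\<Sum>l<k. act (scalar (fps_nth (S l) 0)) (w l)) + act b_elt f"
    using eq by (simp add: w_def f_def sum.distrib xi_act_sum_right)
  moreover have "act (ahat_a P) (\<phi> x) = (\<Sum>l<k. act (scalar (fps_nth (S l) 0)) (w l)) - w k"
  proof -
    have "act (ahat_a (\<Sum>l<k. fps_const (fps_nth (S l) 0) * fps_X ^ l)) (\<phi> x) = (\<Sum>l<k. act (scalar (fps_nth (S l) 0)) (w l))"
      by (simp add: ahat_a_sum xi_act_sum_left w_def ahat_a_power ahat_a_simps xi_act_mult)
    moreover have "act (ahat_a (\<Sum>l<k. fps_const (fps_nth (S l) 0) * fps_X ^ l)) (\<phi> x) = act (ahat_a P) (\<phi> x) + w k"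
      unfolding w_def ahat_a_power xi_act_add_left[symmetric] ahat_a_simps(3)[symmetric] by (simp add: P_def)
    ultimately show ?thesis by (metis add_diff_cancel_right')
  qed
  ultimately have "act (ahat_a P) (\<phi> x) = - act b_elt f"
    by (rule diff_eq_uminusI)
  also have "\<dots> = act b_elt (- f)"
    using xi_act_diff_right[of lam b_elt 0 f] by (simp add: xi_act_zero_right)
  finally have "w i = act (ahat_a (inverse u)) (act b_elt (- f))"
    by (simp add: w_def ahat_a_power Xi_eq ahat_a_simps xi_act_mult)
  also have "\<dots> = act b_elt (act (ahat_a (inverse u) + ahat_deriv (ahat_a (inverse u)) * b_elt) (- f))"
    by (simp only: xi_act_mult[symmetric] mult_b_eq[of "ahat_a (inverse u)"])
  finally have wi: "w i = act b_elt (act (ahat_a (inverse u) + ahat_deriv (ahat_a (inverse u)) * b_elt) (- f))" .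
  have "- f = act (scalar (- 1)) f"
    unfolding xi_act_scalar by (intro ext) (simp flip: fps_const_neg)
  then have f': "act (ahat_a (inverse u) + ahat_deriv (ahat_a (inverse u)) * b_elt) (- f) \<in> fib V \<phi> x"
    using f by (simp add: fib_act[OF x])
  then obtain T where T: "act (ahat_a (inverse u) + ahat_deriv (ahat_a (inverse u)) * b_elt) (- f) = (\<Sum>l<k. act (ahat_b (T l)) (w l))"
    using fib_mem[OF x] unfolding w_def by auto
  have "(\<Sum>l<k. act (ahat_b (if l = i then 1 else 0)) (w l)) = (\<Sum>l<k. act (ahat_b (fps_X * T l)) (w l))"
  proof -
    have "(\<Sum>l<k. act (ahat_b (if l = i then 1 else 0)) (w l)) = (\<Sum>l<k. if l = i then w i else 0)"
      using ahat_b_const[of 1]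
      by (intro sum.cong refl) (auto simp: ahat_b_0 xi_act_zero_left ahat_a_simps xi_act_one)
    also have "\<dots> = w i" using i by simp
    also have "\<dots> = (\<Sum>l<k. act (ahat_b (fps_X * T l)) (w l))"
      by (simp only: wi T xi_act_sum_right ahat_b_mult xi_act_mult)
    finally show ?thesis .
  qed
  then have "1 = fps_X * T i"
    using fib_unique[OF x _ i(1), of "\<lambda>l. if l = i then 1 else 0" "\<lambda>l. fps_X * T l"] by (simp add: w_def)
  then have "fps_nth (1 :: complex fps) 0 = fps_nth (fps_X * T i) 0" by (rule arg_cong)
  then show False by simp
qed

text \<open>The coefficients of \<open>a^k \<phi>\<close> vanish at \<open>b = 0\<close> in every fibre, hence are divisible by \<open>b\<close>
in $\mathcal{O}_X[[b]]$.\<close>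
lemma power_k_section:
  assumes W: "openin X W" "W \<subseteq> V"
  shows "\<exists>y\<in>G W. \<forall>x\<in>W. act (a_elt ^ k) (\<phi> x) = act b_elt (y x)"
proof -
  have "restr W (\<lambda>x. act (a_elt ^ k) (\<phi> x)) \<in> G W"
    by (intro subsheaf_onD(6)[OF subsheaf_G V order.refl W] subsheaf_onD(4)[OF subsheaf_G V order.refl] section_in_gen)
  then obtain g where g: "\<And>j. j < k \<Longrightarrow> g j \<in> ob W" "restr W (\<lambda>x. act (a_elt ^ k) (\<phi> x)) = comb \<phi> k g"
    using span[OF W] by blast
  have eq: "act (a_elt ^ k) (\<phi> x) = (\<Sum>j<k. act (ahat_b (g j x)) (act (a_elt ^ j) (\<phi> x)))" if "x \<in> W" for x
    using fun_cong[OF g(2), of x] that by (simp add: restr_def comb_def)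
  have "act (a_elt ^ k) (\<phi> x) = act b_elt (comb \<phi> k (\<lambda>j x. fps_shift 1 (g j x)) x)" if x: "x \<in> W" for x
  proof -
    have "ahat_b (g j x) = b_elt * ahat_b (fps_shift 1 (g j x))" if "j < k" for j
    proof -
      have "fps_nth (g j x) 0 = 0"
        using x W by (intro fib_coeff_zero[OF _ eq that]) auto
      then show ?thesis using ahat_b_split[of "g j x"] by (simp add: scalar_simps ahat_a_simps)
    qed
    then show ?thesis
      unfolding eq[OF x] comb_def by (simp add: xi_act_mult xi_act_sum_right)
  qed
  moreover have "comb \<phi> k (\<lambda>j x. fps_shift 1 (g j x)) \<in> G W"
    using W g(1) by (intro comb_G ob_shift)
  ultimately show ?thesis by blast
qed

end

section \<open>Change of variable for a generated family\<close>

text \<open>A power of the variable is a power series in \<open>\<theta>\<close>, and \<open>\<theta>^k\<close> is divisible by the \<open>k\<close>-th power of the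
variable.\<close>
lemma (in variable_change) power_expansion:
  "\<exists>\<sigma> \<rho>. fps_X ^ l = (\<Sum>n<k. fps_const (\<sigma> n) * \<theta> ^ n) + \<rho> * fps_X ^ k"
proof -
  define \<tau> where "\<tau> = fps_inv \<theta> ^ l"
  have "\<tau> = (\<Sum>n<k. fps_const (fps_nth \<tau> n) * fps_X ^ n) + fps_shift k \<tau> * fps_X ^ k"
  proof (rule fps_ext)
    fix i
    have "fps_nth (\<Sum>n<k. fps_const (fps_nth \<tau> n) * fps_X ^ n) i = (\<Sum>n<k. if n = i then fps_nth \<tau> i else 0)"
      unfolding fps_sum_nth by (intro sum.cong) auto
    then show "fps_nth \<tau> i = fps_nth ((\<Sum>n<k. fps_const (fps_nth \<tau> n) * fps_X ^ n) + fps_shift k \<tau> * fps_X ^ k) i"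
      by (auto simp: fps_X_power_mult_right_nth)
  qed
  then have "fps_compose \<tau> \<theta> = fps_compose ((\<Sum>n<k. fps_const (fps_nth \<tau> n) * fps_X ^ n) + fps_shift k \<tau> * fps_X ^ k) \<theta>"
    by (rule arg_cong)
  also have "\<dots> = (\<Sum>n<k. fps_const (fps_nth \<tau> n) * \<theta> ^ n) + fps_compose (fps_shift k \<tau>) \<theta> * \<theta> ^ k"
    by (simp add: fps_compose_add_distrib fps_compose_sum_distrib fps_compose_mult_distrib[OF theta_nth_0]
        fps_X_power_compose[OF theta_nth_0])
  also have "\<theta> ^ k = fps_shift 1 \<theta> ^ k * fps_X ^ k"
  proof -
    have "\<theta> = fps_shift 1 \<theta> * fps_X"
      by (intro fps_ext) (auto simp: theta_nth_0)
    then show ?thesis by (metis power_mult_distrib)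
  qed
  also have "fps_compose \<tau> \<theta> = fps_X ^ l"
    using fps_inv[OF theta_nth_0 lead_nonzero] fps_compose_power[OF theta_nth_0, of "fps_inv \<theta>" l]
    by (simp add: \<tau>_def)
  finally have "fps_X ^ l = (\<Sum>n<k. fps_const (fps_nth \<tau> n) * \<theta> ^ n) +
      (fps_compose (fps_shift k \<tau>) \<theta> * fps_shift 1 \<theta> ^ k) * fps_X ^ k"
    by (simp only: mult.assoc)
  then show ?thesis by blast
qed

lemma xi_act_scalar_sum: "xi_act lam (scalar (\<Sum>l\<in>A. c l)) s = (\<Sum>l\<in>A. xi_act lam (scalar (c l)) s)"
  by (rule sum_additive[of "\<lambda>c. xi_act lam (scalar c) s"])
     (simp only: fps_const_add[symmetric] ahat_a_simps xi_act_add_left)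

lemma xi_act_scalar_scalar: "xi_act lam (scalar c) (xi_act lam (scalar d) s) = xi_act lam (scalar (c * d)) s"
  by (simp only: xi_act_mult[symmetric] scalar_mult)

lemma xi_act_scalar_commute: "xi_act lam (scalar c) (xi_act lam z s) = xi_act lam z (xi_act lam (scalar c) s)"
  unfolding xi_act_mult[symmetric] by (subst scalar_commute) (rule refl)

context spanned_section
begin

lemma G_sum:
  assumes W: "openin X W" "W \<subseteq> V" and f: "\<And>t. t \<in> T \<Longrightarrow> f t \<in> G W"
  shows "(\<lambda>x. \<Sum>t\<in>T. f t x) \<in> G W"
  using f
proof (induction T rule: infinite_finite_induct)
  case (infinite T)
  show "(\<lambda>x. \<Sum>t\<in>T. f t x) \<in> G W" using subsheaf_onD(2)[OF subsheaf_G W] infinite by simp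
next
  case empty
  show "(\<lambda>x. \<Sum>t\<in>{}. f t x) \<in> G W" using subsheaf_onD(2)[OF subsheaf_G W] by simp
next
  case (insert t T)
  then have "(\<lambda>x. f t x + (\<Sum>t\<in>T. f t x)) \<in> G W"
    by (intro subsheaf_onD(3)[OF subsheaf_G W]) auto
  then show "(\<lambda>x. \<Sum>t\<in>insert t T. f t x) \<in> G W" using insert by simp
qed

lemma G_scalar:
  assumes W: "openin X W" "W \<subseteq> V" and f: "f \<in> Ox W" and s: "s \<in> G W"
  shows "(\<lambda>x. act (scalar (f x)) (s x)) \<in> G W"
  using subsheaf_onD(5)[OF subsheaf_G W ob_fps_const[OF W(1) f] s] by (simp add: ahat_b_const)

text \<open>The images under \<open>Phi\<close> of the powers \<open>a^j \<psi>\<close> of the transported section.\<close>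
definition phi_theta :: "nat \<Rightarrow> 'x \<Rightarrow> expansion"
  where "phi_theta j x = act (ahat_a \<theta> ^ j) (\<phi> x)"

text \<open>One step of the \<open>\<beta>\<close>-adic division. Modulo \<open>b\<close>, the powers of \<open>a\<close> are combinations of the powers of
\<open>\<theta>(a)\<close> up to multiples of \<open>a^k\<close>, and \<open>a^k \<phi>\<close> is divisible by \<open>b\<close>; finally \<open>b\<close> is \<open>\<beta>\<close> times a unit.\<close>
lemma beta_expansion:
  assumes W: "openin X W" "W \<subseteq> V" and s: "s \<in> G W"
  shows "\<exists>f s'. (\<forall>j<k. f j \<in> Ox W) \<and> s' \<in> G W \<and>
    (\<forall>x. s x = (\<Sum>j<k. act (scalar (f j x)) (phi_theta j x)) + act beta (s' x))"
proof -
  obtain g where g: "\<And>j. j < k \<Longrightarrow> g j \<in> ob W" "s = comb \<phi> k g" using span[OF W s] by blast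
  obtain y where y: "y \<in> G W" "\<And>x. x \<in> W \<Longrightarrow> act (a_elt ^ k) (\<phi> x) = act b_elt (y x)"
    using power_k_section[OF W] by blast
  have "\<forall>l. \<exists>\<sigma> \<rho>. fps_X ^ l = (\<Sum>n<k. fps_const (\<sigma> n) * \<theta> ^ n) + \<rho> * fps_X ^ k"
    using power_expansion by blast
  then obtain \<sigma> \<rho> where \<sigma>: "\<And>l. fps_X ^ l = (\<Sum>n<k. fps_const (\<sigma> l n) * \<theta> ^ n) + \<rho> l * fps_X ^ k"
    by metis
  define f where "f n x = (\<Sum>l<k. fps_nth (g l x) 0 * \<sigma> l n)" for n x
  \<comment> \<open>moving b to the left past \<rho>(a) replaces it by r\<close>
  define r where "r l = ahat_a (\<rho> l) + ahat_deriv (ahat_a (\<rho> l)) * b_elt" for l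
  define z where "z x = (\<Sum>l<k. act (scalar (fps_nth (g l x) 0)) (act (r l) (y x))) + comb \<phi> k (\<lambda>l x. fps_shift 1 (g l x)) x" for x
  \<comment> \<open>\<beta> times the inverse of \<theta>'(a) is b, so that \<beta> s' = b z\<close>
  define s' where "s' x = act (ahat_a (inverse (fps_deriv \<theta>))) (z x)" for x
  have "f n \<in> Ox W" for n
  proof -
    have "(\<lambda>x. \<sigma> l n * fps_nth (g l x) 0) \<in> Ox W" if "l < k" for l
      using that by (intro Ox_cmult W obD g)
    then show ?thesis
      unfolding f_def by (intro Ox_sum W) (auto simp: mult.commute)
  qed
  moreover have zG: "(\<lambda>x. z x) \<in> G W"
    unfolding z_def
    by (intro subsheaf_onD(3)[OF subsheaf_G W] G_sum W G_scalar obD subsheaf_onD(4)[OF subsheaf_G W] y comb_G ob_shift g) auto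
  then have "s' \<in> G W"
    using subsheaf_onD(4)[OF subsheaf_G W zG] by (simp add: s'_def[abs_def])
  moreover have "s x = (\<Sum>j<k. act (scalar (f j x)) (phi_theta j x)) + act beta (s' x)" for x
  proof (cases "x \<in> W")
    case True
    have bs: "act beta (s' x) = act b_elt (z x)"
      by (simp only: s'_def xi_act_mult[symmetric] b_elt_eq_beta[symmetric])
    have 1: "act (a_elt ^ l) (\<phi> x) = (\<Sum>n<k. act (scalar (\<sigma> l n)) (phi_theta n x)) + act b_elt (act (r l) (y x))" for l
    proof -
      have "act (a_elt ^ l) (\<phi> x) = act (ahat_a ((\<Sum>n<k. fps_const (\<sigma> l n) * \<theta> ^ n) + \<rho> l * fps_X ^ k)) (\<phi> x)"
        by (simp only: ahat_a_power \<sigma>[symmetric])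
      also have "\<dots> = (\<Sum>n<k. act (scalar (\<sigma> l n)) (phi_theta n x)) + act (ahat_a (\<rho> l)) (act (a_elt ^ k) (\<phi> x))"
        by (simp only: ahat_a_simps ahat_a_sum xi_act_add_left xi_act_sum_left xi_act_mult phi_theta_def ahat_a_power)
      also have "act (ahat_a (\<rho> l)) (act (a_elt ^ k) (\<phi> x)) = act b_elt (act (r l) (y x))"
        by (simp only: y(2)[OF True] xi_act_mult[symmetric] mult_b_eq[of "ahat_a (\<rho> l)"] r_def)
      finally show ?thesis .
    qed
    have "s x = (\<Sum>l<k. act (scalar (fps_nth (g l x) 0)) (act (a_elt ^ l) (\<phi> x)) +
        act b_elt (act (ahat_b (fps_shift 1 (g l x))) (act (a_elt ^ l) (\<phi> x))))"
      unfolding g(2) comb_def by (subst ahat_b_split) (simp only: xi_act_add_left xi_act_mult)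
    also have "\<dots> = (\<Sum>l<k. act (scalar (fps_nth (g l x) 0)) (act (a_elt ^ l) (\<phi> x))) +
        act b_elt (comb \<phi> k (\<lambda>l x. fps_shift 1 (g l x)) x)"
      by (simp only: sum.distrib comb_def xi_act_sum_right)
    also have "(\<Sum>l<k. act (scalar (fps_nth (g l x) 0)) (act (a_elt ^ l) (\<phi> x))) =
        (\<Sum>l<k. \<Sum>n<k. act (scalar (fps_nth (g l x) 0 * \<sigma> l n)) (phi_theta n x)) +
        act b_elt (\<Sum>l<k. act (scalar (fps_nth (g l x) 0)) (act (r l) (y x)))"
      by (simp only: 1 xi_act_add_right xi_act_sum_right sum.distrib xi_act_scalar_scalar xi_act_scalar_commute[of _ _ b_elt])
    also have "(\<Sum>l<k. \<Sum>n<k. act (scalar (fps_nth (g l x) 0 * \<sigma> l n)) (phi_theta n x)) =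
        (\<Sum>n<k. act (scalar (f n x)) (phi_theta n x))"
      by (subst sum.swap) (simp only: f_def xi_act_scalar_sum)
    finally show ?thesis
      by (simp only: bs z_def xi_act_add_right add.assoc)
  next
    case False
    have "fps_nth (g l x) 0 = 0" if "l < k" for l using ob_outside[OF W(1) g(1)[OF that] False] by simp
    then have "f j x = 0" for j by (simp add: f_def)
    moreover have "s x = 0" "s' x = 0"
      using False xsec_outside[OF W(1)] subsheaf_onD(1)[OF subsheaf_G W] s \<open>s' \<in> G W\<close> by blast+
    ultimately show ?thesis by (simp add: ahat_a_simps xi_act_zero_left xi_act_zero_right)
  qed
  ultimately show ?thesis by (intro exI[of _ f] exI[of _ s']) auto
qed

text \<open>Stability of \<open>G\<close> under the twisted action $\sum_n h_n b^n \mapsto \sum_n h_n \beta^n$ of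
$\mathcal{O}_X[[b]]$. Writing \<open>\<beta>^n = b^n \<gamma>_n\<close>, the sections \<open>\<gamma>_n y\<close> have coefficients with respect
to the powers of \<open>a\<close>, and the sums of these multiplied by \<open>h_n b^n\<close> converge coefficientwise.\<close>
lemma G_Theta_ob:
  assumes W: "openin X W" "W \<subseteq> V" and y: "y \<in> G W" and h: "h \<in> ob W"
  shows "(\<lambda>x. act (Theta \<theta> (ahat_b (h x))) (y x)) \<in> G W"
proof -
  have "\<forall>n. \<exists>\<gamma>. beta ^ n = b_elt ^ n * \<gamma>" using beta_power_eq by blast
  then obtain \<gamma> where \<gamma>: "\<And>n. beta ^ n = b_elt ^ n * \<gamma> n" by metis
  have "\<forall>n. \<exists>g. (\<forall>j<k. g j \<in> ob W) \<and> (\<lambda>x. act (\<gamma> n) (y x)) = comb \<phi> k g"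
    using span[OF W] subsheaf_onD(4)[OF subsheaf_G W y] by blast
  then obtain g where g: "\<And>n j. j < k \<Longrightarrow> g n j \<in> ob W" "\<And>n. (\<lambda>x. act (\<gamma> n) (y x)) = comb \<phi> k (g n)"
    by metis
  \<comment> \<open>the coefficient of a^l \<phi> in \<Sum>n. h n b^n (\<gamma> n y)\<close>
  define H where "H l x = Abs_fps (\<lambda>d. \<Sum>n\<le>d. fps_nth (h x) n * fps_nth (g n l x) (d - n))" for l x
  have H: "H l \<in> ob W" if "l < k" for l
    unfolding H_def using that by (intro ob_Abs_fps Ox_sum W Ox_mult obD h g)
  have "act (Theta \<theta> (ahat_b (h x))) (y x) = comb \<phi> k H x" for x
  proof -
    define w where "w j = act (a_elt ^ j) (\<phi> x)" for j
    have "act (Theta \<theta> (ahat_b (h x))) (y x) - comb \<phi> k H x \<in> xi_ord d" for d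
    proof -
      have L: "act (Theta \<theta> (ahat_b (h x))) (y x) =
          (\<Sum>n<d. act (scalar (fps_nth (h x) n)) (act (b_elt ^ n) (act (\<gamma> n) (y x)))) +
          act (beta ^ d) (act (Theta \<theta> (ahat_b (fps_shift d (h x)))) (y x))"
        by (subst ahat_b_expand[of "h x" d])
           (simp only: Theta_simps additive_sum[of "Theta \<theta>", OF Theta_add[OF theta_nth_0]] Theta_scalar Theta_power
             Theta_b_elt xi_act_add_left xi_act_sum_left xi_act_mult[symmetric] \<gamma> mult.assoc)
      have "act (\<gamma> n) (y x) = (\<Sum>l<k. act (ahat_b (g n l x)) (w l))" for n
        using fun_cong[OF g(2)[of n], of x] by (simp add: comb_def w_def)
      then have "(\<Sum>n<d. act (scalar (fps_nth (h x) n)) (act (b_elt ^ n) (act (\<gamma> n) (y x)))) =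
          (\<Sum>n<d. \<Sum>l<k. act (ahat_b (fps_const (fps_nth (h x) n) * (fps_X ^ n * g n l x))) (w l))"
        by (simp only: xi_act_sum_right ahat_b_mult ahat_b_const ahat_b_X_power xi_act_mult)
      also have "\<dots> = (\<Sum>l<k. act (ahat_b (\<Sum>n<d. fps_const (fps_nth (h x) n) * (fps_X ^ n * g n l x))) (w l))"
      proof -
        have "ahat_b (\<Sum>n\<in>A. F n) = (\<Sum>n\<in>A. ahat_b (F n))" for A :: "nat set" and F
          by (rule sum_additive[of ahat_b]) (rule ahat_b_add)
        then show ?thesis by (subst sum.swap) (simp only: xi_act_sum_left)
      qed
      finally have L': "(\<Sum>n<d. act (scalar (fps_nth (h x) n)) (act (b_elt ^ n) (act (\<gamma> n) (y x)))) =
          (\<Sum>l<k. act (ahat_b (\<Sum>n<d. fps_const (fps_nth (h x) n) * (fps_X ^ n * g n l x))) (w l))" .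
      have "\<exists>R. H l x = (\<Sum>n<d. fps_const (fps_nth (h x) n) * (fps_X ^ n * g n l x)) + fps_X ^ d * R" for l
      proof -
        have "fps_nth (H l x) i = fps_nth (\<Sum>n<d. fps_const (fps_nth (h x) n) * (fps_X ^ n * g n l x)) i" if "i < d" for i
        proof -
          have "fps_nth (\<Sum>n<d. fps_const (fps_nth (h x) n) * (fps_X ^ n * g n l x)) i =
              (\<Sum>n<d. if n \<le> i then fps_nth (h x) n * fps_nth (g n l x) (i - n) else 0)"
            unfolding fps_sum_nth by (intro sum.cong) (auto simp: fps_X_power_mult_nth)
          also have "\<dots> = (\<Sum>n\<le>i. fps_nth (h x) n * fps_nth (g n l x) (i - n))"
            using that by (intro sum.mono_neutral_cong_right) auto
          finally show ?thesis by (simp add: H_def)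
        qed
        then have "H l x - (\<Sum>n<d. fps_const (fps_nth (h x) n) * (fps_X ^ n * g n l x)) =
            fps_X ^ d * fps_shift d (H l x - (\<Sum>n<d. fps_const (fps_nth (h x) n) * (fps_X ^ n * g n l x)))"
          by (intro fps_ext) (auto simp: fps_X_power_mult_nth)
        then have "H l x = (\<Sum>n<d. fps_const (fps_nth (h x) n) * (fps_X ^ n * g n l x)) +
            fps_X ^ d * fps_shift d (H l x - (\<Sum>n<d. fps_const (fps_nth (h x) n) * (fps_X ^ n * g n l x)))"
          by (simp only: diff_eq_eq add.commute)
        then show ?thesis by blast
      qed
      then obtain R where R: "\<And>l. H l x = (\<Sum>n<d. fps_const (fps_nth (h x) n) * (fps_X ^ n * g n l x)) + fps_X ^ d * R l"
        by metis
      have "comb \<phi> k H x = (\<Sum>l<k. act (ahat_b (\<Sum>n<d. fps_const (fps_nth (h x) n) * (fps_X ^ n * g n l x))) (w l)) +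
          act (b_elt ^ d) (\<Sum>l<k. act (ahat_b (R l)) (w l))"
        unfolding comb_def w_def[symmetric] R
        by (simp only: ahat_b_add ahat_b_mult ahat_b_X_power xi_act_add_left xi_act_mult sum.distrib xi_act_sum_right)
      then have "act (Theta \<theta> (ahat_b (h x))) (y x) - comb \<phi> k H x =
          act (beta ^ d) (act (Theta \<theta> (ahat_b (fps_shift d (h x)))) (y x)) - act (b_elt ^ d) (\<Sum>l<k. act (ahat_b (R l)) (w l))"
        unfolding L L' by (simp only: add_diff_cancel_left)
      also have "\<dots> \<in> xi_ord d"
        using act_beta_power_ord[of _ 0 d] act_b_power_ord[of _ 0 d] by (intro xi_ord_diff) simp_all
      finally show ?thesis .
    qed
    then have "act (Theta \<theta> (ahat_b (h x))) (y x) - comb \<phi> k H x = 0" by (rule xi_ord_separated)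
    then show ?thesis by (simp only: right_minus_eq)
  qed
  then have "(\<lambda>x. act (Theta \<theta> (ahat_b (h x))) (y x)) = comb \<phi> k H" by (rule ext)
  then show ?thesis using comb_G[OF W H] by simp
qed

definition \<psi> :: "'x \<Rightarrow> expansion"
  where "\<psi> x = Psi (\<phi> x)"

text \<open>The twist of \<open>G\<close> moved into \<open>\<Xi>\<close> by the inverse of \<open>Phi\<close>. It turns out to be the sheaf generated by
\<open>\<psi>\<close> (\<open>gen_psi\<close>).\<close>
definition P :: "'x set \<Rightarrow> ('x \<Rightarrow> expansion) set"
  where "P W = {s \<in> xsec W. (\<lambda>x. Phi (s x)) \<in> G W}"

lemma phi_carr: "\<phi> x \<in> carr"
  by (rule xsec_carr[OF \<phi>])

lemma Phi_psi: "Phi (\<psi> x) = \<phi> x"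
  by (simp add: \<psi>_def Phi_Psi phi_carr)

lemma psi_xsec: "\<psi> \<in> xsec V"
  unfolding \<psi>_def[abs_def] by (rule xsec_Psi[OF V \<phi>])

lemma psi_P: "\<psi> \<in> P V"
  using psi_xsec section_in_gen by (simp add: P_def Phi_psi)

lemma subsheaf_P: "subsheaf_on X Ox V Xi P"
  unfolding subsheaf_on_iff
proof (intro allI impI, elim conjE)
  fix W assume W: "openin X W" "W \<subseteq> V"
  note GD = subsheaf_onD[OF subsheaf_G W]
  have Phi_ob: "Phi (act (ahat_b S) s) = act (Theta \<theta> (ahat_b S)) (Phi s)" for S s
    by (rule Phi_ahat_b)
  show "P W \<subseteq> xsec W \<and> (\<lambda>x. 0) \<in> P W \<and> (\<forall>s\<in>P W. \<forall>t\<in>P W. (\<lambda>x. s x + t x) \<in> P W) \<and>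
    (\<forall>z. \<forall>s\<in>P W. (\<lambda>x. act z (s x)) \<in> P W) \<and>
    (\<forall>g\<in>ob W. \<forall>s\<in>P W. (\<lambda>x. act (ahat_b (g x)) (s x)) \<in> P W) \<and>
    (\<forall>W' s. openin X W' \<and> W' \<subseteq> W \<and> s \<in> P W \<longrightarrow> restr W' s \<in> P W') \<and>
    (\<forall>s\<in>xsec W. (\<forall>x\<in>W. \<exists>W'. openin X W' \<and> x \<in> W' \<and> W' \<subseteq> W \<and> restr W' s \<in> P W') \<longrightarrow> s \<in> P W)"
  proof (intro conjI ballI allI impI)
    show "P W \<subseteq> xsec W" by (auto simp: P_def)
    show "(\<lambda>x. 0) \<in> P W"
      using xsec_zero[OF W(1)] GD(2) by (simp add: P_def Phi_zero)
    fix s assume s: "s \<in> P W"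
    show "(\<lambda>x. s x + t x) \<in> P W" if "t \<in> P W" for t
      using s that xsec_add[OF W(1), of s t] GD(3)[of "\<lambda>x. Phi (s x)" "\<lambda>x. Phi (t x)"] by (simp add: P_def Phi_add)
    show "(\<lambda>x. act z (s x)) \<in> P W" for z
      using s xsec_act[OF W(1), of s z] GD(4)[of "\<lambda>x. Phi (s x)" "Theta \<theta> z"] xsec_carr[of s W] by (simp add: P_def Phi_act)
    show "(\<lambda>x. act (ahat_b (g x)) (s x)) \<in> P W" if "g \<in> ob W" for g
      using s that xsec_ob_act[OF W(1), of g s] G_Theta_ob[OF W, of "\<lambda>x. Phi (s x)" g] by (simp add: P_def Phi_ob)
  next
    fix W' s assume s: "openin X W' \<and> W' \<subseteq> W \<and> s \<in> P W"
    have "(\<lambda>x. Phi (restr W' s x)) = restr W' (\<lambda>x. Phi (s x))"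
      by (auto simp: restr_def Phi_zero)
    then show "restr W' s \<in> P W'"
      using s xsec_restr[OF W(1), of W' s] GD(6)[of W' "\<lambda>x. Phi (s x)"] by (simp add: P_def)
  next
    fix s assume s: "s \<in> xsec W" and loc: "\<forall>x\<in>W. \<exists>W'. openin X W' \<and> x \<in> W' \<and> W' \<subseteq> W \<and> restr W' s \<in> P W'"
    have "\<exists>W'. openin X W' \<and> x \<in> W' \<and> W' \<subseteq> W \<and> restr W' (\<lambda>x. Phi (s x)) \<in> G W'" if x: "x \<in> W" for x
    proof -
      obtain W' where W': "openin X W'" "x \<in> W'" "W' \<subseteq> W" "restr W' s \<in> P W'" using bspec[OF loc x] by (elim exE conjE)
      have "(\<lambda>x. Phi (restr W' s x)) = restr W' (\<lambda>x. Phi (s x))"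
        by (auto simp: restr_def Phi_zero)
      then have "restr W' (\<lambda>x. Phi (s x)) \<in> G W'" using W'(4) by (simp add: P_def)
      then show ?thesis using W'(1-3) by blast
    qed
    then have "(\<lambda>x. Phi (s x)) \<in> G W"
      by (rule GD(7)[OF xsec_Phi[OF W(1) s]])
    then show "s \<in> P W" using s by (simp add: P_def)
  qed
qed

text \<open>Iterated \<open>\<beta>\<close>-adic division of \<open>Phi s\<close> produces the coefficients with respect to \<open>\<theta>(a)^j \<phi>\<close>; applying
the inverse of \<open>Phi\<close> turns \<open>\<beta>\<close> into \<open>b\<close> and \<open>\<theta>(a)^j \<phi>\<close> into \<open>a^j \<psi>\<close>.\<close>
lemma P_span:
  assumes W: "openin X W" "W \<subseteq> V" and s: "s \<in> P W"
  shows "\<exists>h. (\<forall>j<k. h j \<in> ob W) \<and> s = comb \<psi> k h"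
proof -
  define Q where "Q y p \<longleftrightarrow> (\<forall>j<k. fst p j \<in> Ox W) \<and> snd p \<in> G W \<and>
      (\<forall>x. y x = (\<Sum>j<k. act (scalar (fst p j x)) (phi_theta j x)) + act beta (snd p x))" for y p
  have "\<exists>p. Q y p" if y: "y \<in> G W" for y
  proof -
    obtain f s' where "(\<forall>j<k. f j \<in> Ox W) \<and> s' \<in> G W \<and>
      (\<forall>x. y x = (\<Sum>j<k. act (scalar (f j x)) (phi_theta j x)) + act beta (s' x))"
      using beta_expansion[OF W y] by (elim exE)
    then have "Q y (f, s')" unfolding Q_def fst_conv snd_conv .
    then show ?thesis ..
  qed
  then have "\<forall>y\<in>G W. \<exists>p. Q y p" ..
  from bchoice[OF this] obtain r where "\<forall>y\<in>G W. Q y (r y)" ..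
  note r = bspec[OF this, unfolded Q_def]
  \<comment> \<open>the successive quotients of the division by \<beta>; h collects the remainders\<close>
  define y where "y d = ((\<lambda>y. snd (r y)) ^^ d) (\<lambda>x. Phi (s x))" for d
  have y_Suc: "y (Suc d) = snd (r (y d))" for d by (simp add: y_def)
  have y0: "y 0 = (\<lambda>x. Phi (s x))" by (simp add: y_def)
  have yG: "y d \<in> G W" for d
  proof (induction d)
    case 0
    show "y 0 \<in> G W" using s by (simp add: y0 P_def)
  next
    case (Suc d)
    show "y (Suc d) \<in> G W" unfolding y_Suc by (rule conjunct1[OF conjunct2[OF r[OF Suc]]])
  qed
  define h where "h j x = Abs_fps (\<lambda>d. fst (r (y d)) j x)" for j x
  have h: "h j \<in> ob W" if "j < k" for j
    unfolding h_def using r[OF yG] that by (intro ob_Abs_fps) auto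
  have step: "y d x = (\<Sum>j<k. act (scalar (fps_nth (h j x) d)) (phi_theta j x)) + act beta (y (Suc d) x)" for d x
    unfolding y_Suc h_def fps_nth_Abs_fps using r[OF yG[of d]] by (elim conjE) (erule spec)
  have "s x = comb \<psi> k h x" for x
  proof (rule Phi_inj)
    \<comment> \<open>the error after removing the terms of degree at least d; it is divisible by \<beta>\<close>
    define T where "T d = y d x - (\<Sum>j<k. act (Theta \<theta> (ahat_b (fps_shift d (h j x)))) (phi_theta j x))" for d
    have T: "T d = act beta (T (Suc d))" for d
    proof -
      have "act (Theta \<theta> (ahat_b (fps_shift d (h j x)))) (phi_theta j x) =
          act (scalar (fps_nth (h j x) d)) (phi_theta j x) + act beta (act (Theta \<theta> (ahat_b (fps_shift (Suc d) (h j x)))) (phi_theta j x))" for j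
      proof -
        have "fps_shift 1 (fps_shift d (h j x)) = fps_shift (Suc d) (h j x)" by (rule fps_ext) simp
        then show ?thesis
          by (subst ahat_b_split) (simp add: Theta_simps Theta_scalar Theta_b_elt xi_act_add_left xi_act_mult)
      qed
      then have "T d = act beta (y (Suc d) x) -
          act beta (\<Sum>j<k. act (Theta \<theta> (ahat_b (fps_shift (Suc d) (h j x)))) (phi_theta j x))"
        unfolding T_def step[of d x] by (simp only: sum.distrib xi_act_sum_right add_diff_cancel_left)
      then show ?thesis by (simp only: T_def xi_act_diff_right)
    qed
    have "T 0 = act (beta ^ d) (T d)" for d
    proof (induction d)
      case 0
      show "T 0 = act (beta ^ 0) (T 0)" by (simp add: xi_act_one)
    next
      case (Suc d)
      show "T 0 = act (beta ^ Suc d) (T (Suc d))"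
        by (simp only: Suc[unfolded T[of d]] power_Suc2 xi_act_mult)
    qed
    then have "T 0 \<in> xi_ord d" for d
      using act_beta_power_ord[of "T d" 0 d] by simp
    then have "T 0 = 0" by (rule xi_ord_separated)
    then have "Phi (s x) = (\<Sum>j<k. act (Theta \<theta> (ahat_b (h j x))) (phi_theta j x))"
      by (simp only: T_def y0 fps_shift_0 right_minus_eq)
    also have "\<dots> = (\<Sum>j<k. Phi (act (ahat_b (h j x)) (act (a_elt ^ j) (\<psi> x))))"
      using psi_xsec xsec_carr by (simp add: Phi_ahat_b Phi_act Phi_psi phi_theta_def Theta_power Theta_a_elt)
    also have "\<dots> = Phi (comb \<psi> k h x)"
      unfolding comb_def by (rule sum_additive[of Phi, symmetric]) (rule Phi_add)
    finally show "Phi (s x) = Phi (comb \<psi> k h x)" .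
    show "s x \<in> carr" using s by (intro xsec_carr[of s W]) (simp add: P_def)
    show "comb \<psi> k h x \<in> carr"
      unfolding comb_def using psi_xsec by (intro carr_sum carr_act xsec_carr)
  qed
  then have "s = comb \<psi> k h" by (rule ext)
  then show ?thesis using h by blast
qed

lemma gen_psi: "openin X W \<Longrightarrow> W \<subseteq> V \<Longrightarrow> gen V \<psi> W = P W"
proof
  assume W: "openin X W" "W \<subseteq> V"
  show "gen V \<psi> W \<subseteq> P W" by (rule gen_least[OF subsheaf_P psi_P])
  show "P W \<subseteq> gen V \<psi> W"
  proof
    fix s assume "s \<in> P W"
    then obtain h where h: "\<And>j. j < k \<Longrightarrow> h j \<in> ob W" "s = comb \<psi> k h" using P_span[OF W] by blast
    show "s \<in> gen V \<psi> W"
      unfolding h(2) by (rule comb_in_subsheaf[OF subsheaf_on_gen[OF psi_xsec] section_in_gen V W h(1)])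
  qed
qed

lemma fib_psi: "fib V \<psi> x = {v \<in> carr. Phi v \<in> fib V \<phi> x}"
proof (intro equalityI subsetI)
  fix v assume "v \<in> fib V \<psi> x"
  then obtain s W where s: "v = s x" "openin X W" "x \<in> W" "W \<subseteq> V" "s \<in> gen V \<psi> W" unfolding fib_iff by blast
  then have "s \<in> P W" using gen_psi by simp
  then have sP: "s \<in> xsec W" "(\<lambda>x. Phi (s x)) \<in> G W" by (auto simp: P_def)
  have "Phi v \<in> fib V \<phi> x"
    unfolding fib_iff by (intro exI[of _ "\<lambda>x. Phi (s x)"] exI[of _ W]) (use s sP in simp)
  moreover have "v \<in> carr" using s(1) sP(1) xsec_carr by simp
  ultimately show "v \<in> {v \<in> carr. Phi v \<in> fib V \<phi> x}" by simp
next
  fix v assume v: "v \<in> {v \<in> carr. Phi v \<in> fib V \<phi> x}"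
  then obtain s W where s: "Phi v = s x" "openin X W" "x \<in> W" "W \<subseteq> V" "s \<in> G W" unfolding fib_iff by blast
  have sx: "s \<in> xsec W" by (rule subsheaf_onD(1)[OF subsheaf_G s(2,4,5)])
  have "(\<lambda>x. Psi (s x)) \<in> P W"
    using s xsec_Psi[OF s(2) sx] xsec_carr[OF sx] by (simp add: P_def Phi_Psi)
  moreover have "v = Psi (s x)" using v s(1) Psi_Phi[of v] by simp
  ultimately show "v \<in> fib V \<psi> x"
    unfolding fib_iff by (intro exI[of _ "\<lambda>x. Psi (s x)"] exI[of _ W]) (use s gen_psi[OF s(2,4)] in simp)
qed

text \<open>\<open>Phi\<close> identifies the fibre with the twist of a fresco.\<close>
lemma fresco_psi:
  assumes x: "x \<in> V"
  shows "fresco ((xi_module lam N m)\<lparr>carrier := fib V \<psi> x\<rparr>) k"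
proof (rule fresco_iso)
  let ?M = "(xi_module lam N m)\<lparr>carrier := fib V \<psi> x\<rparr>"
  show "fresco (tw (fibM x)) k" by (rule fresco_twist[OF fresco[OF x]])
  have cl: "act z v \<in> fib V \<psi> x" if "v \<in> fib V \<psi> x" for z v
    using that carr_act fib_act[OF x] by (simp add: fib_psi Phi_act)
  have add: "v + w \<in> fib V \<psi> x" if "v \<in> fib V \<psi> x" "w \<in> fib V \<psi> x" for v w
    using that carr_add fib_add[OF x] by (simp add: fib_psi Phi_add)
  have zero: "0 \<in> fib V \<psi> x"
  proof -
    have "Phi 0 = act 0 (\<phi> x)" by (simp add: Phi_zero xi_act_zero_left)
    then show ?thesis using power_section_in_fib[OF x, of 0] carr_zero by (simp add: fib_psi)
  qed
  have "abelian_group ?M"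
  proof (rule abelian_groupI)
    fix v assume v: "v \<in> carrier ?M"
    have "act (- 1) v + v = act (- 1 + 1) v" by (simp only: xi_act_add_left xi_act_one)
    then have "act (- 1) v + v = 0" by (simp add: xi_act_zero_left)
    then show "\<exists>w\<in>carrier ?M. w \<oplus>\<^bsub>?M\<^esub> v = \<zero>\<^bsub>?M\<^esub>"
      using v cl[of v "- 1"] by (intro bexI[of _ "act (- 1) v"]) simp_all
  qed (simp_all add: add zero add_ac)
  then show "left_module ?M"
    using cl by (simp add: left_module_def xi_act_add_left xi_act_add_right xi_act_mult xi_act_one)
  show "module_embedding ?M (tw (fibM x)) Phi"
    using fib_psi Phi_inj by (auto simp: module_embedding_def inj_on_def Phi_add Phi_act)
  show "Phi ` carrier ?M = carrier (tw (fibM x))"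
  proof (intro equalityI subsetI)
    fix v assume v: "v \<in> carrier (tw (fibM x))"
    then have "v \<in> carr"
      using subsheaf_onD(1)[OF subsheaf_G] xsec_carr unfolding twist_simps fibM_simps fib_iff by blast
    then show "v \<in> Phi ` carrier ?M"
      using v by (intro image_eqI[of _ _ "Psi v"]) (simp_all add: Phi_Psi Psi_carr fib_psi)
  qed (auto simp: fib_psi)
qed

lemma spanned_section_psi: "spanned_section \<theta> lam N m X Ox k V \<psi>"
  by unfold_locales (use V psi_xsec P_span gen_psi fresco_psi in auto)

end

section \<open>The twisted sheaf\<close>

context expansion_family
begin

lemma Psi_add: "s \<in> carr \<Longrightarrow> t \<in> carr \<Longrightarrow> Psi (s + t) = Psi s + Psi t"
  by (rule Phi_inj) (simp_all add: Psi_carr carr_add Phi_add Phi_Psi)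

lemma Psi_act: "s \<in> carr \<Longrightarrow> Psi (act (Theta \<theta> z) s) = act z (Psi s)"
  by (rule Phi_inj) (simp_all add: Psi_carr carr_act Phi_act Phi_Psi)

lemma Psi_zero: "Psi 0 = 0"
  using Psi_Phi[OF carr_zero] by (simp add: Phi_zero)

end

locale ahat_sheaf_on = reduced_space X Ox
  for X :: "'x topology" and Ox :: "'x set \<Rightarrow> ('x \<Rightarrow> complex) set" +
  fixes E :: "('x, 's) ahat_sheaf"
  assumes sheaf: "is_ahat_sheaf X Ox E"
begin

lemma sheaf_ob_module: "openin X U \<Longrightarrow> ob_module Ox E U"
  and rest_id: "openin X U \<Longrightarrow> s \<in> secs E U \<Longrightarrow> rest E U U s = s"
  using conjunct1[OF sheaf[unfolded is_ahat_sheaf_def]] by simp_all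

lemma sect_module: "openin X U \<Longrightarrow> ahat_module (sect E U)"
  using sheaf_ob_module[of U] by unfold_locales (simp add: ob_module_def)

lemma ob_act_rules:
  assumes U: "openin X U" and s: "s \<in> secs E U"
  shows ob_act_closed: "g \<in> ob U \<Longrightarrow> ob_act E U g s \<in> secs E U"
    and ob_act_add_left: "g \<in> ob U \<Longrightarrow> h \<in> ob U \<Longrightarrow>
      ob_act E U (\<lambda>x. g x + h x) s = ob_act E U g s \<oplus>\<^bsub>sect E U\<^esub> ob_act E U h s"
    and ob_act_scalar: "f \<in> Ox U \<Longrightarrow> ob_act E U (\<lambda>x. fps_const (f x)) (z \<odot>\<^bsub>sect E U\<^esub> s) =
      z \<odot>\<^bsub>sect E U\<^esub> ob_act E U (\<lambda>x. fps_const (f x)) s"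
  using sheaf_ob_module[OF U] s unfolding ob_module_def by simp_all

lemma ob_act_zero:
  assumes U: "openin X U" and s: "s \<in> secs E U"
  shows "ob_act E U (\<lambda>x. 0) s = \<zero>\<^bsub>sect E U\<^esub>"
proof -
  interpret M: ahat_module "sect E U" by (rule sect_module[OF U])
  have "ob_act E U (\<lambda>x. 0) s \<oplus>\<^bsub>sect E U\<^esub> ob_act E U (\<lambda>x. 0) s = ob_act E U (\<lambda>x. 0) s"
    using ob_act_add_left[OF U s ob_zero[OF U] ob_zero[OF U]] by simp
  then show ?thesis
    using ob_act_closed[OF U s ob_zero[OF U]] by simp
qed

lemma rest_rules:
  assumes U: "openin X U" and W: "openin X W" "W \<subseteq> U" and s: "s \<in> secs E U"
  shows rest_closed: "rest E U W s \<in> secs E W"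
    and rest_add: "t \<in> secs E U \<Longrightarrow> rest E U W (s \<oplus>\<^bsub>sect E U\<^esub> t) = rest E U W s \<oplus>\<^bsub>sect E W\<^esub> rest E U W t"
    and rest_smult: "rest E U W (z \<odot>\<^bsub>sect E U\<^esub> s) = z \<odot>\<^bsub>sect E W\<^esub> rest E U W s"
    and rest_ob_act: "g \<in> ob U \<Longrightarrow> rest E U W (ob_act E U g s) = ob_act E W (restr W g) (rest E U W s)"
    and rest_rest: "openin X W' \<Longrightarrow> W' \<subseteq> W \<Longrightarrow> rest E W W' (rest E U W s) = rest E U W' s"
proof -
  have "\<forall>U W. openin X U \<and> openin X W \<and> W \<subseteq> U \<longrightarrow> (\<forall>s\<in>secs E U.
       rest E U W s \<in> secs E W \<and>
       (\<forall>t\<in>secs E U. rest E U W (s \<oplus>\<^bsub>sect E U\<^esub> t) = rest E U W s \<oplus>\<^bsub>sect E W\<^esub> rest E U W t) \<and>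
       (\<forall>\<alpha>. rest E U W (\<alpha> \<odot>\<^bsub>sect E U\<^esub> s) = \<alpha> \<odot>\<^bsub>sect E W\<^esub> rest E U W s) \<and>
       (\<forall>g\<in>ob U. rest E U W (ob_act E U g s) = ob_act E W (restr W g) (rest E U W s)) \<and>
       (\<forall>W'. openin X W' \<and> W' \<subseteq> W \<longrightarrow> rest E W W' (rest E U W s) = rest E U W' s))"
    by (rule conjunct1[OF conjunct2[OF sheaf[unfolded is_ahat_sheaf_def]]])
  note r = this[rule_format, OF conjI[OF U conjI[OF W]] s]
  show "rest E U W s \<in> secs E W"
    and "t \<in> secs E U \<Longrightarrow> rest E U W (s \<oplus>\<^bsub>sect E U\<^esub> t) = rest E U W s \<oplus>\<^bsub>sect E W\<^esub> rest E U W t"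
    and "rest E U W (z \<odot>\<^bsub>sect E U\<^esub> s) = z \<odot>\<^bsub>sect E W\<^esub> rest E U W s"
    and "g \<in> ob U \<Longrightarrow> rest E U W (ob_act E U g s) = ob_act E W (restr W g) (rest E U W s)"
    and "openin X W' \<Longrightarrow> W' \<subseteq> W \<Longrightarrow> rest E W W' (rest E U W s) = rest E U W' s"
    using r by simp_all
qed

lemma sheaf_conditions:
  "\<forall>\<U>. (\<forall>W\<in>\<U>. openin X W) \<longrightarrow>
       (\<forall>s\<in>secs E (\<Union>\<U>). \<forall>t\<in>secs E (\<Union>\<U>).
          (\<forall>W\<in>\<U>. rest E (\<Union>\<U>) W s = rest E (\<Union>\<U>) W t) \<longrightarrow> s = t) \<and>
       (\<forall>\<sigma>. (\<forall>W\<in>\<U>. \<sigma> W \<in> secs E W) \<and>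
          (\<forall>W\<in>\<U>. \<forall>W'\<in>\<U>. rest E W (W \<inter> W') (\<sigma> W) = rest E W' (W \<inter> W') (\<sigma> W')) \<longrightarrow>
          (\<exists>s\<in>secs E (\<Union>\<U>). \<forall>W\<in>\<U>. rest E (\<Union>\<U>) W s = \<sigma> W))"
  by (rule conjunct2[OF conjunct2[OF sheaf[unfolded is_ahat_sheaf_def]]])

lemma section_eqI:
  assumes "\<And>W. W \<in> \<U> \<Longrightarrow> openin X W" "\<Union>\<U> = U" "s \<in> secs E U" "t \<in> secs E U"
    and "\<And>W. W \<in> \<U> \<Longrightarrow> rest E U W s = rest E U W t"
  shows "s = t"
  using sheaf_conditions[rule_format, of \<U>, THEN conjunct1, rule_format, of s t] assms by simp

lemma section_glue:
  assumes "\<And>W. W \<in> \<U> \<Longrightarrow> openin X W" "\<Union>\<U> = U" "\<And>W. W \<in> \<U> \<Longrightarrow> \<sigma> W \<in> secs E W"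
    and "\<And>W W'. W \<in> \<U> \<Longrightarrow> W' \<in> \<U> \<Longrightarrow> rest E W (W \<inter> W') (\<sigma> W) = rest E W' (W \<inter> W') (\<sigma> W')"
  obtains s where "s \<in> secs E U" "\<And>W. W \<in> \<U> \<Longrightarrow> rest E U W s = \<sigma> W"
proof -
  have "\<exists>s\<in>secs E (\<Union>\<U>). \<forall>W\<in>\<U>. rest E (\<Union>\<U>) W s = \<sigma> W"
  proof (rule mp[OF spec[OF conjunct2[OF mp[OF spec[OF sheaf_conditions, of \<U>]]], of \<sigma>]])
    show "\<forall>W\<in>\<U>. openin X W" using assms(1) by (rule ballI)
    show "(\<forall>W\<in>\<U>. \<sigma> W \<in> secs E W) \<and>
        (\<forall>W\<in>\<U>. \<forall>W'\<in>\<U>. rest E W (W \<inter> W') (\<sigma> W) = rest E W' (W \<inter> W') (\<sigma> W'))"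
      using assms(3,4) by (intro conjI ballI)
  qed
  then show thesis using that unfolding assms(2) by blast
qed

end

locale twisted_sheaf = variable_change \<theta> + ahat_sheaf_on X Ox E
  for \<theta> :: "complex fps" and X :: "'x topology" and Ox :: "'x set \<Rightarrow> ('x \<Rightarrow> complex) set"
    and E :: "('x, 's) ahat_sheaf" +
  fixes lam :: complex
begin

text \<open>Local coordinates for the twisted sheaf with values in the functions into \<open>\<Xi>\<close>. They turn the action of
\<open>Theta z\<close> into that of \<open>z\<close>, in particular that of \<open>\<beta>\<close> into that of \<open>b\<close>, and respect
$\mathcal{O}_X$. The last clause, stability of the image under $\mathcal{O}_X[[b]]$, provides the
limits. Compatibility with the twisted action of $\mathcal{O}_X[[b]]$ is then a consequence
(\<open>tob_coordinate\<close>).\<close>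
definition coordinate :: "nat \<Rightarrow> nat \<Rightarrow> 'x set \<Rightarrow> ('s \<Rightarrow> 'x \<Rightarrow> expansion) \<Rightarrow> bool"
  where "coordinate N m W h \<longleftrightarrow>
    inj_on h (secs E W) \<and>
    (\<forall>s\<in>secs E W. \<forall>t\<in>secs E W. h (s \<oplus>\<^bsub>sect E W\<^esub> t) = (\<lambda>x. h s x + h t x)) \<and>
    (\<forall>z. \<forall>s\<in>secs E W. h (Theta \<theta> z \<odot>\<^bsub>sect E W\<^esub> s) = (\<lambda>x. xi_act lam z (h s x))) \<and>
    (\<forall>f\<in>Ox W. \<forall>s\<in>secs E W. h (ob_act E W (\<lambda>x. fps_const (f x)) s) = (\<lambda>x. xi_act lam (scalar (f x)) (h s x))) \<and>
    (\<forall>g\<in>ob W. \<forall>s\<in>secs E W. \<exists>t\<in>secs E W. h t = (\<lambda>x. xi_act lam (ahat_b (g x)) (h s x)))"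

text \<open>All open subsets are included, so that the limits over two small sets can be compared on their
intersection.\<close>
definition small :: "'x set \<Rightarrow> bool"
  where "small V \<longleftrightarrow> openin X V \<and> (\<forall>W. openin X W \<and> W \<subseteq> V \<longrightarrow> (\<exists>N m h. coordinate N m W h))"

definition partial :: "'x set \<Rightarrow> ('x \<Rightarrow> complex fps) \<Rightarrow> 's \<Rightarrow> nat \<Rightarrow> 's"
  where "partial U g s d = (\<Oplus>\<^bsub>sect E U\<^esub>n\<in>{..<d}.
    ob_act E U (\<lambda>x. fps_const (fps_nth (g x) n)) (beta ^ n \<odot>\<^bsub>sect E U\<^esub> s))"

text \<open>\<open>t\<close> is the \<open>\<beta>\<close>-adic limit of the partial sums of $\sum_n g_n \beta^n s$.\<close>
definition is_lim :: "'x set \<Rightarrow> ('x \<Rightarrow> complex fps) \<Rightarrow> 's \<Rightarrow> 's \<Rightarrow> bool"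
  where "is_lim U g s t \<longleftrightarrow> t \<in> secs E U \<and>
    (\<forall>d. \<exists>u\<in>secs E U. t = partial U g s d \<oplus>\<^bsub>sect E U\<^esub> beta ^ d \<odot>\<^bsub>sect E U\<^esub> u)"

abbreviation tob :: "'x set \<Rightarrow> ('x \<Rightarrow> complex fps) \<Rightarrow> 's \<Rightarrow> 's"
  where "tob \<equiv> ob_act (twist_sheaf \<theta> E)"

lemma twist_sheaf_simps [simp]:
  "sect (twist_sheaf \<theta> E) U = tw (sect E U)" "rest (twist_sheaf \<theta> E) = rest E"
  by (simp_all add: twist_sheaf_def)

lemma tob_eq: "tob U g s = (THE t. is_lim U g s t)"
  by (simp add: twist_sheaf_def is_lim_def partial_def Let_def change_aut_eq Theta_b_elt)

lemma partial_term_closed: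
  assumes U: "openin X U" and g: "g \<in> ob U" and s: "s \<in> secs E U"
  shows "ob_act E U (\<lambda>x. fps_const (fps_nth (g x) n)) (z \<odot>\<^bsub>sect E U\<^esub> s) \<in> secs E U"
proof -
  interpret M: ahat_module "sect E U" by (rule sect_module[OF U])
  show ?thesis using s by (intro ob_act_closed[OF U] ob_fps_const[OF U] obD[OF g]) auto
qed

lemma partial_0: "openin X U \<Longrightarrow> partial U g s 0 = \<zero>\<^bsub>sect E U\<^esub>"
proof -
  assume U: "openin X U"
  interpret M: ahat_module "sect E U" by (rule sect_module[OF U])
  show ?thesis by (simp add: partial_def)
qed

lemma partial_Suc:
  assumes U: "openin X U" and g: "g \<in> ob U" and s: "s \<in> secs E U"
  shows "partial U g s (Suc d) = ob_act E U (\<lambda>x. fps_const (fps_nth (g x) d)) (beta ^ d \<odot>\<^bsub>sect E U\<^esub> s)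
    \<oplus>\<^bsub>sect E U\<^esub> partial U g s d"
proof -
  interpret M: ahat_module "sect E U" by (rule sect_module[OF U])
  show ?thesis
    unfolding partial_def lessThan_Suc
    by (subst M.finsum_insert) (auto intro: partial_term_closed[OF assms])
qed

lemma partial_closed:
  assumes U: "openin X U" and g: "g \<in> ob U" and s: "s \<in> secs E U"
  shows "partial U g s d \<in> secs E U"
proof -
  interpret M: ahat_module "sect E U" by (rule sect_module[OF U])
  show ?thesis
    unfolding partial_def by (intro M.finsum_closed) (auto intro: partial_term_closed[OF assms])
qed

lemma rest_zero:
  assumes "openin X U" "openin X W" "W \<subseteq> U"
  shows "rest E U W \<zero>\<^bsub>sect E U\<^esub> = \<zero>\<^bsub>sect E W\<^esub>"
proof -
  interpret M: ahat_module "sect E U" by (rule sect_module[OF assms(1)])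
  interpret M': ahat_module "sect E W" by (rule sect_module[OF assms(2)])
  have "rest E U W \<zero>\<^bsub>sect E U\<^esub> \<oplus>\<^bsub>sect E W\<^esub> rest E U W \<zero>\<^bsub>sect E U\<^esub> = rest E U W \<zero>\<^bsub>sect E U\<^esub>"
    using rest_add[OF assms M.zero_closed M.zero_closed] by simp
  then show ?thesis using rest_closed[OF assms M.zero_closed] by simp
qed

lemma rest_partial:
  assumes U: "openin X U" and W: "openin X W" "W \<subseteq> U" and g: "g \<in> ob U" and s: "s \<in> secs E U"
  shows "rest E U W (partial U g s d) = partial W (restr W g) (rest E U W s) d"
proof (induction d)
  case 0
  show ?case by (simp add: partial_0 U W rest_zero)
next
  case (Suc d)
  interpret M: ahat_module "sect E U" by (rule sect_module[OF U])
  have "restr W (\<lambda>x. fps_const (fps_nth (g x) d)) = (\<lambda>x. fps_const (fps_nth (restr W g x) d))"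
    by (auto simp: restr_def fun_eq_iff)
  moreover have "(\<lambda>x. fps_const (fps_nth (g x) d)) \<in> ob U" by (intro ob_fps_const[OF U] obD[OF g])
  ultimately show ?case
    using Suc partial_term_closed[OF U g s] partial_closed[OF U g s] s ob_restr[OF U W g] rest_closed[OF U W s]
    by (simp add: partial_Suc U W g rest_add[OF U W] rest_ob_act[OF U W] rest_smult[OF U W])
qed

lemma is_lim_rest:
  assumes U: "openin X U" and W: "openin X W" "W \<subseteq> U" and g: "g \<in> ob U" and s: "s \<in> secs E U"
    and lim: "is_lim U g s t"
  shows "is_lim W (restr W g) (rest E U W s) (rest E U W t)"
  unfolding is_lim_def
proof (intro conjI allI)
  interpret M: ahat_module "sect E U" by (rule sect_module[OF U])
  have t: "t \<in> secs E U" using lim by (simp add: is_lim_def)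
  then show "rest E U W t \<in> secs E W" by (rule rest_closed[OF U W])
  fix d
  obtain u where u: "u \<in> secs E U" "t = partial U g s d \<oplus>\<^bsub>sect E U\<^esub> beta ^ d \<odot>\<^bsub>sect E U\<^esub> u"
    using lim unfolding is_lim_def by blast
  have "rest E U W t = partial W (restr W g) (rest E U W s) d \<oplus>\<^bsub>sect E W\<^esub> beta ^ d \<odot>\<^bsub>sect E W\<^esub> rest E U W u"
    unfolding u(2) using u(1)
    by (subst rest_add[OF U W partial_closed[OF U g s]]) (simp_all add: rest_partial[OF U W g s] rest_smult[OF U W])
  then show "\<exists>u\<in>secs E W. rest E U W t = partial W (restr W g) (rest E U W s) d \<oplus>\<^bsub>sect E W\<^esub> beta ^ d \<odot>\<^bsub>sect E W\<^esub> u"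
    using rest_closed[OF U W u(1)] by blast
qed

lemma coordinateD:
  assumes "coordinate N m W h" "s \<in> secs E W"
  shows "t \<in> secs E W \<Longrightarrow> h s = h t \<Longrightarrow> s = t"
    "t \<in> secs E W \<Longrightarrow> h (s \<oplus>\<^bsub>sect E W\<^esub> t) = (\<lambda>x. h s x + h t x)"
    "h (Theta \<theta> z \<odot>\<^bsub>sect E W\<^esub> s) = (\<lambda>x. xi_act lam z (h s x))"
    "f \<in> Ox W \<Longrightarrow> h (ob_act E W (\<lambda>x. fps_const (f x)) s) = (\<lambda>x. xi_act lam (scalar (f x)) (h s x))"
    "g \<in> ob W \<Longrightarrow> \<exists>t\<in>secs E W. h t = (\<lambda>x. xi_act lam (ahat_b (g x)) (h s x))"
  using assms unfolding coordinate_def inj_on_def by blast+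

lemma coordinate_beta:
  assumes "coordinate N m W h" "s \<in> secs E W"
  shows "h (beta ^ n \<odot>\<^bsub>sect E W\<^esub> s) = (\<lambda>x. xi_act lam (b_elt ^ n) (h s x))"
  using coordinateD(3)[OF assms, of "b_elt ^ n"] by (simp add: Theta_power Theta_b_elt)

lemma coordinate_partial:
  assumes h: "coordinate N m W h" and W: "openin X W" and g: "g \<in> ob W" and s: "s \<in> secs E W"
  shows "h (partial W g s d) = (\<lambda>x. \<Sum>n<d. xi_act lam (scalar (fps_nth (g x) n)) (xi_act lam (b_elt ^ n) (h s x)))"
proof (induction d)
  interpret M: ahat_module "sect E W" by (rule sect_module[OF W])
  case 0
  have "h (0 \<odot>\<^bsub>sect E W\<^esub> s) = (\<lambda>x. 0)"
    using coordinateD(3)[OF h s, of 0] by (simp add: Theta_0 xi_act_zero_left)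
  then show "h (partial W g s 0) = (\<lambda>x. \<Sum>n<0. xi_act lam (scalar (fps_nth (g x) n)) (xi_act lam (b_elt ^ n) (h s x)))"
    using s by (simp add: partial_0 W M.smult_l_null)
next
  interpret M: ahat_module "sect E W" by (rule sect_module[OF W])
  case (Suc d)
  have "h (partial W g s (Suc d)) = (\<lambda>x. h (ob_act E W (\<lambda>x. fps_const (fps_nth (g x) d)) (beta ^ d \<odot>\<^bsub>sect E W\<^esub> s)) x + h (partial W g s d) x)"
    unfolding partial_Suc[OF W g s]
    by (rule coordinateD(2)[OF h partial_term_closed[OF W g s] partial_closed[OF W g s]])
  also have "h (ob_act E W (\<lambda>x. fps_const (fps_nth (g x) d)) (beta ^ d \<odot>\<^bsub>sect E W\<^esub> s)) =
      (\<lambda>x. xi_act lam (scalar (fps_nth (g x) d)) (xi_act lam (b_elt ^ d) (h s x)))"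
    using coordinateD(4)[OF h M.smult_closed[OF s] obD[OF g]] by (simp only: coordinate_beta[OF h s])
  finally show "h (partial W g s (Suc d)) =
      (\<lambda>x. \<Sum>n<Suc d. xi_act lam (scalar (fps_nth (g x) n)) (xi_act lam (b_elt ^ n) (h s x)))"
    unfolding Suc by (simp only: sum.lessThan_Suc add.commute)
qed

text \<open>In coordinates the partial sums are those of the power series \<open>g\<close> in \<open>b\<close> applied to \<open>h s\<close>, and their
\<open>b\<close>-adic limit is known.\<close>
lemma coordinate_lim:
  assumes h: "coordinate N m W h" and W: "openin X W" and g: "g \<in> ob W" and s: "s \<in> secs E W" and t: "t \<in> secs E W"
  shows "is_lim W g s t \<longleftrightarrow> h t = (\<lambda>x. xi_act lam (ahat_b (g x)) (h s x))"
proof -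
  interpret M: ahat_module "sect E W" by (rule sect_module[OF W])
  have expand: "xi_act lam (ahat_b (g x)) v =
      (\<Sum>n<d. xi_act lam (scalar (fps_nth (g x) n)) (xi_act lam (b_elt ^ n) v)) +
      xi_act lam (b_elt ^ d) (xi_act lam (ahat_b (fps_shift d (g x))) v)" for x v d
    by (subst ahat_b_expand[of "g x" d]) (simp only: xi_act_add_left xi_act_sum_left xi_act_mult)
  have sum: "h (partial W g s d \<oplus>\<^bsub>sect E W\<^esub> beta ^ d \<odot>\<^bsub>sect E W\<^esub> u) =
      (\<lambda>x. (\<Sum>n<d. xi_act lam (scalar (fps_nth (g x) n)) (xi_act lam (b_elt ^ n) (h s x))) + xi_act lam (b_elt ^ d) (h u x))"
    if u: "u \<in> secs E W" for u d
    by (simp only: coordinateD(2)[OF h partial_closed[OF W g s] M.smult_closed[OF u]]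
        coordinate_partial[OF h W g s] coordinate_beta[OF h u])
  show ?thesis
  proof
    assume lim: "is_lim W g s t"
    show "h t = (\<lambda>x. xi_act lam (ahat_b (g x)) (h s x))"
    proof
      fix x
      have "h t x - xi_act lam (ahat_b (g x)) (h s x) \<in> xi_ord d" for d
      proof -
        obtain u where u: "u \<in> secs E W" "t = partial W g s d \<oplus>\<^bsub>sect E W\<^esub> beta ^ d \<odot>\<^bsub>sect E W\<^esub> u"
          using lim unfolding is_lim_def by blast
        have "h t x - xi_act lam (ahat_b (g x)) (h s x) =
            xi_act lam (b_elt ^ d) (h u x) - xi_act lam (b_elt ^ d) (xi_act lam (ahat_b (fps_shift d (g x))) (h s x))"
          unfolding u(2) sum[OF u(1)] expand[of x "h s x" d] by (simp only: add_diff_cancel_left)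
        also have "\<dots> = xi_act lam (b_elt ^ d) (h u x - xi_act lam (ahat_b (fps_shift d (g x))) (h s x))"
          by (simp only: xi_act_diff_right)
        also have "\<dots> \<in> xi_ord d"
          using xi_act_total_filt[of "b_elt ^ d" d _ 0] acoeff_mult_b_power[of 1 d] by (simp add: total_filt_def)
        finally show ?thesis .
      qed
      then have "h t x - xi_act lam (ahat_b (g x)) (h s x) = 0" by (rule xi_ord_separated)
      then show "h t x = xi_act lam (ahat_b (g x)) (h s x)" by (simp only: right_minus_eq)
    qed
  next
    assume eq: "h t = (\<lambda>x. xi_act lam (ahat_b (g x)) (h s x))"
    show "is_lim W g s t"
      unfolding is_lim_def
    proof (intro conjI allI)
      fix d
      obtain u where u: "u \<in> secs E W" "h u = (\<lambda>x. xi_act lam (ahat_b (fps_shift d (g x))) (h s x))"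
        using coordinateD(5)[OF h s ob_shift[OF g, of d]] by blast
      have "h t = h (partial W g s d \<oplus>\<^bsub>sect E W\<^esub> beta ^ d \<odot>\<^bsub>sect E W\<^esub> u)"
        unfolding eq sum[OF u(1)] u(2) by (intro ext) (simp only: expand[of _ _ d])
      moreover have "partial W g s d \<oplus>\<^bsub>sect E W\<^esub> beta ^ d \<odot>\<^bsub>sect E W\<^esub> u \<in> secs E W"
        using u(1) partial_closed[OF W g s] by simp
      ultimately have "t = partial W g s d \<oplus>\<^bsub>sect E W\<^esub> beta ^ d \<odot>\<^bsub>sect E W\<^esub> u"
        using coordinateD(1)[OF h t] by blast
      then show "\<exists>u\<in>secs E W. t = partial W g s d \<oplus>\<^bsub>sect E W\<^esub> beta ^ d \<odot>\<^bsub>sect E W\<^esub> u"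
        using u(1) by blast
    qed (rule t)
  qed
qed

lemma small_open: "small W \<Longrightarrow> openin X W"
  by (simp add: small_def)

lemma small_subset: "small V \<Longrightarrow> openin X W \<Longrightarrow> W \<subseteq> V \<Longrightarrow> small W"
  by (auto simp: small_def)

lemma small_coordinate:
  assumes "small W"
  obtains N m h where "coordinate N m W h"
  using assms unfolding small_def by blast

lemma small_lim_ex1:
  assumes W: "small W" and g: "g \<in> ob W" and s: "s \<in> secs E W"
  shows "\<exists>!t. is_lim W g s t"
proof -
  obtain N m h where h: "coordinate N m W h" using small_coordinate[OF W] .
  note Wo = small_open[OF W]
  obtain t where t: "t \<in> secs E W" "h t = (\<lambda>x. xi_act lam (ahat_b (g x)) (h s x))"
    using coordinateD(5)[OF h s g] by blast
  show ?thesis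
  proof (rule ex1I[of _ t])
    show "is_lim W g s t" using coordinate_lim[OF h Wo g s t(1)] t(2) by simp
    fix t' assume lim: "is_lim W g s t'"
    then have t': "t' \<in> secs E W" by (simp add: is_lim_def)
    have "h t' = h t" using coordinate_lim[OF h Wo g s t'] lim t(2) by simp
    then show "t' = t" using coordinateD(1)[OF h t' t(1)] by blast
  qed
qed

text \<open>The remainder after \<open>d\<close> terms is determined by the limit. This is used to glue remainders.\<close>
lemma small_beta_inject:
  assumes W: "small W" and u: "u \<in> secs E W" "u' \<in> secs E W" and p: "p \<in> secs E W"
    and eq: "p \<oplus>\<^bsub>sect E W\<^esub> beta ^ d \<odot>\<^bsub>sect E W\<^esub> u = p \<oplus>\<^bsub>sect E W\<^esub> beta ^ d \<odot>\<^bsub>sect E W\<^esub> u'"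
  shows "u = u'"
proof -
  interpret M: ahat_module "sect E W" by (rule sect_module[OF small_open[OF W]])
  obtain N m h where h: "coordinate N m W h" using small_coordinate[OF W] .
  have "beta ^ d \<odot>\<^bsub>sect E W\<^esub> u = beta ^ d \<odot>\<^bsub>sect E W\<^esub> u'"
    using eq u p by simp
  then have "(\<lambda>x. xi_act lam (b_elt ^ d) (h u x)) = (\<lambda>x. xi_act lam (b_elt ^ d) (h u' x))"
    using coordinate_beta[OF h u(1), of d] coordinate_beta[OF h u(2), of d] by simp
  moreover have "v = w" if "xi_act lam (b_elt ^ d) v = xi_act lam (b_elt ^ d) w" for v w
  proof -
    have "(\<lambda>j i. fps_X ^ d * v j i) = (\<lambda>j i. fps_X ^ d * w j i)"
      using that by (metis xi_act_ahat_b ahat_b_X_power)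
    then have "fps_X ^ d * v j i = fps_X ^ d * w j i" for j i by (simp add: fun_eq_iff)
    then show ?thesis by (intro ext) simp
  qed
  ultimately have "h u = h u'" by (auto simp: fun_eq_iff)
  then show ?thesis using coordinateD(1)[OF h u] by blast
qed

end

locale covered_twisted_sheaf = twisted_sheaf \<theta> X Ox E lam
  for \<theta> :: "complex fps" and X :: "'x topology" and Ox :: "'x set \<Rightarrow> ('x \<Rightarrow> complex) set"
    and E :: "('x, 's) ahat_sheaf" and lam :: complex +
  assumes covered: "\<And>p. p \<in> topspace X \<Longrightarrow> \<exists>V. p \<in> V \<and> small V"
begin

definition cover :: "'x set \<Rightarrow> 'x set set"
  where "cover U = {W. W \<subseteq> U \<and> small W}"

lemma cover_open: "W \<in> cover U \<Longrightarrow> openin X W"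
  by (simp add: cover_def small_open)

lemma cover_small: "W \<in> cover U \<Longrightarrow> small W" and cover_subset: "W \<in> cover U \<Longrightarrow> W \<subseteq> U"
  by (simp_all add: cover_def)

lemma Union_cover:
  assumes U: "openin X U"
  shows "\<Union>(cover U) = U"
proof (intro equalityI subsetI)
  fix p assume p: "p \<in> U"
  then obtain V where V: "p \<in> V" "small V" using covered openin_subset[OF U] by blast
  have "small (U \<inter> V)" using V(2) by (rule small_subset) (auto simp: U V(2) small_open)
  then show "p \<in> \<Union>(cover U)" using p V(1) by (auto simp: cover_def)
qed (auto simp: cover_def)

lemma local_eqI:
  assumes U: "openin X U" and "s \<in> secs E U" "t \<in> secs E U"
    and "\<And>W. W \<in> cover U \<Longrightarrow> rest E U W s = rest E U W t"
  shows "s = t"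
  using cover_open Union_cover[OF U] assms(2-4) by (rule section_eqI)

text \<open>The limits over small open sets exist and, being unique, are compatible with restriction; so they
glue. That the glued section is a limit needs a global remainder for every \<open>d\<close>, obtained by gluing the
local ones, which are unique as well.\<close>
lemma lim_ex1:
  assumes U: "openin X U" and g: "g \<in> ob U" and s: "s \<in> secs E U"
  shows "\<exists>!t. is_lim U g s t"
proof (rule ex_ex1I)
  interpret M: ahat_module "sect E U" by (rule sect_module[OF U])
  have W: "openin X W" "W \<subseteq> U" "small W" if "W \<in> cover U" for W
    using that by (simp_all add: cover_def small_open)
  have gW: "restr W g \<in> ob W" and sW: "rest E U W s \<in> secs E W" if "W \<in> cover U" for W
    using ob_restr[OF U W(1,2)[OF that] g] rest_closed[OF U W(1,2)[OF that] s] .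
  define \<sigma> where "\<sigma> W = (THE t. is_lim W (restr W g) (rest E U W s) t)" for W
  have \<sigma>: "is_lim W (restr W g) (rest E U W s) (\<sigma> W)" if "W \<in> cover U" for W
    unfolding \<sigma>_def by (rule theI'[OF small_lim_ex1[OF W(3)[OF that] gW[OF that] sW[OF that]]])
  then have \<sigma>c: "\<sigma> W \<in> secs E W" if "W \<in> cover U" for W using that by (simp add: is_lim_def)
  have \<sigma>_rest: "rest E W W' (\<sigma> W) = \<sigma> W'" if W1: "W \<in> cover U" and W2: "W' \<in> cover U" "W' \<subseteq> W" for W W'
  proof -
    have "is_lim W' (restr W' (restr W g)) (rest E W W' (rest E U W s)) (rest E W W' (\<sigma> W))"
      by (rule is_lim_rest[OF W(1)[OF W1] W(1)[OF W2(1)] W2(2) gW[OF W1] sW[OF W1] \<sigma>[OF W1]])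
    moreover have "restr W' (restr W g) = restr W' g"
      using W2(2) by (auto simp: restr_def fun_eq_iff)
    moreover have "rest E W W' (rest E U W s) = rest E U W' s"
      by (rule rest_rest[OF U W(1,2)[OF W1] s W(1)[OF W2(1)] W2(2)])
    ultimately show ?thesis
      using \<sigma>[OF W2(1)] small_lim_ex1[OF W(3)[OF W2(1)] gW[OF W2(1)] sW[OF W2(1)]] by auto
  qed
  have Int: "W \<inter> W' \<in> cover U" if "W \<in> cover U" "W' \<in> cover U" for W W'
  proof -
    have "openin X (W \<inter> W')" using that by (intro openin_Int W(1))
    then show ?thesis using that small_subset[of W "W \<inter> W'"] by (auto simp: cover_def)
  qed
  obtain t where t: "t \<in> secs E U" "\<And>W. W \<in> cover U \<Longrightarrow> rest E U W t = \<sigma> W"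
  proof (rule section_glue[of "cover U" U \<sigma>])
    show "rest E W (W \<inter> W') (\<sigma> W) = rest E W' (W \<inter> W') (\<sigma> W')" if "W \<in> cover U" "W' \<in> cover U" for W W'
      using \<sigma>_rest[OF that(1) Int[OF that]] \<sigma>_rest[OF that(2) Int[OF that]] by simp
  qed (use W Union_cover[OF U] \<sigma>c in auto)
  have "\<exists>u\<in>secs E U. t = partial U g s d \<oplus>\<^bsub>sect E U\<^esub> beta ^ d \<odot>\<^bsub>sect E U\<^esub> u" for d
  proof -
    define Q where "Q W u \<longleftrightarrow> u \<in> secs E W \<and>
      \<sigma> W = partial W (restr W g) (rest E U W s) d \<oplus>\<^bsub>sect E W\<^esub> beta ^ d \<odot>\<^bsub>sect E W\<^esub> u" for W u
    have "\<forall>W\<in>cover U. \<exists>u. Q W u"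
      using \<sigma> unfolding is_lim_def Q_def by blast
    from bchoice[OF this] obtain u where u: "\<And>W. W \<in> cover U \<Longrightarrow> Q W (u W)" by blast
    have uc: "u W \<in> secs E W" if "W \<in> cover U" for W using u[OF that] by (simp add: Q_def)
    \<comment> \<open>local remainders are unique because \<beta>^d is injective on small sets\<close>
    have u_rest: "rest E W W' (u W) = u W'" if W1: "W \<in> cover U" and W2: "W' \<in> cover U" "W' \<subseteq> W" for W W'
    proof -
      interpret MW: ahat_module "sect E W" by (rule sect_module[OF W(1)[OF W1]])
      note r = W(1)[OF W1] W(1)[OF W2(1)] W2(2)
      have "rest E W W' (partial W (restr W g) (rest E U W s) d) = partial W' (restr W' g) (rest E U W' s) d"
      proof -
        have "restr W' (restr W g) = restr W' g"
          using W2(2) by (auto simp: restr_def fun_eq_iff)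
        moreover have "rest E W W' (rest E U W s) = rest E U W' s"
          by (rule rest_rest[OF U W(1,2)[OF W1] s W(1)[OF W2(1)] W2(2)])
        ultimately show ?thesis by (simp only: rest_partial[OF r gW[OF W1] sW[OF W1]])
      qed
      moreover have "rest E W W' (\<sigma> W) = rest E W W' (partial W (restr W g) (rest E U W s) d) \<oplus>\<^bsub>sect E W'\<^esub>
          beta ^ d \<odot>\<^bsub>sect E W'\<^esub> rest E W W' (u W)"
        using u[OF W1] partial_closed[OF W(1)[OF W1] gW[OF W1] sW[OF W1]]
        by (simp add: Q_def rest_add[OF r] rest_smult[OF r])
      ultimately have "partial W' (restr W' g) (rest E U W' s) d \<oplus>\<^bsub>sect E W'\<^esub> beta ^ d \<odot>\<^bsub>sect E W'\<^esub> rest E W W' (u W) =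
          partial W' (restr W' g) (rest E U W' s) d \<oplus>\<^bsub>sect E W'\<^esub> beta ^ d \<odot>\<^bsub>sect E W'\<^esub> u W'"
        using u[OF W2(1)] \<sigma>_rest[OF W1 W2] by (simp add: Q_def)
      then show ?thesis
        by (rule small_beta_inject[OF W(3)[OF W2(1)] rest_closed[OF r uc[OF W1]] uc[OF W2(1)]
            partial_closed[OF W(1)[OF W2(1)] gW[OF W2(1)] sW[OF W2(1)]]])
    qed
    obtain v where v: "v \<in> secs E U" "\<And>W. W \<in> cover U \<Longrightarrow> rest E U W v = u W"
    proof (rule section_glue[of "cover U" U u])
      show "rest E W (W \<inter> W') (u W) = rest E W' (W \<inter> W') (u W')" if "W \<in> cover U" "W' \<in> cover U" for W W'
        using u_rest[OF that(1) Int[OF that]] u_rest[OF that(2) Int[OF that]] by simp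
    qed (use W Union_cover[OF U] uc in auto)
    have "t = partial U g s d \<oplus>\<^bsub>sect E U\<^esub> beta ^ d \<odot>\<^bsub>sect E U\<^esub> v"
    proof (rule local_eqI[OF U t(1)])
      show "partial U g s d \<oplus>\<^bsub>sect E U\<^esub> beta ^ d \<odot>\<^bsub>sect E U\<^esub> v \<in> secs E U"
        using v(1) partial_closed[OF U g s] by simp
      fix W' assume W': "W' \<in> cover U"
      note r = U W(1,2)[OF W']
      have "rest E U W' (partial U g s d \<oplus>\<^bsub>sect E U\<^esub> beta ^ d \<odot>\<^bsub>sect E U\<^esub> v) =
          partial W' (restr W' g) (rest E U W' s) d \<oplus>\<^bsub>sect E W'\<^esub> beta ^ d \<odot>\<^bsub>sect E W'\<^esub> u W'"
        using v partial_closed[OF U g s] W'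
        by (simp add: rest_add[OF r] rest_smult[OF r] rest_partial[OF r g s])
      then show "rest E U W' t = rest E U W' (partial U g s d \<oplus>\<^bsub>sect E U\<^esub> beta ^ d \<odot>\<^bsub>sect E U\<^esub> v)"
        using u[OF W'] t(2)[OF W'] by (simp add: Q_def)
    qed
    then show ?thesis using v(1) by blast
  qed
  then show "\<exists>t. is_lim U g s t" using t(1) unfolding is_lim_def by blast
  fix t t' assume lim: "is_lim U g s t" "is_lim U g s t'"
  show "t = t'"
  proof (rule local_eqI[OF U])
    show "t \<in> secs E U" "t' \<in> secs E U" using lim by (simp_all add: is_lim_def)
    fix W' assume W': "W' \<in> cover U"
    show "rest E U W' t = rest E U W' t'"
      using is_lim_rest[OF U W(1,2)[OF W'] g s lim(1)] is_lim_rest[OF U W(1,2)[OF W'] g s lim(2)]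
        small_lim_ex1[OF W(3)[OF W'] gW[OF W'] sW[OF W']] by auto
  qed
qed

lemma tob_lim: "openin X U \<Longrightarrow> g \<in> ob U \<Longrightarrow> s \<in> secs E U \<Longrightarrow> is_lim U g s (tob U g s)"
  unfolding tob_eq by (rule theI'[OF lim_ex1])

lemma tob_eqI: "openin X U \<Longrightarrow> g \<in> ob U \<Longrightarrow> s \<in> secs E U \<Longrightarrow> is_lim U g s t \<Longrightarrow> tob U g s = t"
  using lim_ex1[of U g s] tob_lim[of U g s] by blast

lemma tob_closed: "openin X U \<Longrightarrow> g \<in> ob U \<Longrightarrow> s \<in> secs E U \<Longrightarrow> tob U g s \<in> secs E U"
  using tob_lim[of U g s] by (simp add: is_lim_def)

lemma tob_rest:
  assumes U: "openin X U" and W: "openin X W" "W \<subseteq> U" and g: "g \<in> ob U" and s: "s \<in> secs E U"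
  shows "rest E U W (tob U g s) = tob W (restr W g) (rest E U W s)"
  by (rule tob_eqI[OF W(1) ob_restr[OF U W g] rest_closed[OF U W s] is_lim_rest[OF U W g s tob_lim[OF U g s]], symmetric])

lemma tob_coordinate:
  assumes h: "coordinate N m W h" and W: "openin X W" and g: "g \<in> ob W" and s: "s \<in> secs E W"
  shows "h (tob W g s) = (\<lambda>x. xi_act lam (ahat_b (g x)) (h s x))"
  using coordinate_lim[OF h W g s tob_closed[OF W g s]] tob_lim[OF W g s] by simp

text \<open>For coefficients without \<open>b\<close> the partial sums are stationary: $\mathcal{O}_X$ acts as it did before the
twist.\<close>
lemma tob_const:
  assumes U: "openin X U" and f: "f \<in> Ox U" and s: "s \<in> secs E U"
  shows "tob U (\<lambda>x. fps_const (f x)) s = ob_act E U (\<lambda>x. fps_const (f x)) s"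
proof (rule tob_eqI[OF U ob_fps_const[OF U f] s])
  interpret M: ahat_module "sect E U" by (rule sect_module[OF U])
  let ?g = "\<lambda>x. fps_const (f x)" and ?t = "ob_act E U (\<lambda>x. fps_const (f x)) s"
  have t: "?t \<in> secs E U" by (rule ob_act_closed[OF U s ob_fps_const[OF U f]])
  have 1: "partial U ?g s (Suc d) = ?t" for d
  proof (induction d)
    case 0
    show ?case
      using t s by (simp add: partial_Suc[OF U ob_fps_const[OF U f] s] partial_0[OF U] M.smult_one)
  next
    case (Suc d)
    have "ob_act E U (\<lambda>x. fps_const (fps_nth (?g x) (Suc d))) (beta ^ Suc d \<odot>\<^bsub>sect E U\<^esub> s) = \<zero>\<^bsub>sect E U\<^esub>"
      using ob_act_zero[OF U, of "beta ^ Suc d \<odot>\<^bsub>sect E U\<^esub> s"] s by simp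
    then show ?case
      unfolding partial_Suc[OF U ob_fps_const[OF U f] s, of "Suc d"] Suc using t by simp
  qed
  show "is_lim U ?g s ?t"
    unfolding is_lim_def
  proof (intro conjI allI)
    fix d
    show "\<exists>u\<in>secs E U. ?t = partial U ?g s d \<oplus>\<^bsub>sect E U\<^esub> beta ^ d \<odot>\<^bsub>sect E U\<^esub> u"
    proof (cases d)
      case 0
      then show ?thesis using t by (intro bexI[of _ ?t]) (simp_all add: partial_0[OF U] M.smult_one)
    next
      case (Suc d')
      show ?thesis unfolding Suc 1 using t
        by (intro bexI[of _ "\<zero>\<^bsub>sect E U\<^esub>"]) (simp_all add: M.smult_r_null)
    qed
  qed (rule t)
qed

text \<open>Equations between sections are checked in coordinates, where the twisted action is the standard one.\<close>
lemma coordinate_eqI: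
  assumes U: "openin X U" and s: "s \<in> secs E U" and t: "t \<in> secs E U"
    and eq: "\<And>N m W h. W \<in> cover U \<Longrightarrow> openin X W \<Longrightarrow> W \<subseteq> U \<Longrightarrow> coordinate N m W h \<Longrightarrow>
      h (rest E U W s) = h (rest E U W t)"
  shows "s = t"
proof (rule local_eqI[OF U s t])
  fix W assume W: "W \<in> cover U"
  obtain N m h where h: "coordinate N m W h" using small_coordinate[OF cover_small[OF W]] .
  note r = U cover_open[OF W] cover_subset[OF W]
  show "rest E U W s = rest E U W t"
    by (rule coordinateD(1)[OF h rest_closed[OF r s] rest_closed[OF r t] eq[OF W r(2,3) h]])
qed

lemma twist_ob_module:
  assumes U: "openin X U"
  shows "ob_module Ox (twist_sheaf \<theta> E) U"
proof -
  interpret M: ahat_module "sect E U" by (rule sect_module[OF U])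
  have coord: "h (rest E U W (tob U g s)) = (\<lambda>x. xi_act lam (ahat_b (restr W g x)) (h (rest E U W s) x))"
    if "openin X W" "W \<subseteq> U" "coordinate N m W h" "g \<in> ob U" "s \<in> secs E U" for N m W h g s
    unfolding tob_rest[OF U that(1,2,4,5)]
    by (rule tob_coordinate[OF that(3,1) ob_restr[OF U that(1,2,4)] rest_closed[OF U that(1,2,5)]])
  have add: "h (rest E U W (s \<oplus>\<^bsub>sect E U\<^esub> t)) = (\<lambda>x. h (rest E U W s) x + h (rest E U W t) x)"
    if "openin X W" "W \<subseteq> U" "coordinate N m W h" "s \<in> secs E U" "t \<in> secs E U" for N m W h s t
    unfolding rest_add[OF U that(1,2,4,5)]
    by (rule coordinateD(2)[OF that(3) rest_closed[OF U that(1,2,4)] rest_closed[OF U that(1,2,5)]])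
  have 1: "tob U g (s \<oplus>\<^bsub>sect E U\<^esub> t) = tob U g s \<oplus>\<^bsub>sect E U\<^esub> tob U g t"
    if g: "g \<in> ob U" and s: "s \<in> secs E U" and t: "t \<in> secs E U" for g s t
  proof (rule coordinate_eqI[OF U])
    fix N m W h assume W: "openin X W" "W \<subseteq> U" and h: "coordinate N m W h"
    show "h (rest E U W (tob U g (s \<oplus>\<^bsub>sect E U\<^esub> t))) = h (rest E U W (tob U g s \<oplus>\<^bsub>sect E U\<^esub> tob U g t))"
      by (simp only: coord[OF W h g M.a_closed[OF s t]] coord[OF W h g s] coord[OF W h g t] add[OF W h s t]
          add[OF W h tob_closed[OF U g s] tob_closed[OF U g t]] xi_act_add_right)
  qed (use g s t in \<open>simp_all add: tob_closed[OF U]\<close>)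
  have 2: "tob U (\<lambda>x. g x + g' x) s = tob U g s \<oplus>\<^bsub>sect E U\<^esub> tob U g' s"
    if g: "g \<in> ob U" and g': "g' \<in> ob U" and s: "s \<in> secs E U" for g g' s
  proof (rule coordinate_eqI[OF U])
    fix N m W h assume W: "openin X W" "W \<subseteq> U" and h: "coordinate N m W h"
    have "restr W (\<lambda>x. g x + g' x) x = restr W g x + restr W g' x" for x by (simp add: restr_def)
    then show "h (rest E U W (tob U (\<lambda>x. g x + g' x) s)) = h (rest E U W (tob U g s \<oplus>\<^bsub>sect E U\<^esub> tob U g' s))"
      by (simp only: coord[OF W h ob_add[OF U g g'] s] coord[OF W h g s] coord[OF W h g' s]
          add[OF W h tob_closed[OF U g s] tob_closed[OF U g' s]] xi_act_add_left ahat_b_add)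
  qed (use g g' s in \<open>simp_all add: tob_closed[OF U] ob_add[OF U]\<close>)
  have 3: "tob U (\<lambda>x. g x * g' x) s = tob U g (tob U g' s)"
    if g: "g \<in> ob U" and g': "g' \<in> ob U" and s: "s \<in> secs E U" for g g' s
  proof (rule coordinate_eqI[OF U])
    fix N m W h assume W: "openin X W" "W \<subseteq> U" and h: "coordinate N m W h"
    have "restr W (\<lambda>x. g x * g' x) x = restr W g x * restr W g' x" for x by (simp add: restr_def)
    then show "h (rest E U W (tob U (\<lambda>x. g x * g' x) s)) = h (rest E U W (tob U g (tob U g' s)))"
      by (simp only: coord[OF W h ob_mult[OF U g g'] s] coord[OF W h g tob_closed[OF U g' s]] coord[OF W h g' s]
          xi_act_mult ahat_b_mult)
  qed (use g g' s in \<open>simp_all add: tob_closed[OF U] ob_mult[OF U]\<close>)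
  have 4: "tob U (restr U (\<lambda>_. S)) s = Theta \<theta> (ahat_b S) \<odot>\<^bsub>sect E U\<^esub> s" if s: "s \<in> secs E U" for S s
  proof (rule coordinate_eqI[OF U])
    fix N m W h assume W: "openin X W" "W \<subseteq> U" and h: "coordinate N m W h"
    have out: "h (rest E U W s) x = 0" if "x \<notin> W" for x
    proof -
      \<comment> \<open>multiplication by the function 1 on W is the identity\<close>
      have 1: "restr W (\<lambda>_. 1) \<in> Ox W" by (rule Ox_const[OF W(1)])
      have a: "ob_act E W (restr W (\<lambda>_. 1)) (rest E U W s) = ahat_b 1 \<odot>\<^bsub>sect E W\<^esub> rest E U W s"
        using sheaf_ob_module[OF W(1)] rest_closed[OF U W s] unfolding ob_module_def by blast
      have b: "restr W (\<lambda>_. 1) = (\<lambda>x. fps_const (restr W (\<lambda>_. 1) x))"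
        by (auto simp: restr_def fun_eq_iff)
      have c: "ahat_b 1 = 1" using ahat_b_const[of 1] by (simp add: ahat_a_simps)
      have "ob_act E W (\<lambda>x. fps_const (restr W (\<lambda>_. 1) x)) (rest E U W s) = rest E U W s"
        using a[unfolded b c] ahat_module.smult_one[OF sect_module[OF W(1)] rest_closed[OF U W s]] by (rule trans)
      then have "h (rest E U W s) = (\<lambda>x. xi_act lam (scalar (restr W (\<lambda>_. 1) x)) (h (rest E U W s) x))"
        using coordinateD(4)[OF h rest_closed[OF U W s] 1] by simp
      from fun_cong[OF this, of x] show ?thesis
        using that by (simp add: restr_def ahat_a_simps xi_act_zero_left)
    qed
    have "xi_act lam (ahat_b (restr W (restr U (\<lambda>_. S)) x)) (h (rest E U W s) x) = xi_act lam (ahat_b S) (h (rest E U W s) x)" for x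
      using out[of x] W(2) by (auto simp: restr_def xi_act_zero_right)
    then have "h (rest E U W (tob U (restr U (\<lambda>_. S)) s)) = (\<lambda>x. xi_act lam (ahat_b S) (h (rest E U W s) x))"
      by (simp only: coord[OF W h ob_const[OF U] s])
    also have "\<dots> = h (rest E U W (Theta \<theta> (ahat_b S) \<odot>\<^bsub>sect E U\<^esub> s))"
      by (simp only: rest_smult[OF U W s] coordinateD(3)[OF h rest_closed[OF U W s]])
    finally show "h (rest E U W (tob U (restr U (\<lambda>_. S)) s)) = h (rest E U W (Theta \<theta> (ahat_b S) \<odot>\<^bsub>sect E U\<^esub> s))" .
  qed (use s in \<open>simp_all add: tob_closed[OF U] ob_const[OF U]\<close>)
  have 5: "tob U (\<lambda>x. fps_const (f x)) (Theta \<theta> z \<odot>\<^bsub>sect E U\<^esub> s) = Theta \<theta> z \<odot>\<^bsub>sect E U\<^esub> tob U (\<lambda>x. fps_const (f x)) s"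
    if "f \<in> Ox U" "s \<in> secs E U" for f z s
    using that ob_act_scalar[OF U that(2,1)] by (simp add: tob_const[OF U])
  show ?thesis
    unfolding ob_module_def twist_sheaf_simps
  proof (intro conjI ballI allI)
    show "left_module (tw (sect E U))" by (rule left_module_twist[OF M.left_module])
  qed (simp_all add: 1 2 3 4 5 tob_closed[OF U])
qed

lemma is_ahat_sheaf_twist: "is_ahat_sheaf X Ox (twist_sheaf \<theta> E)"
  unfolding is_ahat_sheaf_def
proof (intro conjI)
  show "\<forall>U. openin X U \<longrightarrow> ob_module Ox (twist_sheaf \<theta> E) U \<and>
      (\<forall>s\<in>secs (twist_sheaf \<theta> E) U. rest (twist_sheaf \<theta> E) U U s = s)"
    using twist_ob_module by (simp add: rest_id)
  show "\<forall>U W. openin X U \<and> openin X W \<and> W \<subseteq> U \<longrightarrow> (\<forall>s\<in>secs (twist_sheaf \<theta> E) U.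
       rest (twist_sheaf \<theta> E) U W s \<in> secs (twist_sheaf \<theta> E) W \<and>
       (\<forall>t\<in>secs (twist_sheaf \<theta> E) U. rest (twist_sheaf \<theta> E) U W (s \<oplus>\<^bsub>sect (twist_sheaf \<theta> E) U\<^esub> t) =
          rest (twist_sheaf \<theta> E) U W s \<oplus>\<^bsub>sect (twist_sheaf \<theta> E) W\<^esub> rest (twist_sheaf \<theta> E) U W t) \<and>
       (\<forall>\<alpha>. rest (twist_sheaf \<theta> E) U W (\<alpha> \<odot>\<^bsub>sect (twist_sheaf \<theta> E) U\<^esub> s) =
          \<alpha> \<odot>\<^bsub>sect (twist_sheaf \<theta> E) W\<^esub> rest (twist_sheaf \<theta> E) U W s) \<and>
       (\<forall>g\<in>ob U. rest (twist_sheaf \<theta> E) U W (ob_act (twist_sheaf \<theta> E) U g s) =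
          ob_act (twist_sheaf \<theta> E) W (restr W g) (rest (twist_sheaf \<theta> E) U W s)) \<and>
       (\<forall>W'. openin X W' \<and> W' \<subseteq> W \<longrightarrow> rest (twist_sheaf \<theta> E) W W' (rest (twist_sheaf \<theta> E) U W s) =
          rest (twist_sheaf \<theta> E) U W' s))"
    by (simp add: rest_closed rest_add rest_smult rest_rest tob_rest)
  show "\<forall>\<U>. (\<forall>W\<in>\<U>. openin X W) \<longrightarrow>
       (\<forall>s\<in>secs (twist_sheaf \<theta> E) (\<Union>\<U>). \<forall>t\<in>secs (twist_sheaf \<theta> E) (\<Union>\<U>).
          (\<forall>W\<in>\<U>. rest (twist_sheaf \<theta> E) (\<Union>\<U>) W s = rest (twist_sheaf \<theta> E) (\<Union>\<U>) W t) \<longrightarrow> s = t) \<and>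
       (\<forall>\<sigma>. (\<forall>W\<in>\<U>. \<sigma> W \<in> secs (twist_sheaf \<theta> E) W) \<and>
          (\<forall>W\<in>\<U>. \<forall>W'\<in>\<U>. rest (twist_sheaf \<theta> E) W (W \<inter> W') (\<sigma> W) = rest (twist_sheaf \<theta> E) W' (W \<inter> W') (\<sigma> W')) \<longrightarrow>
          (\<exists>s\<in>secs (twist_sheaf \<theta> E) (\<Union>\<U>). \<forall>W\<in>\<U>. rest (twist_sheaf \<theta> E) (\<Union>\<U>) W s = \<sigma> W))"
    unfolding twist_sheaf_simps twist_simps by (rule sheaf_conditions)
qed

text \<open>The fibre is formed with the action of $\mathcal{O}_X$ only, which the twist does not change.\<close>
lemma fibre_twist:
  shows "fibre X Ox (twist_sheaf \<theta> E) x = tw (fibre X Ox E x)"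
proof -
  have span: "max_ideal_span Ox (twist_sheaf \<theta> E) x W = max_ideal_span Ox E x W" if "openin X W" for W
  proof -
    have "(\<forall>f\<in>Ox W. \<forall>t\<in>secs E W. f x = 0 \<longrightarrow> tob W (\<lambda>y. fps_const (f y)) t \<in> S) \<longleftrightarrow>
        (\<forall>f\<in>Ox W. \<forall>t\<in>secs E W. f x = 0 \<longrightarrow> ob_act E W (\<lambda>y. fps_const (f y)) t \<in> S)" for S
      using tob_const[OF that] by simp
    then show ?thesis
      unfolding max_ideal_span_def twist_sheaf_simps twist_simps by simp
  qed
  have minus: "s \<ominus>\<^bsub>tw M\<^esub> t = s \<ominus>\<^bsub>M\<^esub> t" for M :: "(ahat, 's) module" and s t
    by (simp add: a_minus_def a_inv_def)
  have rel: "fibre_rel X Ox (twist_sheaf \<theta> E) x = fibre_rel X Ox E x"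
    unfolding fibre_rel_def twist_sheaf_simps twist_simps minus using span by (intro Collect_cong) (auto)
  show ?thesis
    unfolding fibre_def Let_def rel twist_sheaf_simps twist_simps by (simp add: twist_module_def change_aut_eq)
qed

end

section \<open>Holomorphy of the twisted family\<close>

lemma (in expansion_family) admissible_imp_spanned:
  assumes "openin X V" "admissible X Ox lam N m k V \<phi>"
  shows "spanned_section \<theta> lam N m X Ox k V \<phi>"
proof (unfold_locales)
  note adm = assms(2)[unfolded admissible_iff]
  show "openin X V" by (rule assms(1))
  show "\<phi> \<in> xsec V" by (rule conjunct1[OF adm])
  show "\<exists>g. (\<forall>j<k. g j \<in> ob W) \<and> s = comb \<phi> k g" if "openin X W" "W \<subseteq> V" "s \<in> gen V \<phi> W" for W s
  proof -
    have "\<exists>!g. (\<forall>j<k. g j \<in> ob W) \<and> (\<forall>j\<ge>k. g j = 0) \<and> s = comb \<phi> k g"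
      using conjunct1[OF conjunct2[OF adm]] that by simp
    then show ?thesis by (elim ex1E conjE) (rule exI, rule conjI)
  qed
  show "fresco ((xi_module lam N m)\<lparr>carrier := fib V \<phi> x\<rparr>) k" if "x \<in> V" for x
    using conjunct2[OF conjunct2[OF adm]] that by (rule bspec)
qed

lemma generated_sheaf_simps [simp]:
  "add (sect (generated_sheaf X Ox V F \<phi>) W) = add (sect F W)"
  "smult (sect (generated_sheaf X Ox V F \<phi>) W) = smult (sect F W)"
  "ob_act (generated_sheaf X Ox V F \<phi>) = ob_act F"
  "rest (generated_sheaf X Ox V F \<phi>) = rest F"
  by (simp_all add: generated_sheaf_def)

text \<open>A sheaf with an isomorphism \<open>\<eta>\<close>, over an open set, to the sheaf generated by a section as above.\<close>
locale charted_family = spanned_section \<theta> lam N m X Ox k V \<phi> + twisted_sheaf \<theta> X Ox E lam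
  for \<theta> :: "complex fps" and lam :: complex and N m :: nat
    and X :: "'x topology" and Ox :: "'x set \<Rightarrow> ('x \<Rightarrow> complex) set"
    and k :: nat and V :: "'x set" and \<phi> :: "'x \<Rightarrow> expansion" and E :: "('x, 's) ahat_sheaf" +
  fixes \<eta> :: "'x set \<Rightarrow> 's \<Rightarrow> 'x \<Rightarrow> expansion"
  assumes iso: "\<forall>W. openin X W \<and> W \<subseteq> V \<longrightarrow>
    bij_betw (\<eta> W) (secs E W) (gen V \<phi> W) \<and>
    (\<forall>s\<in>secs E W.
       (\<forall>t\<in>secs E W. \<eta> W (s \<oplus>\<^bsub>sect E W\<^esub> t) = \<eta> W s + \<eta> W t) \<and>
       (\<forall>z. \<eta> W (z \<odot>\<^bsub>sect E W\<^esub> s) = (\<lambda>x. act z (\<eta> W s x))) \<and>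
       (\<forall>g\<in>ob W. \<eta> W (ob_act E W g s) = (\<lambda>x. act (ahat_b (g x)) (\<eta> W s x))) \<and>
       (\<forall>W'. openin X W' \<and> W' \<subseteq> W \<longrightarrow> \<eta> W' (rest E W W' s) = restr W' (\<eta> W s)))"
begin

lemma eta_bij: "openin X W \<Longrightarrow> W \<subseteq> V \<Longrightarrow> bij_betw (\<eta> W) (secs E W) (G W)"
  using iso by simp

lemma eta_rules:
  assumes "openin X W" "W \<subseteq> V" "s \<in> secs E W"
  shows "t \<in> secs E W \<Longrightarrow> \<eta> W (s \<oplus>\<^bsub>sect E W\<^esub> t) = \<eta> W s + \<eta> W t"
    "\<eta> W (z \<odot>\<^bsub>sect E W\<^esub> s) = (\<lambda>x. act z (\<eta> W s x))"
    "g \<in> ob W \<Longrightarrow> \<eta> W (ob_act E W g s) = (\<lambda>x. act (ahat_b (g x)) (\<eta> W s x))"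
    "openin X W' \<Longrightarrow> W' \<subseteq> W \<Longrightarrow> \<eta> W' (rest E W W' s) = restr W' (\<eta> W s)"
  using iso assms by simp_all

lemma eta_G: "openin X W \<Longrightarrow> W \<subseteq> V \<Longrightarrow> s \<in> secs E W \<Longrightarrow> \<eta> W s \<in> G W"
  using eta_bij bij_betwE by blast

lemma eta_carr: "openin X W \<Longrightarrow> W \<subseteq> V \<Longrightarrow> s \<in> secs E W \<Longrightarrow> \<eta> W s x \<in> carr"
  by (rule xsec_carr[OF subsheaf_onD(1)[OF subsheaf_G _ _ eta_G]])

definition chart :: "'x set \<Rightarrow> 's \<Rightarrow> 'x \<Rightarrow> expansion"
  where "chart W s = (\<lambda>x. Psi (\<eta> W s x))"

lemma chart_bij:
  assumes W: "openin X W" "W \<subseteq> V"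
  shows "bij_betw (chart W) (secs E W) (P W)"
  unfolding bij_betw_def
proof (intro conjI equalityI subsetI)
  have Phi_chart: "(\<lambda>x. Phi (chart W s x)) = \<eta> W s" if "s \<in> secs E W" for s
    using eta_carr[OF W that] by (simp add: chart_def Phi_Psi)
  show "inj_on (chart W) (secs E W)"
  proof (rule inj_onI)
    fix s t assume st: "s \<in> secs E W" "t \<in> secs E W" "chart W s = chart W t"
    then have "\<eta> W s = \<eta> W t" using Phi_chart by metis
    then show "s = t" using bij_betw_imp_inj_on[OF eta_bij[OF W]] st by (simp add: inj_on_def)
  qed
  show "u \<in> P W" if u: "u \<in> chart W ` secs E W" for u
  proof -
    obtain s where s: "s \<in> secs E W" "u = chart W s" using u by blast
    have "\<eta> W s \<in> xsec W" by (rule subsheaf_onD(1)[OF subsheaf_G W eta_G[OF W s(1)]])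
    then have "u \<in> xsec W" unfolding s(2) chart_def by (rule xsec_Psi[OF W(1)])
    then show ?thesis using eta_G[OF W s(1)] by (simp add: P_def s(2) Phi_chart[OF s(1)])
  qed
  show "u \<in> chart W ` secs E W" if u: "u \<in> P W" for u
  proof -
    have "(\<lambda>x. Phi (u x)) \<in> G W" and ux: "u \<in> xsec W" using u by (simp_all add: P_def)
    then obtain s where s: "s \<in> secs E W" "\<eta> W s = (\<lambda>x. Phi (u x))"
      using bij_betw_imp_surj_on[OF eta_bij[OF W]] by (metis imageE)
    have "u = chart W s"
      unfolding chart_def s(2) using Psi_Phi xsec_carr[OF ux] by simp
    then show ?thesis using s(1) by (rule image_eqI)
  qed
qed

lemma chart_add:
  assumes "openin X W" "W \<subseteq> V" "s \<in> secs E W" "t \<in> secs E W"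
  shows "chart W (s \<oplus>\<^bsub>sect E W\<^esub> t) = (\<lambda>x. chart W s x + chart W t x)"
  unfolding chart_def eta_rules(1)[OF assms] plus_fun_apply[where x = "_ :: 'x"]
  by (intro ext[where 'a = 'x] Psi_add eta_carr assms)

lemma chart_smult:
  assumes "openin X W" "W \<subseteq> V" "s \<in> secs E W"
  shows "chart W (Theta \<theta> z \<odot>\<^bsub>sect E W\<^esub> s) = (\<lambda>x. act z (chart W s x))"
  unfolding chart_def eta_rules(2)[OF assms]
  by (intro ext[where 'a = 'x] Psi_act eta_carr assms)

lemma coordinate_chart:
  assumes W: "openin X W" "W \<subseteq> V"
  shows "coordinate N m W (chart W)"
  unfolding coordinate_def
proof (intro conjI ballI allI)
  show "inj_on (chart W) (secs E W)" using chart_bij[OF W] by (rule bij_betw_imp_inj_on)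
  fix s assume s: "s \<in> secs E W"
  show "chart W (s \<oplus>\<^bsub>sect E W\<^esub> t) = (\<lambda>x. chart W s x + chart W t x)" if "t \<in> secs E W" for t
    by (rule chart_add[OF W s that])
  show "chart W (Theta \<theta> z \<odot>\<^bsub>sect E W\<^esub> s) = (\<lambda>x. act z (chart W s x))" for z
    by (rule chart_smult[OF W s])
  show "\<exists>t\<in>secs E W. chart W t = (\<lambda>x. act (ahat_b (g x)) (chart W s x))" if g: "g \<in> ob W" for g
  proof -
    have "chart W s \<in> P W" using bij_betwE[OF chart_bij[OF W]] s by blast
    then have "(\<lambda>x. act (ahat_b (g x)) (chart W s x)) \<in> chart W ` secs E W"
      unfolding bij_betw_imp_surj_on[OF chart_bij[OF W]] by (rule subsheaf_onD(5)[OF subsheaf_P W g])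
    then obtain t where t: "(\<lambda>x. act (ahat_b (g x)) (chart W s x)) = chart W t" "t \<in> secs E W"
      by (rule imageE)
    show ?thesis by (rule bexI[of _ t], rule t(1)[symmetric], rule t(2))
  qed
next
  fix f s assume f: "f \<in> Ox W" and s: "s \<in> secs E W"
  have "Psi (act (scalar c) v) = act (scalar c) (Psi v)" if "v \<in> carr" for c v
    using Psi_act[OF that, of "scalar c"] by (simp add: Theta_scalar)
  then show "chart W (ob_act E W (\<lambda>x. fps_const (f x)) s) = (\<lambda>x. act (scalar (f x)) (chart W s x))"
    unfolding chart_def eta_rules(3)[OF W s ob_fps_const[OF W(1) f]] ahat_b_const using eta_carr[OF W s] by simp
qed

lemma small_chart: "small V"
  unfolding small_def
proof (intro conjI allI impI V)
  fix W assume "openin X W \<and> W \<subseteq> V"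
  then have "coordinate N m W (chart W)" by (intro coordinate_chart) simp_all
  then show "\<exists>N m h. coordinate N m W h" by (intro exI)
qed

text \<open>The chart is already compatible with addition, restriction and the twisted action of the algebra; for
$\mathcal{O}_X[[b]]$ the limit in its definition is computed in the chart.\<close>
lemma sheaf_iso_twist:
  assumes "covered_twisted_sheaf \<theta> X Ox E lam"
  shows "sheaf_iso_on X Ox V (twist_sheaf \<theta> E) (generated_sheaf X Ox V Xi \<psi>)"
  unfolding sheaf_iso_on_def
proof (intro exI[of _ chart] allI impI, elim conjE)
  interpret covered_twisted_sheaf \<theta> X Ox E lam by (rule assms)
  fix W assume W: "openin X W" "W \<subseteq> V"
  show "bij_betw (chart W) (secs (twist_sheaf \<theta> E) W) (gen V \<psi> W) \<and>
    (\<forall>s\<in>secs (twist_sheaf \<theta> E) W.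
       (\<forall>t\<in>secs (twist_sheaf \<theta> E) W. chart W (s \<oplus>\<^bsub>sect (twist_sheaf \<theta> E) W\<^esub> t) =
          chart W s \<oplus>\<^bsub>sect (generated_sheaf X Ox V Xi \<psi>) W\<^esub> chart W t) \<and>
       (\<forall>\<alpha>. chart W (\<alpha> \<odot>\<^bsub>sect (twist_sheaf \<theta> E) W\<^esub> s) = \<alpha> \<odot>\<^bsub>sect (generated_sheaf X Ox V Xi \<psi>) W\<^esub> chart W s) \<and>
       (\<forall>g\<in>ob W. chart W (tob W g s) = ob_act (generated_sheaf X Ox V Xi \<psi>) W g (chart W s)) \<and>
       (\<forall>W'. openin X W' \<and> W' \<subseteq> W \<longrightarrow> chart W' (rest (twist_sheaf \<theta> E) W W' s) =
          rest (generated_sheaf X Ox V Xi \<psi>) W W' (chart W s)))"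
  proof (intro conjI ballI allI impI)
    show "bij_betw (chart W) (secs (twist_sheaf \<theta> E) W) (gen V \<psi> W)"
      using chart_bij[OF W] by (simp add: gen_psi[OF W])
    fix s assume "s \<in> secs (twist_sheaf \<theta> E) W"
    then have s: "s \<in> secs E W" by simp
    show "chart W (s \<oplus>\<^bsub>sect (twist_sheaf \<theta> E) W\<^esub> t) = chart W s \<oplus>\<^bsub>sect (generated_sheaf X Ox V Xi \<psi>) W\<^esub> chart W t"
      if "t \<in> secs (twist_sheaf \<theta> E) W" for t
    proof -
      have t: "t \<in> secs E W" using that by simp
      have "chart W (s \<oplus>\<^bsub>sect E W\<^esub> t) = chart W s + chart W t"
        using chart_add[OF W s t] by (rule trans) (rule plus_fun_def[symmetric])
      then show ?thesis by simp
    qed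
    show "chart W (\<alpha> \<odot>\<^bsub>sect (twist_sheaf \<theta> E) W\<^esub> s) = \<alpha> \<odot>\<^bsub>sect (generated_sheaf X Ox V Xi \<psi>) W\<^esub> chart W s" for \<alpha>
      using chart_smult[OF W s, of \<alpha>] by simp
    show "chart W (tob W g s) = ob_act (generated_sheaf X Ox V Xi \<psi>) W g (chart W s)" if "g \<in> ob W" for g
      using tob_coordinate[OF coordinate_chart[OF W] W(1) that s] by simp
    show "chart W' (rest (twist_sheaf \<theta> E) W W' s) = rest (generated_sheaf X Ox V Xi \<psi>) W W' (chart W s)"
      if "openin X W' \<and> W' \<subseteq> W" for W'
    proof -
      have "\<eta> W' (rest E W W' s) = restr W' (\<eta> W s)" using eta_rules(4)[OF W s] that by blast
      then have "chart W' (rest E W W' s) = restr W' (chart W s)"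
        unfolding chart_def by (auto simp: restr_def Psi_zero)
      then show ?thesis by simp
    qed
  qed
qed

end

lemma holomorphic_family_chart:
  assumes red: "reduced_complex_space X Ox" and change: "change_of_variable \<theta>"
    and fam: "holomorphic_family X Ox lam k E" and p: "p \<in> topspace X"
  shows "\<exists>N m V \<phi> \<eta>. p \<in> V \<and> charted_family \<theta> (of_rat lam) N m X Ox k V \<phi> E \<eta>"
proof -
  obtain V N m \<phi> where ch: "openin X V" "p \<in> V" "admissible X Ox (of_rat lam) N m k V \<phi>"
    "sheaf_iso_on X Ox V E (generated_sheaf X Ox V (xi_sheaf Ox (of_rat lam) N m) \<phi>)"
    using bspec[OF conjunct2[OF fam[unfolded holomorphic_family_def]] p] by (elim exE conjE)
  have sheaf: "is_ahat_sheaf X Ox E" using fam by (simp add: holomorphic_family_def)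
  interpret expansion_family \<theta> "of_rat lam" N m X Ox
    by unfold_locales (use red change in auto)
  interpret spanned_section \<theta> "of_rat lam" N m X Ox k V \<phi>
    by (rule admissible_imp_spanned[OF ch(1,3)])
  interpret twisted_sheaf \<theta> X Ox E "of_rat lam"
    by unfold_locales (rule sheaf)
  obtain \<eta> where "\<forall>W. openin X W \<and> W \<subseteq> V \<longrightarrow>
    bij_betw (\<eta> W) (secs E W) (gen V \<phi> W) \<and>
    (\<forall>s\<in>secs E W.
       (\<forall>t\<in>secs E W. \<eta> W (s \<oplus>\<^bsub>sect E W\<^esub> t) = \<eta> W s + \<eta> W t) \<and>
       (\<forall>z. \<eta> W (z \<odot>\<^bsub>sect E W\<^esub> s) = (\<lambda>x. act z (\<eta> W s x))) \<and>
       (\<forall>g\<in>ob W. \<eta> W (ob_act E W g s) = (\<lambda>x. act (ahat_b (g x)) (\<eta> W s x))) \<and>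
       (\<forall>W'. openin X W' \<and> W' \<subseteq> W \<longrightarrow> \<eta> W' (rest E W W' s) = restr W' (\<eta> W s)))"
    using ch(4) unfolding sheaf_iso_on_def generated_sheaf_simps xi_sheaf_simps xi_sheaf_ob_act by (elim exE)
  then have "charted_family \<theta> (of_rat lam) N m X Ox k V \<phi> E \<eta>"
    by unfold_locales
  then show ?thesis using ch(2) by blast
qed

theorem proposition3p1p5:
  fixes X :: "'x topology" and Ox :: "'x set \<Rightarrow> ('x \<Rightarrow> complex) set"
    and E :: "('x, 's) ahat_sheaf" and lam :: rat and k :: nat and \<theta> :: "complex fps"
  assumes "reduced_complex_space X Ox"
    and "0 < lam" and "lam \<le> 1"
    and "holomorphic_family X Ox lam k E"
    and "change_of_variable \<theta>"
  shows "holomorphic_family X Ox lam k (twist_sheaf \<theta> E) \<and>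
    (\<forall>x\<in>topspace X. fibre X Ox (twist_sheaf \<theta> E) x = twist_module \<theta> (fibre X Ox E x))"
proof -
  define L :: complex where "L = of_rat lam"
  have sheaf: "is_ahat_sheaf X Ox E" using assms(4) by (simp add: holomorphic_family_def)
  have charted: "\<exists>N m V \<phi> \<eta>. p \<in> V \<and> charted_family \<theta> L N m X Ox k V \<phi> E \<eta>" if "p \<in> topspace X" for p
    unfolding L_def using assms(1,5,4) that by (rule holomorphic_family_chart)
  interpret twisted_sheaf \<theta> X Ox E L
    by unfold_locales (rule assms(5), rule assms(1), rule sheaf)
  interpret covered_twisted_sheaf \<theta> X Ox E L
  proof unfold_locales
    fix p assume p: "p \<in> topspace X"
    obtain N m V \<phi> \<eta> where V: "p \<in> V" "charted_family \<theta> L N m X Ox k V \<phi> E \<eta>"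
      using charted[OF p] by (elim exE conjE)
    show "\<exists>V. p \<in> V \<and> small V"
      by (intro exI[of _ V] conjI V(1) charted_family.small_chart[OF V(2)])
  qed
  have "\<exists>V N m \<phi>. openin X V \<and> p \<in> V \<and> admissible X Ox L N m k V \<phi> \<and>
       sheaf_iso_on X Ox V (twist_sheaf \<theta> E) (generated_sheaf X Ox V (xi_sheaf Ox L N m) \<phi>)"
    if p: "p \<in> topspace X" for p
  proof -
    obtain N m V \<phi> \<eta> where V: "p \<in> V" "charted_family \<theta> L N m X Ox k V \<phi> E \<eta>"
      using charted[OF p] by (elim exE conjE)
    interpret C: charted_family \<theta> L N m X Ox k V \<phi> E \<eta> by (rule V(2))
    interpret S: spanned_section \<theta> L N m X Ox k V C.\<psi> by (rule C.spanned_section_psi)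
    show ?thesis
      by (intro exI[of _ V] exI[of _ N] exI[of _ m] exI[of _ C.\<psi>] conjI C.V V(1) S.admissible
          C.sheaf_iso_twist covered_twisted_sheaf_axioms)
  qed
  then have "holomorphic_family X Ox lam k (twist_sheaf \<theta> E)"
    unfolding holomorphic_family_def L_def by (intro conjI ballI is_ahat_sheaf_twist)
  then show ?thesis
    by (intro conjI ballI fibre_twist)
qed

end
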